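(* Let $m\ge 4$ be an integer, $0<\epsilon\le 1$, $\Omega=(a,b)$, $T_{\rm end}>0$, and let $\Phi$ be the exact solution of the one-dimensional semiclassical Dirac equation with periodic boundary conditions (written out in the context), with total probability density $\rho(t,x)=\Phi(t,x)^*\Phi(t,x)$ and current density $J(t,x)=\Phi(t,x)^*\sigma_1\Phi(t,x)$. Assume: (A) $\Phi\in C^2([0,T_{\rm end}];W^{m,\infty}_p(\Omega))$ and $V,A_1\in C^m(\Omega)$, with $V,A_1$ periodic on $\Omega$; (B) for all $0\le r\le 2$ and $0\le k\le m$, $$\Big\|\frac{\partial^{r+k}}{\partial t^r\partial x^k}\Phi\Big\|_{L^\infty([0,T_{\rm end}];(L^\infty(\Omega))^2)}\le \frac{C_{r+k}}{\epsilon^{r+k}},\qquad \|\partial_x^kV\|_{L^\infty(\Omega)}\le D_k,\qquad \|\partial_x^kA_1\|_{L^\infty(\Omega)}\le D_k,$$ with constants $C_{r+k},D_k$ independent of $\epsilon$. Assume further that $\tau=o(\epsilon)$ and $h=o(\epsilon)$. Let $\rho_I^n$ and $J_I^n$ be the trigonometric interpolants of the numerical densities $\rho^n_j=(\Phi_j^n)^*\Phi_j^n$ and $J_j^n=(\Phi_j^n)^*\sigma_1\Phi_j^n$, where $\Phi^n$ is produced by the first-order splitting scheme $S_1$. Then there are positive constants $\hat C_1$ and $\hat E_{m,1}$, independent of $\epsilon,\tau,h$, such that for all integers $0\le n\le T_{\rm end}/\tau$, $$\|\rho(t_n,\cdot)-\rho_I^n(\cdot)\|_{L^2}\le \hat C_1T_{\rm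 end}\,\frac{\tau}{\epsilon^2}+\hat E_{m,1}\,\frac{T_{\rm end}}{\tau}\Big(\frac{h}{\epsilon(b-a)}\Big)^m,$$ $$\|J(t_n,\cdot)-J_I^n(\cdot)\|_{L^2}\le \hat C_1T_{\rm end}\,\frac{\tau}{\epsilon^2}+\hat E_{m,1}\,\frac{T_{\rm end}}{\tau}\Big(\frac{h}{\epsilon(b-a)}\Big)^m.$$
   Context: Pauli matrices: $\sigma_1=\begin{pmatrix}0&1\\1&0\end{pmatrix}$, $\sigma_3=\begin{pmatrix}1&0\\0&-1\end{pmatrix}$; $I_2$ is the $2\times2$ identity; $^*$ is conjugate transpose. Problem: $V,A_1:\overline\Omega\to\mathbb R$ are given time-independent potentials, $\Phi=\Phi(t,x)\in\mathbb C^2$ solves $$i\epsilon\,\partial_t\Phi=\big[-i\epsilon\sigma_1\partial_x+\sigma_3+V(x)I_2-A_1(x)\sigma_1\big]\Phi,\quad x\in\Omega=(a,b),$$ with $\Phi(t,a)=\Phi(t,b)$, $\partial_x\Phi(t,a)=\partial_x\Phi(t,b)$ and $\Phi(0,x)=\Phi_0(x)$. The solution (and initial datum) may depend on $\epsilon$. $W^{m,\infty}_p(\Omega)=\{f\in W^{m,\infty}(\Omega):\partial_x^kf(a)=\partial_x^kf(b),\ k=0,\dots,m-1\}$ (componentwise for $\mathbb C^2$-valued functions). Periodicity of $V,A_1$ means that $\partial_x^k V$ and $\partial_x^k A_1$ agree at $a$ and $b$ for $k=0,\dots,m-1$. $\|f\|_{L^2}=(\int_\Omega|f|^2dx)^{1/2}$.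 Grid: $M$ is an even positive integer, $h=(b-a)/M$, $x_j=a+jh$ $(0\le j\le M-1)$, $\tau>0$, $t_n=n\tau$, $\mu_l=2\pi l/(b-a)$ for $-M/2\le l\le M/2-1$. For (scalar- or vector-valued) grid values $U=(U_0,\dots,U_{M-1})$ put $\hat U_l=\frac1M\sum_{j=0}^{M-1}U_je^{-i\mu_l(x_j-a)}$ and let the interpolant be $U_I(x)=\sum_{l=-M/2}^{M/2-1}\hat U_le^{i\mu_l(x-a)}$. Scheme $S_1$: $\Phi_j^0=\Phi_0(x_j)$ and, for $n\ge0$, $$\Phi_j^{n,*}=\sum_{l=-M/2}^{M/2-1}e^{\tau(-i\mu_l\sigma_1-\frac i\epsilon\sigma_3)}\,\hat\Phi^n_l\,e^{i\mu_l(x_j-a)},\qquad \Phi_j^{n+1}=e^{\tau[-\frac i\epsilon V(x_j)I_2+\frac i\epsilon A_1(x_j)\sigma_1]}\,\Phi_j^{n,*}.$$ (Here the superscript in $\Phi^{n,*}_j$ only labels an intermediate stage.) Asymptotic conditions: $\tau=o(\epsilon)$, $h=o(\epsilon)$ are understood as: there is a fixed bounded function $\eta:(0,1]\to(0,\infty)$ with $\eta(\epsilon)\to0$ as $\epsilon\to0^+$ such that $\tau/\epsilon\le\eta(\epsilon)$ and $h/\epsilon\le\eta(\epsilon)$; constants in the conclusion may depend on $\eta$ and on the data of the problem ($m$, $T_{\rm end}$, $a$, $b$, the $C_{r+k}$, $D_k$), but not on $\epsilon,\tau,h$. *)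

theory Defs
  imports "HOL-Analysis.Analysis" "HOL-Probability.Essential_Supremum"
begin

section \<open>Matrices and the Pauli matrices\<close>

text \<open>On the type \<^typ>\<open>complex^2^2\<close> the operations \<open>*\<close>, \<open>^\<close> and \<open>1\<close> of the library act entrywise, and
  there is no \<open>exp\<close>; matrix powers and the matrix exponential are therefore built from \<open>**\<close> and
  \<^term>\<open>mat 1\<close>.\<close>

definition cscale :: "complex \<Rightarrow> complex^2^2 \<Rightarrow> complex^2^2"  (infixr "*\<^sub>M" 75)
  where "c *\<^sub>M A = (\<chi> i j. c * A $ i $ j)"

definition mexp :: "complex^2^2 \<Rightarrow> complex^2^2"
  where "mexp A = (\<Sum>n. ((\<lambda>B. A ** B) ^^ n) (mat 1) /\<^sub>R fact n)"

definition sigma1 :: "complex^2^2"  (\<open>\<sigma>\<^sub>1\<close>)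
  where "\<sigma>\<^sub>1 = vector [vector [0, 1], vector [1, 0]]"

definition sigma3 :: "complex^2^2"  (\<open>\<sigma>\<^sub>3\<close>)
  where "\<sigma>\<^sub>3 = vector [vector [1, 0], vector [0, -1]]"

definition herm :: "complex^2 \<Rightarrow> complex^2 \<Rightarrow> complex"
  where "herm u v = (\<Sum>i\<in>UNIV. cnj (u $ i) * v $ i)"

definition prob_density :: "complex^2 \<Rightarrow> complex"
  where "prob_density u = herm u u"

definition current_density :: "complex^2 \<Rightarrow> complex"
  where "current_density u = herm u (\<sigma>\<^sub>1 *v u)"


section \<open>Function spaces\<close>

definition Linf_norm :: "real set \<Rightarrow> (real \<Rightarrow> 'v::real_normed_vector) \<Rightarrow> ereal"
  where "Linf_norm S f = esssup (lebesgue_on S) (\<lambda>x. ereal (norm (f x)))"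

definition L2_norm_on :: "real set \<Rightarrow> (real \<Rightarrow> complex) \<Rightarrow> real"
  where "L2_norm_on S f = sqrt (LINT x:S|lebesgue. (norm (f x))\<^sup>2)"

definition test_functions :: "real set \<Rightarrow> (real \<Rightarrow> real) set"
  where "test_functions S =
    {\<phi>. (\<forall>k x. (deriv ^^ k) \<phi> field_differentiable (at x)) \<and>
         compact (closure {x. \<phi> x \<noteq> 0}) \<and> closure {x. \<phi> x \<noteq> 0} \<subseteq> S}"

definition has_weak_deriv ::
  "real set \<Rightarrow> nat \<Rightarrow> (real \<Rightarrow> 'v::euclidean_space) \<Rightarrow> (real \<Rightarrow> 'v) \<Rightarrow> bool"
  where "has_weak_deriv S k f g \<longleftrightarrow>
    (\<forall>K. compact K \<and> K \<subseteq> S \<longrightarrow> f absolutely_integrable_on K \<and> g absolutely_integrable_on K) \<and>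
    (\<forall>\<phi>\<in>test_functions S.
       (LINT x:S|lebesgue. (deriv ^^ k) \<phi> x *\<^sub>R f x) = (-1) ^ k *\<^sub>R (LINT x:S|lebesgue. \<phi> x *\<^sub>R g x))"

text \<open>Only determined up to a null set, and only meaningful if the weak derivative exists.\<close>

definition weak_deriv ::
  "real set \<Rightarrow> nat \<Rightarrow> (real \<Rightarrow> 'v::euclidean_space) \<Rightarrow> real \<Rightarrow> 'v"
  where "weak_deriv S k f = (SOME g. has_weak_deriv S k f g)"

definition Winf :: "nat \<Rightarrow> real set \<Rightarrow> (real \<Rightarrow> 'v::euclidean_space) set"
  where "Winf m S = {f. \<forall>k\<le>m. \<exists>g. has_weak_deriv S k f g \<and> Linf_norm S g < \<infinity>}"

definition Winf_norm :: "nat \<Rightarrow> real set \<Rightarrow> (real \<Rightarrow> 'v::euclidean_space) \<Rightarrow> ereal"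
  where "Winf_norm m S f = (SUP k\<in>{..m}. Linf_norm S (weak_deriv S k f))"

text \<open>Elements of the periodic space are represented by functions that are continuous on the closed
  interval, and the boundary values of the weak derivative of order \<open>k < m\<close> are those of its continuous
  representative on the closed interval.\<close>

definition Winf_per :: "nat \<Rightarrow> real \<Rightarrow> real \<Rightarrow> (real \<Rightarrow> 'v::euclidean_space) set"
  where "Winf_per m a b =
    {f \<in> Winf m {a<..<b}. continuous_on {a..b} f \<and>
       (\<forall>k<m. \<exists>g. has_weak_deriv {a<..<b} k f g \<and> continuous_on {a..b} g \<and> g a = g b)}"

definition dx :: "real \<Rightarrow> real \<Rightarrow> (real \<Rightarrow> 'v::real_normed_vector) \<Rightarrow> real \<Rightarrow> 'v"
  where "dx a b f x = vector_derivative f (at x within {a..b})"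

definition dt :: "real \<Rightarrow> (real \<Rightarrow> real \<Rightarrow> 'v::real_normed_vector) \<Rightarrow> real \<Rightarrow> real \<Rightarrow> 'v"
  where "dt T u t x = vector_derivative (\<lambda>s. u s x) (at t within {0..T})"

text \<open>The space \<open>C\<^sup>r([0,T]; W)\<close> with \<open>W\<close> the periodic Sobolev space: time derivatives are limits of
  difference quotients in the norm of \<open>W\<close>.  Norm limits in \<open>W\<close> are uniform on the closed interval,
  so the \<open>W\<close>-valued time derivative is the pointwise one.\<close>

definition Cr_Winf_per ::
  "nat \<Rightarrow> real \<Rightarrow> nat \<Rightarrow> real \<Rightarrow> real \<Rightarrow> (real \<Rightarrow> real \<Rightarrow> 'v::euclidean_space) set"
  where "Cr_Winf_per r T m a b =
    {u. (\<forall>q\<le>r. \<forall>t\<in>{0..T}. (dt T ^^ q) u t \<in> Winf_per m a b) \<and>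
        (\<forall>q<r. \<forall>t\<in>{0..T}.
           ((\<lambda>s. Winf_norm m {a<..<b}
                   (\<lambda>x. ((dt T ^^ q) u s x - (dt T ^^ q) u t x) /\<^sub>R (s - t) - (dt T ^^ Suc q) u t x))
             \<longlongrightarrow> 0) (at t within {0..T})) \<and>
        (\<forall>t\<in>{0..T}.
           ((\<lambda>s. Winf_norm m {a<..<b} (\<lambda>x. (dt T ^^ r) u s x - (dt T ^^ r) u t x))
             \<longlongrightarrow> 0) (at t within {0..T}))}"

text \<open>The norm of \<open>\<partial>\<^sub>t\<^sup>r \<partial>\<^sub>x\<^sup>k u\<close> in \<open>L\<^sup>\<infinity>([0,T]; L\<^sup>\<infinity>(a,b))\<close>.\<close>

definition mixed_norm ::
  "real \<Rightarrow> real \<Rightarrow> real \<Rightarrow> nat \<Rightarrow> nat \<Rightarrow> (real \<Rightarrow> real \<Rightarrow> 'v::euclidean_space) \<Rightarrow> ereal"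
  where "mixed_norm T a b r k u =
    esssup (lebesgue_on {0..T})
      (\<lambda>t. Linf_norm {a<..<b} (weak_deriv {a<..<b} k ((dt T ^^ r) u t)))"

definition Cm_open :: "nat \<Rightarrow> real \<Rightarrow> real \<Rightarrow> (real \<Rightarrow> real) set"
  where "Cm_open m a b =
    {f. (\<forall>k<m. \<forall>x\<in>{a<..<b}. (dx a b ^^ k) f differentiable (at x)) \<and>
        continuous_on {a<..<b} ((dx a b ^^ m) f)}"

text \<open>Continuity up to the boundary makes the endpoint values of the derivatives meaningful, so that
  they can be compared.\<close>

definition periodic_derivs :: "nat \<Rightarrow> real \<Rightarrow> real \<Rightarrow> (real \<Rightarrow> real) \<Rightarrow> bool"
  where "periodic_derivs m a b f \<longleftrightarrow>
    (\<forall>k<m. continuous_on {a..b} ((dx a b ^^ k) f) \<and> (dx a b ^^ k) f a = (dx a b ^^ k) f b)"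


section \<open>The semiclassical Dirac equation\<close>

definition dirac_solution ::
  "real \<Rightarrow> real \<Rightarrow> real \<Rightarrow> real \<Rightarrow> (real \<Rightarrow> real) \<Rightarrow> (real \<Rightarrow> real) \<Rightarrow>
   (real \<Rightarrow> complex^2) \<Rightarrow> (real \<Rightarrow> real \<Rightarrow> complex^2) \<Rightarrow> bool"
  where "dirac_solution \<epsilon> T a b V A\<^sub>1 \<Phi>\<^sub>0 \<Phi> \<longleftrightarrow>
    (\<forall>t\<in>{0..T}. \<forall>x\<in>{a..b}.
       (\<lambda>s. \<Phi> s x) differentiable (at t within {0..T}) \<and>
       \<Phi> t differentiable (at x within {a..b})) \<and>
    (\<forall>t\<in>{0..T}. \<forall>x\<in>{a<..<b}.
       (\<i> * of_real \<epsilon>) *s dt T \<Phi> t x =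
         (- \<i> * of_real \<epsilon>) *s (\<sigma>\<^sub>1 *v dx a b (\<Phi> t) x) + \<sigma>\<^sub>3 *v \<Phi> t x
         + of_real (V x) *s \<Phi> t x - of_real (A\<^sub>1 x) *s (\<sigma>\<^sub>1 *v \<Phi> t x)) \<and>
    (\<forall>t\<in>{0..T}. \<Phi> t a = \<Phi> t b \<and> dx a b (\<Phi> t) a = dx a b (\<Phi> t) b) \<and>
    (\<forall>x\<in>{a..b}. \<Phi> 0 x = \<Phi>\<^sub>0 x)"


section \<open>Grid, trigonometric interpolation and the splitting scheme\<close>

definition grid :: "real \<Rightarrow> real \<Rightarrow> nat \<Rightarrow> nat \<Rightarrow> real"
  where "grid a b M j = a + real j * ((b - a) / real M)"

definition freq :: "real \<Rightarrow> real \<Rightarrow> int \<Rightarrow> real"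
  where "freq a b l = 2 * pi * of_int l / (b - a)"

definition modes :: "nat \<Rightarrow> int set"
  where "modes M = {- (int M div 2) .. int M div 2 - 1}"

definition wave :: "real \<Rightarrow> real \<Rightarrow> int \<Rightarrow> real \<Rightarrow> complex"
  where "wave a b l x = exp (\<i> * of_real (freq a b l * (x - a)))"

definition dft :: "real \<Rightarrow> real \<Rightarrow> nat \<Rightarrow> (nat \<Rightarrow> complex) \<Rightarrow> int \<Rightarrow> complex"
  where "dft a b M U l =
    (\<Sum>j<M. U j * exp (- \<i> * of_real (freq a b l * (grid a b M j - a)))) / of_nat M"

definition dft_vec :: "real \<Rightarrow> real \<Rightarrow> nat \<Rightarrow> (nat \<Rightarrow> complex^2) \<Rightarrow> int \<Rightarrow> complex^2"
  where "dft_vec a b M U l = (\<chi> i. dft a b M (\<lambda>j. U j $ i) l)"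

definition interpolant :: "real \<Rightarrow> real \<Rightarrow> nat \<Rightarrow> (nat \<Rightarrow> complex) \<Rightarrow> real \<Rightarrow> complex"
  where "interpolant a b M U x = (\<Sum>l\<in>modes M. dft a b M U l * wave a b l x)"

definition free_step ::
  "real \<Rightarrow> real \<Rightarrow> real \<Rightarrow> nat \<Rightarrow> real \<Rightarrow> (nat \<Rightarrow> complex^2) \<Rightarrow> nat \<Rightarrow> complex^2"
  where "free_step \<epsilon> a b M \<tau> U j =
    (\<Sum>l\<in>modes M. wave a b l (grid a b M j) *s
       (mexp (\<tau> *\<^sub>R ((- \<i> * of_real (freq a b l)) *\<^sub>M \<sigma>\<^sub>1 - (\<i> / of_real \<epsilon>) *\<^sub>M \<sigma>\<^sub>3))
          *v dft_vec a b M U l))"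

definition potential_step ::
  "real \<Rightarrow> real \<Rightarrow> real \<Rightarrow> nat \<Rightarrow> real \<Rightarrow> (real \<Rightarrow> real) \<Rightarrow> (real \<Rightarrow> real) \<Rightarrow>
   (nat \<Rightarrow> complex^2) \<Rightarrow> nat \<Rightarrow> complex^2"
  where "potential_step \<epsilon> a b M \<tau> V A\<^sub>1 U j =
    mexp (\<tau> *\<^sub>R ((- (\<i> / of_real \<epsilon>) * of_real (V (grid a b M j))) *\<^sub>M mat 1
              + (\<i> / of_real \<epsilon> * of_real (A\<^sub>1 (grid a b M j))) *\<^sub>M \<sigma>\<^sub>1)) *v U j"

primrec scheme_S1 ::
  "real \<Rightarrow> real \<Rightarrow> real \<Rightarrow> nat \<Rightarrow> real \<Rightarrow> (real \<Rightarrow> real) \<Rightarrow> (real \<Rightarrow> real) \<Rightarrow>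
   (real \<Rightarrow> complex^2) \<Rightarrow> nat \<Rightarrow> nat \<Rightarrow> complex^2"
  where
    "scheme_S1 \<epsilon> a b M \<tau> V A\<^sub>1 \<Phi>\<^sub>0 0 = (\<lambda>j. \<Phi>\<^sub>0 (grid a b M j))"
  | "scheme_S1 \<epsilon> a b M \<tau> V A\<^sub>1 \<Phi>\<^sub>0 (Suc n) =
       potential_step \<epsilon> a b M \<tau> V A\<^sub>1 (free_step \<epsilon> a b M \<tau> (scheme_S1 \<epsilon> a b M \<tau> V A\<^sub>1 \<Phi>\<^sub>0 n))"

end

theory Submission
  imports Defs "HOL-Probability.Characteristic_Functions"
begin

text \<open>Conjugating by half a potential step turns the Lie splitting into the symmetric Strang splitting, so
  the scheme is compared with that conjugate of the Fourier truncation of the exact solution. The local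
  error is tested against trigonometric polynomials evolving by the free Dirac flow; the
  derivative in time of the pairing contains one commutator of the critical order, and its contribution
  is odd about the midpoint of the step, hence cancels. With \<open>\<omega> = 1/\<epsilon>\<close> this gives the error
  \<open>O(\<omega>\<tau> + \<omega>\<^sup>3\<tau>\<^sup>2 + \<omega> (h\<omega>)\<^sup>m)\<close> for the spinors, which is better in \<open>\<omega>\<close> than the claim for the densities.
  The room is needed because the passage to the densities costs the supremum of the numerical solution:
  the scheme nearly commutes with translations by grid points, so its difference quotients are
  \<open>O(\<omega>)\<close> and the discrete Sobolev inequality bounds the supremum by \<open>O(\<omega>\<^sup>1\<^sup>/\<^sup>2)\<close>. This
  suffices when \<open>\<tau> \<le> \<epsilon>\<^sup>3\<^sup>/\<^sup>2\<close>; for larger \<open>\<tau>\<close> the claimed bound exceeds the size of the densities.\<close>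

section \<open>Periodic functions with derivatives on the scale \<open>\<omega>\<close>\<close>

text \<open>The densities are quadratic, so their error is the spinor error times a pointwise bound
  on both spinors, and the conserved mean square gives no such bound for the numerical one.
  Estimating the local error directly gives \<omega>^2 \<tau>^2 per step, hence \<omega>^2 \<tau>
  for the spinors: the claimed order, with nothing left to pay for \<omega>^(1/2). Parity improves
  this to \<omega>\<tau> + \<omega>^3 \<tau>^2, and \<omega>^(1/2) times that is at most \<omega>^2
  \<tau> (1 + \<omega>^(3/2) \<tau>). Space needs the same care: a projection error (h\<omega>)^m in
  each of the T/\<tau> steps would already exhaust the claim. The error made by commuting a
  potential step with Fourier truncation is therefore bounded with an extra factor \<omega>\<tau>,
  available because exp(i\<theta>v) - 1 is of order \<theta> with all its derivatives. The other
  obstacle is regularity: the assumed bounds concern weak derivatives at almost every time, while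
  the argument uses classical derivatives at every time. These are recovered by duality with bump
  functions.\<close>

text \<open>The top derivative is only Lipschitz: a Sobolev function of order \<open>n + 1\<close> with bounded
  derivatives is in the class of index \<open>n\<close>.\<close>

fun periodic_smooth ::
  "real \<Rightarrow> real \<Rightarrow> real \<Rightarrow> nat \<Rightarrow> real \<Rightarrow> (real \<Rightarrow> complex) \<Rightarrow> bool"
  where
    "periodic_smooth a b \<omega> 0 K f \<longleftrightarrow>
       f a = f b \<and> (\<forall>x\<in>{a..b}. norm (f x) \<le> K) \<and>
       (\<forall>x\<in>{a..b}. \<forall>y\<in>{a..b}. norm (f x - f y) \<le> K * \<omega> * \<bar>x - y\<bar>)"
  | "periodic_smooth a b \<omega> (Suc n) K f \<longleftrightarrow>
       f a = f b \<and> (\<forall>x\<in>{a..b}. norm (f x) \<le> K) \<and>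
       (\<exists>f'. (\<forall>x\<in>{a..b}. (f has_vector_derivative f' x) (at x within {a..b})) \<and>
             periodic_smooth a b \<omega> n (K * \<omega>) f')"

text \<open>Bounds \<open>exp(i\<theta>v) - 1\<close> by induction, through its derivative \<open>i\<theta>v' ((exp(i\<theta>v) - 1) + 1)\<close>.\<close>

primrec exp_const :: "real \<Rightarrow> real \<Rightarrow> nat \<Rightarrow> real"
  where
    "exp_const P H 0 = P"
  | "exp_const P H (Suc n) = P + 2 ^ (n + 1) * P * (exp_const P H n * H + 1)"

lemma exp_const_nonneg: "0 \<le> P \<Longrightarrow> 0 \<le> H \<Longrightarrow> 0 \<le> exp_const P H n"
  by (induction n) auto

lemma norm_exp_i_diff_le: "norm (exp (\<i> * of_real x) - exp (\<i> * of_real y)) \<le> \<bar>x - y\<bar>"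
proof -
  have "exp (\<i> * of_real x) - exp (\<i> * of_real y)
        = exp (\<i> * of_real y) * (exp (\<i> * of_real (x - y)) - 1)"
    by (simp add: algebra_simps flip: exp_add)
  also have "norm \<dots> = norm (exp (\<i> * of_real (x - y)) - 1)"
    by (simp add: norm_mult)
  also have "\<dots> \<le> \<bar>x - y\<bar>"
    using iexp_approx1[of "x - y" 0] by simp
  finally show ?thesis .
qed

lemma norm_exp_i_linear_le: "norm (exp (\<i> * of_real x) - 1 - \<i> * of_real x) \<le> x\<^sup>2"
proof -
  have "norm (exp (\<i> * of_real x) - 1 - \<i> * of_real x) \<le> \<bar>x\<bar> ^ 2 / 2"
    using iexp_approx1[of x 1] by (simp add: algebra_simps numeral_2_eq_2)
  then show ?thesis using zero_le_power2[of x] unfolding power2_abs by linarith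
qed

locale real_interval =
  fixes a b :: real
  assumes ab: "a < b"
begin

abbreviation "psm \<equiv> periodic_smooth a b"

lemma psm_periodic: "psm \<omega> n K f \<Longrightarrow> f a = f b"
  by (cases n) auto

lemma psm_bound: "psm \<omega> n K f \<Longrightarrow> x \<in> {a..b} \<Longrightarrow> norm (f x) \<le> K"
  by (cases n) auto

lemma psm_nonneg: "psm \<omega> n K f \<Longrightarrow> 0 \<le> K"
  using psm_bound[of \<omega> n K f a] ab norm_ge_zero[of "f a"] by (simp del: norm_ge_zero)

lemma psm_SucE:
  assumes "psm \<omega> (Suc n) K f"
  obtains f' where "\<And>x. x \<in> {a..b} \<Longrightarrow> (f has_vector_derivative f' x) (at x within {a..b})"
    "psm \<omega> n (K * \<omega>) f'"
  using assms unfolding periodic_smooth.simps(2) by blast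

lemma psm_SucI:
  assumes "\<And>x. x \<in> {a..b} \<Longrightarrow> (f has_vector_derivative f' x) (at x within {a..b})"
    "psm \<omega> n (K * \<omega>) f'" "f a = f b" "\<And>x. x \<in> {a..b} \<Longrightarrow> norm (f x) \<le> K"
  shows "psm \<omega> (Suc n) K f"
  using assms unfolding periodic_smooth.simps(2) by blast

lemma psm_lipschitz:
  assumes "psm \<omega> n K f" "x \<in> {a..b}" "y \<in> {a..b}"
  shows "norm (f x - f y) \<le> K * \<omega> * \<bar>x - y\<bar>"
proof (cases n)
  case 0
  then show ?thesis using assms by auto
next
  case (Suc k)
  then obtain f' where f': "\<And>x. x \<in> {a..b} \<Longrightarrow> (f has_vector_derivative f' x) (at x within {a..b})"
    and s: "psm \<omega> k (K * \<omega>) f'"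
    using assms psm_SucE by blast
  have "norm (f x - f y) \<le> K * \<omega> * norm (x - y)"
  proof (rule differentiable_bound[of "{a..b}" f "\<lambda>x h. h *\<^sub>R f' x"])
    fix z assume z: "z \<in> {a..b}"
    show "(f has_derivative (\<lambda>h. h *\<^sub>R f' z)) (at z within {a..b})"
      using f'[OF z] by (simp add: has_vector_derivative_def)
    show "onorm (\<lambda>h. h *\<^sub>R f' z) \<le> K * \<omega>"
      using psm_bound[OF s z] by (intro onorm_le) (simp add: mult.commute mult_left_mono)
  qed (use assms in auto)
  then show ?thesis by simp
qed

lemma psm_continuous:
  assumes "psm \<omega> n K f" shows "continuous_on {a..b} f"
proof (rule lipschitz_on_continuous_on)
  show "\<bar>K * \<omega>\<bar>-lipschitz_on {a..b} f"
  proof (rule lipschitz_onI)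
    fix x y assume xy: "x \<in> {a..b}" "y \<in> {a..b}"
    have "norm (f x - f y) \<le> K * \<omega> * \<bar>x - y\<bar>" by (rule psm_lipschitz[OF assms xy])
    also have "\<dots> \<le> \<bar>K * \<omega>\<bar> * \<bar>x - y\<bar>" by (intro mult_right_mono) auto
    finally show "dist (f x) (f y) \<le> \<bar>K * \<omega>\<bar> * dist x y" by (simp add: dist_norm)
  qed simp
qed

lemma psm_cong:
  assumes "psm \<omega> n K f" "\<And>x. x \<in> {a..b} \<Longrightarrow> f x = g x"
  shows "psm \<omega> n K g"
proof (cases n)
  case 0
  then show ?thesis using assms ab by auto
next
  case (Suc k)
  then obtain f' where f': "\<And>x. x \<in> {a..b} \<Longrightarrow> (f has_vector_derivative f' x) (at x within {a..b})"
    and s: "psm \<omega> k (K * \<omega>) f'"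
    using assms psm_SucE by blast
  have fK: "f a = f b" "\<And>x. x \<in> {a..b} \<Longrightarrow> norm (f x) \<le> K"
    using assms psm_periodic psm_bound by blast+
  have "(g has_vector_derivative f' x) (at x within {a..b})" if "x \<in> {a..b}" for x
    using has_vector_derivative_transform[OF that _ f'[OF that], of g] assms(2) by simp
  moreover have "g a = g b"
    using fK(1) assms(2)[of a] assms(2)[of b] ab by simp
  moreover have "norm (g x) \<le> K" if "x \<in> {a..b}" for x
    using fK(2)[OF that] assms(2)[OF that] by simp
  ultimately show ?thesis unfolding \<open>n = Suc k\<close> using s by (intro psm_SucI[of g])
qed

lemma psm_0I:
  assumes "f a = f b" "\<And>x. x \<in> {a..b} \<Longrightarrow> norm (f x) \<le> K"
    "\<And>x y. x \<in> {a..b} \<Longrightarrow> y \<in> {a..b} \<Longrightarrow> norm (f x - f y) \<le> K * \<omega> * \<bar>x - y\<bar>"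
  shows "psm \<omega> 0 K f"
  using assms unfolding periodic_smooth.simps(1) by blast

lemma psm_mono:
  "psm \<omega> n K f \<Longrightarrow> K \<le> K' \<Longrightarrow> 0 \<le> \<omega> \<Longrightarrow> psm \<omega> n K' f"
proof (induction n arbitrary: K K' f)
  case 0
  have *: "K * \<omega> * \<bar>x - y\<bar> \<le> K' * \<omega> * \<bar>x - y\<bar>" for x y :: real
    using 0 by (intro mult_right_mono) auto
  show ?case
    by (rule psm_0I[OF psm_periodic[OF 0(1)] order_trans[OF psm_bound[OF 0(1)] 0(2)]
          order_trans[OF psm_lipschitz[OF 0(1)] *]])
next
  case (Suc n)
  have K: "K * \<omega> \<le> K' * \<omega>" using Suc.prems by (intro mult_right_mono) auto
  obtain f' where
    f': "\<And>x. x \<in> {a..b} \<Longrightarrow> (f has_vector_derivative f' x) (at x within {a..b})" and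
    s: "psm \<omega> n (K * \<omega>) f'"
    by (rule psm_SucE[OF Suc.prems(1)]) (rule that)
  show ?case
    by (rule psm_SucI[OF f' Suc.IH[OF s K Suc.prems(3)] psm_periodic[OF Suc.prems(1)]
          order_trans[OF psm_bound[OF Suc.prems(1)] Suc.prems(2)]])
qed

lemma psm_mono_omega:
  "psm \<omega> n K f \<Longrightarrow> 0 \<le> \<omega> \<Longrightarrow> \<omega> \<le> \<omega>' \<Longrightarrow> psm \<omega>' n K f"
proof (induction n arbitrary: K f)
  case 0
  have "0 \<le> K" using psm_nonneg[OF 0(1)] .
  then have *: "K * \<omega> * \<bar>x - y\<bar> \<le> K * \<omega>' * \<bar>x - y\<bar>" for x y :: real
    using 0 by (intro mult_right_mono mult_left_mono) auto
  show ?case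
    by (rule psm_0I[OF psm_periodic[OF 0(1)] psm_bound[OF 0(1)]
          order_trans[OF psm_lipschitz[OF 0(1)] *]])
next
  case (Suc n)
  have "0 \<le> K" using psm_nonneg[OF Suc(2)] .
  then have K: "K * \<omega> \<le> K * \<omega>'" using Suc.prems by (intro mult_left_mono) auto
  obtain f' where
    f': "\<And>x. x \<in> {a..b} \<Longrightarrow> (f has_vector_derivative f' x) (at x within {a..b})" and
    s: "psm \<omega> n (K * \<omega>) f'"
    by (rule psm_SucE[OF Suc.prems(1)]) (rule that)
  have "0 \<le> \<omega>'" using Suc.prems by simp
  show ?case
    by (rule psm_SucI[OF f' psm_mono[OF Suc.IH[OF s Suc.prems(2,3)] K \<open>0 \<le> \<omega>'\<close>]
          psm_periodic[OF Suc.prems(1)] psm_bound[OF Suc.prems(1)]])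
qed

text \<open>At the level where the shorter chain ends, the required Lipschitz bound comes from the
  bound on the next derivative by the mean value inequality.\<close>

lemma psm_Suc:
  "psm \<omega> (Suc n) K f \<Longrightarrow> psm \<omega> n K f"
proof (induction n arbitrary: K f)
  case 0
  show ?case
    by (rule psm_0I[OF psm_periodic[OF 0] psm_bound[OF 0] psm_lipschitz[OF 0]])
next
  case (Suc n)
  obtain f' where
    f': "\<And>x. x \<in> {a..b} \<Longrightarrow> (f has_vector_derivative f' x) (at x within {a..b})" and
    s: "psm \<omega> (Suc n) (K * \<omega>) f'"
    by (rule psm_SucE[OF Suc.prems(1)]) (rule that)
  show ?case
    by (rule psm_SucI[OF f' Suc.IH[OF s] psm_periodic[OF Suc.prems] psm_bound[OF Suc.prems]])
qed

lemma psm_le: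
  assumes "psm \<omega> n K f" "k \<le> n"
  shows "psm \<omega> k K f"
  using assms(2)
proof (induction rule: inc_induct)
  case base
  show ?case by (rule assms(1))
next
  case (step j)
  show ?case by (rule psm_Suc[OF step.IH])
qed

lemma psm_const: "norm c \<le> K \<Longrightarrow> 0 \<le> \<omega> \<Longrightarrow> psm \<omega> n K (\<lambda>_. c)"
proof (induction n arbitrary: c K)
  case 0
  have "0 \<le> K" using 0 norm_ge_zero[of c] by linarith
  then show ?case using 0 by auto
next
  case (Suc n)
  have "0 \<le> K" using Suc norm_ge_zero[of c] by linarith
  then have *: "psm \<omega> n (K * \<omega>) (\<lambda>_. 0)"
    by (intro Suc.IH) (use Suc.prems in simp_all)
  show ?case
    by (rule psm_SucI[OF has_vector_derivative_const * refl Suc.prems(1)])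
qed

lemma psm_add:
  "psm \<omega> n K f \<Longrightarrow> psm \<omega> n K' g \<Longrightarrow> psm \<omega> n (K + K') (\<lambda>x. f x + g x)"
proof (induction n arbitrary: K K' f g)
  case 0
  have "norm (f x + g x - (f y + g y)) \<le> (K + K') * \<omega> * \<bar>x - y\<bar>"
    if "x \<in> {a..b}" "y \<in> {a..b}" for x y
  proof -
    have "norm (f x + g x - (f y + g y)) \<le> norm (f x - f y) + norm (g x - g y)"
      by (metis add_diff_add norm_triangle_ineq)
    also have "\<dots> \<le> K * \<omega> * \<bar>x - y\<bar> + K' * \<omega> * \<bar>x - y\<bar>"
      using 0 that by (intro add_mono) auto
    finally show ?thesis by (simp add: algebra_simps)
  qed
  then show ?case using 0 by (auto intro!: norm_triangle_le add_mono)
next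
  case (Suc n)
  obtain f' where
    f': "\<And>x. x \<in> {a..b} \<Longrightarrow> (f has_vector_derivative f' x) (at x within {a..b})" and
    s1: "psm \<omega> n (K * \<omega>) f'"
    by (rule psm_SucE[OF Suc.prems(1)]) (rule that)
  obtain g' where
    g': "\<And>x. x \<in> {a..b} \<Longrightarrow> (g has_vector_derivative g' x) (at x within {a..b})" and
    s2: "psm \<omega> n (K' * \<omega>) g'"
    by (rule psm_SucE[OF Suc.prems(2)]) (rule that)
  note s = s1 s2
  have "psm \<omega> n ((K + K') * \<omega>) (\<lambda>x. f' x + g' x)"
    using Suc.IH[OF s] by (simp add: algebra_simps)
  moreover have "((\<lambda>x. f x + g x) has_vector_derivative f' x + g' x) (at x within {a..b})"
    if "x \<in> {a..b}" for x
    using f'[OF that] g'[OF that] by (rule has_vector_derivative_add)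
  moreover have "norm (f x + g x) \<le> K + K'" if "x \<in> {a..b}" for x
    using norm_triangle_le[OF add_mono[OF psm_bound[OF Suc.prems(1) that] psm_bound[OF Suc.prems(2) that]]] .
  moreover have "f a + g a = f b + g b"
    using psm_periodic[OF Suc.prems(1)] psm_periodic[OF Suc.prems(2)] by simp
  ultimately show ?case by (intro psm_SucI[of "\<lambda>x. f x + g x"])
qed

text \<open>Leibniz rule. The Lipschitz bound of a product has two terms, which gives the first
  factor 2; every differentiation again produces two products and doubles the constant.\<close>

lemma psm_mult:
  "psm \<omega> n K f \<Longrightarrow> psm \<omega> n K' g \<Longrightarrow> psm \<omega> n (2 ^ (n + 1) * K * K') (\<lambda>x. f x * g x)"
proof (induction n arbitrary: K K' f g)
  case 0
  have K: "0 \<le> K" "0 \<le> K'" using 0 psm_nonneg by blast+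
  have 1: "norm (f x * g x) \<le> 2 * K * K'" if "x \<in> {a..b}" for x
  proof -
    have "norm (f x * g x) \<le> K * K'"
      using 0 that K by (auto simp: norm_mult intro!: mult_mono)
    also have "\<dots> \<le> 2 * K * K'" using K by simp
    finally show ?thesis .
  qed
  have 2: "norm (f x * g x - f y * g y) \<le> 2 * K * K' * \<omega> * \<bar>x - y\<bar>"
    if "x \<in> {a..b}" "y \<in> {a..b}" for x y
  proof -
    have "f x * g x - f y * g y = f x * (g x - g y) + (f x - f y) * g y"
      by (simp add: algebra_simps)
    also have "norm \<dots> \<le> norm (f x) * norm (g x - g y) + norm (f x - f y) * norm (g y)"
      by (metis norm_mult norm_triangle_ineq)
    also have "\<dots> \<le> K * (K' * \<omega> * \<bar>x - y\<bar>) + (K * \<omega> * \<bar>x - y\<bar>) * K'"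
    proof (rule add_mono; rule mult_mono)
      show "0 \<le> K * \<omega> * \<bar>x - y\<bar>"
        using 0(1) that norm_ge_zero[of "f x - f y"] by (auto simp del: norm_ge_zero intro: order_trans)
    qed (use 0 K that in auto)
    finally show ?thesis by (simp add: algebra_simps)
  qed
  show ?case using 0 1 2 by auto
next
  case (Suc n)
  obtain f' where
    f': "\<And>x. x \<in> {a..b} \<Longrightarrow> (f has_vector_derivative f' x) (at x within {a..b})" and
    s1: "psm \<omega> n (K * \<omega>) f'"
    by (rule psm_SucE[OF Suc.prems(1)]) (rule that)
  obtain g' where
    g': "\<And>x. x \<in> {a..b} \<Longrightarrow> (g has_vector_derivative g' x) (at x within {a..b})" and
    s2: "psm \<omega> n (K' * \<omega>) g'"
    by (rule psm_SucE[OF Suc.prems(2)]) (rule that)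
  note s = s1 s2
  have K: "0 \<le> K" "0 \<le> K'" using Suc.prems psm_nonneg by blast+
  have fg: "psm \<omega> n K f" "psm \<omega> n K' g" using Suc.prems psm_Suc by blast+
  have "psm \<omega> n (2 ^ (Suc n + 1) * K * K' * \<omega>) (\<lambda>x. f x * g' x + f' x * g x)"
    using psm_add[OF Suc.IH[OF fg(1) s(2)] Suc.IH[OF s(1) fg(2)]] by (simp add: algebra_simps)
  moreover have "((\<lambda>x. f x * g x) has_vector_derivative f x * g' x + f' x * g x) (at x within {a..b})"
    if "x \<in> {a..b}" for x
    using has_vector_derivative_mult[OF f'[OF that] g'[OF that]] .
  moreover have "norm (f x * g x) \<le> 2 ^ (Suc n + 1) * K * K'" if "x \<in> {a..b}" for x
  proof -
    have "norm (f x * g x) \<le> K * K'"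
      using psm_bound[OF Suc.prems(1) that] psm_bound[OF Suc.prems(2) that] K
      by (auto simp: norm_mult intro!: mult_mono)
    also have "\<dots> \<le> 2 ^ (Suc n + 1) * (K * K')"
      using K mult_right_mono[of 1 "2 ^ (Suc n + 1)" "K * K'"] by (simp del: power_Suc)
    finally show ?thesis by (simp add: mult.assoc)
  qed
  moreover have "f a * g a = f b * g b"
    using psm_periodic[OF Suc.prems(1)] psm_periodic[OF Suc.prems(2)] by simp
  ultimately show ?case by (intro psm_SucI[of "\<lambda>x. f x * g x"])
qed

lemma psm_cmult:
  "psm \<omega> n K f \<Longrightarrow> norm c \<le> C \<Longrightarrow> 0 \<le> \<omega> \<Longrightarrow> psm \<omega> n (C * K) (\<lambda>x. c * f x)"
proof (induction n arbitrary: K f)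
  case 0
  have C: "0 \<le> C" using 0 norm_ge_zero[of c] by linarith
  have "norm (c * f x - c * f y) \<le> C * K * \<omega> * \<bar>x - y\<bar>"
    if "x \<in> {a..b}" "y \<in> {a..b}" for x y
  proof -
    have "norm (c * f x - c * f y) = norm c * norm (f x - f y)"
      by (simp add: right_diff_distrib[symmetric] norm_mult)
    also have "\<dots> \<le> C * (K * \<omega> * \<bar>x - y\<bar>)"
      using 0 that C by (intro mult_mono) auto
    finally show ?thesis by (simp add: algebra_simps)
  qed
  then show ?case using 0 C by (auto simp: norm_mult intro!: mult_mono)
next
  case (Suc n)
  have C: "0 \<le> C" using Suc.prems norm_ge_zero[of c] by linarith
  obtain f' where
    f': "\<And>x. x \<in> {a..b} \<Longrightarrow> (f has_vector_derivative f' x) (at x within {a..b})" and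
    s: "psm \<omega> n (K * \<omega>) f'"
    by (rule psm_SucE[OF Suc.prems(1)]) (rule that)
  have "psm \<omega> n (C * K * \<omega>) (\<lambda>x. c * f' x)"
    using Suc.IH[OF s] Suc.prems by (simp add: algebra_simps)
  moreover have "((\<lambda>x. c * f x) has_vector_derivative c * f' x) (at x within {a..b})"
    if "x \<in> {a..b}" for x
    using has_vector_derivative_mult_right[OF f'[OF that]] .
  moreover have "norm (c * f x) \<le> C * K" if "x \<in> {a..b}" for x
    using psm_bound[OF Suc.prems(1) that] Suc.prems(2) C by (auto simp: norm_mult intro!: mult_mono)
  moreover have "c * f a = c * f b"
    using psm_periodic[OF Suc.prems(1)] by simp
  ultimately show ?case by (intro psm_SucI[of "\<lambda>x. c * f x"])
qed

lemma psm_cnj: "psm \<omega> n K f \<Longrightarrow> psm \<omega> n K (\<lambda>x. cnj (f x))"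
proof (induction n arbitrary: K f)
  case 0
  then show ?case by (auto simp flip: complex_cnj_diff)
next
  case (Suc n)
  obtain f' where
    f': "\<And>x. x \<in> {a..b} \<Longrightarrow> (f has_vector_derivative f' x) (at x within {a..b})" and
    s: "psm \<omega> n (K * \<omega>) f'"
    by (rule psm_SucE[OF Suc.prems(1)]) (rule that)
  have "((\<lambda>x. cnj (f x)) has_vector_derivative cnj (f' x)) (at x within {a..b})"
    if "x \<in> {a..b}" for x
    using bounded_linear.has_vector_derivative[OF bounded_linear_cnj f'[OF that]] .
  moreover have "norm (cnj (f x)) \<le> K" if "x \<in> {a..b}" for x
    using psm_bound[OF Suc.prems(1) that] by simp
  moreover have "cnj (f a) = cnj (f b)"
    using psm_periodic[OF Suc.prems(1)] by simp
  ultimately show ?case using Suc.IH[OF s] by (intro psm_SucI[of "\<lambda>x. cnj (f x)"])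
qed

text \<open>Subtracting 1 keeps a factor |\<theta>| in front of all derivatives at once, which later
  makes the spatial error of one step proportional to the step. The bound \<open>H\<close> enters
  only through the exponential inside the derivative, which has to be bounded but not small.\<close>

lemma psm_exp_minus_1:
  fixes v :: "real \<Rightarrow> real"
  assumes "\<bar>\<theta>\<bar> \<le> H" "0 \<le> \<omega>"
  shows "psm \<omega> n P (\<lambda>x. of_real (v x)) \<Longrightarrow>
    psm \<omega> n (\<bar>\<theta>\<bar> * exp_const P H n) (\<lambda>x. exp (\<i> * of_real (\<theta> * v x)) - 1)"
proof (induction n)
  case 0
  have "norm (exp (\<i> * of_real (\<theta> * v x)) - exp (\<i> * of_real (\<theta> * v y))) \<le> \<bar>\<theta>\<bar> * P * \<omega> * \<bar>x - y\<bar>"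
    if "x \<in> {a..b}" "y \<in> {a..b}" for x y
  proof -
    have "norm (exp (\<i> * of_real (\<theta> * v x)) - exp (\<i> * of_real (\<theta> * v y))) \<le> \<bar>\<theta> * v x - \<theta> * v y\<bar>"
      by (rule norm_exp_i_diff_le)
    also have "\<dots> = \<bar>\<theta>\<bar> * norm (of_real (v x) - of_real (v y) :: complex)"
      by (simp add: abs_mult right_diff_distrib[symmetric] flip: of_real_diff)
    also have "\<dots> \<le> \<bar>\<theta>\<bar> * (P * \<omega> * \<bar>x - y\<bar>)"
      using 0 that by (intro mult_left_mono) auto
    finally show ?thesis by (simp add: algebra_simps)
  qed
  moreover have "norm (exp (\<i> * of_real (\<theta> * v x)) - 1) \<le> \<bar>\<theta>\<bar> * P" if "x \<in> {a..b}" for x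
  proof -
    have "norm (exp (\<i> * of_real (\<theta> * v x)) - 1) \<le> \<bar>\<theta>\<bar> * \<bar>v x\<bar>"
      using norm_exp_i_diff_le[of "\<theta> * v x" 0] by (simp add: abs_mult)
    also have "\<dots> \<le> \<bar>\<theta>\<bar> * P" using 0 that by (intro mult_left_mono) auto
    finally show ?thesis .
  qed
  moreover have "v a = v b" using 0 by simp
  ultimately show ?case by simp
next
  case (Suc n)
  have P: "0 \<le> P" using psm_nonneg[OF Suc.prems] .
  have H: "0 \<le> H" using assms by linarith
  let ?e = "\<lambda>x. exp (\<i> * of_real (\<theta> * v x)) - 1 :: complex"
  let ?c = "exp_const P H n"
  have c: "0 \<le> ?c" by (rule exp_const_nonneg[OF P H])
  obtain v' where
    v': "\<And>x. x \<in> {a..b} \<Longrightarrow> ((\<lambda>x. of_real (v x) :: complex) has_vector_derivative v' x) (at x within {a..b})" and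
    s: "psm \<omega> n (P * \<omega>) v'"
    by (rule psm_SucE[OF Suc.prems]) (rule that)
  have 1: "psm \<omega> n (\<bar>\<theta>\<bar> * ?c) ?e" by (rule Suc.IH[OF psm_Suc[OF Suc.prems]])
  have "psm \<omega> n (\<bar>\<theta>\<bar> * ?c + 1) (\<lambda>x. ?e x + 1)"
    by (rule psm_add[OF 1 psm_const]) (use assms in auto)
  then have "psm \<omega> n (H * ?c + 1) (\<lambda>x. ?e x + 1)"
    by (rule psm_mono) (use assms c in \<open>auto intro!: mult_right_mono\<close>)
  from psm_mult[OF s this]
  have "psm \<omega> n (2 ^ (n + 1) * (P * \<omega>) * (H * ?c + 1)) (\<lambda>x. v' x * exp (\<i> * of_real (\<theta> * v x)))" by simp
  from psm_cmult[OF this, of "\<i> * of_real \<theta>" "\<bar>\<theta>\<bar>"]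
  have "psm \<omega> n (\<bar>\<theta>\<bar> * (2 ^ (n + 1) * (P * \<omega>) * (H * ?c + 1))) (\<lambda>x. \<i> * of_real \<theta> * (v' x * exp (\<i> * of_real (\<theta> * v x))))"
    using assms by (simp add: norm_mult)
  then have 2: "psm \<omega> n (\<bar>\<theta>\<bar> * exp_const P H (Suc n) * \<omega>) (\<lambda>x. \<i> * of_real \<theta> * (v' x * exp (\<i> * of_real (\<theta> * v x))))"
    by (rule psm_mono) (use assms c P in \<open>auto simp: algebra_simps\<close>)
  have 3: "(?e has_vector_derivative \<i> * of_real \<theta> * (v' x * exp (\<i> * of_real (\<theta> * v x)))) (at x within {a..b})"
    if "x \<in> {a..b}" for x
  proof -
    have "((\<lambda>x. \<i> * of_real \<theta> * of_real (v x)) has_vector_derivative \<i> * of_real \<theta> * v' x) (at x within {a..b})"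
      by (rule has_vector_derivative_mult_right[OF v'[OF that]])
    from field_vector_diff_chain_within[OF this, of exp "exp (\<i> * of_real \<theta> * of_real (v x))"]
    have "((\<lambda>x. exp (\<i> * of_real \<theta> * of_real (v x))) has_vector_derivative
        \<i> * of_real \<theta> * v' x * exp (\<i> * of_real \<theta> * of_real (v x))) (at x within {a..b})"
      by (simp add: o_def DERIV_subset[OF DERIV_exp])
    from has_vector_derivative_diff[OF this has_vector_derivative_const[of 1]]
    show ?thesis by (simp add: algebra_simps)
  qed
  have "norm (?e x) \<le> \<bar>\<theta>\<bar> * exp_const P H (Suc n)" if "x \<in> {a..b}" for x
  proof -
    have "norm (of_real (v x) :: complex) \<le> P" using psm_bound[OF Suc.prems that] .
    then have "\<bar>v x\<bar> \<le> P" by simp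
    have "norm (?e x) \<le> \<bar>\<theta>\<bar> * \<bar>v x\<bar>"
      using norm_exp_i_diff_le[of "\<theta> * v x" 0] by (simp add: abs_mult)
    also have "\<dots> \<le> \<bar>\<theta>\<bar> * P" using \<open>\<bar>v x\<bar> \<le> P\<close> by (intro mult_left_mono) auto
    also have "\<dots> \<le> \<bar>\<theta>\<bar> * exp_const P H (Suc n)"
      using P c H by (intro mult_left_mono) auto
    finally show ?thesis .
  qed
  moreover have "v a = v b" using psm_periodic[OF Suc.prems] by simp
  ultimately show ?case using 2 3 by (intro psm_SucI[of ?e]) auto
qed

section \<open>Fourier coefficients\<close>

abbreviation "S \<equiv> {a<..<b}"
abbreviation "M\<^sub>S \<equiv> lebesgue_on {a<..<b}"

definition mean :: "(real \<Rightarrow> complex) \<Rightarrow> complex"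
  where "mean f = (LINT x|M\<^sub>S. f x) / of_real (b - a)"

text \<open>Bounded and measurable rather than continuous: the quotients in the convergence proof
  for Fourier series and the time derivatives obtained as pointwise limits are not known to be
  continuous, yet they and their products with waves must be integrable.\<close>

definition bm :: "(real \<Rightarrow> complex) \<Rightarrow> bool"
  where "bm f \<longleftrightarrow> f \<in> borel_measurable M\<^sub>S \<and> (\<exists>K. \<forall>x\<in>S. norm (f x) \<le> K)"

abbreviation "e \<equiv> wave a b"
abbreviation "\<mu> \<equiv> freq a b"

definition fc :: "(real \<Rightarrow> complex) \<Rightarrow> int \<Rightarrow> complex"
  where "fc f l = mean (\<lambda>x. f x * cnj (e l x))"

lemma finite_measure_S: "finite_measure M\<^sub>S"
  by (intro finite_measure_lebesgue_on) simp

lemma bm_measurable: "bm f \<Longrightarrow> f \<in> borel_measurable M\<^sub>S"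
  by (simp add: bm_def)

lemma bmI: "f \<in> borel_measurable M\<^sub>S \<Longrightarrow> (\<And>x. x \<in> S \<Longrightarrow> norm (f x) \<le> K) \<Longrightarrow> bm f"
  unfolding bm_def by blast

lemma integrable_bounded:
  fixes f :: "real \<Rightarrow> 'c::{banach, second_countable_topology}"
  assumes "f \<in> borel_measurable M\<^sub>S" "\<And>x. x \<in> S \<Longrightarrow> norm (f x) \<le> K"
  shows "integrable M\<^sub>S f"
  by (rule finite_measure.integrable_const_bound[OF finite_measure_S AE_I2 assms(1)])
    (use assms(2) in auto)

lemma bmE:
  assumes "bm f"
  obtains K where "0 \<le> K" "\<And>x. x \<in> S \<Longrightarrow> norm (f x) \<le> K"
proof -
  obtain K where K: "\<forall>x\<in>S. norm (f x) \<le> K" using assms unfolding bm_def by blast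
  show ?thesis by (rule that[of "max 0 K"]) (use K in \<open>auto simp: le_max_iff_disj\<close>)
qed

lemma bm_integrable:
  assumes "bm f" shows "integrable M\<^sub>S f"
proof -
  obtain K where "0 \<le> K" and K: "\<And>x. x \<in> S \<Longrightarrow> norm (f x) \<le> K" by (rule bmE[OF assms]) (rule that)
  show ?thesis by (rule integrable_bounded[OF bm_measurable[OF assms] K])
qed

lemma bm_continuous:
  assumes "continuous_on {a..b} f" shows "bm f"
proof -
  have "compact (f ` {a..b})" using assms by (intro compact_continuous_image) auto
  then obtain K where "\<forall>y\<in>f ` {a..b}. norm y \<le> K" using compact_imp_bounded bounded_iff by metis
  moreover have "f \<in> borel_measurable M\<^sub>S"
    by (rule continuous_imp_measurable_on_sets_lebesgue[OF continuous_on_subset[OF assms]]) auto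
  ultimately show ?thesis by (intro bmI[of f K]) auto
qed

lemma bm_const [simp]: "bm (\<lambda>_. c)"
  by (rule bm_continuous) auto

lemma bm_mult [intro]:
  assumes "bm f" "bm g" shows "bm (\<lambda>x. f x * g x)"
proof -
  obtain K where "0 \<le> K" and K: "\<And>x. x \<in> S \<Longrightarrow> norm (f x) \<le> K" by (rule bmE[OF assms(1)]) (rule that)
  obtain K' where "0 \<le> K'" and K': "\<And>x. x \<in> S \<Longrightarrow> norm (g x) \<le> K'" by (rule bmE[OF assms(2)]) (rule that)
  show ?thesis
  proof (rule bmI)
    show "norm (f x * g x) \<le> K * K'" if "x \<in> S" for x
      unfolding norm_mult by (rule mult_mono[OF K[OF that] K'[OF that] \<open>0 \<le> K\<close>]) simp
    show "(\<lambda>x. f x * g x) \<in> borel_measurable M\<^sub>S"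
      by (intro borel_measurable_times bm_measurable assms)
  qed
qed

lemma bm_add [intro]:
  assumes "bm f" "bm g" shows "bm (\<lambda>x. f x + g x)"
proof -
  obtain K where "0 \<le> K" and K: "\<And>x. x \<in> S \<Longrightarrow> norm (f x) \<le> K" by (rule bmE[OF assms(1)]) (rule that)
  obtain K' where "0 \<le> K'" and K': "\<And>x. x \<in> S \<Longrightarrow> norm (g x) \<le> K'" by (rule bmE[OF assms(2)]) (rule that)
  show ?thesis
  proof (rule bmI)
    show "norm (f x + g x) \<le> K + K'" if "x \<in> S" for x
      by (rule norm_triangle_le[OF add_mono[OF K[OF that] K'[OF that]]])
    show "(\<lambda>x. f x + g x) \<in> borel_measurable M\<^sub>S"
      by (intro borel_measurable_add bm_measurable assms)
  qed
qed

lemma bm_cnj [intro]: assumes "bm f" shows "bm (\<lambda>x. cnj (f x))"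
proof -
  have 1: "(\<lambda>x. cnj (f x)) \<in> borel_measurable M\<^sub>S"
    by (rule borel_measurable_continuous_on[OF _ bm_measurable[OF assms]])
      (intro continuous_intros)
  obtain K where "0 \<le> K" and K: "\<And>x. x \<in> S \<Longrightarrow> norm (f x) \<le> K" by (rule bmE[OF assms]) (rule that)
  show ?thesis by (rule bmI[OF 1]) (use K in simp)
qed

lemma bm_diff [intro]: "bm f \<Longrightarrow> bm g \<Longrightarrow> bm (\<lambda>x. f x - g x)"
  using bm_add[OF _ bm_mult[OF bm_const[of "-1"]], of f g] by simp

lemma bm_sum [intro]: "(\<And>i. i \<in> I \<Longrightarrow> bm (f i)) \<Longrightarrow> bm (\<lambda>x. \<Sum>i\<in>I. f i x)"
  by (induction I rule: infinite_finite_induct) auto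

lemma continuous_wave: "continuous_on A (e l)"
  unfolding wave_def by (intro continuous_intros)

lemma bm_wave [simp]: "bm (e l)"
  by (rule bm_continuous[OF continuous_wave])

lemmas bm_intros = bm_const bm_wave bm_mult bm_add bm_diff bm_cnj bm_sum

lemma psm_bm: "psm \<omega> n K f \<Longrightarrow> bm f"
  by (rule bm_continuous[OF psm_continuous])

lemma mean_add: "bm f \<Longrightarrow> bm g \<Longrightarrow> mean (\<lambda>x. f x + g x) = mean f + mean g"
  by (simp add: mean_def bm_integrable add_divide_distrib)

lemma mean_diff: "bm f \<Longrightarrow> bm g \<Longrightarrow> mean (\<lambda>x. f x - g x) = mean f - mean g"
  by (simp add: mean_def bm_integrable diff_divide_distrib)

lemma mean_cmult: "mean (\<lambda>x. c * f x) = c * mean f"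
  by (simp add: mean_def)

lemma mean_sum: "(\<And>i. i \<in> I \<Longrightarrow> bm (f i)) \<Longrightarrow> mean (\<lambda>x. \<Sum>i\<in>I. f i x) = (\<Sum>i\<in>I. mean (f i))"
  by (simp add: mean_def bm_integrable sum_divide_distrib)

lemma mean_cong: "(\<And>x. x \<in> S \<Longrightarrow> f x = g x) \<Longrightarrow> mean f = mean g"
  unfolding mean_def by (intro arg_cong2[where f="(/)"] Bochner_Integration.integral_cong) auto

lemma mean_cnj: "mean (\<lambda>x. cnj (f x)) = cnj (mean f)"
  by (simp add: mean_def)

lemma measure_S: "measure M\<^sub>S S = b - a"
  using ab by (simp add: measure_restrict_space)

lemma mean_const: "mean (\<lambda>_. c) = c"
proof -
  have "(LINT x|M\<^sub>S. c) = of_real (b - a) * c"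
    using measure_S by (simp add: scaleR_conv_of_real)
  then show ?thesis using ab by (simp add: mean_def)
qed

lemma norm_mean_le:
  assumes "\<And>x. x \<in> S \<Longrightarrow> norm (f x) \<le> K" "f \<in> borel_measurable M\<^sub>S"
  shows "norm (mean f) \<le> K"
proof -
  have "norm (LINT x|M\<^sub>S. f x) \<le> (LINT x|M\<^sub>S. norm (f x))" by (rule integral_norm_bound)
  also have "\<dots> \<le> (LINT x|M\<^sub>S. K)"
    using integrable_bounded[OF assms(2,1)] assms(1) finite_measure.integrable_const[OF finite_measure_S]
    by (intro integral_mono) auto
  also have "\<dots> = (b - a) * K" using measure_S by simp
  finally have *: "norm (LINT x|M\<^sub>S. f x) \<le> (b - a) * K" .
  have "norm (of_real (b - a) :: complex) = b - a" using ab by (simp del: of_real_diff)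
  then have "norm (mean f) = norm (LINT x|M\<^sub>S. f x) / (b - a)" unfolding mean_def norm_divide by simp
  also have "\<dots> \<le> K" using ab * by (simp add: pos_divide_le_eq mult.commute)
  finally show ?thesis .
qed

lemma integral_S_eq:
  fixes f :: "real \<Rightarrow> complex"
  assumes "bm f" shows "(LINT x|M\<^sub>S. f x) = integral {a..b} f"
  using lebesgue_integral_eq_integral[OF bm_integrable[OF assms]] by (simp add: integral_open_interval_real)

lemma mean_derivative:
  assumes F: "\<And>x. x \<in> {a..b} \<Longrightarrow> (F has_vector_derivative f x) (at x within {a..b})" and "bm f"
  shows "mean f = (F b - F a) / of_real (b - a)"
proof -
  have "(f has_integral (F b - F a)) {a..b}"
    using ab F by (intro fundamental_theorem_of_calculus) auto
  then show ?thesis using integral_S_eq[OF \<open>bm f\<close>] by (simp add: mean_def integral_unique)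
qed

section \<open>The waves as an orthonormal system, and Bessel's inequality\<close>

lemma wave_add: "e (k + l) x = e k x * e l x"
  by (simp add: wave_def freq_def distrib_left distrib_right add_divide_distrib algebra_simps flip: exp_add)

lemma wave_0 [simp]: "e 0 x = 1" by (simp add: wave_def freq_def)

lemma cnj_wave: "cnj (e l x) = e (- l) x"
  by (simp add: wave_def freq_def exp_cnj)

lemma norm_wave [simp]: "norm (e l x) = 1"
  by (simp add: wave_def)

lemma wave_nonzero [simp]: "e l x \<noteq> 0"
  by (simp add: wave_def)

lemma wave_a [simp]: "e l a = 1" by (simp add: wave_def)

lemma wave_b [simp]: "e l b = 1"
proof -
  have "freq a b l * (b - a) = 2 * pi * of_int l" using ab by (simp add: freq_def)
  then have "e l b = cis (2 * pi * of_int l)" by (simp add: wave_def cis_conv_exp)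
  also have "\<dots> = 1" by (rule cis_multiple_2pi) auto
  finally show ?thesis .
qed

lemma freq_eq_0_iff [simp]: "\<mu> l = 0 \<longleftrightarrow> l = 0" using ab by (simp add: freq_def)

lemma freq_minus [simp]: "\<mu> (- l) = - \<mu> l" by (simp add: freq_def)

lemma wave_deriv: "(e l has_vector_derivative \<i> * \<mu> l * e l x) (at x within A)"
proof -
  have "(e l has_vector_derivative (\<i> * of_real (\<mu> l)) * exp (\<i> * of_real (\<mu> l * (x - a)))) (at x within A)"
  proof -
    have 1: "((\<lambda>x. \<i> * of_real (\<mu> l * (x - a))) has_vector_derivative \<i> * of_real (\<mu> l)) (at x within A)"
      by (auto intro!: derivative_eq_intros simp: has_vector_derivative_def fun_eq_iff scaleR_conv_of_real)
    show ?thesis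
      using field_vector_diff_chain_within[OF 1, of exp, OF DERIV_subset[OF DERIV_exp]]
      by (simp add: o_def wave_def[abs_def])
  qed
  then show ?thesis by (simp add: wave_def)
qed

lemma mean_wave: "mean (e l) = (if l = 0 then 1 else 0)"
proof (cases "l = 0")
  case False
  have "mean (\<lambda>x. \<i> * \<mu> l * e l x) = (e l b - e l a) / of_real (b - a)"
    by (rule mean_derivative[OF wave_deriv]) auto
  then have "\<i> * \<mu> l * mean (e l) = 0" by (simp add: mean_cmult)
  then show ?thesis using False by simp
next
  case True
  have "e 0 = (\<lambda>_. 1)" by (rule ext) simp
  then show ?thesis using True mean_const[of 1] by simp
qed

lemma mean_wave_cnj: "mean (\<lambda>x. e k x * cnj (e l x)) = (if k = l then 1 else 0)"
proof -
  have "(\<lambda>x. e k x * cnj (e l x)) = e (k - l)"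
    by (rule ext) (use wave_add[of k "- l"] in \<open>simp add: cnj_wave\<close>)
  then show ?thesis using mean_wave[of "k - l"] by simp
qed

lemma norm2_mean_sum:
  assumes "finite F"
  shows "mean (\<lambda>x. (\<Sum>l\<in>F. c l * e l x) * cnj (\<Sum>l\<in>F. c l * e l x)) = of_real (\<Sum>l\<in>F. (norm (c l))\<^sup>2)"
proof -
  have "(\<Sum>l\<in>F. c l * e l x) * cnj (\<Sum>l\<in>F. c l * e l x) =
     (\<Sum>k\<in>F. \<Sum>l\<in>F. (c k * cnj (c l)) * (e k x * cnj (e l x)))" for x
    by (simp add: sum_product algebra_simps)
  then have "mean (\<lambda>x. (\<Sum>l\<in>F. c l * e l x) * cnj (\<Sum>l\<in>F. c l * e l x)) =
     (\<Sum>k\<in>F. \<Sum>l\<in>F. (c k * cnj (c l)) * mean (\<lambda>x. e k x * cnj (e l x)))"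
    by (simp add: mean_cmult mean_sum bm_sum bm_mult bm_cnj)
  also have "\<dots> = (\<Sum>k\<in>F. \<Sum>l\<in>F. if k = l then c k * cnj (c l) else 0)"
    by (intro sum.cong refl) (simp add: mean_wave_cnj)
  also have "\<dots> = (\<Sum>k\<in>F. c k * cnj (c k))" using assms by (simp add: sum.delta)
  also have "\<dots> = of_real (\<Sum>l\<in>F. (norm (c l))\<^sup>2)" by (simp only: of_real_sum complex_norm_square)
  finally show ?thesis .
qed

lemma mean_norm2_nonneg: "0 \<le> Re (mean (\<lambda>x. f x * cnj (f x)))"
proof -
  have "mean (\<lambda>x. f x * cnj (f x)) = of_real ((LINT x|M\<^sub>S. (norm (f x))\<^sup>2) / (b - a))"
    unfolding mean_def complex_norm_square[symmetric] by (simp flip: of_real_power)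
  then show ?thesis using ab by simp
qed

text \<open>The mean of |f - P|^2 is nonnegative for the partial sum P, and each of the three terms
  containing P reduces to the sum of the squared coefficients. The right side is a supremum bound
  because that is what \<open>psm\<close> controls.\<close>

lemma bessel:
  assumes f: "bm f" and K: "\<And>x. x \<in> S \<Longrightarrow> norm (f x) \<le> K" and F: "finite F"
  shows "(\<Sum>l\<in>F. (norm (fc f l))\<^sup>2) \<le> K\<^sup>2"
proof -
  let ?P = "\<lambda>x. \<Sum>l\<in>F. fc f l * e l x"
  let ?N = "of_real (\<Sum>l\<in>F. (norm (fc f l))\<^sup>2) :: complex"
  have P: "bm ?P" by (intro bm_sum bm_mult) auto
  have fP: "mean (\<lambda>x. f x * cnj (?P x)) = ?N"
  proof -
    have "mean (\<lambda>x. f x * cnj (?P x)) = mean (\<lambda>x. \<Sum>l\<in>F. cnj (fc f l) * (f x * cnj (e l x)))"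
      by (intro mean_cong) (simp add: sum_distrib_left mult_ac)
    also have "\<dots> = (\<Sum>l\<in>F. cnj (fc f l) * fc f l)"
      by (subst mean_sum) (rule bm_mult[OF bm_const bm_mult[OF f bm_cnj[OF bm_wave]]], simp add: mean_cmult fc_def)
    finally show ?thesis by (simp only: of_real_sum complex_norm_square mult.commute)
  qed
  have Pf: "mean (\<lambda>x. ?P x * cnj (f x)) = ?N"
  proof -
    have "mean (\<lambda>x. ?P x * cnj (f x)) = cnj (mean (\<lambda>x. f x * cnj (?P x)))"
      by (simp flip: mean_cnj add: mult.commute)
    then show ?thesis unfolding fP by simp
  qed
  have "mean (\<lambda>x. (f x - ?P x) * cnj (f x - ?P x)) =
     mean (\<lambda>x. (f x * cnj (f x) - f x * cnj (?P x)) - (?P x * cnj (f x) - ?P x * cnj (?P x)))"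
    by (simp add: algebra_simps)
  also have "\<dots> = mean (\<lambda>x. f x * cnj (f x)) - ?N - (?N - ?N)"
    using f P by (simp add: mean_diff bm_diff bm_mult bm_cnj fP Pf norm2_mean_sum[OF F] del: cnj_sum complex_cnj_mult)
  finally have "0 \<le> Re (mean (\<lambda>x. f x * cnj (f x)) - ?N)"
    using mean_norm2_nonneg[of "\<lambda>x. f x - ?P x"] by simp
  then have "(\<Sum>l\<in>F. (norm (fc f l))\<^sup>2) \<le> Re (mean (\<lambda>x. f x * cnj (f x)))" by simp
  also have "\<dots> \<le> norm (mean (\<lambda>x. f x * cnj (f x)))" by (rule complex_Re_le_cmod)
  also have "\<dots> \<le> K\<^sup>2"
  proof (rule norm_mean_le)
    show "norm (f x * cnj (f x)) \<le> K\<^sup>2" if "x \<in> S" for x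
      using power_mono[OF K[OF that], of 2] by (simp add: norm_mult power2_eq_square)
  qed (rule bm_measurable[OF bm_mult[OF f bm_cnj[OF f]]])
  finally show ?thesis .
qed

lemma fc_derivative:
  assumes F: "\<And>x. x \<in> {a..b} \<Longrightarrow> (f has_vector_derivative f' x) (at x within {a..b})"
    and "bm f'" "f a = f b"
  shows "fc f' l = \<i> * \<mu> l * fc f l"
proof -
  have f: "bm f"
    by (rule bm_continuous[OF continuous_on_vector_derivative[OF F]])
  have d: "((\<lambda>x. f x * cnj (e l x)) has_vector_derivative
      f x * (\<i> * \<mu> (- l) * cnj (e l x)) + f' x * cnj (e l x)) (at x within {a..b})"
    if "x \<in> {a..b}" for x
    using has_vector_derivative_mult[OF F[OF that] wave_deriv[of "- l" x "{a..b}"]]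
    by (simp add: cnj_wave)
  have "mean (\<lambda>x. f x * (\<i> * \<mu> (- l) * cnj (e l x)) + f' x * cnj (e l x)) = 0"
    using \<open>f a = f b\<close> f \<open>bm f'\<close> by (subst mean_derivative[OF d]) (auto intro!: bm_intros)
  moreover have "mean (\<lambda>x. f x * (\<i> * \<mu> (- l) * cnj (e l x)) + f' x * cnj (e l x)) =
      mean (\<lambda>x. (\<i> * \<mu> (- l)) * (f x * cnj (e l x)) + f' x * cnj (e l x))"
    by (simp add: algebra_simps)
  moreover have "\<dots> = mean (\<lambda>x. (\<i> * \<mu> (- l)) * (f x * cnj (e l x))) + mean (\<lambda>x. f' x * cnj (e l x))"
    by (rule mean_add) (intro bm_intros f \<open>bm f'\<close>)+
  moreover have "\<dots> = (\<i> * \<mu> (- l)) * fc f l + fc f' l"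
    by (simp only: mean_cmult fc_def)
  ultimately show ?thesis by (simp add: algebra_simps)
qed

section \<open>Translations of the circle and the decay of Fourier coefficients\<close>

definition shift :: "real \<Rightarrow> (real \<Rightarrow> complex) \<Rightarrow> real \<Rightarrow> complex"
  where "shift \<delta> h x = (if x \<le> b - \<delta> then h (x + \<delta>) else h (x + \<delta> - (b - a)))"

lemma continuous_shift:
  assumes h: "continuous_on {a..b} h" "h a = h b" and \<delta>: "0 < \<delta>" "\<delta> < b - a"
  shows "continuous_on {a..b} (shift \<delta> h)"
  unfolding shift_def
proof (rule continuous_on_cases_le)
  show "continuous_on {t \<in> {a..b}. t \<le> b - \<delta>} (\<lambda>x. h (x + \<delta>))"
    by (rule continuous_on_compose2[OF h(1)]) (use \<delta> in \<open>auto intro!: continuous_intros\<close>)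
  show "continuous_on {t \<in> {a..b}. b - \<delta> \<le> t} (\<lambda>x. h (x + \<delta> - (b - a)))"
    by (rule continuous_on_compose2[OF h(1)]) (use \<delta> in \<open>auto intro!: continuous_intros\<close>)
qed (use h \<delta> in \<open>auto intro!: continuous_intros\<close>)

text \<open>The translation exchanges the two pieces \<open>{a..a+\<delta>}\<close> and
  \<open>{a+\<delta>..b}\<close> of the interval; on each piece it is a plain change of
  variables.\<close>

lemma mean_shift:
  assumes h: "continuous_on {a..b} h" "h a = h b" and \<delta>: "0 < \<delta>" "\<delta> < b - a"
  shows "mean (shift \<delta> h) = mean h"
proof -
  have i1: "h integrable_on {a..a+\<delta>}" and i2: "h integrable_on {a+\<delta>..b}"
    using \<delta> by (auto intro!: integrable_continuous_interval continuous_on_subset[OF h(1)])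
  have j: "(h has_integral (integral {a..a+\<delta>} h + integral {a+\<delta>..b} h)) {a..b}"
    using \<delta> by (intro has_integral_combine[of a "a+\<delta>" b] integrable_integral i1 i2) auto
  have k2: "((\<lambda>x. h (x + \<delta>)) has_integral integral {a+\<delta>..b} h) {a..b-\<delta>}"
    using has_integral_shift_real_ivl[OF integrable_integral[OF i2], of \<delta>] by simp
  have k1: "((\<lambda>x. h (x + (\<delta> - (b - a)))) has_integral integral {a..a+\<delta>} h) {b-\<delta>..b}"
    using has_integral_shift_real_ivl[OF integrable_integral[OF i1], of "\<delta> - (b - a)"]
    by (simp add: algebra_simps)
  have l2: "(shift \<delta> h has_integral integral {a+\<delta>..b} h) {a..b-\<delta>}"
    by (rule has_integral_eq[OF _ k2]) (simp add: shift_def)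
  \<comment> \<open>At the common endpoint \<open>b-\<delta>\<close> the first branch of
    \<open>shift\<close> applies and gives \<open>h b\<close>, whereas this piece calls for
    \<open>h a\<close>; periodicity reconciles them.\<close>
  have l1: "(shift \<delta> h has_integral integral {a..a+\<delta>} h) {b-\<delta>..b}"
    by (rule has_integral_eq[OF _ k1]) (use h(2) in \<open>auto simp: shift_def algebra_simps\<close>)
  have "(shift \<delta> h has_integral (integral {a+\<delta>..b} h + integral {a..a+\<delta>} h)) {a..b}"
    using \<delta> by (intro has_integral_combine[of a "b-\<delta>" b] l1 l2) auto
  then have "integral {a..b} (shift \<delta> h) = integral {a..b} h"
    using j by (simp add: integral_unique add.commute)
  then show ?thesis
    using integral_S_eq[OF bm_continuous[OF continuous_shift[OF assms]]]
      integral_S_eq[OF bm_continuous[OF h(1)]] by (simp add: mean_def)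
qed

lemma wave_shift: "e l (x + \<delta>) = exp (\<i> * of_real (\<mu> l * \<delta>)) * e l x"
  by (simp add: wave_def algebra_simps flip: exp_add)

lemma wave_period: "e l (x - (b - a)) = e l x"
proof -
  have "e l (x + (a - b)) = exp (\<i> * of_real (\<mu> l * (a - b))) * e l x" by (rule wave_shift)
  moreover have "e l (a + (b - a)) = exp (\<i> * of_real (\<mu> l * (b - a))) * e l a" by (rule wave_shift)
  then have "exp (\<i> * of_real (\<mu> l * (b - a))) = 1" by simp
  then have "exp (- (\<i> * of_real (\<mu> l * (b - a)))) = 1" by (simp add: exp_minus)
  then have "exp (\<i> * of_real (\<mu> l * (a - b))) = 1" by (simp add: algebra_simps)
  ultimately show ?thesis by (simp add: algebra_simps)
qed

lemma fc_shift:
  assumes g: "continuous_on {a..b} g" "g a = g b" and \<delta>: "0 < \<delta>" "\<delta> < b - a"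
  shows "fc (shift \<delta> g) l = exp (\<i> * of_real (\<mu> l * \<delta>)) * fc g l"
proof -
  let ?h = "\<lambda>x. g x * cnj (e l x)"
  have "continuous_on {a..b} ?h"
    by (intro continuous_intros g continuous_wave)
  moreover have "?h a = ?h b" using g by simp
  ultimately have "mean (shift \<delta> ?h) = fc g l"
    unfolding fc_def by (rule mean_shift[OF _ _ \<delta>])
  moreover have "shift \<delta> ?h = (\<lambda>x. cnj (exp (\<i> * of_real (\<mu> l * \<delta>))) * (shift \<delta> g x * cnj (e l x)))"
    by (rule ext) (simp add: shift_def wave_period wave_shift)
  ultimately have 1: "cnj (exp (\<i> * of_real (\<mu> l * \<delta>))) * fc (shift \<delta> g) l = fc g l"
    by (simp only: mean_cmult fc_def)
  have "exp (\<i> * of_real (\<mu> l * \<delta>)) * cnj (exp (\<i> * of_real (\<mu> l * \<delta>))) = 1"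
    by (simp flip: complex_norm_square)
  then show ?thesis unfolding 1[symmetric] mult.assoc[symmetric] by simp
qed

lemma fc_cmult: "fc (\<lambda>x. c * f x) l = c * fc f l"
  by (simp add: fc_def mean_cmult mult.assoc)

lemma fc_diff: "bm f \<Longrightarrow> bm g \<Longrightarrow> fc (\<lambda>x. f x - g x) l = fc f l - fc g l"
  unfolding fc_def left_diff_distrib by (rule mean_diff) (intro bm_intros; assumption)+

text \<open>The second-order Taylor bound read backwards: the chord falls short of the arc by at
  most the square of the arc, so the two are comparable for small angles.\<close>

lemma norm_exp_i_ge: "\<bar>\<theta>\<bar> - \<theta>\<^sup>2 \<le> norm (exp (\<i> * of_real \<theta>) - 1)"
proof -
  have "\<bar>\<theta>\<bar> = norm (\<i> * of_real \<theta>)" by (simp add: norm_mult)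
  also have "\<dots> \<le> norm (exp (\<i> * of_real \<theta>) - 1) + norm (exp (\<i> * of_real \<theta>) - 1 - \<i> * of_real \<theta>)"
    using norm_triangle_sub[of "\<i> * of_real \<theta>" "exp (\<i> * of_real \<theta>) - 1"]
    by (simp add: norm_minus_commute)
  finally show ?thesis using norm_exp_i_linear_le[of \<theta>] by linarith
qed

text \<open>Bessel's inequality for the difference quotients of \<open>g\<close>, whose coefficients tend to those a
  derivative would have.\<close>

lemma coeffs_lipschitz:
  assumes g: "psm \<omega> 0 K g" and F: "finite F"
  shows "(\<Sum>l\<in>F. (\<bar>\<mu> l\<bar> * norm (fc g l))\<^sup>2) \<le> (K * \<omega>)\<^sup>2"
proof -
  have gc: "continuous_on {a..b} g" and gp: "g a = g b"
    using psm_continuous[OF g] psm_periodic[OF g] .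
  \<comment> \<open>\<open>small\<close> makes |\<mu>| - \<mu>^2 \<delta> nonnegative, so that this
    lower bound for the Fourier factor of the difference quotient survives squaring. As
    \<open>F\<close> is finite, all sufficiently small \<delta> qualify and the limit \<delta>
    \<rightarrow> 0 can be taken.\<close>
  have main: "(\<Sum>l\<in>F. ((\<bar>\<mu> l\<bar> - (\<mu> l)\<^sup>2 * \<delta>) * norm (fc g l))\<^sup>2) \<le> (K * \<omega>)\<^sup>2"
    if \<delta>: "0 < \<delta>" "\<delta> < b - a" and small: "\<forall>l\<in>F. \<bar>\<mu> l\<bar> * \<delta> \<le> 1" for \<delta>
  proof -
    let ?q = "\<lambda>x. of_real (1 / \<delta>) * (shift \<delta> g x - g x)"
    have bm0: "bm (shift \<delta> g)" "bm g"
      using bm_continuous[OF continuous_shift[OF gc gp \<delta>]] bm_continuous[OF gc] .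
    have "bm ?q" by (intro bm_intros bm0)
    note bm = bm0 this
    have q: "norm (?q x) \<le> K * \<omega>" if "x \<in> S" for x
    proof -
      have "norm (shift \<delta> g x - g x) \<le> K * \<omega> * \<delta>"
      proof (cases "x \<le> b - \<delta>")
        case True
        then show ?thesis using psm_lipschitz[OF g, of "x + \<delta>" x] that \<delta> by (simp add: shift_def)
      next
        case False
        let ?y = "x + \<delta> - (b - a)"
        \<comment> \<open>The translated point has passed \<open>b\<close>: the increment is split
          at the glued endpoint, and the two distances add up to \<delta>.\<close>
        have "norm (shift \<delta> g x - g x) = norm ((g ?y - g a) + (g b - g x))"
          using False gp by (simp add: shift_def)
        also have "\<dots> \<le> norm (g ?y - g a) + norm (g b - g x)" by (rule norm_triangle_ineq)
        also have "\<dots> \<le> K * \<omega> * \<bar>?y - a\<bar> + K * \<omega> * \<bar>b - x\<bar>"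
          using that \<delta> False by (intro add_mono psm_lipschitz[OF g]) auto
        also have "\<dots> = K * \<omega> * \<delta>" using that False by (simp add: algebra_simps)
        finally show ?thesis .
      qed
      then show ?thesis using \<delta> by (simp add: norm_mult norm_divide field_simps)
    qed
    have fcq: "fc ?q l = of_real (1 / \<delta>) * ((exp (\<i> * of_real (\<mu> l * \<delta>)) - 1) * fc g l)" for l
      by (simp only: fc_cmult fc_diff[OF bm(1,2)] fc_shift[OF gc gp \<delta>] left_diff_distrib mult_1_left)
    have "(\<Sum>l\<in>F. ((\<bar>\<mu> l\<bar> - (\<mu> l)\<^sup>2 * \<delta>) * norm (fc g l))\<^sup>2) \<le> (\<Sum>l\<in>F. (norm (fc ?q l))\<^sup>2)"
    proof (intro sum_mono power_mono)
      fix l assume l: "l \<in> F"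
      have "\<bar>\<mu> l\<bar> * (\<bar>\<mu> l\<bar> * \<delta>) \<le> \<bar>\<mu> l\<bar> * 1"
        using small l by (intro mult_left_mono) auto
      then show "0 \<le> (\<bar>\<mu> l\<bar> - (\<mu> l)\<^sup>2 * \<delta>) * norm (fc g l)"
        by (intro mult_nonneg_nonneg) (auto simp: power2_eq_square mult.assoc[symmetric])
      have "\<bar>\<mu> l * \<delta>\<bar> - (\<mu> l * \<delta>)\<^sup>2 \<le> norm (exp (\<i> * of_real (\<mu> l * \<delta>)) - 1)" by (rule norm_exp_i_ge)
      then have "\<delta> * (\<bar>\<mu> l\<bar> - (\<mu> l)\<^sup>2 * \<delta>) \<le> norm (exp (\<i> * of_real (\<mu> l * \<delta>)) - 1)"
        using \<delta> by (simp add: abs_mult power2_eq_square algebra_simps)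
      then have "\<bar>\<mu> l\<bar> - (\<mu> l)\<^sup>2 * \<delta> \<le> norm (exp (\<i> * of_real (\<mu> l * \<delta>)) - 1) / \<delta>"
        using \<delta> by (simp add: field_simps)
      then have "(\<bar>\<mu> l\<bar> - (\<mu> l)\<^sup>2 * \<delta>) * norm (fc g l)
          \<le> norm (exp (\<i> * of_real (\<mu> l * \<delta>)) - 1) / \<delta> * norm (fc g l)"
        by (rule mult_right_mono) simp
      also have "\<dots> = norm (fc ?q l)" using \<delta> by (simp only: fcq norm_mult norm_of_real) simp
      finally show "(\<bar>\<mu> l\<bar> - (\<mu> l)\<^sup>2 * \<delta>) * norm (fc g l) \<le> norm (fc ?q l)" .
    qed
    also have "\<dots> \<le> (K * \<omega>)\<^sup>2" by (rule bessel[OF bm(3) q F])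
    finally show ?thesis .
  qed
  have ev: "\<forall>\<^sub>F \<delta> in at_right 0. (\<Sum>l\<in>F. ((\<bar>\<mu> l\<bar> - (\<mu> l)\<^sup>2 * \<delta>) * norm (fc g l))\<^sup>2) \<le> (K * \<omega>)\<^sup>2"
  proof -
    have "\<forall>\<^sub>F \<delta> in at_right 0. \<delta> < b - a"
      using ab by (intro order_tendstoD[OF tendsto_ident_at]) auto
    moreover have "\<forall>\<^sub>F \<delta> in at_right (0::real). 0 < \<delta>" by (simp add: eventually_at_right_less)
    moreover have "\<forall>\<^sub>F \<delta> in at_right 0. \<forall>l\<in>F. \<bar>\<mu> l\<bar> * \<delta> \<le> 1"
    proof (rule eventually_ball_finite[OF F], rule ballI)
      fix l
      have "((\<lambda>\<delta>. \<bar>\<mu> l\<bar> * \<delta>) \<longlongrightarrow> \<bar>\<mu> l\<bar> * 0) (at_right 0)" by (intro tendsto_intros)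
      then show "\<forall>\<^sub>F \<delta> in at_right 0. \<bar>\<mu> l\<bar> * \<delta> \<le> 1"
        using order_tendstoD(2)[of "\<lambda>\<delta>. \<bar>\<mu> l\<bar> * \<delta>" 0 "at_right 0" 1] by (auto elim: eventually_mono)
    qed
    ultimately show ?thesis by eventually_elim (rule main)
  qed
  have lim: "((\<lambda>\<delta>. \<Sum>l\<in>F. ((\<bar>\<mu> l\<bar> - (\<mu> l)\<^sup>2 * \<delta>) * norm (fc g l))\<^sup>2) \<longlongrightarrow>
      (\<Sum>l\<in>F. ((\<bar>\<mu> l\<bar> - (\<mu> l)\<^sup>2 * 0) * norm (fc g l))\<^sup>2)) (at_right 0)"
    by (intro tendsto_intros)
  show ?thesis using tendsto_upperbound[OF lim ev] by simp
qed

text \<open>Each classical derivative multiplies the coefficients by i\<mu>, and the Lipschitz bound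
  on the last one supplies one more power. Hence index \<open>n\<close> yields \<open>n + 1\<close>
  powers.\<close>

lemma coeffs_psm:
  assumes F: "finite F"
  shows "psm \<omega> n K f \<Longrightarrow> (\<Sum>l\<in>F. (\<bar>\<mu> l\<bar> ^ (n + 1) * norm (fc f l))\<^sup>2) \<le> (K * \<omega> ^ (n + 1))\<^sup>2"
proof (induction n arbitrary: K f)
  case 0
  show ?case using coeffs_lipschitz[OF 0 F] by simp
next
  case (Suc n)
  obtain f' where
    f': "\<And>x. x \<in> {a..b} \<Longrightarrow> (f has_vector_derivative f' x) (at x within {a..b})" and
    s: "psm \<omega> n (K * \<omega>) f'"
    by (rule psm_SucE[OF Suc.prems(1)]) (rule that)
  have "norm (fc f' l) = \<bar>\<mu> l\<bar> * norm (fc f l)" for l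
    using fc_derivative[OF f' psm_bm[OF s] psm_periodic[OF Suc.prems]] by (simp add: norm_mult)
  then show ?case using Suc.IH[OF s] by (simp add: mult_ac)
qed

section \<open>Pointwise convergence of Fourier series\<close>

lemma wave_ratio: "e 1 x / e 1 y = exp (\<i> * of_real (2 * pi * (x - y) / (b - a)))"
  by (simp add: wave_def freq_def algebra_simps diff_divide_distrib flip: exp_diff)

text \<open>Lipschitz continuity on the circle, measured by chords. For points that are close,
  either inside the interval or across its glued ends, the chord dominates a multiple of the
  distance. For all other angles it is at least sqrt(2 - 2 cos(1/2)), and the supremum of
  \<open>f\<close> suffices.\<close>

lemma chord_bound:
  assumes f: "psm \<omega> 0 K f" and xy: "x \<in> {a..b}" "y \<in> {a..b}" and \<omega>: "0 \<le> \<omega>"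
  shows "norm (f x - f y) \<le>
    (K * \<omega> * (b - a) + 4 * K / sqrt (2 - 2 * cos (1/2))) * norm (e 1 x / e 1 y - 1)"
    (is "_ \<le> (?A + ?B) * ?c")
proof -
  \<comment> \<open>The angle between the two points on the circle; 2 pi - \<phi> then measures the
    way across the endpoints.\<close>
  define \<phi> where "\<phi> = 2 * pi * \<bar>x - y\<bar> / (b - a)"
  have K: "0 \<le> K" by (rule psm_nonneg[OF f])
  have cos: "cos (1/2::real) < 1"
    using cos_monotone_0_pi[of 0 "1/2"] pi_gt3 by simp
  have A: "0 \<le> ?A" and B: "0 \<le> ?B" using K \<omega> ab cos by auto
  have small: "\<theta> / 2 \<le> norm (exp (\<i> * of_real \<theta>) - 1)" if "0 \<le> \<theta>" "\<theta> \<le> 1/2" for \<theta>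
  proof -
    have "\<theta> * \<theta> \<le> \<theta> * (1/2)" using that by (intro mult_left_mono) auto
    then show ?thesis using norm_exp_i_ge[of \<theta>] that by (simp add: power2_eq_square)
  qed
  have c: "?c = norm (exp (\<i> * of_real \<phi>) - 1)"
  proof (cases "y \<le> x")
    case True
    then show ?thesis by (simp add: wave_ratio \<phi>_def)
  next
    case False
    then have "e 1 x / e 1 y = cnj (exp (\<i> * of_real \<phi>))"
      by (simp add: wave_ratio \<phi>_def exp_cnj algebra_simps diff_divide_distrib)
    then have "e 1 x / e 1 y - 1 = cnj (exp (\<i> * of_real \<phi>) - 1)" by simp
    then show ?thesis by (simp only: complex_mod_cnj)
  qed
  have c': "?c = norm (exp (\<i> * of_real (2 * pi - \<phi>)) - 1)"
  proof -
    have "exp (\<i> * of_real (2 * pi - \<phi>)) = cnj (exp (\<i> * of_real \<phi>))"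
      using cis_multiple_2pi[of 1] by (simp add: exp_cnj right_diff_distrib exp_diff exp_minus divide_inverse mult_ac cis_conv_exp)
    then have "exp (\<i> * of_real (2 * pi - \<phi>)) - 1 = cnj (exp (\<i> * of_real \<phi>) - 1)" by simp
    then show ?thesis unfolding c by (simp only: complex_mod_cnj)
  qed
  have "\<bar>x - y\<bar> \<le> b - a" using xy by auto
  then have "\<bar>x - y\<bar> / (b - a) \<le> 1" using ab by simp
  from mult_left_mono[OF this, of "2 * pi"]
  have \<phi>: "0 \<le> \<phi>" "\<phi> \<le> 2 * pi"
    using ab by (auto simp: \<phi>_def)
  have L: "\<bar>x - y\<bar> = (b - a) * \<phi> / (2 * pi)" "b - a - \<bar>x - y\<bar> = (b - a) * (2 * pi - \<phi>) / (2 * pi)"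
    using ab by (auto simp: \<phi>_def field_simps)
  have l1: "(b - a) * \<theta> / (2 * pi) \<le> (b - a) * ?c" if "\<theta> / 2 \<le> ?c" "0 \<le> \<theta>" for \<theta>
  proof -
    have "\<theta> / (2 * pi) \<le> \<theta> / 2" using that pi_gt3 by (intro divide_left_mono) auto
    then have "\<theta> / (2 * pi) \<le> ?c" using that by linarith
    then show ?thesis using ab by (metis less_eq_real_def mult_left_mono times_divide_eq_right diff_ge_0_iff_ge)
  qed
  consider "\<phi> \<le> 1/2" | "2 * pi - \<phi> \<le> 1/2" | "1/2 < \<phi>" "1/2 < 2 * pi - \<phi>" by linarith
  then show ?thesis
  proof cases
    case 1
    have "norm (f x - f y) \<le> K * \<omega> * \<bar>x - y\<bar>" by (rule psm_lipschitz[OF f xy])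
    also have "\<dots> \<le> K * \<omega> * ((b - a) * ?c)"
      using small[of \<phi>] 1 \<phi> K \<omega> l1[of \<phi>] unfolding c[symmetric] L(1)
      by (intro mult_left_mono) auto
    also have "\<dots> = ?A * ?c" by simp
    also have "\<dots> \<le> (?A + ?B) * ?c" using B by (intro mult_right_mono) auto
    finally show ?thesis .
  next
    case 2
    have "norm (f x - f y) \<le> K * \<omega> * (b - a - \<bar>x - y\<bar>)"
    proof -
      have *: "norm (f u - f v) \<le> K * \<omega> * (b - a - (v - u))"
        if "u \<in> {a..b}" "v \<in> {a..b}" "u \<le> v" for u v
      proof -
        have "norm (f u - f v) = norm ((f u - f a) + (f b - f v))"
          using psm_periodic[OF f] by simp
        also have "\<dots> \<le> norm (f u - f a) + norm (f b - f v)" by (rule norm_triangle_ineq)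
        also have "\<dots> \<le> K * \<omega> * \<bar>u - a\<bar> + K * \<omega> * \<bar>b - v\<bar>"
          using that ab by (intro add_mono psm_lipschitz[OF f]) auto
        also have "\<dots> = K * \<omega> * (b - a - (v - u))" using that by (simp add: algebra_simps)
        finally show ?thesis .
      qed
      show ?thesis
      proof (cases "x \<le> y")
        case True then show ?thesis using *[OF xy True] by simp
      next
        case False then show ?thesis using *[OF xy(2,1)] by (simp add: norm_minus_commute)
      qed
    qed
    also have "\<dots> \<le> K * \<omega> * ((b - a) * ?c)"
      using small[of "2 * pi - \<phi>"] 2 \<phi> K \<omega> l1[of "2 * pi - \<phi>"] unfolding c'[symmetric] L(2)
      by (intro mult_left_mono) auto
    also have "\<dots> = ?A * ?c" by simp
    also have "\<dots> \<le> (?A + ?B) * ?c" using B by (intro mult_right_mono) auto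
    finally show ?thesis .
  next
    case 3
    have cosphi: "cos \<phi> \<le> cos (1/2)"
    proof (cases "\<phi> \<le> pi")
      case True then show ?thesis using 3 by (intro cos_monotone_0_pi_le) auto
    next
      case False
      then have "cos (2 * pi - \<phi>) \<le> cos (1/2)" using 3 by (intro cos_monotone_0_pi_le) auto
      then show ?thesis by (simp add: cos_diff)
    qed
    have "?c\<^sup>2 = 2 - 2 * cos \<phi>"
      unfolding c cis_conv_exp[symmetric] cmod_power2
      using sin_cos_squared_add[of \<phi>] by (simp add: power2_eq_square algebra_simps)
    then have "2 - 2 * cos (1/2) \<le> ?c\<^sup>2" using cosphi by simp
    then have "sqrt (2 - 2 * cos (1/2)) \<le> ?c" by (intro real_le_lsqrt) auto
    then have 4: "1 \<le> ?c / sqrt (2 - 2 * cos (1/2))" using cos by (simp add: field_simps)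
    have "norm (f x - f y) \<le> norm (f x) + norm (f y)" by (rule norm_triangle_ineq4)
    also have "\<dots> \<le> 4 * K * 1" using psm_bound[OF f xy(1)] psm_bound[OF f xy(2)] K by simp
    also have "\<dots> \<le> 4 * K * (?c / sqrt (2 - 2 * cos (1/2)))" using 4 K by (intro mult_left_mono) auto
    also have "\<dots> = ?B * ?c" by simp
    also have "\<dots> \<le> (?A + ?B) * ?c" using A by (intro mult_right_mono) auto
    finally show ?thesis .
  qed
qed

text \<open>Riemann-Lebesgue along any sequence of distinct frequencies: by Bessel's inequality the
  squared coefficients are summable.\<close>

lemma fc_tendsto_0:
  assumes g: "bm g" and c: "inj c"
  shows "(\<lambda>n::nat. fc g (c n)) \<longlonglongrightarrow> 0"
proof -
  obtain K where "0 \<le> K" and K: "\<And>x. x \<in> S \<Longrightarrow> norm (g x) \<le> K" by (rule bmE[OF g]) (rule that)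
  have "summable (\<lambda>n. (norm (fc g (c n)))\<^sup>2)"
  proof (rule bounded_imp_summable)
    fix n
    have "(\<Sum>k\<le>n. (norm (fc g (c k)))\<^sup>2) = (\<Sum>l\<in>c ` {..n}. (norm (fc g l))\<^sup>2)"
      by (subst sum.reindex) (auto intro: inj_on_subset[OF c])
    also have "\<dots> \<le> K\<^sup>2" by (rule bessel[OF g K]) auto
    finally show "(\<Sum>k\<le>n. (norm (fc g (c k)))\<^sup>2) \<le> K\<^sup>2" .
  qed auto
  then have "(\<lambda>n. (norm (fc g (c n)))\<^sup>2) \<longlonglongrightarrow> 0" by (rule summable_LIMSEQ_zero)
  then have "(\<lambda>n. sqrt ((norm (fc g (c n)))\<^sup>2)) \<longlonglongrightarrow> sqrt 0" by (intro tendsto_intros)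
  then show ?thesis by (simp add: tendsto_norm_zero_iff)
qed

lemma sum_telescope_int:
  fixes T :: "int \<Rightarrow> 'a::ab_group_add"
  assumes "A \<le> B + 1"
  shows "(\<Sum>l\<in>{A..B}. T (l - 1) - T l) = T (A - 1) - T B"
proof -
  have "A - 1 \<le> B" using assms by simp
  then show ?thesis
  proof (induction B rule: int_ge_induct)
  case (step i)
  have "{A..i + 1} = insert (i + 1) {A..i}" using step by auto
  then show ?case using step by simp
  qed simp
qed

text \<open>Chernoff's argument: dividing \<open>f - f(y)\<close> by \<open>e\<^sub>1/e\<^sub>1(y) - 1\<close> gives a bounded function whose
  Fourier coefficients make the partial sums telescope.\<close>

lemma fourier_partial_sum:
  assumes f: "psm \<omega> 0 K f" and \<omega>: "0 \<le> \<omega>" and y: "y \<in> {a..b}"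
  obtains g where "bm g"
    "\<And>x. x \<in> S \<Longrightarrow> norm (g x) \<le> K * \<omega> * (b - a) + 4 * K / sqrt (2 - 2 * cos (1/2))"
    "\<And>A B. A \<le> 0 \<Longrightarrow> 0 \<le> B \<Longrightarrow> (\<Sum>l\<in>{A..B}. fc f l * e l y) - f y
       = fc g (A - 1) * e (A - 1) y - fc g B * e B y"
proof
  let ?C = "K * \<omega> * (b - a) + 4 * K / sqrt (2 - 2 * cos (1/2))"
  let ?d = "\<lambda>x. e 1 x / e 1 y - 1"
  define g where "g = (\<lambda>x. (f x - f y) / ?d x)"
  have cb: "norm (f x - f y) \<le> ?C * norm (?d x)" if "x \<in> {a..b}" for x
    by (rule chord_bound[OF f that y \<omega>])
  have C: "0 \<le> ?C"
  proof -
    have "cos (1/2::real) < 1"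
      using cos_monotone_0_pi[of 0 "1/2"] pi_gt3 by simp
    then show ?thesis using psm_nonneg[OF f] \<omega> ab by simp
  qed
  show gC: "norm (g x) \<le> ?C" if "x \<in> S" for x
  proof (cases "?d x = 0")
    case True
    then show ?thesis unfolding g_def True using C by simp
  next
    case False
    then have "0 < norm (?d x)" by simp
    moreover have "norm (f x - f y) \<le> ?C * norm (?d x)" using that by (intro cb) auto
    ultimately show ?thesis unfolding g_def norm_divide by (simp only: pos_divide_le_eq)
  qed
  \<comment> \<open>Where the denominator vanishes, \<open>g\<close> is 0 by the convention for
    division, and the chord bound forces \<open>f x = f y\<close> there.\<close>
  have fy: "f x - f y = g x * ?d x" if "x \<in> S" for x
    using cb[of x] that by (cases "?d x = 0") (simp_all add: g_def)
  have "g \<in> borel_measurable M\<^sub>S"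
    unfolding g_def
    by (intro borel_measurable_divide borel_measurable_diff borel_measurable_const
        bm_measurable[OF psm_bm[OF f]] bm_measurable[OF bm_wave])
  then show bg: "bm g" by (rule bmI[OF _ gC])
  \<comment> \<open>The mean of \<open>(f x - f y) * cnj (e l x)\<close> is computed twice:
    directly, and with \<open>f x - f y\<close> replaced by
    \<open>g x * (e 1 x / e 1 y - 1)\<close>, where the factor \<open>e 1 x\<close> lowers the index
    by one.\<close>
  have fcf: "fc f l - (if l = 0 then f y else 0) = fc g (l - 1) / e 1 y - fc g l" for l
  proof -
    have 1: "mean (\<lambda>x. (f x - f y) * cnj (e l x)) = fc f l - (if l = 0 then f y else 0)"
    proof -
      have "mean (\<lambda>x. f y * cnj (e l x)) = (if l = 0 then f y else 0)"
        using mean_wave[of "- l"] by (simp add: mean_cmult cnj_wave)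
      moreover have "mean (\<lambda>x. (f x - f y) * cnj (e l x)) = fc f l - mean (\<lambda>x. f y * cnj (e l x))"
        unfolding left_diff_distrib fc_def
        by (rule mean_diff) (intro bm_intros psm_bm[OF f])+
      ultimately show ?thesis by simp
    qed
    have "mean (\<lambda>x. (f x - f y) * cnj (e l x))
        = mean (\<lambda>x. (1 / e 1 y) * (g x * cnj (e (l - 1) x)) - g x * cnj (e l x))"
    proof (rule mean_cong)
      fix x assume x: "x \<in> S"
      have "cnj (e (l - 1) x) = e 1 x * cnj (e l x)"
        using wave_add[of 1 "- l" x] by (simp add: cnj_wave)
      then show "(f x - f y) * cnj (e l x) = (1 / e 1 y) * (g x * cnj (e (l - 1) x)) - g x * cnj (e l x)"
        unfolding fy[OF x] by (simp add: algebra_simps)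
    qed
    also have "\<dots> = mean (\<lambda>x. (1 / e 1 y) * (g x * cnj (e (l - 1) x))) - mean (\<lambda>x. g x * cnj (e l x))"
      by (rule mean_diff) (intro bm_intros bg)+
    also have "\<dots> = (1 / e 1 y) * fc g (l - 1) - fc g l" by (simp only: mean_cmult fc_def)
    finally show ?thesis using 1 by simp
  qed
  fix A B :: int assume AB: "A \<le> 0" "0 \<le> B"
  let ?T = "\<lambda>l. fc g l * e l y"
  \<comment> \<open>The index 0 lies in the range, so correcting that one coefficient by
    \<open>f y\<close> subtracts exactly \<open>f y\<close> from the partial sum.\<close>
  have "(\<Sum>l\<in>{A..B}. fc f l * e l y) - f y
      = (\<Sum>l\<in>{A..B}. fc f l * e l y) - (\<Sum>l\<in>{A..B}. (if l = 0 then f y else 0) * e l y)"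
  proof -
    have "(\<Sum>l\<in>{A..B}. (if l = 0 then f y else 0) * e l y) = (\<Sum>l\<in>{A..B}. if l = 0 then f y else 0)"
      by (rule sum.cong) auto
    then show ?thesis using AB by (simp add: sum.delta)
  qed
  also have "\<dots> = (\<Sum>l\<in>{A..B}. ?T (l - 1) - ?T l)"
    unfolding sum_subtractf[symmetric] left_diff_distrib[symmetric] fcf
  proof (rule sum.cong[OF refl])
    fix l
    have "e l y = e 1 y * e (l - 1) y" using wave_add[of 1 "l - 1" y] by simp
    then show "(fc g (l - 1) / e 1 y - fc g l) * e l y = ?T (l - 1) - ?T l"
      by (simp add: left_diff_distrib)
  qed
  also have "\<dots> = ?T (A - 1) - ?T B" using AB by (intro sum_telescope_int) auto
  finally show "(\<Sum>l\<in>{A..B}. fc f l * e l y) - f y = ?T (A - 1) - ?T B" .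
qed

end

section \<open>Grid functions and the discrete Fourier transform\<close>

lemma sum_inverse_squares_le: "(\<Sum>k=1..n. 1 / (real k)\<^sup>2) \<le> 2"
proof -
  have "0 < n \<Longrightarrow> (\<Sum>k=1..n. 1 / (real k)\<^sup>2) \<le> 2 - 1 / real n"
  proof (induction n)
    case (Suc n)
    show ?case
    proof (cases "n = 0")
      case False
      have "1 / (real (Suc n))\<^sup>2 \<le> 1 / real n - 1 / real (Suc n)"
      proof -
        have "1 / (real (Suc n))\<^sup>2 \<le> 1 / (real n * real (Suc n))"
          using False by (intro divide_left_mono) (auto simp: power2_eq_square intro!: mult_right_mono)
        also have "\<dots> = 1 / real n - 1 / real (Suc n)" using False by (simp add: field_simps)
        finally show ?thesis .
      qed
      moreover have "(\<Sum>k=1..n. 1 / (real k)\<^sup>2) \<le> 2 - 1 / real n" using Suc.IH False by simp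
      moreover have "(\<Sum>k=1..Suc n. 1 / (real k)\<^sup>2) = (\<Sum>k=1..n. 1 / (real k)\<^sup>2) + 1 / (real (Suc n))\<^sup>2"
        by simp
      ultimately show ?thesis by linarith
    qed simp
  qed simp
  moreover have "0 \<le> 1 / real n" by simp
  ultimately show ?thesis by (cases "n = 0") (auto intro: order_trans)
qed

locale periodic_grid = real_interval +
  fixes M :: nat
  assumes M_pos: "0 < M" and M_even: "even M"
begin

abbreviation "gx \<equiv> grid a b M"

definition h where "h = (b - a) / real M"

lemma h_pos: "0 < h" using ab M_pos by (simp add: h_def)

lemma grid_eq: "gx j = a + real j * h" by (simp add: grid_def h_def)

lemma grid_in: "j < M \<Longrightarrow> gx j \<in> {a..b}" "j \<le> M \<Longrightarrow> gx j \<in> {a..b}"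
proof -
  have *: "gx j \<in> {a..b}" if "j \<le> M" for j
  proof -
    have "real j * h \<le> real M * h" using that h_pos by (intro mult_right_mono) auto
    moreover have "real M * h = b - a" using M_pos by (simp add: h_def)
    ultimately show ?thesis using h_pos by (auto simp: grid_eq)
  qed
  show "j < M \<Longrightarrow> gx j \<in> {a..b}" "j \<le> M \<Longrightarrow> gx j \<in> {a..b}" using * by auto
qed

lemma wave_grid: "e l (gx j) = exp (\<i> * of_real (2 * pi * of_int l * real j / real M))"
proof -
  have "x / d * (y * (d / z)) = x * y / z" if "d \<noteq> 0" for x y z d :: real
    using that by simp
  from this[of "b - a"] have "\<mu> l * (gx j - a) = 2 * pi * of_int l * real j / real M"
    using ab by (simp add: freq_def grid_def)
  then show ?thesis unfolding wave_def by (simp only:)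
qed

lemma wave_grid_power: "e l (gx j) = e l (gx 1) ^ j"
  by (simp add: wave_grid flip: exp_of_nat_mult) (simp add: mult_ac)

text \<open>The source of aliasing: with \<open>wave_grid_power\<close> and \<open>wave_add\<close>
  it follows that frequencies differing by a multiple of \<open>M\<close> coincide at all grid
  points.\<close>

lemma wave_grid_eq_1_iff: "e l (gx 1) = 1 \<longleftrightarrow> int M dvd l"
proof
  assume "e l (gx 1) = 1"
  then obtain n :: int where "2 * pi * of_int l / real M = of_int (2 * n) * pi"
    unfolding wave_grid exp_eq_1 by auto
  then have "real_of_int l = of_int (n * int M)" using M_pos by (simp add: field_simps)
  then have "l = n * int M" by linarith
  then show "int M dvd l" by simp
next
  assume "int M dvd l"
  then obtain n where "l = int M * n" ..
  then show "e l (gx 1) = 1" unfolding wave_grid exp_eq_1 using M_pos by (auto intro!: exI[of _ n])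
qed

lemma sum_wave_grid: "(\<Sum>j<M. e l (gx j)) = (if int M dvd l then of_nat M else 0)"
proof (cases "int M dvd l")
  case True
  then have "e l (gx 1) = 1" by (simp only: wave_grid_eq_1_iff)
  then have "e l (gx j) = 1" for j using wave_grid_power[of l j] by simp
  then show ?thesis using True by simp
next
  case False
  then have n1: "e l (gx 1) \<noteq> 1" by (simp only: wave_grid_eq_1_iff not_False_eq_True)
  have "e l (gx 1) ^ M = e l (gx M)" by (rule wave_grid_power[symmetric])
  also have "\<dots> = 1" using M_pos by (simp add: grid_def)
  finally have "(\<Sum>j<M. e l (gx 1) ^ j) = 0" using n1 by (simp add: sum_gp_strict)
  moreover have "(\<Sum>j<M. e l (gx j)) = (\<Sum>j<M. e l (gx 1) ^ j)"
    by (intro sum.cong refl wave_grid_power)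
  ultimately show ?thesis using False by simp
qed

lemma modes_iff: "l \<in> modes M \<longleftrightarrow> - (int M div 2) \<le> l \<and> l \<le> int M div 2 - 1"
  by (simp add: modes_def)

lemma finite_modes [simp]: "finite (modes M)" by (simp add: modes_def)

lemma half: "int M = 2 * (int M div 2)" using M_even by simp

text \<open>Since \<open>M\<close> is even, \<open>modes M\<close> consists of exactly
  \<open>M\<close> consecutive integers and hence represents every residue class once.\<close>

lemma modes_cong:
  assumes "l \<in> modes M" "k \<in> modes M"
  shows "int M dvd l - k \<longleftrightarrow> l = k"
proof
  assume "int M dvd l - k"
  moreover have "\<bar>l - k\<bar> < int M" using assms half by (auto simp: modes_iff)
  ultimately show "l = k" using dvd_imp_le_int[of "l - k" "int M"] by force
qed simp

lemma wave_grid_orth: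
  assumes "l \<in> modes M" "k \<in> modes M"
  shows "(\<Sum>j<M. e l (gx j) * cnj (e k (gx j))) = (if l = k then of_nat M else 0)"
  using sum_wave_grid[of "l - k"] wave_add[of l "- k"] modes_cong[OF assms] by (simp add: cnj_wave)

text \<open>Shifting the frequencies to 0, ..., M - 1 turns the sum over modes into a sum over grid
  points of the wave with index j - i, up to a unimodular factor.\<close>

lemma wave_grid_dual:
  assumes "i < M" "j < M"
  shows "(\<Sum>l\<in>modes M. e l (gx j) * cnj (e l (gx i))) = (if i = j then of_nat M else 0)"
proof -
  let ?H = "int M div 2"
  let ?d = "int j - int i"
  have t: "e l (gx j) * cnj (e l (gx i)) = exp (\<i> * of_real (2 * pi * of_int l * of_int ?d / real M))" for l
    by (simp add: wave_grid exp_cnj diff_divide_distrib right_diff_distrib flip: exp_add)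
  have "(\<Sum>l\<in>modes M. e l (gx j) * cnj (e l (gx i)))
      = (\<Sum>k<M. exp (\<i> * of_real (2 * pi * of_int (int k - ?H) * of_int ?d / real M)))"
    unfolding t using half
    by (intro sum.reindex_bij_witness[where i="\<lambda>k. int k - ?H" and j="\<lambda>l. nat (l + ?H)"])
      (auto simp: modes_iff)
  also have "\<dots> = (\<Sum>k<M. exp (- \<i> * of_real (2 * pi * of_int ?H * of_int ?d / real M)) * e ?d (gx k))"
  proof (intro sum.cong refl)
    fix k
    have "2 * pi * of_int (int k - ?H) * of_int ?d / real M
        = 2 * pi * of_int ?d * real k / real M - 2 * pi * of_int ?H * of_int ?d / real M"
      by (simp add: diff_divide_distrib[symmetric] algebra_simps)
    moreover have "exp (\<i> * of_real (x - y)) = exp (- \<i> * of_real y) * exp (\<i> * of_real x)" for x y :: real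
      by (simp add: right_diff_distrib flip: exp_add)
    ultimately show "exp (\<i> * of_real (2 * pi * of_int (int k - ?H) * of_int ?d / real M))
        = exp (- \<i> * of_real (2 * pi * of_int ?H * of_int ?d / real M)) * e ?d (gx k)"
      by (simp only: wave_grid)
  qed
  also have "\<dots> = exp (- \<i> * of_real (2 * pi * of_int ?H * of_int ?d / real M)) * (if int M dvd ?d then of_nat M else 0)"
    unfolding sum_distrib_left[symmetric] sum_wave_grid ..
  also have "int M dvd ?d \<longleftrightarrow> i = j"
  proof
    assume "int M dvd ?d"
    then show "i = j" using dvd_imp_le_int[of ?d "int M"] assms by force
  qed simp
  finally show ?thesis by simp
qed

lemma dft_eq: "dft a b M U l = (\<Sum>j<M. U j * cnj (e l (gx j))) / of_nat M"
  unfolding dft_def wave_def by (simp add: exp_cnj)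

lemma dft_trig:
  assumes "l \<in> modes M"
  shows "dft a b M (\<lambda>j. \<Sum>k\<in>modes M. c k * e k (gx j)) l = c l"
proof -
  have "(\<Sum>j<M. (\<Sum>k\<in>modes M. c k * e k (gx j)) * cnj (e l (gx j)))
      = (\<Sum>k\<in>modes M. c k * (\<Sum>j<M. e k (gx j) * cnj (e l (gx j))))"
    unfolding sum_distrib_right sum_distrib_left by (subst sum.swap) (simp add: mult.assoc)
  also have "\<dots> = (\<Sum>k\<in>modes M. if k = l then c k * of_nat M else 0)"
    by (intro sum.cong refl) (simp add: wave_grid_orth assms)
  also have "\<dots> = c l * of_nat M" using assms by (simp add: sum.delta)
  finally show ?thesis using M_pos by (simp add: dft_eq)
qed

lemma dft_inverse:
  assumes "j < M"
  shows "(\<Sum>l\<in>modes M. dft a b M U l * e l (gx j)) = U j"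
proof -
  have "(\<Sum>l\<in>modes M. dft a b M U l * e l (gx j))
      = (\<Sum>l\<in>modes M. \<Sum>i<M. U i * (e l (gx j) * cnj (e l (gx i)))) / of_nat M"
    unfolding dft_eq sum_divide_distrib sum_distrib_right by (simp add: mult_ac)
  also have "(\<Sum>l\<in>modes M. \<Sum>i<M. U i * (e l (gx j) * cnj (e l (gx i))))
      = (\<Sum>i<M. U i * (\<Sum>l\<in>modes M. e l (gx j) * cnj (e l (gx i))))"
    unfolding sum_distrib_left by (rule sum.swap)
  also have "\<dots> = (\<Sum>i<M. if i = j then U i * of_nat M else 0)"
    by (intro sum.cong refl) (simp add: wave_grid_dual assms)
  also have "\<dots> = U j * of_nat M" using assms by (simp add: sum.delta)
  finally show ?thesis using M_pos by simp
qed

lemma parseval_grid: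
  "(\<Sum>j<M. (norm (\<Sum>k\<in>modes M. c k * e k (gx j)))\<^sup>2) = real M * (\<Sum>k\<in>modes M. (norm (c k))\<^sup>2)"
proof -
  let ?t = "\<lambda>j. \<Sum>k\<in>modes M. c k * e k (gx j)"
  have "complex_of_real (\<Sum>j<M. (norm (?t j))\<^sup>2) = (\<Sum>j<M. ?t j * cnj (?t j))"
    by (simp only: of_real_sum complex_norm_square)
  also have "\<dots> = (\<Sum>j<M. \<Sum>k\<in>modes M. cnj (c k) * (?t j * cnj (e k (gx j))))"
    by (intro sum.cong refl) (simp add: sum_distrib_left mult_ac)
  also have "\<dots> = (\<Sum>k\<in>modes M. cnj (c k) * (\<Sum>j<M. ?t j * cnj (e k (gx j))))"
    unfolding sum_distrib_left by (rule sum.swap)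
  also have "\<dots> = (\<Sum>k\<in>modes M. cnj (c k) * (of_nat M * c k))"
    using dft_trig[of _ c] M_pos by (intro sum.cong refl) (simp add: dft_eq field_simps)
  also have "\<dots> = complex_of_real (real M * (\<Sum>k\<in>modes M. (norm (c k))\<^sup>2))"
    by (simp only: of_real_mult of_real_sum complex_norm_square sum_distrib_left of_real_of_nat_eq)
      (simp add: mult_ac)
  finally show ?thesis by (simp only: of_real_eq_iff)
qed

text \<open>A root mean square instead of a sum weighted by \<open>h\<close>: constants keep their
  norm and Parseval's identity has no factor. For trigonometric polynomials in the modes the L2 norm
  on the interval is sqrt(b - a) times this one.\<close>

definition gn :: "(nat \<Rightarrow> 'v::real_normed_vector) \<Rightarrow> real"
  where "gn U = sqrt ((\<Sum>j<M. (norm (U j))\<^sup>2) / real M)"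

definition trunc :: "(real \<Rightarrow> complex) \<Rightarrow> real \<Rightarrow> complex"
  where "trunc f x = (\<Sum>l\<in>modes M. fc f l * e l x)"

text \<open>The union of the 2n + 1 translates of \<open>modes M\<close> by multiples of
  \<open>M\<close> closest to the centre, so that a partial sum over it folds onto the modes with
  complete residue classes.\<close>

definition blk :: "nat \<Rightarrow> int set"
  where "blk n = {- (int M div 2) - int n * int M .. int M div 2 - 1 + int n * int M}"

text \<open>Division with remainder by \<open>M\<close>, centred by the offset
  \<open>M div 2\<close>.\<close>

lemma sum_blk: "(\<Sum>l\<in>blk n. F l) = (\<Sum>r\<in>modes M. \<Sum>k\<in>{- int n..int n}. F (r + k * int M))"
  for F :: "int \<Rightarrow> 'z::comm_monoid_add"
proof -
  let ?H = "int M div 2"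
  have Mp: "0 < int M" using M_pos by simp
  have "(\<Sum>r\<in>modes M. \<Sum>k\<in>{- int n..int n}. F (r + k * int M))
      = (\<Sum>(r, k)\<in>modes M \<times> {- int n..int n}. F (r + k * int M))"
    by (simp add: sum.cartesian_product)
  also have "\<dots> = (\<Sum>l\<in>blk n. F l)"
  proof (rule sum.reindex_bij_witness[where i="\<lambda>l. ((l + ?H) mod int M - ?H, (l + ?H) div int M)"
        and j="\<lambda>(r, k). r + k * int M"])
    fix z assume z: "z \<in> modes M \<times> {- int n..int n}"
    then obtain r k where rk: "z = (r, k)" "r \<in> modes M" "- int n \<le> k" "k \<le> int n" by auto
    have r': "0 \<le> r + ?H" "r + ?H < int M" using rk half by (auto simp: modes_iff)
    have eq: "r + k * int M + ?H = (r + ?H) + k * int M" by simp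
    have "(r + k * int M + ?H) mod int M = r + ?H" "(r + k * int M + ?H) div int M = k"
      unfolding eq using r' by simp_all
    then show "(((case z of (r, k) \<Rightarrow> r + k * int M) + ?H) mod int M - ?H,
          ((case z of (r, k) \<Rightarrow> r + k * int M) + ?H) div int M) = z"
      by (simp_all add: rk)
    have "k * int M \<le> int n * int M" "- int n * int M \<le> k * int M"
      using rk Mp mult_right_mono[of "- int n" k "int M"] by (auto intro: mult_right_mono)
    then show "(case z of (r, k) \<Rightarrow> r + k * int M) \<in> blk n"
      using rk by (auto simp: blk_def modes_iff)
    show "F (case z of (r, k) \<Rightarrow> r + k * int M) = (case z of (r, k) \<Rightarrow> F (r + k * int M))"
      by (simp add: rk)
  next
    fix l assume l: "l \<in> blk n"
    show "(case ((l + ?H) mod int M - ?H, (l + ?H) div int M) of (r, k) \<Rightarrow> r + k * int M) = l"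
      unfolding prod.case using div_mult_mod_eq[of "l + ?H" "int M"] by linarith
    have "0 \<le> (l + ?H) mod int M" "(l + ?H) mod int M < int M" using Mp by auto
    then have 1: "(l + ?H) mod int M - ?H \<in> modes M" using half by (auto simp: modes_iff)
    have "(- int n) * int M \<le> l + ?H" "l + ?H < (int n + 1) * int M"
      using l half by (auto simp: blk_def algebra_simps)
    moreover have "(l + ?H) div int M * int M \<le> l + ?H" "l + ?H < ((l + ?H) div int M + 1) * int M"
      using div_mult_mod_eq[of "l + ?H" "int M"] \<open>0 \<le> (l + ?H) mod int M\<close> \<open>(l + ?H) mod int M < int M\<close>
      unfolding distrib_right by linarith+
    ultimately have "(- int n) * int M < ((l + ?H) div int M + 1) * int M"
      "(l + ?H) div int M * int M < (int n + 1) * int M" by linarith+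
    then have "- int n \<le> (l + ?H) div int M" "(l + ?H) div int M < int n + 1"
      using Mp by (simp_all only: mult_less_cancel_right_pos)
    then show "((l + ?H) mod int M - ?H, (l + ?H) div int M) \<in> modes M \<times> {- int n..int n}"
      using 1 by simp
  qed
  finally show ?thesis ..
qed

lemma gn_L2_set: "gn U = L2_set (\<lambda>j. norm (U j)) {..<M} / sqrt (real M)"
  by (simp add: gn_def L2_set_def real_sqrt_divide)

lemma gn_nonneg [simp]: "0 \<le> gn U"
  by (simp add: gn_def sum_nonneg)

lemma gn_mono: "(\<And>j. j < M \<Longrightarrow> norm (U j) \<le> norm (W j)) \<Longrightarrow> gn U \<le> gn W"
  unfolding gn_def by (intro real_sqrt_le_mono divide_right_mono sum_mono power_mono) auto

lemma gn_cong: "(\<And>j. j < M \<Longrightarrow> norm (U j) = norm (W j)) \<Longrightarrow> gn U = gn W"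
  unfolding gn_def by (auto intro!: arg_cong[where f=sqrt] sum.cong)

lemma gn_triangle: "gn (\<lambda>j. U j + W j) \<le> gn U + gn W"
proof -
  have "L2_set (\<lambda>j. norm (U j + W j)) {..<M} \<le> L2_set (\<lambda>j. norm (U j) + norm (W j)) {..<M}"
    by (rule L2_set_mono) (auto intro: norm_triangle_ineq)
  also have "\<dots> \<le> L2_set (\<lambda>j. norm (U j)) {..<M} + L2_set (\<lambda>j. norm (W j)) {..<M}"
    by (rule L2_set_triangle_ineq)
  finally show ?thesis
    unfolding gn_L2_set add_divide_distrib[symmetric] by (intro divide_right_mono) auto
qed

lemma gn_minus_commute: "gn (\<lambda>j. U j - W j) = gn (\<lambda>j. W j - U j)"
  by (rule gn_cong) (simp add: norm_minus_commute)

lemma gn_triangle_diff: "gn (\<lambda>j. U j - W j) \<le> gn (\<lambda>j. U j - Z j) + gn (\<lambda>j. Z j - W j)"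
  using gn_triangle[of "\<lambda>j. U j - Z j" "\<lambda>j. Z j - W j"] by simp

lemma gn_le_const:
  assumes "\<And>j. j < M \<Longrightarrow> norm (U j) \<le> c * w j" "0 \<le> c" "\<And>j. j < M \<Longrightarrow> 0 \<le> w j"
  shows "gn U \<le> c * gn w"
proof -
  have "gn U \<le> sqrt ((\<Sum>j<M. (c * norm (w j))\<^sup>2) / real M)"
    unfolding gn_def using assms
    by (intro real_sqrt_le_mono divide_right_mono sum_mono power_mono) auto
  also have "\<dots> = c * gn w"
    using assms(2)
    by (simp add: gn_def power_mult_distrib real_sqrt_mult flip: sum_distrib_left times_divide_eq_right)
  finally show ?thesis .
qed

lemma gn_const: "gn (\<lambda>_. c) = norm c"
  using M_pos by (simp add: gn_def)

lemma gn_bound: "(\<And>j. j < M \<Longrightarrow> norm (U j) \<le> c) \<Longrightarrow> 0 \<le> c \<Longrightarrow> gn U \<le> c"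
  using gn_mono[of U "\<lambda>_. c"] gn_const[of c] by simp

lemma gn_trig: "gn (\<lambda>j. \<Sum>k\<in>modes M. c k * e k (gx j)) = L2_set (\<lambda>k. norm (c k)) (modes M)"
  using parseval_grid[of c] M_pos by (simp add: gn_def L2_set_def)

section \<open>Truncation, aliasing and interpolation errors\<close>

lemma freq_blk:
  assumes "r \<in> modes M"
  shows "pi * \<bar>real_of_int k\<bar> / h \<le> \<bar>\<mu> (r + k * int M)\<bar>"
proof (cases "k = 0")
  case False
  have "\<bar>r\<bar> \<le> int M div 2" using assms by (auto simp: modes_iff)
  then have r: "2 * \<bar>r\<bar> \<le> int M" using half by linarith
  have "int M * 1 \<le> int M * \<bar>k\<bar>" using False by (intro mult_left_mono) auto
  \<comment> \<open>As |r| is at most M/2 and |k| at least 1, at least half of |k| M is left after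
    subtracting |r|.\<close>
  then have "\<bar>k\<bar> * int M \<le> 2 * (\<bar>k * int M\<bar> - \<bar>r\<bar>)" using r by (simp add: abs_mult mult.commute)
  also have "\<dots> \<le> 2 * \<bar>r + k * int M\<bar>" using abs_triangle_ineq4[of "r + k * int M" r] by simp
  finally have "real_of_int (\<bar>k\<bar> * int M) \<le> real_of_int (2 * \<bar>r + k * int M\<bar>)" by (simp only: of_int_le_iff)
  then have "\<bar>real_of_int k\<bar> * real M \<le> 2 * \<bar>real_of_int (r + k * int M)\<bar>" by simp
  then have "pi * (\<bar>real_of_int k\<bar> * real M) / (b - a) \<le> pi * (2 * \<bar>real_of_int (r + k * int M)\<bar>) / (b - a)"
    using ab by (intro divide_right_mono mult_left_mono) auto
  moreover have "pi * (\<bar>real_of_int k\<bar> * real M) / (b - a) = pi * \<bar>real_of_int k\<bar> / h"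
    by (simp add: h_def)
  moreover have "pi * (2 * \<bar>real_of_int (r + k * int M)\<bar>) / (b - a) = \<bar>\<mu> (r + k * int M)\<bar>"
    using ab by (simp add: freq_def abs_mult)
  ultimately show ?thesis by simp
qed simp

lemma freq_outside:
  assumes "l \<notin> modes M" shows "pi / h \<le> \<bar>\<mu> l\<bar>"
proof -
  have "int M \<le> 2 * \<bar>l\<bar>" using assms half by (auto simp: modes_iff)
  then have "real M \<le> 2 * \<bar>real_of_int l\<bar>" by linarith
  then have "pi * real M / (b - a) \<le> pi * (2 * \<bar>real_of_int l\<bar>) / (b - a)"
    using ab by (intro divide_right_mono mult_left_mono) auto
  moreover have "pi * real M / (b - a) = pi / h" by (simp add: h_def)
  moreover have "pi * (2 * \<bar>real_of_int l\<bar>) / (b - a) = \<bar>\<mu> l\<bar>"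
    using ab by (simp add: freq_def abs_mult)
  ultimately show ?thesis by simp
qed

lemma inv_le_h: "pi * c / h \<le> x \<Longrightarrow> 1 \<le> c \<Longrightarrow> 1 / x \<le> h / c"
proof -
  assume x: "pi * c / h \<le> x" and c: "1 \<le> c"
  have "1 * c / h \<le> pi * c / h" using c h_pos pi_gt3 by (intro divide_right_mono mult_right_mono) auto
  then have "c / h \<le> x" using x by simp
  moreover have "0 < c / h" using c h_pos by simp
  ultimately have "1 / x \<le> 1 / (c / h)" by (intro divide_left_mono mult_pos_pos) auto
  then show ?thesis by simp
qed

lemma tail_coeffs:
  assumes f: "psm \<omega> n K f" and F: "finite F" "F \<inter> modes M = {}"
  shows "(\<Sum>l\<in>F. (norm (fc f l))\<^sup>2) \<le> (K * (h * \<omega>) ^ (n + 1))\<^sup>2"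
proof -
  have "(\<Sum>l\<in>F. (norm (fc f l))\<^sup>2) \<le> (\<Sum>l\<in>F. (h ^ (n + 1) * (\<bar>\<mu> l\<bar> ^ (n + 1) * norm (fc f l)))\<^sup>2)"
  proof (intro sum_mono power_mono)
    fix l assume "l \<in> F"
    then have "l \<notin> modes M" using F by auto
    then have \<mu>: "pi * 1 / h \<le> \<bar>\<mu> l\<bar>" using freq_outside by simp
    have "0 < pi * 1 / h" using h_pos by simp
    then have p: "0 < \<bar>\<mu> l\<bar>" by (rule less_le_trans[OF _ \<mu>])
    have "1 / \<bar>\<mu> l\<bar> \<le> h" using inv_le_h[OF \<mu>] by simp
    then have "1 \<le> h * \<bar>\<mu> l\<bar>" unfolding pos_divide_le_eq[OF p] .
    then have "1 \<le> (h * \<bar>\<mu> l\<bar>) ^ (n + 1)" by (rule one_le_power)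
    then have "1 * norm (fc f l) \<le> (h * \<bar>\<mu> l\<bar>) ^ (n + 1) * norm (fc f l)" by (rule mult_right_mono) simp
    then show "norm (fc f l) \<le> h ^ (n + 1) * (\<bar>\<mu> l\<bar> ^ (n + 1) * norm (fc f l))"
      by (simp only: power_mult_distrib mult.assoc mult_1_left)
  qed auto
  also have "\<dots> = (h ^ (n + 1))\<^sup>2 * (\<Sum>l\<in>F. (\<bar>\<mu> l\<bar> ^ (n + 1) * norm (fc f l))\<^sup>2)"
    unfolding sum_distrib_left power_mult_distrib ..
  also have "\<dots> \<le> (h ^ (n + 1))\<^sup>2 * (K * \<omega> ^ (n + 1))\<^sup>2"
    by (intro mult_left_mono coeffs_psm[OF F(1) f]) auto
  finally show ?thesis by (simp only: power_mult_distrib mult_ac)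
qed

lemma sum_inverse_squares_int: "(\<Sum>k\<in>{- int n..int n} - {0}. 1 / (real_of_int k)\<^sup>2) \<le> 4"
proof -
  have "{- int n..int n} - {0} = int ` {1..n} \<union> (\<lambda>k. - int k) ` {1..n}"
  proof (intro set_eqI iffI)
    fix k assume k: "k \<in> {- int n..int n} - {0}"
    show "k \<in> int ` {1..n} \<union> (\<lambda>k. - int k) ` {1..n}"
    proof (cases "0 < k")
      case True
      then show ?thesis using k by (intro UnI1 image_eqI[of _ _ "nat k"]) auto
    next
      case False
      then show ?thesis using k by (intro UnI2 image_eqI[of _ _ "nat (- k)"]) auto
    qed
  qed auto
  also have "(\<Sum>k\<in>\<dots>. 1 / (real_of_int k)\<^sup>2)
      = (\<Sum>k\<in>int ` {1..n}. 1 / (real_of_int k)\<^sup>2) + (\<Sum>k\<in>(\<lambda>k. - int k) ` {1..n}. 1 / (real_of_int k)\<^sup>2)"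
    by (rule sum.union_disjoint) auto
  also have "\<dots> = (\<Sum>k=1..n. 1 / (real k)\<^sup>2) + (\<Sum>k=1..n. 1 / (real k)\<^sup>2)"
    by (subst (1 2) sum.reindex) (auto simp: inj_on_def)
  also have "\<dots> \<le> 4" using sum_inverse_squares_le[of n] by linarith
  finally show ?thesis .
qed

text \<open>Cauchy-Schwarz with the weights |\<mu>|^-(n+1). In each residue class the squared
  weights sum to at most 4 h^(2n+2), by \<open>freq_blk\<close> and the series of 1/k^2, and the
  weighted coefficients of all classes together are bounded by \<open>coeffs_psm\<close>. The bound
  is uniform in the number of blocks, so the limit can be taken.\<close>

lemma alias_coeffs:
  assumes f: "psm \<omega> n K f"
  shows "(\<Sum>r\<in>modes M. (norm (\<Sum>k\<in>{- int N..int N} - {0}. fc f (r + k * int M)))\<^sup>2)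
    \<le> (2 * K * (h * \<omega>) ^ (n + 1))\<^sup>2"
proof -
  let ?I = "{- int N..int N}"
  let ?a = "\<lambda>l. \<bar>\<mu> l\<bar> ^ (n + 1) * norm (fc f l)"
  let ?H = "(h ^ (n + 1))\<^sup>2"
  have "(norm (\<Sum>k\<in>?I - {0}. fc f (r + k * int M)))\<^sup>2 \<le> (4 * ?H) * (\<Sum>k\<in>?I. (?a (r + k * int M))\<^sup>2)"
    if r: "r \<in> modes M" for r
  proof -
    let ?w = "\<lambda>k. 1 / \<bar>\<mu> (r + k * int M)\<bar> ^ (n + 1)"
    have p: "1 \<le> \<bar>real_of_int k\<bar> \<and> 0 < \<bar>\<mu> (r + k * int M)\<bar>" if "k \<in> ?I - {0}" for k
    proof
      show k: "1 \<le> \<bar>real_of_int k\<bar>" using that by auto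
      then have "0 < pi * \<bar>real_of_int k\<bar> / h" using h_pos by (intro divide_pos_pos mult_pos_pos) auto
      then show "0 < \<bar>\<mu> (r + k * int M)\<bar>" using freq_blk[OF r, of k] by linarith
    qed
    have "norm (\<Sum>k\<in>?I - {0}. fc f (r + k * int M)) \<le> (\<Sum>k\<in>?I - {0}. norm (fc f (r + k * int M)))"
      by (rule norm_sum)
    also have "\<dots> = (\<Sum>k\<in>?I - {0}. ?w k * ?a (r + k * int M))"
      using p by (intro sum.cong refl) (auto simp: field_simps)
    finally have "(norm (\<Sum>k\<in>?I - {0}. fc f (r + k * int M)))\<^sup>2 \<le> (\<Sum>k\<in>?I - {0}. ?w k * ?a (r + k * int M))\<^sup>2"
      by (intro power_mono) auto
    also have "\<dots> \<le> (\<Sum>k\<in>?I - {0}. (?w k)\<^sup>2) * (\<Sum>k\<in>?I - {0}. (?a (r + k * int M))\<^sup>2)"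
      by (rule Cauchy_Schwarz_ineq_sum)
    also have "\<dots> \<le> (4 * ?H) * (\<Sum>k\<in>?I. (?a (r + k * int M))\<^sup>2)"
    proof (rule mult_mono)
      have "(\<Sum>k\<in>?I - {0}. (?w k)\<^sup>2) \<le> (\<Sum>k\<in>?I - {0}. ?H * (1 / (real_of_int k)\<^sup>2))"
      proof (rule sum_mono)
        fix k assume k: "k \<in> ?I - {0}"
        have "1 / \<bar>\<mu> (r + k * int M)\<bar> \<le> h / \<bar>real_of_int k\<bar>"
          using inv_le_h[OF freq_blk[OF r, of k]] p[OF k] by simp
        then have "(1 / \<bar>\<mu> (r + k * int M)\<bar>) ^ (2 * (n + 1)) \<le> (h / \<bar>real_of_int k\<bar>) ^ (2 * (n + 1))"
          by (intro power_mono) auto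
        also have "\<dots> = h ^ (2 * (n + 1)) * (1 / \<bar>real_of_int k\<bar>) ^ (2 * (n + 1))"
          by (simp add: power_divide)
        \<comment> \<open>Lowering the exponent of 1/|k| to 2 is possible because |k| is at least 1,
          and makes the sum over \<open>k\<close> bounded independently of \<open>n\<close>.\<close>
        also have "\<dots> \<le> h ^ (2 * (n + 1)) * (1 / \<bar>real_of_int k\<bar>) ^ 2"
          using p[OF k] h_pos by (intro mult_left_mono power_decreasing) auto
        finally show "(?w k)\<^sup>2 \<le> ?H * (1 / (real_of_int k)\<^sup>2)"
          by (simp only: power_divide power_one power2_abs power_mult[symmetric] mult.commute[of 2])
      qed
      also have "\<dots> = ?H * (\<Sum>k\<in>?I - {0}. 1 / (real_of_int k)\<^sup>2)" by (simp only: sum_distrib_left)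
      also have "\<dots> \<le> ?H * 4" by (intro mult_left_mono sum_inverse_squares_int) auto
      finally show "(\<Sum>k\<in>?I - {0}. (?w k)\<^sup>2) \<le> 4 * ?H" by simp
      show "(\<Sum>k\<in>?I - {0}. (?a (r + k * int M))\<^sup>2) \<le> (\<Sum>k\<in>?I. (?a (r + k * int M))\<^sup>2)"
        by (rule sum_mono2) auto
    qed (auto intro: sum_nonneg)
    finally show ?thesis .
  qed
  then have "(\<Sum>r\<in>modes M. (norm (\<Sum>k\<in>?I - {0}. fc f (r + k * int M)))\<^sup>2)
      \<le> (\<Sum>r\<in>modes M. (4 * ?H) * (\<Sum>k\<in>?I. (?a (r + k * int M))\<^sup>2))"
    by (rule sum_mono)
  also have "\<dots> = (4 * ?H) * (\<Sum>l\<in>blk N. (?a l)\<^sup>2)"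
    by (simp only: sum_blk sum_distrib_left)
  also have "\<dots> \<le> (4 * ?H) * (K * \<omega> ^ (n + 1))\<^sup>2"
    by (intro mult_left_mono coeffs_psm[OF _ f]) (auto simp: blk_def)
  finally show ?thesis by (simp add: power_mult_distrib mult_ac)
qed

text \<open>Both boundary terms of the telescoped partial sum are Fourier coefficients of one
  bounded function at frequencies tending to infinity. The second claim is uniform in
  \<open>y\<close> and \<open>n\<close>; it supplies the dominating constant for convergence in
  L2.\<close>

lemma fourier_blk_tendsto:
  assumes f: "psm \<omega> 0 K f" and \<omega>: "0 \<le> \<omega>" and y: "y \<in> {a..b}"
  shows "(\<lambda>n. \<Sum>l\<in>blk n. fc f l * e l y) \<longlonglongrightarrow> f y"
    and "\<exists>C. \<forall>n. \<forall>y\<in>{a..b}. norm ((\<Sum>l\<in>blk n. fc f l * e l y) - f y) \<le> C"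
proof -
  let ?A = "\<lambda>n. - (int M div 2) - int n * int M" and ?B = "\<lambda>n. int M div 2 - 1 + int n * int M"
  have AB: "?A n \<le> 0" "0 \<le> ?B n" for n
  proof -
    have "1 \<le> int M div 2" using M_pos half by linarith
    moreover have "0 \<le> int n * int M" by simp
    ultimately show "?A n \<le> 0" "0 \<le> ?B n" by linarith+
  qed
  have "inj (\<lambda>n. ?A n - 1)" "inj ?B" using M_pos by (auto simp: inj_def)
  note inj = this
  obtain g where g: "bm g"
    "\<And>n. (\<Sum>l\<in>blk n. fc f l * e l y) - f y = fc g (?A n - 1) * e (?A n - 1) y - fc g (?B n) * e (?B n) y"
    by (rule fourier_partial_sum[OF f \<omega> y]) (rule that, assumption, unfold blk_def, use AB in blast)
  have "(\<lambda>n. fc g (?A n - 1) * e (?A n - 1) y) \<longlonglongrightarrow> 0"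
    by (rule tendsto_norm_zero_cancel) (simp add: norm_mult tendsto_norm_zero[OF fc_tendsto_0[OF g(1) inj(1)]])
  moreover have "(\<lambda>n. fc g (?B n) * e (?B n) y) \<longlonglongrightarrow> 0"
    by (rule tendsto_norm_zero_cancel) (simp add: norm_mult tendsto_norm_zero[OF fc_tendsto_0[OF g(1) inj(2)]])
  ultimately have "(\<lambda>n. (\<Sum>l\<in>blk n. fc f l * e l y) - f y) \<longlonglongrightarrow> 0"
    unfolding g(2) using tendsto_diff by fastforce
  then show "(\<lambda>n. \<Sum>l\<in>blk n. fc f l * e l y) \<longlonglongrightarrow> f y"
    by (rule LIM_zero_cancel)
next
  let ?C = "K * \<omega> * (b - a) + 4 * K / sqrt (2 - 2 * cos (1/2))"
  let ?A = "\<lambda>n. - (int M div 2) - int n * int M" and ?B = "\<lambda>n. int M div 2 - 1 + int n * int M"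
  have AB: "?A n \<le> 0" "0 \<le> ?B n" for n
  proof -
    have "1 \<le> int M div 2" using M_pos half by linarith
    moreover have "0 \<le> int n * int M" by simp
    ultimately show "?A n \<le> 0" "0 \<le> ?B n" by linarith+
  qed
  have "norm ((\<Sum>l\<in>blk n. fc f l * e l y) - f y) \<le> 2 * ?C" if y: "y \<in> {a..b}" for n y
  proof -
    obtain g where g: "bm g" "\<And>x. x \<in> S \<Longrightarrow> norm (g x) \<le> ?C"
      "(\<Sum>l\<in>blk n. fc f l * e l y) - f y = fc g (?A n - 1) * e (?A n - 1) y - fc g (?B n) * e (?B n) y"
      by (rule fourier_partial_sum[OF f \<omega> y]) (rule that, assumption, assumption, unfold blk_def, use AB in blast)
    have fcg: "norm (fc g l) \<le> ?C" for l
      unfolding fc_def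
      by (rule norm_mean_le) (use g(2) in \<open>auto simp: norm_mult intro!: bm_measurable bm_intros g(1)\<close>)
    show ?thesis unfolding g(3)
      by (rule order_trans[OF norm_triangle_ineq4])
        (use fcg[of "?A n - 1"] fcg[of "?B n"] in \<open>simp add: norm_mult\<close>)
  qed
  then show "\<exists>C. \<forall>n. \<forall>y\<in>{a..b}. norm ((\<Sum>l\<in>blk n. fc f l * e l y) - f y) \<le> C" by blast
qed

text \<open>On the grid a partial sum over blocks is a trigonometric polynomial in the modes. After
  subtracting the truncation its coefficients are the aliased sums of \<open>alias_coeffs\<close>,
  and with finitely many grid points pointwise convergence is enough for the limit.\<close>

lemma trunc_grid_error:
  assumes f: "psm \<omega> n K f" and \<omega>: "0 \<le> \<omega>"
  shows "gn (\<lambda>j. f (gx j) - trunc f (gx j)) \<le> 2 * K * (h * \<omega>) ^ (n + 1)"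
proof -
  let ?P = "\<lambda>N x. \<Sum>l\<in>blk N. fc f l * e l x"
  have K: "0 \<le> K" by (rule psm_nonneg[OF f])
  have le: "gn (\<lambda>j. ?P N (gx j) - trunc f (gx j)) \<le> 2 * K * (h * \<omega>) ^ (n + 1)" for N
  proof -
    let ?c = "\<lambda>r. \<Sum>k\<in>{- int N..int N} - {0}. fc f (r + k * int M)"
    have "?P N (gx j) - trunc f (gx j) = (\<Sum>r\<in>modes M. ?c r * e r (gx j))" for j
    proof -
      have per: "e (r + k * int M) (gx j) = e r (gx j)" for r k
      proof -
        have "e (k * int M) (gx j) = e (k * int M) (gx 1) ^ j" by (rule wave_grid_power)
        also have "e (k * int M) (gx 1) = 1" by (simp add: wave_grid_eq_1_iff del: One_nat_def)
        finally show ?thesis using wave_add[of r "k * int M"] by simp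
      qed
      have "?P N (gx j) = (\<Sum>r\<in>modes M. (\<Sum>k\<in>{- int N..int N}. fc f (r + k * int M)) * e r (gx j))"
        unfolding sum_blk per sum_distrib_right ..
      also have "\<dots> = (\<Sum>r\<in>modes M. (fc f r + ?c r) * e r (gx j))"
      proof (intro sum.cong refl arg_cong2[where f="(*)"])
        fix r
        show "(\<Sum>k\<in>{- int N..int N}. fc f (r + k * int M)) = fc f r + ?c r"
          using sum.remove[of "{- int N..int N}" 0 "\<lambda>k. fc f (r + k * int M)"] by simp
      qed
      finally show ?thesis unfolding trunc_def by (simp add: distrib_right sum.distrib)
    qed
    then have "gn (\<lambda>j. ?P N (gx j) - trunc f (gx j)) = sqrt (\<Sum>r\<in>modes M. (norm (?c r))\<^sup>2)"
      using gn_trig[of ?c] by (simp add: L2_set_def)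
    also have "\<dots> \<le> sqrt ((2 * K * (h * \<omega>) ^ (n + 1))\<^sup>2)"
      by (rule real_sqrt_le_mono[OF alias_coeffs[OF f]])
    also have "\<dots> = 2 * K * (h * \<omega>) ^ (n + 1)" using K \<omega> h_pos by (simp del: power_Suc)
    finally show ?thesis .
  qed
  have "(\<lambda>N. gn (\<lambda>j. ?P N (gx j) - trunc f (gx j))) \<longlonglongrightarrow> gn (\<lambda>j. f (gx j) - trunc f (gx j))"
    unfolding gn_def
    by (intro tendsto_intros fourier_blk_tendsto(1)[OF psm_le[OF f] \<omega>] grid_in) (use M_pos in auto)
  then show ?thesis by (rule LIMSEQ_le_const2) (use le in auto)
qed

text \<open>Orthogonality gives the bound for finite tails. Bounded pointwise convergence of the
  partial sums carries it over to \<open>f\<close> and takes the place of completeness of the waves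
  in L2.\<close>

lemma trunc_L2_error:
  assumes f: "psm \<omega> n K f" and \<omega>: "0 \<le> \<omega>"
  shows "(LINT x|M\<^sub>S. (norm (f x - trunc f x))\<^sup>2) \<le> (b - a) * (K * (h * \<omega>) ^ (n + 1))\<^sup>2"
proof -
  let ?P = "\<lambda>N x. \<Sum>l\<in>blk N. fc f l * e l x"
  have f0: "psm \<omega> 0 K f" by (rule psm_le[OF f]) simp
  have mb: "f \<in> borel_measurable M\<^sub>S" by (rule bm_measurable[OF psm_bm[OF f]])
  have me: "?P N \<in> borel_measurable M\<^sub>S" for N
    by (rule bm_measurable) (intro bm_intros)
  have mt: "bm (trunc f)" unfolding trunc_def by (intro bm_intros)
  have le: "(LINT x|M\<^sub>S. (norm (?P N x - trunc f x))\<^sup>2) \<le> (b - a) * (K * (h * \<omega>) ^ (n + 1))\<^sup>2" for N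
  proof -
    let ?F = "blk N - modes M"
    have fin: "finite (blk N)" by (simp add: blk_def)
    have "0 \<le> int N * int M" by simp
    then have sub: "modes M \<subseteq> blk N" by (auto simp: blk_def modes_def)
    have d: "?P N x - trunc f x = (\<Sum>l\<in>?F. fc f l * e l x)" for x
      unfolding trunc_def by (rule sum_diff[symmetric, OF fin sub])
    have "complex_of_real ((LINT x|M\<^sub>S. (norm (?P N x - trunc f x))\<^sup>2) / (b - a))
        = mean (\<lambda>x. (\<Sum>l\<in>?F. fc f l * e l x) * cnj (\<Sum>l\<in>?F. fc f l * e l x))"
      unfolding d mean_def complex_norm_square[symmetric] by (simp flip: of_real_power)
    also have "\<dots> = complex_of_real (\<Sum>l\<in>?F. (norm (fc f l))\<^sup>2)"
      using fin by (intro norm2_mean_sum) auto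
    finally have "(LINT x|M\<^sub>S. (norm (?P N x - trunc f x))\<^sup>2) / (b - a) = (\<Sum>l\<in>?F. (norm (fc f l))\<^sup>2)"
      by (simp only: of_real_eq_iff)
    also have "\<dots> \<le> (K * (h * \<omega>) ^ (n + 1))\<^sup>2"
      using fin by (intro tail_coeffs[OF f]) auto
    finally show ?thesis using ab by (simp add: field_simps)
  qed
  obtain C where C: "\<And>N x. x \<in> {a..b} \<Longrightarrow> norm (?P N x - f x) \<le> C"
    using fourier_blk_tendsto(2)[OF f0 \<omega>, of a] ab by (meson atLeastAtMost_iff less_imp_le order_refl)
  obtain Kt where Kt: "0 \<le> Kt" "\<And>x. x \<in> S \<Longrightarrow> norm (trunc f x) \<le> Kt" by (rule bmE[OF mt]) (rule that)
  have "(\<lambda>N. LINT x|M\<^sub>S. (norm (?P N x - trunc f x))\<^sup>2) \<longlonglongrightarrow> (LINT x|M\<^sub>S. (norm (f x - trunc f x))\<^sup>2)"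
  proof (rule integral_dominated_convergence[where w="\<lambda>_. (C + K + Kt)\<^sup>2"])
    show "(\<lambda>x. (norm (f x - trunc f x))\<^sup>2) \<in> borel_measurable M\<^sub>S"
      "(\<lambda>x. (norm (?P N x - trunc f x))\<^sup>2) \<in> borel_measurable M\<^sub>S" for N
      using mb me[of N] bm_measurable[OF mt] by measurable
    show "integrable M\<^sub>S (\<lambda>_. (C + K + Kt)\<^sup>2)" by (rule finite_measure.integrable_const[OF finite_measure_S])
    show "AE x in M\<^sub>S. (\<lambda>N. (norm (?P N x - trunc f x))\<^sup>2) \<longlonglongrightarrow> (norm (f x - trunc f x))\<^sup>2"
      by (rule AE_I2, intro tendsto_intros fourier_blk_tendsto(1)[OF f0 \<omega>]) simp
    show "AE x in M\<^sub>S. norm ((norm (?P N x - trunc f x))\<^sup>2) \<le> (C + K + Kt)\<^sup>2" for N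
    proof (rule AE_I2)
      fix x assume "x \<in> space M\<^sub>S"
      then have x: "x \<in> S" "x \<in> {a..b}" by auto
      have "norm (?P N x - trunc f x) \<le> norm (?P N x - f x) + norm (f x) + norm (trunc f x)"
        by (rule norm_triangle_le_diff) (use norm_triangle_sub[of "?P N x" "f x"] in simp)
      also have "\<dots> \<le> C + K + Kt" using C[OF x(2)] psm_bound[OF f x(2)] Kt(2)[OF x(1)] by (intro add_mono) auto
      finally show "norm ((norm (?P N x - trunc f x))\<^sup>2) \<le> (C + K + Kt)\<^sup>2" by (simp add: power_mono)
    qed
  qed
  then show ?thesis by (rule LIMSEQ_le_const2) (use le in auto)
qed

text \<open>The error is split at the Fourier truncation. Truncation minus interpolant is a
  trigonometric polynomial in the modes, so its L2 norm can be read off on the grid, where the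
  interpolant equals \<open>U\<close>. Of the factor 3, one unit is the truncation error in L2 and
  two are aliasing.\<close>

lemma interpolation_error:
  assumes f: "psm \<omega> n K f" and \<omega>: "0 \<le> \<omega>"
  shows "L2_norm_on S (\<lambda>x. f x - interpolant a b M U x) \<le>
    2 * sqrt (b - a) * (3 * K * (h * \<omega>) ^ (n + 1) + gn (\<lambda>j. f (gx j) - U j))"
proof -
  let ?t = "K * (h * \<omega>) ^ (n + 1)"
  let ?d = "\<lambda>l. fc f l - dft a b M U l"
  let ?D = "\<lambda>x. \<Sum>l\<in>modes M. ?d l * e l x"
  let ?G = "L2_set (\<lambda>l. norm (?d l)) (modes M)"
  have K: "0 \<le> K" by (rule psm_nonneg[OF f])
  have t: "0 \<le> ?t" using K \<omega> h_pos by simp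
  have bD: "bm ?D" "bm (trunc f)" "bm f" "bm (interpolant a b M U)"
    unfolding trunc_def interpolant_def[abs_def] by (intro bm_intros psm_bm[OF f])+
  have G: "?G \<le> 2 * ?t + gn (\<lambda>j. f (gx j) - U j)"
  proof -
    have "?G = gn (\<lambda>j. ?D (gx j))" by (simp only: gn_trig)
    also have "\<dots> = gn (\<lambda>j. trunc f (gx j) - U j)"
      by (rule gn_cong) (simp add: trunc_def left_diff_distrib sum_subtractf dft_inverse)
    also have "\<dots> \<le> gn (\<lambda>j. trunc f (gx j) - f (gx j)) + gn (\<lambda>j. f (gx j) - U j)"
      by (rule gn_triangle_diff)
    also have "gn (\<lambda>j. trunc f (gx j) - f (gx j)) \<le> 2 * ?t"
      using trunc_grid_error[OF f \<omega>] by (subst gn_minus_commute) simp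
    finally show ?thesis by simp
  qed
  have D2: "(LINT x|M\<^sub>S. (norm (?D x))\<^sup>2) = (b - a) * ?G\<^sup>2"
  proof -
    have "complex_of_real ((LINT x|M\<^sub>S. (norm (?D x))\<^sup>2) / (b - a)) = mean (\<lambda>x. ?D x * cnj (?D x))"
      unfolding mean_def complex_norm_square[symmetric] by (simp flip: of_real_power)
    also have "\<dots> = complex_of_real (?G\<^sup>2)"
      by (subst norm2_mean_sum) (auto simp: L2_set_def sum_nonneg)
    finally have "(LINT x|M\<^sub>S. (norm (?D x))\<^sup>2) / (b - a) = ?G\<^sup>2" by (simp only: of_real_eq_iff)
    then show ?thesis using ab by (simp add: field_simps)
  qed
  have int: "integrable M\<^sub>S (\<lambda>x. (norm (g x))\<^sup>2)" if bg: "bm g" for g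
  proof -
    obtain Kg where "0 \<le> Kg" "\<And>x. x \<in> S \<Longrightarrow> norm (g x) \<le> Kg" by (rule bmE[OF bg]) (rule that)
    then show ?thesis using bm_measurable[OF bg]
      by (intro integrable_bounded[of _ "Kg\<^sup>2"]) (auto simp: power_mono)
  qed
  have "(L2_norm_on S (\<lambda>x. f x - interpolant a b M U x))\<^sup>2
      = (LINT x|M\<^sub>S. (norm (f x - interpolant a b M U x))\<^sup>2)"
    by (simp add: L2_norm_on_def set_lebesgue_integral_def integral_restrict_space)
  also have "\<dots> \<le> (LINT x|M\<^sub>S. 2 * (norm (f x - trunc f x))\<^sup>2 + 2 * (norm (?D x))\<^sup>2)"
  proof (rule integral_mono)
    fix x
    have "f x - interpolant a b M U x = (f x - trunc f x) + ?D x"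
      by (simp add: interpolant_def trunc_def left_diff_distrib sum_subtractf)
    then have "norm (f x - interpolant a b M U x) \<le> norm (f x - trunc f x) + norm (?D x)"
      by (metis norm_triangle_ineq)
    then have "(norm (f x - interpolant a b M U x))\<^sup>2 \<le> (norm (f x - trunc f x) + norm (?D x))\<^sup>2"
      by (intro power_mono) auto
    also have "\<dots> \<le> 2 * (norm (f x - trunc f x))\<^sup>2 + 2 * (norm (?D x))\<^sup>2"
      using sum_squares_bound[of "norm (f x - trunc f x)" "norm (?D x)"] by (simp add: power2_sum)
    finally show "(norm (f x - interpolant a b M U x))\<^sup>2 \<le> 2 * (norm (f x - trunc f x))\<^sup>2 + 2 * (norm (?D x))\<^sup>2" .
  qed (intro int bm_intros bD Bochner_Integration.integrable_add integrable_mult_right)+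
  also have "\<dots> = 2 * (LINT x|M\<^sub>S. (norm (f x - trunc f x))\<^sup>2) + 2 * (LINT x|M\<^sub>S. (norm (?D x))\<^sup>2)"
    by (subst Bochner_Integration.integral_add) (intro int bm_intros bD integrable_mult_right, simp)+
  also have "\<dots> \<le> 2 * ((b - a) * ?t\<^sup>2) + 2 * ((b - a) * ?G\<^sup>2)"
    unfolding D2 using trunc_L2_error[OF f \<omega>] by simp
  also have "\<dots> \<le> (2 * sqrt (b - a) * (?t + ?G))\<^sup>2"
  proof -
    have "(2 * sqrt (b - a) * (?t + ?G))\<^sup>2 = 4 * (b - a) * (?t + ?G)\<^sup>2"
      using ab by (simp add: power_mult_distrib)
    moreover have "?t\<^sup>2 + ?G\<^sup>2 \<le> (?t + ?G)\<^sup>2" using t by (simp add: power2_sum)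
    then have "(b - a) * (?t\<^sup>2 + ?G\<^sup>2) \<le> (b - a) * (?t + ?G)\<^sup>2" using ab by (intro mult_left_mono) auto
    moreover have "0 \<le> (b - a) * (?t + ?G)\<^sup>2" using ab by simp
    ultimately show ?thesis unfolding distrib_left by linarith
  qed
  finally have sq: "(L2_norm_on S (\<lambda>x. f x - interpolant a b M U x))\<^sup>2 \<le> (2 * sqrt (b - a) * (?t + ?G))\<^sup>2" .
  have c: "0 \<le> 2 * sqrt (b - a)" using ab by simp
  have "L2_norm_on S (\<lambda>x. f x - interpolant a b M U x) \<le> 2 * sqrt (b - a) * (?t + ?G)"
    by (rule power2_le_imp_le[OF sq mult_nonneg_nonneg[OF c add_nonneg_nonneg[OF t L2_set_nonneg]]])
  also have "\<dots> \<le> 2 * sqrt (b - a) * (3 * ?t + gn (\<lambda>j. f (gx j) - U j))"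
    by (rule mult_left_mono[OF _ c]) (use G in linarith)
  finally show ?thesis by (simp only: mult.assoc)
qed

end

section \<open>The free and the potential step\<close>

lemma cscale_nth [simp]: "(c *\<^sub>M A) $ i $ j = c * A $ i $ j"
  by (simp add: cscale_def)

lemma matrix_mult_cscale: "X ** (c *\<^sub>M A) = c *\<^sub>M (X ** A)"
  by (simp add: vec_eq_iff matrix_matrix_mult_def sum_distrib_left mult_ac)

lemma cscale_cscale: "c *\<^sub>M (d *\<^sub>M A) = (c * d) *\<^sub>M A"
  by (simp add: vec_eq_iff mult.assoc)

lemma bounded_linear_cscale: "bounded_linear (\<lambda>c. c *\<^sub>M A)"
  by (intro linear_conv_bounded_linear[THEN iffD1] linearI)
    (simp_all add: vec_eq_iff distrib_right)

text \<open>The powers arise by multiplication from the left, starting from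
  \<open>mat 1 = P + Q\<close>, so it suffices that the columns of \<open>P\<close> and of
  \<open>Q\<close> are eigenvectors of \<open>X\<close>.\<close>

lemma mexp_eigen:
  assumes PQ: "P + Q = mat 1" and P: "X ** P = \<alpha> *\<^sub>M P" and Q: "X ** Q = \<beta> *\<^sub>M Q"
  shows "mexp X = exp \<alpha> *\<^sub>M P + exp \<beta> *\<^sub>M Q"
proof -
  have pow: "((\<lambda>B. X ** B) ^^ n) (mat 1) = \<alpha> ^ n *\<^sub>M P + \<beta> ^ n *\<^sub>M Q" for n
  proof (induction n)
    case 0
    show ?case by (simp add: PQ[symmetric]) (simp add: vec_eq_iff)
  next
    case (Suc n)
    then show ?case
      by (simp add: matrix_add_ldistrib matrix_mult_cscale P Q cscale_cscale mult.commute)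
  qed
  have "(\<lambda>n. (\<alpha> ^ n /\<^sub>R fact n) *\<^sub>M P + (\<beta> ^ n /\<^sub>R fact n) *\<^sub>M Q) sums (exp \<alpha> *\<^sub>M P + exp \<beta> *\<^sub>M Q)"
    by (intro sums_add bounded_linear.sums[OF bounded_linear_cscale] exp_converges)
  moreover have "(\<alpha> ^ n /\<^sub>R fact n) *\<^sub>M P + (\<beta> ^ n /\<^sub>R fact n) *\<^sub>M Q = ((\<lambda>B. X ** B) ^^ n) (mat 1) /\<^sub>R fact n" for n
    unfolding pow by (simp add: vec_eq_iff algebra_simps)
  ultimately show ?thesis unfolding mexp_def by (simp add: sums_unique[symmetric])
qed

text \<open>Diagonalizes \<open>\<sigma>\<^sub>1\<close>, up to a factor \<open>\<surd>2\<close>.\<close>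

definition pm :: "complex^2 \<Rightarrow> complex \<times> complex"
  where "pm X = (X $ 1 + X $ 2, X $ 1 - X $ 2)"

definition herm2 :: "complex \<times> complex \<Rightarrow> complex \<times> complex \<Rightarrow> complex"
  where "herm2 x y = cnj (fst x) * fst y + cnj (snd x) * snd y"

text \<open>The exponential of \<open>s (- i \<mu> \<sigma>\<^sub>1 - i \<omega> \<sigma>\<^sub>3)\<close> in the coordinates \<open>pm\<close>.\<close>

definition dirac_flow :: "real \<Rightarrow> real \<Rightarrow> real \<Rightarrow> complex \<times> complex \<Rightarrow> complex \<times> complex"
  where "dirac_flow \<omega> \<mu> s z =
    (let \<kappa> = sqrt (\<mu>\<^sup>2 + \<omega>\<^sup>2); C = complex_of_real (cos (\<kappa> * s)); D = complex_of_real (sin (\<kappa> * s) / \<kappa>) in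
      (C * fst z - \<i> * D * (of_real \<mu> * fst z + of_real \<omega> * snd z),
       C * snd z - \<i> * D * (of_real \<omega> * fst z - of_real \<mu> * snd z)))"

lemma dirac_flow_0 [simp]: "dirac_flow \<omega> \<mu> 0 z = z"
  by (simp add: dirac_flow_def Let_def)

text \<open>Addition theorems for sine and cosine, combined with the fact that the generator squares
  to -(\<mu>^2 + \<omega>^2); positivity of \<omega> keeps the frequency \<kappa> away from
  0.\<close>

lemma dirac_flow_add:
  assumes "0 < \<omega>"
  shows "dirac_flow \<omega> \<mu> s (dirac_flow \<omega> \<mu> t z) = dirac_flow \<omega> \<mu> (s + t) z"
proof -
  define \<kappa> where "\<kappa> = sqrt (\<mu>\<^sup>2 + \<omega>\<^sup>2)"
  have "0 < \<mu>\<^sup>2 + \<omega>\<^sup>2" using assms by (intro add_nonneg_pos) auto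
  then have \<kappa>: "\<kappa> \<noteq> 0" "\<kappa>\<^sup>2 = \<mu>\<^sup>2 + \<omega>\<^sup>2" using \<open>0 < \<omega>\<close> by (simp_all add: \<kappa>_def)
  define Cs where "Cs = complex_of_real (cos (\<kappa> * s))"
  define Ct where "Ct = complex_of_real (cos (\<kappa> * t))"
  define Ds where "Ds = complex_of_real (sin (\<kappa> * s) / \<kappa>)"
  define Dt where "Dt = complex_of_real (sin (\<kappa> * t) / \<kappa>)"
  have "cos (\<kappa> * (s + t)) = cos (\<kappa> * s) * cos (\<kappa> * t) - (sin (\<kappa> * s) / \<kappa>) * (sin (\<kappa> * t) / \<kappa>) * (\<mu>\<^sup>2 + \<omega>\<^sup>2)"
    "sin (\<kappa> * (s + t)) / \<kappa> = (sin (\<kappa> * s) / \<kappa>) * cos (\<kappa> * t) + cos (\<kappa> * s) * (sin (\<kappa> * t) / \<kappa>)"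
    unfolding \<kappa>(2)[symmetric] using \<kappa>(1)
    by (simp_all add: distrib_left cos_add sin_add add_divide_distrib power2_eq_square)
  then have *: "complex_of_real (cos (\<kappa> * (s + t))) = Cs * Ct - Ds * Dt * (of_real \<mu> * of_real \<mu> + of_real \<omega> * of_real \<omega>)"
    "complex_of_real (sin (\<kappa> * (s + t)) / \<kappa>) = Ds * Ct + Cs * Dt"
    unfolding Cs_def Ct_def Ds_def Dt_def
    by (simp_all only: of_real_add of_real_mult of_real_diff power2_eq_square)
  show ?thesis
    unfolding dirac_flow_def Let_def \<kappa>_def[symmetric] Cs_def[symmetric] Ct_def[symmetric]
      Ds_def[symmetric] Dt_def[symmetric] * fst_conv snd_conv prod.inject
    by (simp add: algebra_simps)
qed

text \<open>The generator is anti-Hermitian, so the adjoint is the flow with reversed time. With the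
  group law this gives unitarity.\<close>

lemma dirac_flow_herm: "herm2 (dirac_flow \<omega> \<mu> s x) y = herm2 x (dirac_flow \<omega> \<mu> (- s) y)"
  by (simp add: dirac_flow_def herm2_def Let_def algebra_simps)

lemma dirac_flow_diff: "dirac_flow \<omega> \<mu> s (x - y) = dirac_flow \<omega> \<mu> s x - dirac_flow \<omega> \<mu> s y"
  by (simp add: dirac_flow_def Let_def algebra_simps)

lemma herm2_self: "herm2 x x = of_real ((norm x)\<^sup>2)"
proof -
  have "(norm x)\<^sup>2 = (norm (fst x))\<^sup>2 + (norm (snd x))\<^sup>2" by (simp add: norm_prod_def)
  then show ?thesis by (simp only: of_real_add complex_norm_square herm2_def mult.commute)
qed

lemma norm_herm2_le: "norm (herm2 x y) \<le> norm x * norm y"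
proof -
  have "norm (herm2 x y) \<le> norm (fst x) * norm (fst y) + norm (snd x) * norm (snd y)"
    unfolding herm2_def by (rule norm_triangle_le) (simp add: norm_mult)
  also have "\<dots> = (norm (fst x), norm (snd x)) \<bullet> (norm (fst y), norm (snd y))" by simp
  also have "\<dots> \<le> norm (norm (fst x), norm (snd x)) * norm (norm (fst y), norm (snd y))"
    by (rule norm_cauchy_schwarz)
  finally show ?thesis by (simp add: norm_prod_def)
qed

lemma norm_dirac_flow:
  assumes "0 < \<omega>" shows "norm (dirac_flow \<omega> \<mu> s x) = norm x"
proof -
  have "herm2 (dirac_flow \<omega> \<mu> s x) (dirac_flow \<omega> \<mu> s x) = herm2 x x"
    by (simp add: dirac_flow_herm dirac_flow_add assms)
  then have "(norm (dirac_flow \<omega> \<mu> s x))\<^sup>2 = (norm x)\<^sup>2"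
    by (simp only: herm2_self of_real_eq_iff)
  then show ?thesis by simp
qed

lemma dirac_flow_deriv:
  assumes "0 < \<omega>"
  shows "((\<lambda>s. fst (dirac_flow \<omega> \<mu> s z)) has_vector_derivative
      - \<i> * of_real \<mu> * fst (dirac_flow \<omega> \<mu> s z) - \<i> * of_real \<omega> * snd (dirac_flow \<omega> \<mu> s z)) (at s within A)"
    and "((\<lambda>s. snd (dirac_flow \<omega> \<mu> s z)) has_vector_derivative
      \<i> * of_real \<mu> * snd (dirac_flow \<omega> \<mu> s z) - \<i> * of_real \<omega> * fst (dirac_flow \<omega> \<mu> s z)) (at s within A)"
proof -
  define \<kappa> where "\<kappa> = sqrt (\<mu>\<^sup>2 + \<omega>\<^sup>2)"
  have "0 < \<mu>\<^sup>2 + \<omega>\<^sup>2" using assms by (intro add_nonneg_pos) auto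
  then have \<kappa>: "\<kappa> \<noteq> 0" "\<kappa>\<^sup>2 = \<mu>\<^sup>2 + \<omega>\<^sup>2" using \<open>0 < \<omega>\<close> by (simp_all add: \<kappa>_def)
  have "((\<lambda>s. cos (\<kappa> * s)) has_real_derivative - (\<mu>\<^sup>2 + \<omega>\<^sup>2) * (sin (\<kappa> * s) / \<kappa>)) (at s within A)"
  proof -
    have "- (\<mu>\<^sup>2 + \<omega>\<^sup>2) * (sin (\<kappa> * s) / \<kappa>) = - sin (\<kappa> * s) * \<kappa>"
      unfolding \<kappa>(2)[symmetric] using \<kappa>(1) by (simp add: power2_eq_square)
    then show ?thesis by (auto intro!: derivative_eq_intros)
  qed
  then have C: "((\<lambda>s. complex_of_real (cos (\<kappa> * s))) has_vector_derivative
      of_real (- (\<mu>\<^sup>2 + \<omega>\<^sup>2) * (sin (\<kappa> * s) / \<kappa>))) (at s within A)"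
    by (intro has_vector_derivative_of_real) (simp add: has_real_derivative_iff_has_vector_derivative)
  have "((\<lambda>s. sin (\<kappa> * s) / \<kappa>) has_real_derivative cos (\<kappa> * s)) (at s within A)"
    using \<kappa> by (auto intro!: derivative_eq_intros)
  then have D: "((\<lambda>s. complex_of_real (sin (\<kappa> * s) / \<kappa>)) has_vector_derivative of_real (cos (\<kappa> * s))) (at s within A)"
    by (intro has_vector_derivative_of_real) (simp add: has_real_derivative_iff_has_vector_derivative)
  have lin: "((\<lambda>s. complex_of_real (cos (\<kappa> * s)) * c - \<i> * complex_of_real (sin (\<kappa> * s) / \<kappa>) * d) has_vector_derivative
      of_real (- (\<mu>\<^sup>2 + \<omega>\<^sup>2) * (sin (\<kappa> * s) / \<kappa>)) * c - \<i> * of_real (cos (\<kappa> * s)) * d) (at s within A)" for c d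
    by (intro has_vector_derivative_diff has_vector_derivative_mult_left has_vector_derivative_mult_right C D)
  show "((\<lambda>s. fst (dirac_flow \<omega> \<mu> s z)) has_vector_derivative
      - \<i> * of_real \<mu> * fst (dirac_flow \<omega> \<mu> s z) - \<i> * of_real \<omega> * snd (dirac_flow \<omega> \<mu> s z)) (at s within A)"
    unfolding dirac_flow_def Let_def \<kappa>_def[symmetric] fst_conv snd_conv
    by (rule has_vector_derivative_eq_rhs[OF lin]) (simp add: algebra_simps power2_eq_square)
  show "((\<lambda>s. snd (dirac_flow \<omega> \<mu> s z)) has_vector_derivative
      \<i> * of_real \<mu> * snd (dirac_flow \<omega> \<mu> s z) - \<i> * of_real \<omega> * fst (dirac_flow \<omega> \<mu> s z)) (at s within A)"
    unfolding dirac_flow_def Let_def \<kappa>_def[symmetric] fst_conv snd_conv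
    by (rule has_vector_derivative_eq_rhs[OF lin]) (simp add: algebra_simps power2_eq_square)
qed

lemma sigma_nth [simp]:
  "\<sigma>\<^sub>1 $ 1 $ 1 = 0" "\<sigma>\<^sub>1 $ 1 $ 2 = 1" "\<sigma>\<^sub>1 $ 2 $ 1 = 1" "\<sigma>\<^sub>1 $ 2 $ 2 = 0"
  "\<sigma>\<^sub>3 $ 1 $ 1 = 1" "\<sigma>\<^sub>3 $ 1 $ 2 = 0" "\<sigma>\<^sub>3 $ 2 $ 1 = 0" "\<sigma>\<^sub>3 $ 2 $ 2 = - 1"
  by (simp_all add: sigma1_def sigma3_def)

lemma mat_nth_2 [simp]:
  "(mat c :: complex^2^2) $ 1 $ 1 = c" "(mat c :: complex^2^2) $ 1 $ 2 = 0"
  "(mat c :: complex^2^2) $ 2 $ 1 = 0" "(mat c :: complex^2^2) $ 2 $ 2 = c"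
  by (simp_all add: mat_def)

lemma matrix_2_eq: "A = B \<longleftrightarrow> A $ 1 $ 1 = B $ 1 $ 1 \<and> A $ 1 $ 2 = B $ 1 $ 2 \<and> A $ 2 $ 1 = B $ 2 $ 1 \<and> A $ 2 $ 2 = B $ 2 $ 2"
  for A B :: "complex^2^2"
  by (simp add: vec_eq_iff forall_2)

lemma matrix_mult_2: "(A ** B) $ i $ j = A $ i $ 1 * B $ 1 $ j + A $ i $ 2 * B $ 2 $ j"
  for A B :: "complex^2^2"
  by (simp add: matrix_matrix_mult_def sum_2)

lemma matrix_vector_2: "(A *v X) $ i = A $ i $ 1 * X $ 1 + A $ i $ 2 * X $ 2"
  for A :: "complex^2^2"
  by (simp add: matrix_vector_mult_def sum_2)

lemma scaleR_complex: "r *\<^sub>R z = of_real r * (z :: complex)"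
  by (rule scaleR_conv_of_real)

text \<open>The exponent is -i\<kappa>\<tau> times a Hermitian matrix that squares to the identity;
  \<open>P\<close> and \<open>Q\<close> are its spectral projections for the eigenvalues 1 and
  -1.\<close>

lemma pm_mexp_free:
  assumes "0 < \<epsilon>"
  shows "pm (mexp (\<tau> *\<^sub>R ((- \<i> * of_real \<mu>) *\<^sub>M \<sigma>\<^sub>1 - (\<i> / of_real \<epsilon>) *\<^sub>M \<sigma>\<^sub>3)) *v X)
    = dirac_flow (1 / \<epsilon>) \<mu> \<tau> (pm X)"
proof -
  define \<omega> where "\<omega> = 1 / \<epsilon>"
  define \<kappa> where "\<kappa> = sqrt (\<mu>\<^sup>2 + \<omega>\<^sup>2)"
  have "0 < \<omega>" using assms by (simp add: \<omega>_def)
  then have "0 < \<mu>\<^sup>2 + \<omega>\<^sup>2" by (intro add_nonneg_pos) auto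
  then have \<kappa>: "\<kappa> \<noteq> 0" "\<kappa>\<^sup>2 = \<mu>\<^sup>2 + \<omega>\<^sup>2" using \<open>0 < \<omega>\<close> by (simp_all add: \<kappa>_def)
  define x where "x = complex_of_real (\<mu> / \<kappa>)"
  define y where "y = complex_of_real (\<omega> / \<kappa>)"
  have xy: "complex_of_real \<mu> = of_real \<kappa> * x" "complex_of_real \<omega> = of_real \<kappa> * y"
    using \<kappa>(1) by (simp_all add: x_def y_def)
  have "(\<mu> / \<kappa>) * (\<mu> / \<kappa>) + (\<omega> / \<kappa>) * (\<omega> / \<kappa>) = 1"
  proof -
    have "(\<mu> / \<kappa>) * (\<mu> / \<kappa>) + (\<omega> / \<kappa>) * (\<omega> / \<kappa>) = (\<mu>\<^sup>2 + \<omega>\<^sup>2) / \<kappa>\<^sup>2"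
      by (simp add: power2_eq_square add_divide_distrib)
    also have "\<dots> = 1" unfolding \<kappa>(2)[symmetric] using \<kappa>(1) by simp
    finally show ?thesis .
  qed
  from arg_cong[OF this, of complex_of_real] have "x * x + y * y = 1"
    by (simp only: x_def y_def of_real_add of_real_mult of_real_1)
  then have yy: "y * y = 1 - x * x" by (simp add: algebra_simps)
  \<comment> \<open>The same elimination of the square of \<open>y\<close>, for products that
    simplification has already reassociated to the right.\<close>
  then have yyz: "y * (y * z) = z - x * (x * z)" for z
    by (simp only: mult.assoc[symmetric] left_diff_distrib mult_1_left)
  define X' where "X' = \<tau> *\<^sub>R ((- \<i> * of_real \<mu>) *\<^sub>M \<sigma>\<^sub>1 - (\<i> * of_real \<omega>) *\<^sub>M \<sigma>\<^sub>3)"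
  define P where "P = (1/2) *\<^sub>M (mat 1 + (x *\<^sub>M \<sigma>\<^sub>1 + y *\<^sub>M \<sigma>\<^sub>3))"
  define Q where "Q = (1/2) *\<^sub>M (mat 1 - (x *\<^sub>M \<sigma>\<^sub>1 + y *\<^sub>M \<sigma>\<^sub>3))"
  let ?c = "\<i> * of_real (\<kappa> * \<tau>)"
  have PQ: "P + Q = mat 1" by (simp add: matrix_2_eq P_def Q_def add_divide_distrib diff_divide_distrib)
  have XP: "X' ** P = (- ?c) *\<^sub>M P"
    unfolding matrix_2_eq X'_def P_def xy
    by (simp add: matrix_mult_2 scaleR_complex algebra_simps add_divide_distrib diff_divide_distrib yy yyz)
  have XQ: "X' ** Q = ?c *\<^sub>M Q"
    unfolding matrix_2_eq X'_def Q_def xy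
    by (simp add: matrix_mult_2 scaleR_complex algebra_simps add_divide_distrib diff_divide_distrib yy yyz)
  have E: "exp (- ?c) = of_real (cos (\<kappa> * \<tau>)) - \<i> * of_real (sin (\<kappa> * \<tau>))"
    "exp ?c = of_real (cos (\<kappa> * \<tau>)) + \<i> * of_real (sin (\<kappa> * \<tau>))"
    using cis_conv_exp[of "- (\<kappa> * \<tau>)"] cis_conv_exp[of "\<kappa> * \<tau>"] by (simp_all add: cis.ctr complex_eq_iff)
  have m: "mexp X' = exp (- ?c) *\<^sub>M P + exp ?c *\<^sub>M Q"
    by (rule mexp_eigen[OF PQ XP XQ])
  have "pm (mexp X' *v X) = dirac_flow \<omega> \<mu> \<tau> (pm X)"
    unfolding m E P_def Q_def dirac_flow_def Let_def \<kappa>_def[symmetric] pm_def of_real_divide xy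
    using \<kappa>(1) by (simp add: matrix_vector_2 algebra_simps add_divide_distrib diff_divide_distrib)
  then show ?thesis by (simp add: X'_def \<omega>_def)
qed

text \<open>On the two \<open>pm\<close> coordinates \<open>\<sigma>\<^sub>1\<close> acts as 1 and
  -1, so the exponential becomes a pair of scalar phases with the potentials v - A and v +
  A.\<close>

lemma pm_mexp_potential:
  "pm (mexp (\<tau> *\<^sub>R ((- (\<i> / of_real \<epsilon>) * of_real v) *\<^sub>M mat 1 + (\<i> / of_real \<epsilon> * of_real A) *\<^sub>M \<sigma>\<^sub>1)) *v X)
    = (exp (- \<i> * of_real (\<tau> / \<epsilon> * (v - A))) * fst (pm X), exp (- \<i> * of_real (\<tau> / \<epsilon> * (v + A))) * snd (pm X))"
proof -
  define X' where "X' = \<tau> *\<^sub>R ((- (\<i> / of_real \<epsilon>) * of_real v) *\<^sub>M mat 1 + (\<i> / of_real \<epsilon> * of_real A) *\<^sub>M \<sigma>\<^sub>1)"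
  define P where "P = (1/2) *\<^sub>M (mat 1 + \<sigma>\<^sub>1)"
  define Q where "Q = (1/2) *\<^sub>M (mat 1 - \<sigma>\<^sub>1)"
  have PQ: "P + Q = mat 1" by (simp add: matrix_2_eq P_def Q_def)
  have XP: "X' ** P = (- \<i> * of_real (\<tau> / \<epsilon> * (v - A))) *\<^sub>M P"
    unfolding matrix_2_eq X'_def P_def
    by (simp add: matrix_mult_2 scaleR_complex algebra_simps add_divide_distrib diff_divide_distrib)
  have XQ: "X' ** Q = (- \<i> * of_real (\<tau> / \<epsilon> * (v + A))) *\<^sub>M Q"
    unfolding matrix_2_eq X'_def Q_def
    by (simp add: matrix_mult_2 scaleR_complex algebra_simps add_divide_distrib diff_divide_distrib)
  have "pm (mexp X' *v X)
    = (exp (- \<i> * of_real (\<tau> / \<epsilon> * (v - A))) * fst (pm X), exp (- \<i> * of_real (\<tau> / \<epsilon> * (v + A))) * snd (pm X))"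
    unfolding mexp_eigen[OF PQ XP XQ] pm_def P_def Q_def
    by (simp add: matrix_vector_2 algebra_simps)
  then show ?thesis by (simp only: X'_def)
qed

section \<open>The scheme in the coordinates \<open>pm\<close>\<close>

context periodic_grid
begin

definition dftp :: "(nat \<Rightarrow> complex \<times> complex) \<Rightarrow> int \<Rightarrow> complex \<times> complex"
  where "dftp Z l = (dft a b M (\<lambda>j. fst (Z j)) l, dft a b M (\<lambda>j. snd (Z j)) l)"

definition trigp :: "(int \<Rightarrow> complex \<times> complex) \<Rightarrow> real \<Rightarrow> complex \<times> complex"
  where "trigp c x = ((\<Sum>l\<in>modes M. fst (c l) * e l x), (\<Sum>l\<in>modes M. snd (c l) * e l x))"

definition flow_step :: "real \<Rightarrow> real \<Rightarrow> (nat \<Rightarrow> complex \<times> complex) \<Rightarrow> nat \<Rightarrow> complex \<times> complex"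
  where "flow_step \<omega> \<tau> Z j = trigp (\<lambda>l. dirac_flow \<omega> (\<mu> l) \<tau> (dftp Z l)) (gx j)"

definition pot_step :: "real \<Rightarrow> (real \<Rightarrow> real) \<Rightarrow> (real \<Rightarrow> real) \<Rightarrow> (nat \<Rightarrow> complex \<times> complex) \<Rightarrow> nat \<Rightarrow> complex \<times> complex"
  where "pot_step \<theta> p q Z j =
    (exp (- \<i> * of_real (\<theta> * p (gx j))) * fst (Z j), exp (- \<i> * of_real (\<theta> * q (gx j))) * snd (Z j))"

lemma dft_add: "dft a b M (\<lambda>j. U j + W j) l = dft a b M U l + dft a b M W l"
  by (simp add: dft_eq distrib_right sum.distrib add_divide_distrib)

lemma dft_diff: "dft a b M (\<lambda>j. U j - W j) l = dft a b M U l - dft a b M W l"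
  by (simp add: dft_eq left_diff_distrib sum_subtractf diff_divide_distrib)

lemma pm_dft_vec: "pm (dft_vec a b M U l) = dftp (\<lambda>j. pm (U j)) l"
  by (simp add: pm_def dft_vec_def dftp_def dft_add dft_diff)

lemma pm_sum: "pm (\<Sum>l\<in>I. c l *s F l) = ((\<Sum>l\<in>I. fst (pm (F l)) * c l), (\<Sum>l\<in>I. snd (pm (F l)) * c l))"
  by (simp add: pm_def sum_component algebra_simps sum.distrib sum_subtractf)

lemma pm_scheme:
  assumes "0 < \<epsilon>"
  shows "pm (scheme_S1 \<epsilon> a b M \<tau> V A\<^sub>1 \<Phi>\<^sub>0 (Suc n) j) =
    pot_step (\<tau> / \<epsilon>) (\<lambda>x. V x - A\<^sub>1 x) (\<lambda>x. V x + A\<^sub>1 x)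
      (flow_step (1 / \<epsilon>) \<tau> (\<lambda>j. pm (scheme_S1 \<epsilon> a b M \<tau> V A\<^sub>1 \<Phi>\<^sub>0 n j))) j"
proof -
  have "pm (free_step \<epsilon> a b M \<tau> U j) = flow_step (1 / \<epsilon>) \<tau> (\<lambda>j. pm (U j)) j" for U
    unfolding free_step_def flow_step_def trigp_def pm_sum pm_mexp_free[OF assms] pm_dft_vec ..
  then show ?thesis
    by (simp only: scheme_S1.simps potential_step_def pm_mexp_potential pot_step_def)
qed

lemma gn_pair: "(gn Z)\<^sup>2 = (gn (\<lambda>j. fst (Z j)))\<^sup>2 + (gn (\<lambda>j. snd (Z j)))\<^sup>2"
  for Z :: "nat \<Rightarrow> complex \<times> complex"
  by (simp add: gn_def sum_nonneg norm_prod_def sum.distrib add_divide_distrib)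

lemma gn_trigp: "gn (\<lambda>j. trigp c (gx j)) = L2_set (\<lambda>l. norm (c l)) (modes M)"
proof -
  have "(gn (\<lambda>j. trigp c (gx j)))\<^sup>2 = (L2_set (\<lambda>l. norm (c l)) (modes M))\<^sup>2"
    unfolding gn_pair trigp_def fst_conv snd_conv gn_trig
    by (simp add: L2_set_def sum_nonneg norm_prod_def sum.distrib)
  then show ?thesis by (simp add: L2_set_nonneg)
qed

lemma trigp_dftp: "j < M \<Longrightarrow> trigp (dftp Z) (gx j) = Z j"
  by (simp add: trigp_def dftp_def dft_inverse)

lemma dftp_trigp: "l \<in> modes M \<Longrightarrow> dftp (\<lambda>j. trigp c (gx j)) l = c l"
  by (simp add: trigp_def dftp_def dft_trig)

lemma gn_dftp: "gn Z = L2_set (\<lambda>l. norm (dftp Z l)) (modes M)"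
proof -
  have "gn Z = gn (\<lambda>j. trigp (dftp Z) (gx j))" by (rule gn_cong) (simp add: trigp_dftp)
  then show ?thesis by (simp only: gn_trigp)
qed

text \<open>Parseval on the grid and unitarity in each mode. Together with
  \<open>gn_pot_step\<close> this is the unconditional stability of the scheme.\<close>

lemma gn_flow_step: "0 < \<omega> \<Longrightarrow> gn (flow_step \<omega> \<tau> Z) = gn Z"
  unfolding flow_step_def[abs_def] gn_trigp gn_dftp[of Z] by (simp add: norm_dirac_flow)

lemma norm_pot_step: "norm (pot_step \<theta> p q Z j) = norm (Z j)"
  by (simp add: pot_step_def norm_prod_def norm_mult flip: of_real_mult)

lemma gn_pot_step: "gn (pot_step \<theta> p q Z) = gn Z"
  by (rule gn_cong) (rule norm_pot_step)

lemma pot_step_diff: "pot_step \<theta> p q (\<lambda>j. Z j - W j) j = pot_step \<theta> p q Z j - pot_step \<theta> p q W j"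
  by (simp add: pot_step_def algebra_simps)

lemma trigp_diff: "trigp (\<lambda>l. c l - d l) x = trigp c x - trigp d x"
  by (simp add: trigp_def left_diff_distrib sum_subtractf)

lemma dftp_diff: "dftp (\<lambda>j. Z j - W j) l = dftp Z l - dftp W l"
  by (simp add: dftp_def dft_diff)

lemma flow_step_diff: "flow_step \<omega> \<tau> (\<lambda>j. Z j - W j) j = flow_step \<omega> \<tau> Z j - flow_step \<omega> \<tau> W j"
  by (simp add: flow_step_def dftp_diff dirac_flow_diff trigp_diff)

end

section \<open>Pairing with free Dirac waves\<close>

text \<open>The form of the derivative that can be tested along sequences, as dominated convergence
  requires.\<close>

lemma has_vector_derivative_iff_tendsto:
  fixes f :: "real \<Rightarrow> 'a::real_normed_vector"
  shows "(f has_vector_derivative y) (at x within A) \<longleftrightarrow>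
    ((\<lambda>t. (f t - f x) /\<^sub>R (t - x)) \<longlongrightarrow> y) (at x within A)"
proof -
  have eq: "norm ((1 / norm (t - x)) *\<^sub>R (f t - (f x + (t - x) *\<^sub>R y))) = norm ((f t - f x) /\<^sub>R (t - x) - y)"
    if "t \<noteq> x" for t
  proof -
    have "(f t - f x) /\<^sub>R (t - x) - y = (f t - (f x + (t - x) *\<^sub>R y)) /\<^sub>R (t - x)"
      using that by (simp add: scaleR_diff_right diff_diff_add[symmetric])
    then show ?thesis by (simp add: divide_inverse abs_inverse)
  qed
  have "(f has_vector_derivative y) (at x within A) \<longleftrightarrow>
    ((\<lambda>t. norm ((1 / norm (t - x)) *\<^sub>R (f t - (f x + (t - x) *\<^sub>R y)))) \<longlongrightarrow> 0) (at x within A)"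
    unfolding has_vector_derivative_def has_derivative_within
    by (subst tendsto_norm_zero_iff) (simp add: bounded_linear_scaleR_left)
  also have "\<dots> \<longleftrightarrow> ((\<lambda>t. norm ((f t - f x) /\<^sub>R (t - x) - y)) \<longlongrightarrow> 0) (at x within A)"
    by (rule filterlim_cong[OF refl refl])
      (unfold eventually_at_filter, rule always_eventually, use eq in blast)
  finally show ?thesis by (simp only: tendsto_norm_zero_iff LIM_zero_iff)
qed

lemma norm_diff_le_of_vector_derivative:
  fixes f :: "real \<Rightarrow> 'a::real_normed_vector"
  assumes "\<And>x. x \<in> A \<Longrightarrow> (f has_vector_derivative f' x) (at x within A)"
    and "convex A" and "\<And>x. x \<in> A \<Longrightarrow> norm (f' x) \<le> B" and "x \<in> A" "y \<in> A"
  shows "norm (f x - f y) \<le> B * \<bar>x - y\<bar>"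
proof -
  have "norm (f x - f y) \<le> B * norm (x - y)"
  proof (rule differentiable_bound[OF assms(2)])
    fix z assume z: "z \<in> A"
    show "(f has_derivative (\<lambda>h. h *\<^sub>R f' z)) (at z within A)"
      using assms(1)[OF z] by (simp add: has_vector_derivative_def)
    show "onorm (\<lambda>h. h *\<^sub>R f' z) \<le> B"
      using assms(3)[OF z] by (intro onorm_le) (auto simp: mult.commute[of B] intro!: mult_left_mono)
  qed (use assms in auto)
  then show ?thesis by simp
qed

context real_interval
begin

text \<open>Fixes the derivative as a function, so that equations can mention it; \<open>psm\<close>
  by itself only asserts that one exists.\<close>

definition Dx :: "(real \<Rightarrow> complex) \<Rightarrow> real \<Rightarrow> complex"
  where "Dx f x = vector_derivative f (at x within {a..b})"

lemma psm_Dx: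
  assumes "psm \<omega> (Suc n) K f"
  shows "x \<in> {a..b} \<Longrightarrow> (f has_vector_derivative Dx f x) (at x within {a..b})" "psm \<omega> n (K * \<omega>) (Dx f)"
proof -
  obtain f' where
    f': "\<And>x. x \<in> {a..b} \<Longrightarrow> (f has_vector_derivative f' x) (at x within {a..b})" and
    s: "psm \<omega> n (K * \<omega>) f'"
    by (rule psm_SucE[OF assms]) (rule that)
  have eq: "Dx f x = f' x" if "x \<in> {a..b}" for x
    unfolding Dx_def using vector_derivative_within_closed_interval[OF ab that f'[OF that]] .
  show "x \<in> {a..b} \<Longrightarrow> (f has_vector_derivative Dx f x) (at x within {a..b})" using f' eq by simp
  show "psm \<omega> n (K * \<omega>) (Dx f)" by (rule psm_cong[OF s]) (simp add: eq)
qed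

lemma bm_limit:
  assumes f: "\<And>i::nat. bm (f i)" and lim: "\<And>x. x \<in> S \<Longrightarrow> (\<lambda>i. f i x) \<longlonglongrightarrow> g x"
    and B: "\<And>x. x \<in> S \<Longrightarrow> norm (g x) \<le> B"
  shows "bm g"
proof (rule bmI[OF _ B])
  show "g \<in> borel_measurable M\<^sub>S"
    by (rule borel_measurable_LIMSEQ_metric[of f]) (use f lim in \<open>auto intro: bm_measurable\<close>)
qed

text \<open>Differentiation under the integral by dominated convergence. The mean value inequality
  turns the bound on the derivative into a bound on the difference quotients, and the derivative
  inherits measurability from them.\<close>

lemma mean_has_derivative:
  assumes J: "J = {\<alpha>..\<beta>}" "\<alpha> < \<beta>" and s: "s \<in> J"
    and bm: "\<And>s. s \<in> J \<Longrightarrow> bm (F s)"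
    and der: "\<And>s x. s \<in> J \<Longrightarrow> x \<in> S \<Longrightarrow> ((\<lambda>s. F s x) has_vector_derivative F' s x) (at s within J)"
    and B: "\<And>s x. s \<in> J \<Longrightarrow> x \<in> S \<Longrightarrow> norm (F' s x) \<le> B"
  shows "((\<lambda>s. mean (F s)) has_vector_derivative mean (F' s)) (at s within J)" and "bm (F' s)"
proof -
  have lip: "norm (F t x - F s x) \<le> B * \<bar>t - s\<bar>" if "t \<in> J" "x \<in> S" for t x
    by (rule norm_diff_le_of_vector_derivative[where A=J and f="\<lambda>s. F s x" and f'="\<lambda>s. F' s x"])
      (use der B that s J in auto)
  have lim: "((\<lambda>t. (F t x - F s x) /\<^sub>R (t - s)) \<longlongrightarrow> F' s x) (at s within J)" if "x \<in> S" for x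
    using der[OF s that] by (simp only: has_vector_derivative_iff_tendsto)
  have quot: "bm (\<lambda>x. (F t x - F s x) /\<^sub>R (t - s))" if "t \<in> J" for t
  proof -
    have "bm (\<lambda>x. of_real (inverse (t - s)) * (F t x - F s x))"
      by (intro bm_intros bm that s)
    then show ?thesis by (simp add: scaleR_conv_of_real)
  qed
  have bF: "bm (F' s)"
  proof -
    \<comment> \<open>The interval is nondegenerate, so difference quotients along a sequence
      tending to \<open>s\<close> exist also at its endpoints.\<close>
    have "s islimpt J" using s J by (simp add: islimpt_Icc)
    then obtain X where X: "\<And>n. X n \<in> J - {s}" "X \<longlonglongrightarrow> s"
      unfolding islimpt_sequential by blast
    show ?thesis
    proof (rule bm_limit[of "\<lambda>n x. (F (X n) x - F s x) /\<^sub>R (X n - s)"])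
      show "bm (\<lambda>x. (F (X i) x - F s x) /\<^sub>R (X i - s))" for i using quot X by auto
      show "(\<lambda>i. (F (X i) x - F s x) /\<^sub>R (X i - s)) \<longlonglongrightarrow> F' s x" if "x \<in> S" for x
        using lim[OF that] X unfolding tendsto_at_iff_sequentially by (auto simp: o_def)
    qed (use B s in auto)
  qed
  then show "bm (F' s)" .
  have "((\<lambda>t. (mean (F t) - mean (F s)) /\<^sub>R (t - s)) \<longlongrightarrow> mean (F' s)) (at s within J)"
    unfolding tendsto_at_iff_sequentially
  proof (intro allI impI)
    fix X assume X: "\<forall>i. X i \<in> J - {s}" "X \<longlonglongrightarrow> s"
    let ?q = "\<lambda>i x. (F (X i) x - F s x) /\<^sub>R (X i - s)"
    have "(\<lambda>i. LINT x|M\<^sub>S. ?q i x) \<longlonglongrightarrow> (LINT x|M\<^sub>S. F' s x)"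
    proof (rule integral_dominated_convergence[where w="\<lambda>_. B"])
      show "F' s \<in> borel_measurable M\<^sub>S" by (rule bm_measurable[OF bF])
      show "?q i \<in> borel_measurable M\<^sub>S" for i using quot X by (auto intro: bm_measurable)
      show "integrable M\<^sub>S (\<lambda>_. B)" by (rule finite_measure.integrable_const[OF finite_measure_S])
      show "AE x in M\<^sub>S. (\<lambda>i. ?q i x) \<longlonglongrightarrow> F' s x"
        using lim X unfolding tendsto_at_iff_sequentially by (intro AE_I2) (auto simp: o_def)
      show "AE x in M\<^sub>S. norm (?q i x) \<le> B" for i
      proof (rule AE_I2)
        fix x assume "x \<in> space M\<^sub>S"
        then have "norm (F (X i) x - F s x) \<le> B * \<bar>X i - s\<bar>" using X by (intro lip) auto
        moreover have "0 < \<bar>X i - s\<bar>" using X by auto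
        moreover have "norm (?q i x) = norm (F (X i) x - F s x) / \<bar>X i - s\<bar>"
          by (simp add: divide_inverse mult.commute)
        ultimately show "norm (?q i x) \<le> B" by (simp only: pos_divide_le_eq)
      qed
    qed
    then have "(\<lambda>i. mean (?q i)) \<longlonglongrightarrow> mean (F' s)"
      unfolding mean_def by (intro tendsto_intros) (use ab in auto)
    moreover have "mean (?q i) = (mean (F (X i)) - mean (F s)) /\<^sub>R (X i - s)" for i
    proof -
      have "mean (?q i) = mean (\<lambda>x. of_real (inverse (X i - s)) * (F (X i) x - F s x))"
        by (simp add: scaleR_conv_of_real)
      also have "\<dots> = of_real (inverse (X i - s)) * (mean (F (X i)) - mean (F s))"
        unfolding mean_cmult using X s bm by (subst mean_diff) auto
      finally show ?thesis by (simp add: scaleR_conv_of_real)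
    qed
    ultimately show "((\<lambda>t. (mean (F t) - mean (F s)) /\<^sub>R (t - s)) \<circ> X) \<longlonglongrightarrow> mean (F' s)"
      by (simp add: o_def)
  qed
  then show "((\<lambda>s. mean (F s)) has_vector_derivative mean (F' s)) (at s within J)"
    by (simp only: has_vector_derivative_iff_tendsto)
qed

end

context periodic_grid
begin

text \<open>\<open>tf1\<close> and \<open>tf2\<close> are the conjugated components of the
  trigonometric polynomial whose coefficients start at \<open>d\<close> and follow the free Dirac
  flow; \<open>tf1x\<close> and \<open>tf2x\<close> are their derivatives in x.\<close>

definition tf1 :: "real \<Rightarrow> (int \<Rightarrow> complex \<times> complex) \<Rightarrow> real \<Rightarrow> real \<Rightarrow> complex"
  where "tf1 \<omega> d s x = (\<Sum>l\<in>modes M. cnj (fst (dirac_flow \<omega> (\<mu> l) s (d l))) * e (- l) x)"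

definition tf2 :: "real \<Rightarrow> (int \<Rightarrow> complex \<times> complex) \<Rightarrow> real \<Rightarrow> real \<Rightarrow> complex"
  where "tf2 \<omega> d s x = (\<Sum>l\<in>modes M. cnj (snd (dirac_flow \<omega> (\<mu> l) s (d l))) * e (- l) x)"

definition tf1x :: "real \<Rightarrow> (int \<Rightarrow> complex \<times> complex) \<Rightarrow> real \<Rightarrow> real \<Rightarrow> complex"
  where "tf1x \<omega> d s x = (\<Sum>l\<in>modes M. cnj (fst (dirac_flow \<omega> (\<mu> l) s (d l))) * (\<i> * \<mu> (- l) * e (- l) x))"

definition tf2x :: "real \<Rightarrow> (int \<Rightarrow> complex \<times> complex) \<Rightarrow> real \<Rightarrow> real \<Rightarrow> complex"
  where "tf2x \<omega> d s x = (\<Sum>l\<in>modes M. cnj (snd (dirac_flow \<omega> (\<mu> l) s (d l))) * (\<i> * \<mu> (- l) * e (- l) x))"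

definition pairing :: "real \<Rightarrow> (int \<Rightarrow> complex \<times> complex) \<Rightarrow> real \<Rightarrow> (real \<Rightarrow> complex) \<Rightarrow> (real \<Rightarrow> complex) \<Rightarrow> complex"
  where "pairing \<omega> d s k1 k2 = mean (\<lambda>x. tf1 \<omega> d s x * k1 x + tf2 \<omega> d s x * k2 x)"

lemma bm_tf [simp]: "bm (tf1 \<omega> d s)" "bm (tf2 \<omega> d s)" "bm (tf1x \<omega> d s)" "bm (tf2x \<omega> d s)"
  unfolding tf1_def[abs_def] tf2_def[abs_def] tf1x_def[abs_def] tf2x_def[abs_def] by (intro bm_intros)+

lemma tf_x_deriv:
  "(tf1 \<omega> d s has_vector_derivative tf1x \<omega> d s x) (at x within A)"
  "(tf2 \<omega> d s has_vector_derivative tf2x \<omega> d s x) (at x within A)"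
  unfolding tf1_def[abs_def] tf2_def[abs_def] tf1x_def tf2x_def
  by (intro has_vector_derivative_sum has_vector_derivative_mult_right wave_deriv)+

lemma tf_s_deriv:
  assumes "0 < \<omega>"
  shows "((\<lambda>s. tf1 \<omega> d s x) has_vector_derivative - tf1x \<omega> d s x + \<i> * \<omega> * tf2 \<omega> d s x) (at s within A)"
    and "((\<lambda>s. tf2 \<omega> d s x) has_vector_derivative tf2x \<omega> d s x + \<i> * \<omega> * tf1 \<omega> d s x) (at s within A)"
proof -
  note D = dirac_flow_deriv[OF assms, THEN bounded_linear.has_vector_derivative[OF bounded_linear_cnj]]
  show "((\<lambda>s. tf1 \<omega> d s x) has_vector_derivative - tf1x \<omega> d s x + \<i> * \<omega> * tf2 \<omega> d s x) (at s within A)"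
    unfolding tf1_def
    by (rule has_vector_derivative_eq_rhs[OF has_vector_derivative_sum[OF has_vector_derivative_mult_left[OF D(1)]]])
      (simp add: tf1x_def tf2_def sum_distrib_left sum_negf[symmetric] sum.distrib[symmetric] algebra_simps)
  show "((\<lambda>s. tf2 \<omega> d s x) has_vector_derivative tf2x \<omega> d s x + \<i> * \<omega> * tf1 \<omega> d s x) (at s within A)"
    unfolding tf2_def
    by (rule has_vector_derivative_eq_rhs[OF has_vector_derivative_sum[OF has_vector_derivative_mult_left[OF D(2)]]])
      (simp add: tf2x_def tf1_def sum_distrib_left sum_negf[symmetric] sum.distrib[symmetric] algebra_simps)
qed

text \<open>The bound grows with the highest frequency of the grid. It serves to justify
  differentiation under the integral and enters no error estimate.\<close>

lemma tf_bounds: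
  assumes "0 < \<omega>"
  obtains B where "0 \<le> B" "\<And>s x. norm (tf1 \<omega> d s x) \<le> B" "\<And>s x. norm (tf2 \<omega> d s x) \<le> B"
    "\<And>s x. norm (tf1x \<omega> d s x) \<le> B" "\<And>s x. norm (tf2x \<omega> d s x) \<le> B"
proof
  let ?B = "\<Sum>l\<in>modes M. (1 + \<bar>\<mu> l\<bar>) * norm (d l)"
  have f: "norm (fst (dirac_flow \<omega> (\<mu> l) s (d l))) \<le> norm (d l)"
    and g: "norm (snd (dirac_flow \<omega> (\<mu> l) s (d l))) \<le> norm (d l)" for l s
    using norm_fst_le[of "fst (dirac_flow \<omega> (\<mu> l) s (d l))" "snd (dirac_flow \<omega> (\<mu> l) s (d l))"]
      norm_snd_le[of "snd (dirac_flow \<omega> (\<mu> l) s (d l))" "fst (dirac_flow \<omega> (\<mu> l) s (d l))"]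
    by (simp_all only: prod.collapse norm_dirac_flow[OF assms])
  show "0 \<le> ?B" by (intro sum_nonneg) simp
  have A: "c * 1 \<le> (1 + \<bar>m\<bar>) * c'" "c * \<bar>m\<bar> \<le> (1 + \<bar>m\<bar>) * c'" if "c \<le> c'" "0 \<le> c" for c c' m :: real
  proof -
    have "1 * c \<le> (1 + \<bar>m\<bar>) * c'" using that by (intro mult_mono) auto
    then show "c * 1 \<le> (1 + \<bar>m\<bar>) * c'" by simp
    have "\<bar>m\<bar> * c \<le> (1 + \<bar>m\<bar>) * c'" using that by (intro mult_mono) auto
    then show "c * \<bar>m\<bar> \<le> (1 + \<bar>m\<bar>) * c'" by (simp add: mult.commute)
  qed
  show "norm (tf1 \<omega> d s x) \<le> ?B" for s x
    unfolding tf1_def using A(1)[OF f norm_ge_zero] by (intro sum_norm_le) (simp add: norm_mult)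
  show "norm (tf2 \<omega> d s x) \<le> ?B" for s x
    unfolding tf2_def using A(1)[OF g norm_ge_zero] by (intro sum_norm_le) (simp add: norm_mult)
  show "norm (tf1x \<omega> d s x) \<le> ?B" for s x
    unfolding tf1x_def using A(2)[OF f norm_ge_zero] by (intro sum_norm_le) (simp add: norm_mult)
  show "norm (tf2x \<omega> d s x) \<le> ?B" for s x
    unfolding tf2x_def using A(2)[OF g norm_ge_zero] by (intro sum_norm_le) (simp add: norm_mult)
qed

text \<open>Only the coefficients of \<open>k1\<close> and \<open>k2\<close> in the grid modes are
  seen: Fourier truncation is built into the pairing.\<close>

lemma pairing_eq:
  assumes k: "bm k1" "bm k2"
  shows "pairing \<omega> d s k1 k2 = (\<Sum>l\<in>modes M. herm2 (dirac_flow \<omega> (\<mu> l) s (d l)) (fc k1 l, fc k2 l))"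
proof -
  have 1: "mean (\<lambda>x. (\<Sum>l\<in>modes M. c l * e (- l) x) * k x) = (\<Sum>l\<in>modes M. c l * fc k l)"
    if "bm k" for c k
  proof -
    have "mean (\<lambda>x. (\<Sum>l\<in>modes M. c l * e (- l) x) * k x) = mean (\<lambda>x. \<Sum>l\<in>modes M. c l * (k x * cnj (e l x)))"
      by (intro mean_cong) (unfold sum_distrib_right, simp add: cnj_wave mult_ac)
    also have "\<dots> = (\<Sum>l\<in>modes M. mean (\<lambda>x. c l * (k x * cnj (e l x))))"
      by (rule mean_sum) (intro bm_intros that)
    finally show ?thesis by (simp only: mean_cmult fc_def)
  qed
  have "pairing \<omega> d s k1 k2 = mean (\<lambda>x. tf1 \<omega> d s x * k1 x) + mean (\<lambda>x. tf2 \<omega> d s x * k2 x)"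
    unfolding pairing_def by (rule mean_add) (intro bm_intros bm_tf k)+
  then show ?thesis
    unfolding tf1_def tf2_def 1[OF k(1)] 1[OF k(2)] herm2_def fst_conv snd_conv
    by (simp add: sum.distrib)
qed

text \<open>Unitarity of the flow and Bessel's inequality leave the l2 norm of \<open>d\<close>
  without any power of the frequencies, which makes the estimates uniform in
  \<open>M\<close>.\<close>

lemma norm_pairing_le:
  assumes k: "bm k1" "bm k2" and K: "\<And>x. x \<in> S \<Longrightarrow> norm (k1 x) \<le> K" "\<And>x. x \<in> S \<Longrightarrow> norm (k2 x) \<le> K"
    and K0: "0 \<le> K" and \<omega>: "0 < \<omega>"
  shows "norm (pairing \<omega> d s k1 k2) \<le> L2_set (\<lambda>l. norm (d l)) (modes M) * (2 * K)"
proof -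
  have "norm (pairing \<omega> d s k1 k2) \<le> (\<Sum>l\<in>modes M. \<bar>norm (d l)\<bar> * \<bar>norm (fc k1 l, fc k2 l)\<bar>)"
    unfolding pairing_eq[OF k]
    by (rule sum_norm_le, rule order_trans[OF norm_herm2_le]) (simp add: norm_dirac_flow \<omega>)
  also have "\<dots> \<le> L2_set (\<lambda>l. norm (d l)) (modes M) * L2_set (\<lambda>l. norm (fc k1 l, fc k2 l)) (modes M)"
    by (rule L2_set_mult_ineq)
  also have "\<dots> \<le> L2_set (\<lambda>l. norm (d l)) (modes M) * (2 * K)"
  proof (rule mult_left_mono[OF _ L2_set_nonneg])
    have "(\<Sum>l\<in>modes M. (norm (fc k1 l, fc k2 l))\<^sup>2) = (\<Sum>l\<in>modes M. (norm (fc k1 l))\<^sup>2) + (\<Sum>l\<in>modes M. (norm (fc k2 l))\<^sup>2)"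
      by (simp add: norm_prod_def sum.distrib)
    also have "\<dots> \<le> K\<^sup>2 + K\<^sup>2" by (intro add_mono bessel k K) auto
    also have "\<dots> \<le> (2 * K)\<^sup>2" using K0 by (simp add: power2_eq_square)
    finally show "L2_set (\<lambda>l. norm (fc k1 l, fc k2 l)) (modes M) \<le> 2 * K"
      unfolding L2_set_def using K0 by (intro real_le_lsqrt) auto
  qed
  finally show ?thesis .
qed

lemma pairing_add:
  assumes "bm k1" "bm k2" "bm k1'" "bm k2'"
  shows "pairing \<omega> d s (\<lambda>x. k1 x + k1' x) (\<lambda>x. k2 x + k2' x) = pairing \<omega> d s k1 k2 + pairing \<omega> d s k1' k2'"
proof -
  have "pairing \<omega> d s k1 k2 + pairing \<omega> d s k1' k2'
    = mean (\<lambda>x. (tf1 \<omega> d s x * k1 x + tf2 \<omega> d s x * k2 x) + (tf1 \<omega> d s x * k1' x + tf2 \<omega> d s x * k2' x))"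
    unfolding pairing_def by (rule mean_add[symmetric]) (intro bm_intros bm_tf assms)+
  also have "\<dots> = pairing \<omega> d s (\<lambda>x. k1 x + k1' x) (\<lambda>x. k2 x + k2' x)"
    unfolding pairing_def by (intro mean_cong) (simp add: algebra_simps)
  finally show ?thesis ..
qed

lemma pairing_cmult:
  "pairing \<omega> d s (\<lambda>x. c * k1 x) (\<lambda>x. c * k2 x) = c * pairing \<omega> d s k1 k2"
  unfolding pairing_def mean_cmult[symmetric] by (intro mean_cong) (simp add: algebra_simps)

text \<open>The test function solves the free Dirac equation, so that only the part of
  \<open>k\<close> not transported by the free flow contributes to the derivative of the pairing.\<close>

lemma pairing_deriv:
  assumes \<omega>: "0 < \<omega>" and J: "J = {\<alpha>..\<beta>}" "\<alpha> < \<beta>" and s: "s \<in> J"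
    and bm: "\<And>s. s \<in> J \<Longrightarrow> bm (k1 s)" "\<And>s. s \<in> J \<Longrightarrow> bm (k2 s)"
    and ds: "\<And>s x. s \<in> J \<Longrightarrow> x \<in> S \<Longrightarrow> ((\<lambda>s. k1 s x) has_vector_derivative k1s s x) (at s within J)"
      "\<And>s x. s \<in> J \<Longrightarrow> x \<in> S \<Longrightarrow> ((\<lambda>s. k2 s x) has_vector_derivative k2s s x) (at s within J)"
    and B: "\<And>s x. s \<in> J \<Longrightarrow> x \<in> S \<Longrightarrow> norm (k1 s x) \<le> B" "\<And>s x. s \<in> J \<Longrightarrow> x \<in> S \<Longrightarrow> norm (k2 s x) \<le> B"
      "\<And>s x. s \<in> J \<Longrightarrow> x \<in> S \<Longrightarrow> norm (k1s s x) \<le> B" "\<And>s x. s \<in> J \<Longrightarrow> x \<in> S \<Longrightarrow> norm (k2s s x) \<le> B"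
    and dx: "\<And>x. x \<in> {a..b} \<Longrightarrow> (k1 s has_vector_derivative k1x x) (at x within {a..b})"
      "\<And>x. x \<in> {a..b} \<Longrightarrow> (k2 s has_vector_derivative k2x x) (at x within {a..b})"
    and bmx: "bm k1x" "bm k2x"
    and per: "k1 s a = k1 s b" "k2 s a = k2 s b"
  shows "((\<lambda>s. pairing \<omega> d s (k1 s) (k2 s)) has_vector_derivative
     pairing \<omega> d s (\<lambda>x. k1x x + k1s s x + \<i> * \<omega> * k2 s x) (\<lambda>x. - k2x x + k2s s x + \<i> * \<omega> * k1 s x)) (at s within J)"
    (is "(_ has_vector_derivative ?R) _")
proof -
  obtain C where C: "0 \<le> C" "\<And>s x. norm (tf1 \<omega> d s x) \<le> C" "\<And>s x. norm (tf2 \<omega> d s x) \<le> C"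
    "\<And>s x. norm (tf1x \<omega> d s x) \<le> C" "\<And>s x. norm (tf2x \<omega> d s x) \<le> C"
    by (rule tf_bounds[OF \<omega>, of d]) (rule that)
  define F where "F = (\<lambda>s x. tf1 \<omega> d s x * k1 s x + tf2 \<omega> d s x * k2 s x)"
  define G1 where "G1 = (\<lambda>s x. tf1 \<omega> d s x * k1s s x + (- tf1x \<omega> d s x + \<i> * \<omega> * tf2 \<omega> d s x) * k1 s x)"
  define G2 where "G2 = (\<lambda>s x. tf2 \<omega> d s x * k2s s x + (tf2x \<omega> d s x + \<i> * \<omega> * tf1 \<omega> d s x) * k2 s x)"
  define F' where "F' = (\<lambda>s x. G1 s x + G2 s x)"
  have mid: "(a + b) / 2 \<in> S" using ab by auto
  have B0: "0 \<le> B" using order_trans[OF norm_ge_zero B(1)[OF s mid]] .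
  have F_der: "((\<lambda>s. F s x) has_vector_derivative F' s x) (at s within J)" if "s \<in> J" "x \<in> S" for s x
    unfolding F_def F'_def G1_def G2_def
    by (intro has_vector_derivative_add has_vector_derivative_mult tf_s_deriv[OF \<omega>] ds that)
  have F_bd: "norm (F' s x) \<le> (C * B + (C + \<omega> * C) * B) + (C * B + (C + \<omega> * C) * B)" if "s \<in> J" "x \<in> S" for s x
  proof -
    have w: "norm (\<i> * complex_of_real \<omega> * z) \<le> \<omega> * C" if "norm z \<le> C" for z
      using that \<omega> by (simp add: norm_mult)
    have "norm (G1 s x) \<le> norm (tf1 \<omega> d s x) * norm (k1s s x)
        + norm (- tf1x \<omega> d s x + \<i> * \<omega> * tf2 \<omega> d s x) * norm (k1 s x)"
      unfolding G1_def by (metis norm_mult norm_triangle_ineq)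
    also have "\<dots> \<le> C * B + (C + \<omega> * C) * B"
      using C \<omega> B0 by (intro add_mono mult_mono B that norm_triangle_le w) auto
    finally have 1: "norm (G1 s x) \<le> C * B + (C + \<omega> * C) * B" .
    have "norm (G2 s x) \<le> norm (tf2 \<omega> d s x) * norm (k2s s x)
        + norm (tf2x \<omega> d s x + \<i> * \<omega> * tf1 \<omega> d s x) * norm (k2 s x)"
      unfolding G2_def by (metis norm_mult norm_triangle_ineq)
    also have "\<dots> \<le> C * B + (C + \<omega> * C) * B"
      using C \<omega> B0 by (intro add_mono mult_mono B that norm_triangle_le w) auto
    finally have "norm (G2 s x) \<le> C * B + (C + \<omega> * C) * B" .
    with 1 show ?thesis unfolding F'_def by (intro norm_triangle_le add_mono)
  qed
  have F_bm: "bm (F s)" if "s \<in> J" for s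
    unfolding F_def by (intro bm_intros bm_tf bm that)
  note main = mean_has_derivative[OF J s F_bm F_der F_bd]
  \<comment> \<open>The x-derivative of tf1 k1 - tf2 k2, with mean 0 by periodicity. Adding it moves
    the space derivatives from the test functions to \<open>k1\<close> and
    \<open>k2\<close>.\<close>
  define T where "T = (\<lambda>x. (tf1 \<omega> d s x * k1x x + tf1x \<omega> d s x * k1 s x) - (tf2 \<omega> d s x * k2x x + tf2x \<omega> d s x * k2 s x))"
  have bT: "bm T" unfolding T_def by (intro bm_intros bm_tf bm bmx s)
  have tper: "tf1 \<omega> d s a = tf1 \<omega> d s b" "tf2 \<omega> d s a = tf2 \<omega> d s b"
    by (simp_all add: tf1_def tf2_def)
  have "mean T = 0"
  proof -
    have "mean T = ((tf1 \<omega> d s b * k1 s b - tf2 \<omega> d s b * k2 s b) - (tf1 \<omega> d s a * k1 s a - tf2 \<omega> d s a * k2 s a)) / of_real (b - a)"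
      by (rule mean_derivative[OF _ bT])
        (unfold T_def, intro has_vector_derivative_diff has_vector_derivative_mult tf_x_deriv dx)
    then show ?thesis using per tper by simp
  qed
  then have "mean (F' s) = mean (F' s) + mean T" by simp
  also have "\<dots> = mean (\<lambda>x. F' s x + T x)" by (rule mean_add[symmetric, OF main(2) bT])
  also have "\<dots> = ?R"
    unfolding pairing_def F'_def G1_def G2_def T_def by (intro mean_cong) (simp add: algebra_simps)
  finally show ?thesis using main(1) by (simp only: F_def pairing_def)
qed

end

section \<open>The local error in time\<close>

definition phase :: "real \<Rightarrow> (real \<Rightarrow> real) \<Rightarrow> real \<Rightarrow> complex"
  where "phase \<theta> v x = exp (\<i> * of_real (\<theta> * v x))"

lemma norm_phase [simp]: "norm (phase \<theta> v x) = 1"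
  by (simp add: phase_def flip: of_real_mult)

lemma phase_add: "phase \<theta> v x * phase \<theta>' v x = phase (\<theta> + \<theta>') v x"
  by (simp add: phase_def algebra_simps flip: exp_add)

lemma phase_deriv: "((\<lambda>s. phase (c * s) v x) has_vector_derivative \<i> * of_real (c * v x) * phase (c * s) v x) (at s within A)"
proof -
  have 1: "((\<lambda>s. \<i> * of_real (c * s * v x)) has_vector_derivative \<i> * of_real (c * v x)) (at s within A)"
    by (auto intro!: derivative_eq_intros simp: has_vector_derivative_def fun_eq_iff scaleR_conv_of_real)
  show ?thesis
    using field_vector_diff_chain_within[OF 1, of exp, OF DERIV_subset[OF DERIV_exp]]
    by (simp add: o_def phase_def)
qed

lemma norm_phase_minus_1_le: "norm (phase \<theta> v x - 1) \<le> \<bar>\<theta>\<bar> * \<bar>v x\<bar>"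
  using norm_exp_i_diff_le[of "\<theta> * v x" 0] by (simp add: phase_def abs_mult)

text \<open>The exact solution in the coordinates \<open>pm\<close>: \<open>u\<close> and
  \<open>w\<close> travel in opposite directions with unit speed and are coupled by \<omega>, and
  \<open>p\<close>, \<open>q\<close> stand for V - A and V + A. The index \<open>Suc r\<close>
  stands for m - 1, the derivative of order m being present as a Lipschitz bound. The solution
  varies on the scale \<omega>, the potentials on the scale 1.\<close>

locale dirac_data = periodic_grid +
  fixes \<omega> T K P :: real and r :: nat and u w :: "real \<Rightarrow> real \<Rightarrow> complex" and p q :: "real \<Rightarrow> real"
  assumes \<omega>1: "1 \<le> \<omega>" and T_pos: "0 < T"
    and su: "\<And>t. t \<in> {0..T} \<Longrightarrow> psm \<omega> (Suc r) K (u t)"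
    and sw: "\<And>t. t \<in> {0..T} \<Longrightarrow> psm \<omega> (Suc r) K (w t)"
    and sp: "psm 1 (Suc r) P (\<lambda>x. of_real (p x))"
    and sq: "psm 1 (Suc r) P (\<lambda>x. of_real (q x))"
    and ut: "\<And>t x. t \<in> {0..T} \<Longrightarrow> x \<in> S \<Longrightarrow> ((\<lambda>s. u s x) has_vector_derivative
        - Dx (u t) x - \<i> * of_real \<omega> * (w t x + of_real (p x) * u t x)) (at t within {0..T})"
    and wt: "\<And>t x. t \<in> {0..T} \<Longrightarrow> x \<in> S \<Longrightarrow> ((\<lambda>s. w s x) has_vector_derivative
        Dx (w t) x - \<i> * of_real \<omega> * (u t x + of_real (q x) * w t x)) (at t within {0..T})"
begin

abbreviation "p' \<equiv> Dx (\<lambda>x. of_real (p x))"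
abbreviation "q' \<equiv> Dx (\<lambda>x. of_real (q x))"

lemma \<omega>_pos: "0 < \<omega>" using \<omega>1 by simp

lemma S_sub: "x \<in> S \<Longrightarrow> x \<in> {a..b}" by auto

lemma K_nonneg: "0 \<le> K" using psm_nonneg[OF su[of 0]] T_pos by simp

lemma P_nonneg: "0 \<le> P" by (rule psm_nonneg[OF sp])

lemma p_bound: "x \<in> {a..b} \<Longrightarrow> \<bar>p x\<bar> \<le> P" "x \<in> {a..b} \<Longrightarrow> \<bar>q x\<bar> \<le> P"
  using psm_bound[OF sp] psm_bound[OF sq] by simp_all

lemma p'_bound: "x \<in> {a..b} \<Longrightarrow> norm (p' x) \<le> P" "x \<in> {a..b} \<Longrightarrow> norm (q' x) \<le> P"
  using psm_bound[OF psm_Dx(2)[OF sp]] psm_bound[OF psm_Dx(2)[OF sq]] by simp_all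

lemma u_bound: "t \<in> {0..T} \<Longrightarrow> x \<in> {a..b} \<Longrightarrow> norm (u t x) \<le> K" "t \<in> {0..T} \<Longrightarrow> x \<in> {a..b} \<Longrightarrow> norm (w t x) \<le> K"
  by (erule psm_bound[OF su], assumption) (erule psm_bound[OF sw])

lemma ux_bound: "t \<in> {0..T} \<Longrightarrow> x \<in> {a..b} \<Longrightarrow> norm (Dx (u t) x) \<le> K * \<omega>" "t \<in> {0..T} \<Longrightarrow> x \<in> {a..b} \<Longrightarrow> norm (Dx (w t) x) \<le> K * \<omega>"
  by (erule psm_bound[OF psm_Dx(2)[OF su]], assumption) (erule psm_bound[OF psm_Dx(2)[OF sw]])

lemma phase_x_deriv:
  assumes "psm \<omega>' (Suc n) P' (\<lambda>x. of_real (v x))" "x \<in> {a..b}"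
  shows "(phase \<theta> v has_vector_derivative \<i> * of_real \<theta> * Dx (\<lambda>x. of_real (v x)) x * phase \<theta> v x) (at x within {a..b})"
proof -
  have 1: "((\<lambda>x. \<i> * of_real \<theta> * of_real (v x)) has_vector_derivative \<i> * of_real \<theta> * Dx (\<lambda>x. of_real (v x)) x) (at x within {a..b})"
    by (rule has_vector_derivative_mult_right[OF psm_Dx(1)[OF assms]])
  show ?thesis
    using field_vector_diff_chain_within[OF 1, of exp, OF DERIV_subset[OF DERIV_exp]]
    by (simp add: o_def phase_def[abs_def] mult.assoc)
qed

lemma bm_phase:
  assumes "psm \<omega>' (Suc n) P' (\<lambda>x. of_real (v x))" shows "bm (phase \<theta> v)"
  by (rule bm_continuous[OF continuous_on_vector_derivative[OF phase_x_deriv[OF assms]]])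

lemma shifted_deriv:
  assumes f: "\<And>t. t \<in> {0..T} \<Longrightarrow> (f has_vector_derivative f' t) (at t within {0..T})"
    and J: "\<And>s. s \<in> J \<Longrightarrow> t + s \<in> {0..T}" and s: "s \<in> J"
  shows "((\<lambda>s. f (t + s)) has_vector_derivative f' (t + s)) (at s within J)"
proof -
  have 1: "((\<lambda>s. t + s) has_vector_derivative 1) (at s within J)"
    by (auto intro!: derivative_eq_intros)
  have 2: "(f has_vector_derivative f' (t + s)) (at (t + s) within (\<lambda>s. t + s) ` J)"
    by (rule has_vector_derivative_within_subset[OF f]) (use J s in auto)
  show ?thesis using vector_diff_chain_within[OF 1 2] by (simp add: o_def)
qed

lemma norm_i\<omega>: "norm (\<i> * complex_of_real \<omega> * z) = \<omega> * norm z"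
  using \<omega>_pos by (simp add: norm_mult)

text \<open>The commutator of \<open>\<sigma>\<^sub>3\<close> with the potential is the only one of order one; its contribution
  to the symmetric step is odd in \<open>s\<close> up to \<open>xi_lipschitz\<close>.\<close>

context
  fixes t \<sigma> :: real and d :: "int \<Rightarrow> complex \<times> complex"
  assumes \<sigma>: "0 < \<sigma>" "0 \<le> t - \<sigma>" "t + \<sigma> \<le> T"
begin

abbreviation "N \<equiv> L2_set (\<lambda>l. norm (d l)) (modes M)"

lemma J_T: "s \<in> {- \<sigma>..\<sigma>} \<Longrightarrow> t + s \<in> {0..T}" using \<sigma> by auto

text \<open>Up to sign, \<open>kA\<close> and \<open>kB\<close> are the components of that
  commutator applied to the solution: in the coordinates \<open>pm\<close>,
  \<open>\<sigma>\<^sub>3\<close> exchanges the components and the potential is diag(p, q).\<close>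

definition "\<alpha> x = complex_of_real (q x - p x)"
definition "kA s x = - \<alpha> x * w (t + s) x"
definition "kB s x = \<alpha> x * u (t + s) x"
definition "\<xi> s = pairing \<omega> d s (kA s) (kB s)"
text \<open>At s = -\<sigma> and s = \<sigma> the pair \<open>f1\<close>, \<open>f2\<close> is the
  exact solution at the two ends of the step, with half a potential step performed at the start and
  half a potential step undone at the end.\<close>

definition "f1 s x = phase (\<omega> * s) p x * u (t + s) x"
definition "f2 s x = phase (\<omega> * s) q x * w (t + s) x"
definition "\<psi> s = pairing \<omega> d s (f1 s) (f2 s)"

lemma u_shift:
  assumes "s \<in> {- \<sigma>..\<sigma>}" "x \<in> S"
  shows "((\<lambda>s. u (t + s) x) has_vector_derivative
      - Dx (u (t + s)) x - \<i> * of_real \<omega> * (w (t + s) x + of_real (p x) * u (t + s) x)) (at s within {- \<sigma>..\<sigma>})"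
  by (rule shifted_deriv[where f="\<lambda>s. u s x", OF ut[OF _ assms(2)] J_T assms(1)])

lemma w_shift:
  assumes "s \<in> {- \<sigma>..\<sigma>}" "x \<in> S"
  shows "((\<lambda>s. w (t + s) x) has_vector_derivative
      Dx (w (t + s)) x - \<i> * of_real \<omega> * (u (t + s) x + of_real (q x) * w (t + s) x)) (at s within {- \<sigma>..\<sigma>})"
  by (rule shifted_deriv[where f="\<lambda>s. w s x", OF wt[OF _ assms(2)] J_T assms(1)])

lemma bmJ:
  assumes "s \<in> {- \<sigma>..\<sigma>}"
  shows "bm (u (t + s))" "bm (w (t + s))" "bm (Dx (u (t + s)))" "bm (Dx (w (t + s)))"
    "bm (\<lambda>x. complex_of_real (p x))" "bm (\<lambda>x. complex_of_real (q x))" "bm p'" "bm q'"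
  using psm_bm[OF su[OF J_T[OF assms]]] psm_bm[OF sw[OF J_T[OF assms]]]
    psm_bm[OF psm_Dx(2)[OF su[OF J_T[OF assms]]]] psm_bm[OF psm_Dx(2)[OF sw[OF J_T[OF assms]]]]
    psm_bm[OF sp] psm_bm[OF sq] psm_bm[OF psm_Dx(2)[OF sp]] psm_bm[OF psm_Dx(2)[OF sq]] by simp_all

lemma bm_\<alpha>: "bm \<alpha>"
  using bm_diff[OF psm_bm[OF sq] psm_bm[OF sp]] by (simp add: \<alpha>_def[abs_def])

lemma \<alpha>_deriv: "x \<in> {a..b} \<Longrightarrow> (\<alpha> has_vector_derivative q' x - p' x) (at x within {a..b})"
  using has_vector_derivative_diff[OF psm_Dx(1)[OF sq] psm_Dx(1)[OF sp]] by (simp add: \<alpha>_def[abs_def])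

lemma \<alpha>_bound: "x \<in> {a..b} \<Longrightarrow> norm (\<alpha> x) \<le> 2 * P" "x \<in> {a..b} \<Longrightarrow> norm (q' x - p' x) \<le> 2 * P"
proof -
  assume x: "x \<in> {a..b}"
  have "\<bar>q x - p x\<bar> \<le> 2 * P" using p_bound[OF x] by linarith
  then show "norm (\<alpha> x) \<le> 2 * P" by (simp add: \<alpha>_def del: of_real_diff)
  show "norm (q' x - p' x) \<le> 2 * P" using p'_bound[OF x] norm_triangle_ineq4[of "q' x" "p' x"] by linarith
qed

lemma norm_mult_le: "norm x \<le> A \<Longrightarrow> norm y \<le> B \<Longrightarrow> norm (x * y :: complex) \<le> A * B"
  unfolding norm_mult by (rule mult_mono) (auto intro: order_trans[OF norm_ge_zero])

lemma wt_bound: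
  assumes "s \<in> {- \<sigma>..\<sigma>}" "x \<in> {a..b}"
  shows "norm (Dx (w (t + s)) x - \<i> * of_real \<omega> * (u (t + s) x + of_real (q x) * w (t + s) x)) \<le> \<omega> * K * (2 + P)"
    "norm (- Dx (u (t + s)) x - \<i> * of_real \<omega> * (w (t + s) x + of_real (p x) * u (t + s) x)) \<le> \<omega> * K * (2 + P)"
proof -
  note tT = J_T[OF assms(1)]
  have pq: "norm (complex_of_real (p x)) \<le> P" "norm (complex_of_real (q x)) \<le> P" using p_bound[OF assms(2)] by simp_all
  have "norm (u (t + s) x + of_real (q x) * w (t + s) x) \<le> K + P * K"
    "norm (w (t + s) x + of_real (p x) * u (t + s) x) \<le> K + P * K"
    by (intro norm_triangle_le add_mono norm_mult_le pq u_bound tT assms(2))+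
  then have 1: "norm (\<i> * of_real \<omega> * (u (t + s) x + of_real (q x) * w (t + s) x)) \<le> \<omega> * (K + P * K)"
    "norm (\<i> * of_real \<omega> * (w (t + s) x + of_real (p x) * u (t + s) x)) \<le> \<omega> * (K + P * K)"
    unfolding norm_i\<omega> using \<omega>_pos by (simp_all add: mult_left_mono)
  have eq: "\<omega> * K * (2 + P) = K * \<omega> + \<omega> * (K + P * K)" by (simp add: algebra_simps)
  show "norm (Dx (w (t + s)) x - \<i> * of_real \<omega> * (u (t + s) x + of_real (q x) * w (t + s) x)) \<le> \<omega> * K * (2 + P)"
    unfolding eq by (rule order_trans[OF norm_triangle_ineq4 add_mono[OF ux_bound(2)[OF tT assms(2)] 1(1)]])
  have "norm (- Dx (u (t + s)) x) \<le> K * \<omega>" using ux_bound(1)[OF tT assms(2)] by simp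
  then show "norm (- Dx (u (t + s)) x - \<i> * of_real \<omega> * (w (t + s) x + of_real (p x) * u (t + s) x)) \<le> \<omega> * K * (2 + P)"
    unfolding eq by (intro order_trans[OF norm_triangle_ineq4] add_mono 1)
qed

text \<open>By \<open>pairing_deriv\<close> only first derivatives occur, each costing at most a
  factor \<omega>. In 10 + 2P, the space derivatives of \<open>kA\<close> and \<open>kB\<close>
  account for 2 + 2, their time derivatives for 4 + 2P and the coupling for 2.\<close>

lemma xi_lipschitz:
  assumes s: "s \<in> {- \<sigma>..\<sigma>}"
  shows "norm (\<xi> s - \<xi> 0) \<le> N * (2 * (\<omega> * K * P * (10 + 2 * P))) * \<bar>s\<bar>"
proof -
  let ?J = "{- \<sigma>..\<sigma>}"
  let ?kAs = "\<lambda>s x. - \<alpha> x * (Dx (w (t + s)) x - \<i> * of_real \<omega> * (u (t + s) x + of_real (q x) * w (t + s) x))"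
  let ?kBs = "\<lambda>s x. \<alpha> x * (- Dx (u (t + s)) x - \<i> * of_real \<omega> * (w (t + s) x + of_real (p x) * u (t + s) x))"
  let ?kAx = "\<lambda>s x. - \<alpha> x * Dx (w (t + s)) x + (- (q' x - p' x)) * w (t + s) x"
  let ?kBx = "\<lambda>s x. \<alpha> x * Dx (u (t + s)) x + (q' x - p' x) * u (t + s) x"
  let ?g1 = "\<lambda>s x. ?kAx s x + ?kAs s x + \<i> * of_real \<omega> * kB s x"
  let ?g2 = "\<lambda>s x. - ?kBx s x + ?kBs s x + \<i> * of_real \<omega> * kA s x"
  let ?W = "\<omega> * K * (2 + P)"
  have W: "0 \<le> ?W" "K \<le> ?W" "K * \<omega> \<le> ?W"
  proof -
    have "1 * K \<le> \<omega> * K" using \<omega>1 K_nonneg by (intro mult_right_mono) auto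
    moreover have "\<omega> * K * 1 \<le> \<omega> * K * (2 + P)" using \<omega>_pos K_nonneg P_nonneg by (intro mult_left_mono) auto
    ultimately show "K \<le> ?W" "K * \<omega> \<le> ?W" by (simp_all add: mult.commute)
    show "0 \<le> ?W" using \<omega>_pos K_nonneg P_nonneg by simp
  qed
  have neg: "norm (- z) \<le> c" if "norm z \<le> c" for z :: complex and c using that by simp
  have b: "norm (kA s x) \<le> 2 * P * K" "norm (kB s x) \<le> 2 * P * K" "norm (?kAs s x) \<le> 2 * P * ?W"
    "norm (?kBs s x) \<le> 2 * P * ?W" "norm (?kAx s x) \<le> 2 * P * (K * \<omega>) + 2 * P * K"
    "norm (?kBx s x) \<le> 2 * P * (K * \<omega>) + 2 * P * K" if "s \<in> ?J" "x \<in> {a..b}" for s x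
    unfolding kA_def kB_def
    by (intro norm_triangle_le add_mono norm_mult_le neg \<alpha>_bound that u_bound ux_bound J_T wt_bound)+
  have bm_f: "bm (kA s)" "bm (kB s)" if "s \<in> ?J" for s
  proof -
    have "bm (\<lambda>x. - 1 * \<alpha> x * w (t + s) x)" by (intro bm_intros bm_\<alpha> bmJ that)
    then show "bm (kA s)" by (simp add: kA_def[abs_def])
    show "bm (kB s)" unfolding kB_def[abs_def] by (intro bm_intros bm_\<alpha> bmJ that)
  qed
  have bm_x: "bm (?kAx s)" "bm (?kBx s)" if "s \<in> ?J" for s
  proof -
    have "bm (\<lambda>x. - 1 * \<alpha> x * Dx (w (t + s)) x + (- 1) * (q' x - p' x) * w (t + s) x)"
      by (intro bm_intros bm_\<alpha> bmJ[OF that])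
    then show "bm (?kAx s)" by simp
    show "bm (?kBx s)" by (intro bm_intros bm_\<alpha> bmJ[OF that])
  qed
  have bm_s: "bm (?kAs s)" "bm (?kBs s)" if "s \<in> ?J" for s
  proof -
    have "bm (\<lambda>x. - 1 * \<alpha> x * (Dx (w (t + s)) x - \<i> * of_real \<omega> * (u (t + s) x + of_real (q x) * w (t + s) x)))"
      by (intro bm_intros bm_\<alpha> bmJ[OF that])
    then show "bm (?kAs s)" by simp
    have "bm (\<lambda>x. \<alpha> x * (- 1 * Dx (u (t + s)) x - \<i> * of_real \<omega> * (w (t + s) x + of_real (p x) * u (t + s) x)))"
      by (intro bm_intros bm_\<alpha> bmJ[OF that])
    then show "bm (?kBs s)" by simp
  qed
  have der: "(\<xi> has_vector_derivative pairing \<omega> d s (?g1 s) (?g2 s)) (at s within ?J)" if s: "s \<in> ?J" for s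
    unfolding \<xi>_def[abs_def]
  proof (rule pairing_deriv[OF \<omega>_pos refl _ s bm_f, where B="2 * P * K + 2 * P * ?W"])
    show "- \<sigma> < \<sigma>" using \<sigma> by simp
    fix s x assume s: "s \<in> ?J" and x: "x \<in> S"
    show "((\<lambda>s. kA s x) has_vector_derivative ?kAs s x) (at s within ?J)"
      "((\<lambda>s. kB s x) has_vector_derivative ?kBs s x) (at s within ?J)"
      unfolding kA_def kB_def by (intro has_vector_derivative_mult_right w_shift u_shift s x)+
    have "0 \<le> 2 * P * K" "0 \<le> 2 * P * ?W" using P_nonneg K_nonneg W by auto
    then show "norm (kA s x) \<le> 2 * P * K + 2 * P * ?W" "norm (kB s x) \<le> 2 * P * K + 2 * P * ?W"
      "norm (?kAs s x) \<le> 2 * P * K + 2 * P * ?W" "norm (?kBs s x) \<le> 2 * P * K + 2 * P * ?W"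
      using b[OF s S_sub[OF x]] by linarith+
  next
    fix x assume x: "x \<in> {a..b}"
    have "((\<lambda>x. - \<alpha> x) has_vector_derivative - (q' x - p' x)) (at x within {a..b})"
      by (rule has_vector_derivative_minus[OF \<alpha>_deriv[OF x]])
    then show "(kA s has_vector_derivative ?kAx s x) (at x within {a..b})"
      unfolding kA_def[abs_def]
      by (intro has_vector_derivative_mult psm_Dx(1)[OF sw[OF J_T[OF s]] x])
    show "(kB s has_vector_derivative ?kBx s x) (at x within {a..b})"
      unfolding kB_def[abs_def]
      by (intro has_vector_derivative_mult psm_Dx(1)[OF su[OF J_T[OF s]] x] \<alpha>_deriv x)
  next
    have "\<alpha> a = \<alpha> b" using psm_periodic[OF sp] psm_periodic[OF sq] by (simp add: \<alpha>_def)
    then show "kA s a = kA s b" "kB s a = kB s b"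
      using psm_periodic[OF su[OF J_T[OF s]]] psm_periodic[OF sw[OF J_T[OF s]]]
      by (simp_all add: kA_def kB_def)
  qed (use s bm_x in auto)
  have bound: "norm (pairing \<omega> d s (?g1 s) (?g2 s)) \<le> N * (2 * (\<omega> * K * P * (10 + 2 * P)))" if s: "s \<in> ?J" for s
  proof (rule norm_pairing_le[OF _ _ _ _ _ \<omega>_pos])
    show "bm (?g1 s)" "bm (?g2 s)"
    proof -
      show "bm (?g1 s)" by (intro bm_add bm_x bm_s bm_mult bm_const bm_f s)
      have "bm (\<lambda>x. - 1 * ?kBx s x + ?kBs s x + \<i> * of_real \<omega> * kA s x)"
        by (intro bm_add bm_x bm_s bm_mult bm_const bm_f s)
      then show "bm (?g2 s)" by (simp only: mult_minus_left mult_1_left)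
    qed
    have i: "norm (\<i> * of_real \<omega> * kA s x) \<le> \<omega> * (2 * P * K)" "norm (\<i> * of_real \<omega> * kB s x) \<le> \<omega> * (2 * P * K)"
      if "x \<in> {a..b}" for x
      unfolding norm_i\<omega> using b[OF s that] \<omega>_pos by (simp_all add: mult_left_mono)
    have le: "(2 * P * (K * \<omega>) + 2 * P * K) + 2 * P * ?W + \<omega> * (2 * P * K) \<le> \<omega> * K * P * (10 + 2 * P)"
    proof -
      have "(P * K) * 1 \<le> (P * K) * \<omega>" using \<omega>1 P_nonneg K_nonneg by (intro mult_left_mono) auto
      moreover have "0 \<le> (P * K) * \<omega>" using \<omega>_pos P_nonneg K_nonneg by simp
      ultimately show ?thesis by (simp add: algebra_simps)
    qed
    show "norm (?g1 s x) \<le> \<omega> * K * P * (10 + 2 * P)" if "x \<in> S" for x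
      by (rule order_trans[OF _ le]) (intro norm_triangle_le add_mono i b s S_sub that)
    show "norm (?g2 s x) \<le> \<omega> * K * P * (10 + 2 * P)" if "x \<in> S" for x
      by (rule order_trans[OF _ le]) (intro norm_triangle_le add_mono neg i b s S_sub that)
    show "0 \<le> \<omega> * K * P * (10 + 2 * P)" using \<omega>_pos P_nonneg K_nonneg by simp
  qed
  have "norm (\<xi> s - \<xi> 0) \<le> N * (2 * (\<omega> * K * P * (10 + 2 * P))) * \<bar>s - 0\<bar>"
    by (rule norm_diff_le_of_vector_derivative[OF der _ bound s]) (use \<sigma> in auto)
  then show ?thesis by simp
qed

text \<open>Transport cancels against the test function and the potential against the time
  derivative of the phases. What remains is the coupling i\<omega> (exp(i\<omega>sq) -
  exp(i\<omega>sp)): its part linear in s is the term with \<open>\<xi>\<close>, and its quadratic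
  remainder goes into \<open>R\<close> with the x-derivative of the phases.\<close>

lemma psi_deriv:
  assumes s: "s \<in> {- \<sigma>..\<sigma>}"
  obtains R where "(\<psi> has_vector_derivative of_real (\<omega>\<^sup>2 * s) * \<xi> s + R) (at s within {- \<sigma>..\<sigma>})"
    "norm R \<le> N * (2 * (\<omega> * \<sigma> * P * K + \<omega> * (2 * (\<omega> * \<sigma> * P)\<^sup>2) * K))"
proof -
  let ?J = "{- \<sigma>..\<sigma>}"
  let ?f1s = "\<lambda>s x. phase (\<omega> * s) p x * (- Dx (u (t + s)) x - \<i> * of_real \<omega> * (w (t + s) x + of_real (p x) * u (t + s) x))
     + \<i> * of_real (\<omega> * p x) * phase (\<omega> * s) p x * u (t + s) x"
  let ?f2s = "\<lambda>s x. phase (\<omega> * s) q x * (Dx (w (t + s)) x - \<i> * of_real \<omega> * (u (t + s) x + of_real (q x) * w (t + s) x))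
     + \<i> * of_real (\<omega> * q x) * phase (\<omega> * s) q x * w (t + s) x"
  let ?f1x = "\<lambda>x. phase (\<omega> * s) p x * Dx (u (t + s)) x + \<i> * of_real (\<omega> * s) * p' x * phase (\<omega> * s) p x * u (t + s) x"
  let ?f2x = "\<lambda>x. phase (\<omega> * s) q x * Dx (w (t + s)) x + \<i> * of_real (\<omega> * s) * q' x * phase (\<omega> * s) q x * w (t + s) x"
  let ?W = "\<omega> * K * (2 + P)"
  let ?rem = "\<lambda>x. (phase (\<omega> * s) q x - 1 - \<i> * of_real (\<omega> * s * q x)) - (phase (\<omega> * s) p x - 1 - \<i> * of_real (\<omega> * s * p x))"
  let ?r1 = "\<lambda>x. \<i> * of_real (\<omega> * s) * p' x * phase (\<omega> * s) p x * u (t + s) x + \<i> * of_real \<omega> * ?rem x * w (t + s) x"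
  let ?r2 = "\<lambda>x. - (\<i> * of_real (\<omega> * s)) * q' x * phase (\<omega> * s) q x * w (t + s) x + (- \<i> * of_real \<omega>) * ?rem x * u (t + s) x"
  let ?R = "\<omega> * \<sigma> * P * K + \<omega> * (2 * (\<omega> * \<sigma> * P)\<^sup>2) * K"
  have bph: "bm (phase \<theta> p)" "bm (phase \<theta> q)" for \<theta> by (rule bm_phase[OF sp], rule bm_phase[OF sq])
  have bq: "bm (\<lambda>x. complex_of_real (c * p x))" "bm (\<lambda>x. complex_of_real (c * q x))" for c
    using bm_mult[OF bm_const bmJ(5)[OF s], of "of_real c"] bm_mult[OF bm_const bmJ(6)[OF s], of "of_real c"] by simp_all
  have nph: "norm (phase \<theta> v x) \<le> 1" for \<theta> v x by simp
  have ip: "norm (\<i> * of_real (\<omega> * p x)) \<le> \<omega> * P" "norm (\<i> * of_real (\<omega> * q x)) \<le> \<omega> * P" if "x \<in> {a..b}" for x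
    using p_bound[OF that] \<omega>_pos by (simp_all add: norm_mult mult_left_mono)
  have bf: "bm (f1 s)" "bm (f2 s)" if "s \<in> ?J" for s
    unfolding f1_def[abs_def] f2_def[abs_def] by (intro bm_intros bph bmJ that)+
  have der: "(\<psi> has_vector_derivative pairing \<omega> d s (\<lambda>x. ?f1x x + ?f1s s x + \<i> * \<omega> * f2 s x)
      (\<lambda>x. - ?f2x x + ?f2s s x + \<i> * \<omega> * f1 s x)) (at s within ?J)"
    unfolding \<psi>_def[abs_def]
  proof (rule pairing_deriv[OF \<omega>_pos refl _ s bf, where B="K + (1 * ?W + \<omega> * P * 1 * K)"])
    show "- \<sigma> < \<sigma>" using \<sigma> by simp
    fix s x assume s: "s \<in> ?J" and x: "x \<in> S"
    show "((\<lambda>s. f1 s x) has_vector_derivative ?f1s s x) (at s within ?J)"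
      "((\<lambda>s. f2 s x) has_vector_derivative ?f2s s x) (at s within ?J)"
      unfolding f1_def f2_def by (intro has_vector_derivative_mult phase_deriv w_shift u_shift s x)+
    have f1: "norm (f1 s x) \<le> 1 * K" "norm (f2 s x) \<le> 1 * K"
      unfolding f1_def f2_def by (intro norm_mult_le nph u_bound J_T s S_sub x)+
    have f2: "norm (?f1s s x) \<le> 1 * ?W + \<omega> * P * 1 * K" "norm (?f2s s x) \<le> 1 * ?W + \<omega> * P * 1 * K"
      by (intro norm_triangle_le add_mono norm_mult_le nph wt_bound ip u_bound J_T s S_sub x)+
    have "0 \<le> ?W" "0 \<le> \<omega> * P * 1 * K" using \<omega>_pos K_nonneg P_nonneg by auto
    then show "norm (f1 s x) \<le> K + (1 * ?W + \<omega> * P * 1 * K)" "norm (f2 s x) \<le> K + (1 * ?W + \<omega> * P * 1 * K)"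
      "norm (?f1s s x) \<le> K + (1 * ?W + \<omega> * P * 1 * K)" "norm (?f2s s x) \<le> K + (1 * ?W + \<omega> * P * 1 * K)"
      using f1 f2 K_nonneg by linarith+
  next
    fix x assume x: "x \<in> {a..b}"
    show "(f1 s has_vector_derivative ?f1x x) (at x within {a..b})"
      unfolding f1_def[abs_def]
      by (intro has_vector_derivative_mult psm_Dx(1)[OF su[OF J_T[OF s]] x] phase_x_deriv[OF sp x])
    show "(f2 s has_vector_derivative ?f2x x) (at x within {a..b})"
      unfolding f2_def[abs_def]
      by (intro has_vector_derivative_mult psm_Dx(1)[OF sw[OF J_T[OF s]] x] phase_x_deriv[OF sq x])
  next
    show "bm ?f1x" "bm ?f2x" by (intro bm_intros bph bmJ[OF s])+
    have "complex_of_real (p a) = of_real (p b)" "complex_of_real (q a) = of_real (q b)"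
      using psm_periodic[OF sp] psm_periodic[OF sq] by auto
    then have "phase \<theta> p a = phase \<theta> p b" "phase \<theta> q a = phase \<theta> q b" for \<theta> by (simp_all add: phase_def)
    then show "f1 s a = f1 s b" "f2 s a = f2 s b"
      using psm_periodic[OF su[OF J_T[OF s]]] psm_periodic[OF sw[OF J_T[OF s]]]
      by (simp_all add: f1_def f2_def)
  qed
  have e1: "(\<lambda>x. ?f1x x + ?f1s s x + \<i> * \<omega> * f2 s x) = (\<lambda>x. of_real (\<omega>\<^sup>2 * s) * kA s x + ?r1 x)"
    by (rule ext) (simp add: f2_def kA_def \<alpha>_def algebra_simps power2_eq_square)
  have e2: "(\<lambda>x. - ?f2x x + ?f2s s x + \<i> * \<omega> * f1 s x) = (\<lambda>x. of_real (\<omega>\<^sup>2 * s) * kB s x + ?r2 x)"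
    by (rule ext) (simp add: f1_def kB_def \<alpha>_def algebra_simps power2_eq_square)
  have br: "bm ?r1" "bm ?r2" by (intro bm_intros bph bmJ[OF s] bq)+
  have bk: "bm (kA s)" "bm (kB s)"
  proof -
    have "bm (\<lambda>x. - 1 * \<alpha> x * w (t + s) x)" by (intro bm_intros bm_\<alpha> bmJ s)
    then show "bm (kA s)" by (simp add: kA_def[abs_def])
    show "bm (kB s)" unfolding kB_def[abs_def] by (intro bm_intros bm_\<alpha> bmJ s)
  qed
  have split: "pairing \<omega> d s (\<lambda>x. ?f1x x + ?f1s s x + \<i> * \<omega> * f2 s x) (\<lambda>x. - ?f2x x + ?f2s s x + \<i> * \<omega> * f1 s x)
      = of_real (\<omega>\<^sup>2 * s) * \<xi> s + pairing \<omega> d s ?r1 ?r2"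
    unfolding e1 e2 \<xi>_def pairing_cmult[symmetric]
    by (rule pairing_add) (intro bm_intros bk br)+
  have "norm (pairing \<omega> d s ?r1 ?r2) \<le> N * (2 * ?R)"
  proof (rule norm_pairing_le[OF br _ _ _ \<omega>_pos])
    show "0 \<le> ?R" using \<omega>_pos \<sigma> P_nonneg K_nonneg by simp
    have lin: "norm (phase (\<omega> * s) v x - 1 - \<i> * of_real (\<omega> * s * v x)) \<le> (\<omega> * \<sigma> * P)\<^sup>2" if "\<bar>v x\<bar> \<le> P" for v x
    proof -
      have "norm (phase (\<omega> * s) v x - 1 - \<i> * of_real (\<omega> * s * v x)) \<le> (\<omega> * s * v x)\<^sup>2"
        unfolding phase_def by (rule norm_exp_i_linear_le)
      also have "\<dots> = \<bar>\<omega> * s * v x\<bar>\<^sup>2" by (simp only: power2_abs)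
      also have "\<dots> \<le> (\<omega> * \<sigma> * P)\<^sup>2"
        unfolding abs_mult using that s \<omega>_pos \<sigma> by (intro power_mono mult_mono) auto
      finally show ?thesis .
    qed
    have rem: "norm (?rem x) \<le> 2 * (\<omega> * \<sigma> * P)\<^sup>2" if "x \<in> {a..b}" for x
      using lin[of p x, OF p_bound(1)[OF that]] lin[of q x, OF p_bound(2)[OF that]]
      by (intro order_trans[OF norm_triangle_ineq4]) linarith
    have is1: "norm (\<i> * complex_of_real (\<omega> * s)) \<le> \<omega> * \<sigma>" "norm (- (\<i> * complex_of_real (\<omega> * s))) \<le> \<omega> * \<sigma>"
      using s \<omega>_pos by (simp_all add: norm_mult abs_mult abs_le_iff)
    have iw: "norm (\<i> * complex_of_real \<omega>) \<le> \<omega>" "norm (- \<i> * complex_of_real \<omega>) \<le> \<omega>"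
      using \<omega>_pos by (simp_all add: norm_mult)
    have eqR: "?R = \<omega> * \<sigma> * P * 1 * K + \<omega> * (2 * (\<omega> * \<sigma> * P)\<^sup>2) * K" by simp
    show "norm (?r1 x) \<le> ?R" "norm (?r2 x) \<le> ?R" if "x \<in> S" for x
      unfolding eqR
      by (intro norm_triangle_le add_mono norm_mult_le is1 iw rem p'_bound nph u_bound J_T s S_sub that)+
  qed
  then show ?thesis using that der unfolding split by blast
qed

text \<open>Replacing \<xi>(s) by \<xi>(0) leaves the even function \<omega>^2 s^2 \<xi>(0) / 2,
  which drops out of the difference. By \<open>xi_lipschitz\<close> the replacement changes the
  derivative by order \<omega>^3 \<sigma>^2, and 2\<sigma> is the time step.\<close>

lemma psi_symmetric_difference:
  "norm (\<psi> (- \<sigma>) - \<psi> \<sigma>) \<le> N * (K * P * (10 + 4 * P) * (\<omega> * (2 * \<sigma>)\<^sup>2 + \<omega> ^ 3 * (2 * \<sigma>) ^ 3))"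
proof -
  let ?J = "{- \<sigma>..\<sigma>}"
  let ?Q = "\<lambda>s. \<psi> s - of_real (\<omega>\<^sup>2 * s\<^sup>2 / 2) * \<xi> 0"
  let ?B1 = "\<omega>\<^sup>2 * \<sigma> * (N * (2 * (\<omega> * K * P * (10 + 2 * P))) * \<sigma>)"
  let ?B2 = "N * (2 * (\<omega> * \<sigma> * P * K + \<omega> * (2 * (\<omega> * \<sigma> * P)\<^sup>2) * K))"
  have N0: "0 \<le> N" by (rule L2_set_nonneg)
  have "\<exists>Q'. \<forall>s\<in>?J. (?Q has_vector_derivative Q' s) (at s within ?J) \<and> norm (Q' s) \<le> ?B1 + ?B2"
  proof (rule bchoice, rule ballI)
    fix s assume s: "s \<in> ?J"
    obtain R where R: "(\<psi> has_vector_derivative of_real (\<omega>\<^sup>2 * s) * \<xi> s + R) (at s within ?J)" "norm R \<le> ?B2"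
      by (rule psi_deriv[OF s]) (rule that)
    have "((\<lambda>s. \<omega>\<^sup>2 * s\<^sup>2 / 2) has_real_derivative \<omega>\<^sup>2 * s) (at s within ?J)"
      by (auto intro!: derivative_eq_intros)
    then have "((\<lambda>s. complex_of_real (\<omega>\<^sup>2 * s\<^sup>2 / 2)) has_vector_derivative of_real (\<omega>\<^sup>2 * s)) (at s within ?J)"
      by (intro has_vector_derivative_of_real) (simp add: has_real_derivative_iff_has_vector_derivative)
    then have "(?Q has_vector_derivative (of_real (\<omega>\<^sup>2 * s) * \<xi> s + R) - of_real (\<omega>\<^sup>2 * s) * \<xi> 0) (at s within ?J)"
      by (intro has_vector_derivative_diff R has_vector_derivative_mult_left)
    moreover have "norm ((of_real (\<omega>\<^sup>2 * s) * \<xi> s + R) - of_real (\<omega>\<^sup>2 * s) * \<xi> 0) \<le> ?B1 + ?B2"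
    proof -
      have "norm (of_real (\<omega>\<^sup>2 * s) * (\<xi> s - \<xi> 0)) \<le> (\<omega>\<^sup>2 * \<sigma>) * (N * (2 * (\<omega> * K * P * (10 + 2 * P))) * \<sigma>)"
      proof (rule norm_mult_le)
        show "norm (complex_of_real (\<omega>\<^sup>2 * s)) \<le> \<omega>\<^sup>2 * \<sigma>"
          unfolding norm_of_real abs_mult using s by (intro mult_mono) auto
        show "norm (\<xi> s - \<xi> 0) \<le> N * (2 * (\<omega> * K * P * (10 + 2 * P))) * \<sigma>"
          by (rule order_trans[OF xi_lipschitz[OF s]])
            (use s N0 \<omega>_pos K_nonneg P_nonneg in \<open>intro mult_left_mono, auto\<close>)
      qed
      moreover have "(of_real (\<omega>\<^sup>2 * s) * \<xi> s + R) - of_real (\<omega>\<^sup>2 * s) * \<xi> 0 = of_real (\<omega>\<^sup>2 * s) * (\<xi> s - \<xi> 0) + R"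
        by (simp add: algebra_simps)
      ultimately show ?thesis using R(2) by (simp only:) (intro norm_triangle_le add_mono)
    qed
    ultimately show "\<exists>y. (?Q has_vector_derivative y) (at s within ?J) \<and> norm y \<le> ?B1 + ?B2" by blast
  qed
  then obtain Q' where Q': "\<And>s. s \<in> ?J \<Longrightarrow> (?Q has_vector_derivative Q' s) (at s within ?J)"
    "\<And>s. s \<in> ?J \<Longrightarrow> norm (Q' s) \<le> ?B1 + ?B2" by blast
  have "norm (?Q (- \<sigma>) - ?Q \<sigma>) \<le> (?B1 + ?B2) * \<bar>- \<sigma> - \<sigma>\<bar>"
    by (rule norm_diff_le_of_vector_derivative[OF Q'(1) _ Q'(2)]) (use \<sigma> in auto)
  moreover have "?Q (- \<sigma>) - ?Q \<sigma> = \<psi> (- \<sigma>) - \<psi> \<sigma>" by simp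
  ultimately have "norm (\<psi> (- \<sigma>) - \<psi> \<sigma>) \<le> (?B1 + ?B2) * (2 * \<sigma>)" using \<sigma> by simp
  also have "(?B1 + ?B2) * (2 * \<sigma>) = N * (K * P * (10 + 4 * P) * (4 * \<omega> ^ 3 * \<sigma> ^ 3) + K * P * (4 * \<omega> * \<sigma>\<^sup>2))"
    by (simp add: algebra_simps power2_eq_square power3_eq_cube)
  also have "\<dots> \<le> N * (K * P * (10 + 4 * P) * (\<omega> ^ 3 * (2 * \<sigma>) ^ 3) + K * P * (10 + 4 * P) * (\<omega> * (2 * \<sigma>)\<^sup>2))"
  proof (rule mult_left_mono[OF _ N0], rule add_mono)
    have "0 \<le> \<omega> ^ 3 * \<sigma> ^ 3" "0 \<le> K * P * (10 + 4 * P)" using \<omega>_pos \<sigma> K_nonneg P_nonneg by auto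
    then show "K * P * (10 + 4 * P) * (4 * \<omega> ^ 3 * \<sigma> ^ 3) \<le> K * P * (10 + 4 * P) * (\<omega> ^ 3 * (2 * \<sigma>) ^ 3)"
      by (intro mult_left_mono) (auto simp: power_mult_distrib)
    have "K * P * 1 \<le> K * P * (10 + 4 * P)" using K_nonneg P_nonneg by (intro mult_left_mono) auto
    show "K * P * (4 * \<omega> * \<sigma>\<^sup>2) \<le> K * P * (10 + 4 * P) * (\<omega> * (2 * \<sigma>)\<^sup>2)"
    proof -
      have "4 * \<omega> * \<sigma>\<^sup>2 = \<omega> * (2 * \<sigma>)\<^sup>2" by (simp add: power_mult_distrib)
      then show ?thesis
        using mult_right_mono[OF \<open>K * P * 1 \<le> K * P * (10 + 4 * P)\<close>, of "\<omega> * (2 * \<sigma>)\<^sup>2"] \<omega>_pos by simp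
    qed
  qed
  finally show ?thesis by (simp add: algebra_simps)
qed

end

end

context periodic_grid
begin

section \<open>The global error and the supremum of the scheme\<close>

lemma pot_step_eq: "pot_step \<theta> p q Z j = (phase (- \<theta>) p (gx j) * fst (Z j), phase (- \<theta>) q (gx j) * snd (Z j))"
  by (simp add: pot_step_def phase_def)

lemma pot_step_add: "pot_step \<theta> p q (pot_step \<theta>' p q Z) = pot_step (\<theta> + \<theta>') p q Z"
  by (rule ext) (simp add: pot_step_eq mult.assoc[symmetric] phase_add)

lemma norm_pair_le: "norm x \<le> c \<Longrightarrow> norm y \<le> d \<Longrightarrow> norm (x, y) \<le> c + d"
  using norm_Pair_le[of x y] by linarith

lemma gn_pair_le:
  fixes U W :: "nat \<Rightarrow> complex"
  shows "gn (\<lambda>j. (U j, W j)) \<le> gn U + gn W"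
proof -
  have "(gn (\<lambda>j. (U j, W j)))\<^sup>2 = (gn U)\<^sup>2 + (gn W)\<^sup>2" by (simp add: gn_pair)
  also have "\<dots> \<le> (gn U + gn W)\<^sup>2" by (simp add: power2_sum)
  finally show ?thesis by (rule power2_le_imp_le) simp
qed

lemma trunc_add:
  assumes "bm f" "bm g" shows "trunc (\<lambda>x. f x + g x) y = trunc f y + trunc g y"
proof -
  have "fc (\<lambda>x. f x + g x) l = fc f l + fc g l" for l
    unfolding fc_def distrib_right by (rule mean_add) (intro bm_intros assms)+
  then show ?thesis by (simp add: trunc_def distrib_right sum.distrib)
qed

text \<open>Multiplication by 1 commutes with truncation, so only \<open>phase - 1\<close>
  contributes. It is of size |\<theta>| with all its derivatives, whence the factor |\<theta>| on
  top of the spatial order.\<close>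

lemma phase_trunc_commute:
  assumes f: "psm \<omega> n K f" and v: "psm \<omega> n P (\<lambda>x. of_real (v x))"
    and \<theta>: "\<bar>\<theta>\<bar> \<le> H" and \<omega>: "0 \<le> \<omega>"
  shows "gn (\<lambda>j. phase \<theta> v (gx j) * trunc f (gx j) - trunc (\<lambda>x. phase \<theta> v x * f x) (gx j))
    \<le> \<bar>\<theta>\<bar> * (2 * K * (P + 2 ^ (n + 1) * exp_const P H n)) * (h * \<omega>) ^ (n + 1)"
proof -
  let ?y = "(h * \<omega>) ^ (n + 1)"
  let ?c = "\<bar>\<theta>\<bar> * exp_const P H n"
  let ?g = "\<lambda>x. (phase \<theta> v x - 1) * f x"
  have K: "0 \<le> K" by (rule psm_nonneg[OF f])
  have g: "psm \<omega> n (2 ^ (n + 1) * ?c * K) ?g"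
    unfolding phase_def by (rule psm_mult[OF psm_exp_minus_1[OF \<theta> \<omega> v] f])
  have t: "trunc (\<lambda>x. phase \<theta> v x * f x) y = trunc ?g y + trunc f y" for y
    using trunc_add[OF psm_bm[OF g] psm_bm[OF f]] by (simp add: algebra_simps)
  have eq: "phase \<theta> v (gx j) * trunc f (gx j) - trunc (\<lambda>x. phase \<theta> v x * f x) (gx j)
      = (phase \<theta> v (gx j) - 1) * (trunc f (gx j) - f (gx j)) + (?g (gx j) - trunc ?g (gx j))" for j
    unfolding t by (simp add: algebra_simps)
  have "gn (\<lambda>j. (phase \<theta> v (gx j) - 1) * (trunc f (gx j) - f (gx j)))
      \<le> (\<bar>\<theta>\<bar> * P) * gn (\<lambda>j. norm (trunc f (gx j) - f (gx j)))"
  proof (rule gn_le_const)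
    show "0 \<le> \<bar>\<theta>\<bar> * P" using psm_nonneg[OF v] by simp
    fix j assume "j < M"
    then have "norm (complex_of_real (v (gx j))) \<le> P" by (intro psm_bound[OF v] grid_in)
    then have "\<bar>v (gx j)\<bar> \<le> P" by simp
    then have "norm (phase \<theta> v (gx j) - 1) \<le> \<bar>\<theta>\<bar> * P"
      by (intro order_trans[OF norm_phase_minus_1_le] mult_left_mono) auto
    then show "norm ((phase \<theta> v (gx j) - 1) * (trunc f (gx j) - f (gx j))) \<le> \<bar>\<theta>\<bar> * P * norm (trunc f (gx j) - f (gx j))"
      unfolding norm_mult by (rule mult_right_mono) simp
  qed auto
  also have "gn (\<lambda>j. norm (trunc f (gx j) - f (gx j))) = gn (\<lambda>j. f (gx j) - trunc f (gx j))"
    by (simp add: gn_def norm_minus_commute)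
  also have "(\<bar>\<theta>\<bar> * P) * \<dots> \<le> (\<bar>\<theta>\<bar> * P) * (2 * K * ?y)"
    using psm_nonneg[OF v] by (intro mult_left_mono trunc_grid_error[OF f \<omega>]) auto
  finally have 1: "gn (\<lambda>j. (phase \<theta> v (gx j) - 1) * (trunc f (gx j) - f (gx j))) \<le> (\<bar>\<theta>\<bar> * P) * (2 * K * ?y)" .
  have 2: "gn (\<lambda>j. ?g (gx j) - trunc ?g (gx j)) \<le> 2 * (2 ^ (n + 1) * ?c * K) * ?y"
    by (rule trunc_grid_error[OF g \<omega>])
  have "gn (\<lambda>j. phase \<theta> v (gx j) * trunc f (gx j) - trunc (\<lambda>x. phase \<theta> v x * f x) (gx j))
      \<le> (\<bar>\<theta>\<bar> * P) * (2 * K * ?y) + 2 * (2 ^ (n + 1) * ?c * K) * ?y"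
    unfolding eq by (rule order_trans[OF gn_triangle add_mono[OF 1 2]])
  also have "\<dots> = \<bar>\<theta>\<bar> * (2 * K * (P + 2 ^ (n + 1) * exp_const P H n)) * ?y"
    by (simp add: algebra_simps del: power_Suc)
  finally show ?thesis .
qed

section \<open>Increments over one grid cell and the supremum of grid functions\<close>

lemma grid_M: "gx M = b" using M_pos by (simp add: grid_def)

lemma grid_0: "gx 0 = a" by (simp add: grid_def)

lemma trigp_cong: "(\<And>l. l \<in> modes M \<Longrightarrow> c l = d l) \<Longrightarrow> trigp c x = trigp d x"
  by (simp add: trigp_def)

lemma trigp_periodic: "trigp c (gx M) = trigp c (gx 0)"
  by (simp add: grid_M grid_0 trigp_def)

lemma gn_trigp_increment:
  "gn (\<lambda>j. trigp c (gx (Suc j)) - trigp c (gx j))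
    = L2_set (\<lambda>l. norm (exp (\<i> * of_real (\<mu> l * h)) - 1) * norm (c l)) (modes M)"
proof -
  let ?z = "\<lambda>l. exp (\<i> * of_real (\<mu> l * h)) - 1"
  let ?c' = "\<lambda>l. (?z l * fst (c l), ?z l * snd (c l))"
  have w: "e l (gx (Suc j)) = exp (\<i> * of_real (\<mu> l * h)) * e l (gx j)" for l j
    using wave_shift[of l "gx j" h] by (simp add: grid_eq algebra_simps)
  have "trigp c (gx (Suc j)) - trigp c (gx j) = trigp ?c' (gx j)" for j
    unfolding trigp_def w by (simp add: sum_subtractf[symmetric] algebra_simps)
  then have "gn (\<lambda>j. trigp c (gx (Suc j)) - trigp c (gx j)) = L2_set (\<lambda>l. norm (?c' l)) (modes M)"
    by (simp only: gn_trigp)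
  moreover have "norm (?c' l) = norm (?z l) * norm (c l)" for l
  proof -
    have "(norm (?c' l))\<^sup>2 = (norm (?z l) * norm (c l))\<^sup>2"
      by (simp add: norm_prod_def norm_mult power_mult_distrib distrib_left)
    then show ?thesis by simp
  qed
  ultimately show ?thesis by (simp only:)
qed

text \<open>The free step is a Fourier multiplier and commutes with the translation by one cell.
  Periodicity is what makes the last increment, which uses the value at index \<open>M\<close>, part
  of the same pattern.\<close>

lemma gn_flow_increment:
  assumes "0 < \<omega>" "Z M = Z 0"
  shows "gn (\<lambda>j. flow_step \<omega> \<tau> Z (Suc j) - flow_step \<omega> \<tau> Z j) = gn (\<lambda>j. Z (Suc j) - Z j)"
proof -
  have Z: "Z j = trigp (dftp Z) (gx j)" if "j \<le> M" for j
  proof (cases "j = M")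
    case True
    then show ?thesis using assms(2) trigp_periodic trigp_dftp[OF M_pos, of Z] by simp
  next
    case False
    then show ?thesis using that by (simp add: trigp_dftp)
  qed
  have "gn (\<lambda>j. Z (Suc j) - Z j) = gn (\<lambda>j. trigp (dftp Z) (gx (Suc j)) - trigp (dftp Z) (gx j))"
    by (rule gn_cong) (simp flip: Z)
  then show ?thesis
    unfolding flow_step_def gn_trigp_increment norm_dirac_flow[OF assms(1)] by simp
qed

lemma gn_mult_bound:
  fixes U :: "nat \<Rightarrow> 'v::real_normed_vector"
  assumes "\<And>j. j < M \<Longrightarrow> norm (W j) \<le> c * norm (U j)" "0 \<le> c"
  shows "gn W \<le> c * gn U"
proof -
  have "gn W \<le> c * gn (\<lambda>j. norm (U j))" using assms by (intro gn_le_const) auto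
  then show ?thesis by (simp add: gn_def)
qed

text \<open>The squares at two grid points differ by at most the sum of all increments of |Z|^2.
  Averaging over the second point produces the mean square, and Cauchy-Schwarz bounds the
  increments.\<close>

lemma discrete_sobolev:
  fixes Z :: "nat \<Rightarrow> 'v::real_normed_vector"
  assumes per: "Z M = Z 0" and j: "j < M"
  shows "(norm (Z j))\<^sup>2 \<le> (gn Z)\<^sup>2 + 2 * real M * gn (\<lambda>k. Z (Suc k) - Z k) * gn Z"
proof -
  let ?d = "\<lambda>k. norm (Z (Suc k) - Z k)"
  let ?V = "\<Sum>k<M. ?d k * (norm (Z (Suc k)) + norm (Z k))"
  have sM: "sqrt (real M) * sqrt (real M) = real M" by simp
  have L: "L2_set (\<lambda>k. norm (Y k)) {..<M} = sqrt (real M) * gn Y" for Y :: "nat \<Rightarrow> 'v"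
    using M_pos by (simp add: gn_L2_set)
  have step: "\<bar>(norm (Z (Suc k)))\<^sup>2 - (norm (Z k))\<^sup>2\<bar> \<le> ?d k * (norm (Z (Suc k)) + norm (Z k))" for k
  proof -
    have "(norm (Z (Suc k)))\<^sup>2 - (norm (Z k))\<^sup>2 = (norm (Z (Suc k)) - norm (Z k)) * (norm (Z (Suc k)) + norm (Z k))"
      by (simp add: power2_eq_square algebra_simps)
    then show ?thesis
      using norm_triangle_ineq3[of "Z (Suc k)" "Z k"] by (simp add: abs_mult mult_right_mono)
  qed
  have V: "?V \<le> real M * (2 * gn (\<lambda>k. Z (Suc k) - Z k) * gn Z)"
  proof -
    have shiftsum: "(\<Sum>k<M. (norm (Z (Suc k)))\<^sup>2) = (\<Sum>k<M. (norm (Z k))\<^sup>2)"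
      using sum.lessThan_Suc_shift[of "\<lambda>k. (norm (Z k))\<^sup>2" M] per by simp
    have "?V = (\<Sum>k<M. \<bar>?d k\<bar> * \<bar>norm (Z (Suc k))\<bar>) + (\<Sum>k<M. \<bar>?d k\<bar> * \<bar>norm (Z k)\<bar>)"
      by (simp add: distrib_left sum.distrib)
    also have "\<dots> \<le> L2_set ?d {..<M} * L2_set (\<lambda>k. norm (Z (Suc k))) {..<M} + L2_set ?d {..<M} * L2_set (\<lambda>k. norm (Z k)) {..<M}"
      by (intro add_mono L2_set_mult_ineq)
    also have "L2_set (\<lambda>k. norm (Z (Suc k))) {..<M} = L2_set (\<lambda>k. norm (Z k)) {..<M}"
      by (simp add: L2_set_def shiftsum)
    finally have "?V \<le> sqrt (real M) * gn (\<lambda>k. Z (Suc k) - Z k) * (sqrt (real M) * gn Z)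
        + sqrt (real M) * gn (\<lambda>k. Z (Suc k) - Z k) * (sqrt (real M) * gn Z)" unfolding L .
    moreover have "s * g * (s * z) + s * g * (s * z) = (s * s) * (2 * g * z)" for s g z :: real
      by (simp add: algebra_simps)
    ultimately show ?thesis by (simp only: sM)
  qed
  have mono: "(norm (Z j'))\<^sup>2 - (norm (Z i'))\<^sup>2 \<le> ?V \<and> (norm (Z i'))\<^sup>2 - (norm (Z j'))\<^sup>2 \<le> ?V"
    if "i' \<le> j'" "j' < M" for i' j'
  proof -
    have "\<bar>(norm (Z j'))\<^sup>2 - (norm (Z i'))\<^sup>2\<bar> = \<bar>\<Sum>k\<in>{i'..<j'}. (norm (Z (Suc k)))\<^sup>2 - (norm (Z k))\<^sup>2\<bar>"
      by (subst sum_Suc_diff'[OF that(1)]) simp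
    also have "\<dots> \<le> (\<Sum>k\<in>{i'..<j'}. ?d k * (norm (Z (Suc k)) + norm (Z k)))"
      by (rule order_trans[OF sum_abs sum_mono[OF step]])
    also have "\<dots> \<le> ?V" using that by (intro sum_mono2) auto
    finally show ?thesis by linarith
  qed
  have "(norm (Z j))\<^sup>2 - (norm (Z i))\<^sup>2 \<le> ?V" if "i < M" for i
    using mono[of i j] mono[of j i] that j by (cases "i \<le> j") auto
  then have "(\<Sum>i<M. (norm (Z j))\<^sup>2) \<le> (\<Sum>i<M. (norm (Z i))\<^sup>2 + ?V)"
    by (intro sum_mono) (simp add: algebra_simps)
  then have "real M * (norm (Z j))\<^sup>2 \<le> (\<Sum>i<M. (norm (Z i))\<^sup>2) + real M * ?V"
    by (simp add: sum.distrib)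
  moreover have "(\<Sum>i<M. (norm (Z i))\<^sup>2) = real M * (gn Z)\<^sup>2"
    using M_pos by (simp add: gn_def sum_nonneg)
  ultimately have "real M * (norm (Z j))\<^sup>2 \<le> real M * ((gn Z)\<^sup>2 + ?V)" by (simp add: distrib_left)
  then have "(norm (Z j))\<^sup>2 \<le> (gn Z)\<^sup>2 + ?V" using M_pos by simp
  with V show ?thesis by (simp add: algebra_simps)
qed

end

text \<open>The initial values reach up to index \<open>M\<close>, the copy of index 0, so that
  increments cover the whole circle. \<open>H\<close> is the bound on \<omega>\<tau> provided by the
  asymptotic conditions.\<close>

locale dirac_scheme = dirac_data +
  fixes \<tau> H :: real and Z :: "nat \<Rightarrow> nat \<Rightarrow> complex \<times> complex"
  assumes \<tau>_pos: "0 < \<tau>" and \<tau>H: "\<omega> * \<tau> \<le> H"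
    and Z0: "\<And>j. j \<le> M \<Longrightarrow> Z 0 j = (u 0 (gx j), w 0 (gx j))"
    and ZSuc: "\<And>n. Z (Suc n) = pot_step (\<omega> * \<tau>) p q (flow_step \<omega> \<tau> (Z n))"
begin

text \<open>With m = r + 2 this is (h/\<epsilon>)^m. Below, \<open>\<theta>\<close> is the parameter
  of half a potential step, \<open>R\<close> the exact solution on the grid and \<open>X\<close> its
  Fourier truncation there.\<close>

definition "y = (h * \<omega>) ^ (r + 2)"
definition "\<theta> = \<omega> * \<tau> / 2"
definition "R t j = (u t (gx j), w t (gx j))"
definition "X t j = (trunc (u t) (gx j), trunc (w t) (gx j))"
definition "c\<^sub>0 = 2 * K * (P + 2 ^ (r + 2) * exp_const P H (r + 1))"
definition "c\<^sub>1 = K * P * (10 + 4 * P)"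

lemma y_nonneg: "0 \<le> y" using h_pos \<omega>_pos by (simp add: y_def)

lemma H_nonneg: "0 \<le> H" using \<tau>H \<omega>_pos \<tau>_pos by (meson less_le_trans mult_pos_pos less_imp_le)

lemma \<theta>_pos: "0 < \<theta>" using \<omega>_pos \<tau>_pos by (simp add: \<theta>_def)

lemma \<theta>_le: "\<theta> \<le> H" using \<tau>H \<omega>_pos \<tau>_pos H_nonneg by (simp add: \<theta>_def)

lemma c0_nonneg: "0 \<le> c\<^sub>0"
  unfolding c\<^sub>0_def using K_nonneg P_nonneg exp_const_nonneg[OF P_nonneg H_nonneg]
  by (intro mult_nonneg_nonneg add_nonneg_nonneg) (simp_all del: exp_const.simps)

lemma c1_nonneg: "0 \<le> c\<^sub>1" unfolding c\<^sub>1_def using K_nonneg P_nonneg by simp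

lemma sp\<omega>: "psm \<omega> (Suc r) P (\<lambda>x. of_real (p x))" "psm \<omega> (Suc r) P (\<lambda>x. of_real (q x))"
  using psm_mono_omega[OF sp _ \<omega>1] psm_mono_omega[OF sq _ \<omega>1] by simp_all

text \<open>\<open>pot_step (- s)\<close> multiplies by phases with parameter \<open>s\<close>.
  Applying them after truncation, as the scheme does, is compared with truncating the solution that
  already carries them, as the pairing sees it.\<close>

lemma gate_commute:
  assumes t: "t \<in> {0..T}" and s: "\<bar>s\<bar> = \<theta>"
  shows "gn (\<lambda>j. pot_step (- s) p q (X t) j
      - trigp (\<lambda>l. (fc (\<lambda>x. phase s p x * u t x) l, fc (\<lambda>x. phase s q x * w t x) l)) (gx j)) \<le> 2 * \<theta> * c\<^sub>0 * y"
proof -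
  have sH: "\<bar>s\<bar> \<le> H" using s \<theta>_le by simp
  have n: "Suc r + 1 = r + 2" "Suc r = r + 1" by simp_all
  have "pot_step (- s) p q (X t) j - trigp (\<lambda>l. (fc (\<lambda>x. phase s p x * u t x) l, fc (\<lambda>x. phase s q x * w t x) l)) (gx j)
    = (phase s p (gx j) * trunc (u t) (gx j) - trunc (\<lambda>x. phase s p x * u t x) (gx j),
       phase s q (gx j) * trunc (w t) (gx j) - trunc (\<lambda>x. phase s q x * w t x) (gx j))" for j
    by (simp add: pot_step_eq X_def trigp_def trunc_def)
  then have "gn (\<lambda>j. pot_step (- s) p q (X t) j
      - trigp (\<lambda>l. (fc (\<lambda>x. phase s p x * u t x) l, fc (\<lambda>x. phase s q x * w t x) l)) (gx j))
    \<le> gn (\<lambda>j. phase s p (gx j) * trunc (u t) (gx j) - trunc (\<lambda>x. phase s p x * u t x) (gx j))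
    + gn (\<lambda>j. phase s q (gx j) * trunc (w t) (gx j) - trunc (\<lambda>x. phase s q x * w t x) (gx j))"
    by (simp only: gn_pair_le)
  also have "\<dots> \<le> \<bar>s\<bar> * c\<^sub>0 * y + \<bar>s\<bar> * c\<^sub>0 * y"
    using phase_trunc_commute[OF su[OF t] sp\<omega>(1) sH] phase_trunc_commute[OF sw[OF t] sp\<omega>(2) sH] \<omega>_pos
    unfolding c\<^sub>0_def y_def n by (intro add_mono) auto
  finally show ?thesis using s by simp
qed

text \<open>The defect \<open>d\<close> of the step is itself chosen as the test function. The
  pairing then changes over the step by exactly the squared norm of \<open>d\<close>, and one factor
  of the norm is cancelled.\<close>

lemma local_error:
  assumes t: "0 \<le> t" "t + \<tau> \<le> T"
  shows "gn (\<lambda>j. flow_step \<omega> \<tau> (pot_step \<theta> p q (X t)) j - pot_step (- \<theta>) p q (X (t + \<tau>)) j)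
    \<le> 4 * \<theta> * c\<^sub>0 * y + c\<^sub>1 * (\<omega> * \<tau>\<^sup>2 + \<omega> ^ 3 * \<tau> ^ 3)"
proof -
  define A where "A = (\<lambda>l. (fc (\<lambda>x. phase (- \<theta>) p x * u t x) l, fc (\<lambda>x. phase (- \<theta>) q x * w t x) l))"
  define B where "B = (\<lambda>l. (fc (\<lambda>x. phase \<theta> p x * u (t + \<tau>) x) l, fc (\<lambda>x. phase \<theta> q x * w (t + \<tau>) x) l))"
  have tT: "t \<in> {0..T}" "t + \<tau> \<in> {0..T}" using t \<tau>_pos by auto
  have A: "gn (\<lambda>j. pot_step \<theta> p q (X t) j - trigp A (gx j)) \<le> 2 * \<theta> * c\<^sub>0 * y"
    using gate_commute[OF tT(1), of "- \<theta>"] \<theta>_pos by (simp add: A_def)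
  have B: "gn (\<lambda>j. pot_step (- \<theta>) p q (X (t + \<tau>)) j - trigp B (gx j)) \<le> 2 * \<theta> * c\<^sub>0 * y"
    using gate_commute[OF tT(2), of \<theta>] \<theta>_pos by (simp add: B_def)
  define d where "d = (\<lambda>l. dirac_flow \<omega> (\<mu> l) \<tau> (A l) - B l)"
  let ?N = "L2_set (\<lambda>l. norm (d l)) (modes M)"
  \<comment> \<open>Test functions are parametrised by their value at the midpoint of the step, so
    the defect, which lives at its end, is carried back by half a step.\<close>
  define d' where "d' = (\<lambda>l. dirac_flow \<omega> (\<mu> l) (- (\<tau> / 2)) (d l))"
  have N': "L2_set (\<lambda>l. norm (d' l)) (modes M) = ?N" by (simp add: d'_def norm_dirac_flow \<omega>_pos)
  have \<sigma>: "0 < \<tau> / 2" "0 \<le> t + \<tau> / 2 - \<tau> / 2" "t + \<tau> / 2 + \<tau> / 2 \<le> T" using \<tau>_pos t by auto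
  have ends: "t + \<tau> / 2 + (- (\<tau> / 2)) = t" "t + \<tau> / 2 + \<tau> / 2 = t + \<tau>" by auto
  have "?N\<^sup>2 = norm (\<psi> (t + \<tau> / 2) d' (- (\<tau> / 2)) - \<psi> (t + \<tau> / 2) d' (\<tau> / 2))"
  proof -
    have b: "bm (u t)" "bm (w t)" "bm (u (t + \<tau>))" "bm (w (t + \<tau>))"
      using psm_bm[OF su[OF tT(1)]] psm_bm[OF sw[OF tT(1)]] psm_bm[OF su[OF tT(2)]] psm_bm[OF sw[OF tT(2)]] .
    have bp: "bm (phase s p)" "bm (phase s q)" for s by (rule bm_phase[OF sp], rule bm_phase[OF sq])
    have 1: "\<psi> (t + \<tau> / 2) d' (- (\<tau> / 2)) = (\<Sum>l\<in>modes M. herm2 (dirac_flow \<omega> (\<mu> l) (- (\<tau> / 2)) (d' l)) (A l))"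
      unfolding \<psi>_def[OF \<sigma>] f1_def[OF \<sigma>, abs_def] f2_def[OF \<sigma>, abs_def] ends A_def \<theta>_def
      by (subst pairing_eq) (intro bm_intros bp b, simp)+
    have 2: "\<psi> (t + \<tau> / 2) d' (\<tau> / 2) = (\<Sum>l\<in>modes M. herm2 (dirac_flow \<omega> (\<mu> l) (\<tau> / 2) (d' l)) (B l))"
      unfolding \<psi>_def[OF \<sigma>] f1_def[OF \<sigma>, abs_def] f2_def[OF \<sigma>, abs_def] ends B_def \<theta>_def
      by (subst pairing_eq) (intro bm_intros bp b, simp)+
    have "herm2 (dirac_flow \<omega> (\<mu> l) (- (\<tau> / 2)) (d' l)) (A l) - herm2 (dirac_flow \<omega> (\<mu> l) (\<tau> / 2) (d' l)) (B l)
        = of_real ((norm (d l))\<^sup>2)" for l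
    proof -
      have "herm2 (dirac_flow \<omega> (\<mu> l) (- (\<tau> / 2)) (d' l)) (A l) = herm2 (d l) (dirac_flow \<omega> (\<mu> l) \<tau> (A l))"
        unfolding d'_def dirac_flow_add[OF \<omega>_pos] dirac_flow_herm by simp
      moreover have "herm2 (dirac_flow \<omega> (\<mu> l) (\<tau> / 2) (d' l)) (B l) = herm2 (d l) (B l)"
        unfolding d'_def dirac_flow_add[OF \<omega>_pos] by simp
      moreover have "herm2 x y - herm2 x z = herm2 x (y - z)" for x y z by (simp add: herm2_def algebra_simps)
      ultimately show ?thesis using herm2_self[of "d l"] by (simp only: d_def)
    qed
    then have "\<psi> (t + \<tau> / 2) d' (- (\<tau> / 2)) - \<psi> (t + \<tau> / 2) d' (\<tau> / 2) = of_real (\<Sum>l\<in>modes M. (norm (d l))\<^sup>2)"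
      unfolding 1 2 sum_subtractf[symmetric] by (simp only: of_real_sum)
    then show ?thesis by (simp add: L2_set_def sum_nonneg del: of_real_sum)
  qed
  also have "\<dots> \<le> ?N * (c\<^sub>1 * (\<omega> * \<tau>\<^sup>2 + \<omega> ^ 3 * \<tau> ^ 3))"
    using psi_symmetric_difference[OF \<sigma>, of d'] unfolding N' c\<^sub>1_def by simp
  finally have "?N * ?N \<le> ?N * (c\<^sub>1 * (\<omega> * \<tau>\<^sup>2 + \<omega> ^ 3 * \<tau> ^ 3))" by (simp add: power2_eq_square)
  then have N: "?N \<le> c\<^sub>1 * (\<omega> * \<tau>\<^sup>2 + \<omega> ^ 3 * \<tau> ^ 3)"
  proof (cases "?N = 0")
    case True
    then show ?thesis using c1_nonneg \<omega>_pos \<tau>_pos by simp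
  next
    case False
    then have "0 < ?N" using L2_set_nonneg[of "\<lambda>l. norm (d l)" "modes M"] by linarith
    with \<open>?N * ?N \<le> _\<close> show ?thesis by (simp only: mult_le_cancel_left_pos)
  qed
  have fA: "flow_step \<omega> \<tau> (\<lambda>j. trigp A (gx j)) j = trigp (\<lambda>l. dirac_flow \<omega> (\<mu> l) \<tau> (A l)) (gx j)" for j
    unfolding flow_step_def by (rule trigp_cong) (simp add: dftp_trigp)
  have "gn (\<lambda>j. flow_step \<omega> \<tau> (pot_step \<theta> p q (X t)) j - flow_step \<omega> \<tau> (\<lambda>j. trigp A (gx j)) j) \<le> 2 * \<theta> * c\<^sub>0 * y"
    using A gn_flow_step[OF \<omega>_pos, of \<tau> "\<lambda>j. pot_step \<theta> p q (X t) j - trigp A (gx j)"]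
    by (simp add: flow_step_diff[symmetric])
  moreover have "gn (\<lambda>j. flow_step \<omega> \<tau> (\<lambda>j. trigp A (gx j)) j - trigp B (gx j)) = ?N"
    unfolding fA trigp_diff[symmetric] gn_trigp d_def ..
  moreover have "gn (\<lambda>j. trigp B (gx j) - pot_step (- \<theta>) p q (X (t + \<tau>)) j) \<le> 2 * \<theta> * c\<^sub>0 * y"
    using B by (subst gn_minus_commute)
  ultimately show ?thesis
    using N gn_triangle_diff[of "flow_step \<omega> \<tau> (pot_step \<theta> p q (X t))" "pot_step (- \<theta>) p q (X (t + \<tau>))" "\<lambda>j. trigp B (gx j)"]
      gn_triangle_diff[of "flow_step \<omega> \<tau> (pot_step \<theta> p q (X t))" "\<lambda>j. trigp B (gx j)" "flow_step \<omega> \<tau> (\<lambda>j. trigp A (gx j))"]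
    by linarith
qed

text \<open>The price of the conjugation: of first order in \<omega>\<tau>, but paid only at the
  initial and at the final time and not in every step.\<close>

lemma R_minus_gate:
  assumes t: "t \<in> {0..T}"
  shows "gn (\<lambda>j. R t j - pot_step \<theta> p q (X t) j) \<le> 2 * \<theta> * P * K + 4 * K * y"
proof -
  have n: "Suc r + 1 = r + 2" by simp
  have "norm (R t j - pot_step \<theta> p q (R t) j) \<le> \<theta> * P * K + \<theta> * P * K" if "j < M" for j
  proof -
    have g: "gx j \<in> {a..b}" by (rule grid_in(1)[OF that])
    have *: "norm (z - phase (- \<theta>) v x * z) \<le> \<theta> * P * K" if "norm z \<le> K" "\<bar>v x\<bar> \<le> P" for z v x
    proof -
      have "norm (z - phase (- \<theta>) v x * z) = norm (phase (- \<theta>) v x - 1) * norm z"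
        by (metis left_diff_distrib mult_1 norm_minus_commute norm_mult)
      also have "\<dots> \<le> (\<theta> * P) * K"
      proof (rule mult_mono)
        have "norm (phase (- \<theta>) v x - 1) \<le> \<bar>- \<theta>\<bar> * \<bar>v x\<bar>" by (rule norm_phase_minus_1_le)
        also have "\<dots> \<le> \<theta> * P" using that \<theta>_pos by (simp add: mult_left_mono)
        finally show "norm (phase (- \<theta>) v x - 1) \<le> \<theta> * P" .
      qed (use that \<theta>_pos P_nonneg in auto)
      finally show ?thesis .
    qed
    show ?thesis unfolding pot_step_eq R_def fst_conv snd_conv diff_Pair
      by (intro norm_pair_le * u_bound p_bound t g)
  qed
  then have 1: "gn (\<lambda>j. R t j - pot_step \<theta> p q (R t) j) \<le> \<theta> * P * K + \<theta> * P * K"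
    using \<theta>_pos P_nonneg K_nonneg by (intro gn_bound) auto
  have "gn (\<lambda>j. pot_step \<theta> p q (R t) j - pot_step \<theta> p q (X t) j) = gn (\<lambda>j. R t j - X t j)"
    unfolding pot_step_diff[symmetric] by (rule gn_pot_step)
  also have "\<dots> \<le> gn (\<lambda>j. u t (gx j) - trunc (u t) (gx j)) + gn (\<lambda>j. w t (gx j) - trunc (w t) (gx j))"
    unfolding R_def X_def diff_Pair by (rule gn_pair_le)
  also have "\<dots> \<le> 2 * K * y + 2 * K * y"
    using trunc_grid_error[OF su[OF t]] trunc_grid_error[OF sw[OF t]] \<omega>_pos unfolding y_def n
    by (intro add_mono) auto
  finally have 2: "gn (\<lambda>j. pot_step \<theta> p q (R t) j - pot_step \<theta> p q (X t) j) \<le> 2 * K * y + 2 * K * y" .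
  show ?thesis
    using gn_triangle_diff[of "R t" "pot_step \<theta> p q (X t)" "pot_step \<theta> p q (R t)"] 1 2 by linarith
qed

lemma gate_error:
  assumes "real n * \<tau> \<le> T"
  shows "gn (\<lambda>j. Z n j - pot_step \<theta> p q (X (real n * \<tau>)) j) \<le> 2 * \<theta> * P * K + 4 * K * y
    + real n * (4 * \<theta> * c\<^sub>0 * y + c\<^sub>1 * (\<omega> * \<tau>\<^sup>2 + \<omega> ^ 3 * \<tau> ^ 3))"
  using assms
proof (induction n)
  case 0
  have "gn (\<lambda>j. Z 0 j - pot_step \<theta> p q (X 0) j) = gn (\<lambda>j. R 0 j - pot_step \<theta> p q (X 0) j)"
    by (rule gn_cong) (simp add: Z0 R_def)
  then show ?case using R_minus_gate[of 0] T_pos by simp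
next
  case (Suc n)
  let ?t = "real n * \<tau>"
  let ?D = "pot_step \<theta> p q (X ?t)"
  have t: "0 \<le> ?t" "?t + \<tau> \<le> T" using Suc.prems \<tau>_pos by (auto simp: algebra_simps)
  have t': "real (Suc n) * \<tau> = ?t + \<tau>" by (simp add: algebra_simps)
  have th: "\<omega> * \<tau> = \<theta> + \<theta>" by (simp add: \<theta>_def)
  \<comment> \<open>Writing the target with a full potential step in front makes that step common to
    both sides; being unitary it disappears from the norm.\<close>
  have "pot_step \<theta> p q (X (?t + \<tau>)) = pot_step (\<theta> + \<theta>) p q (pot_step (- \<theta>) p q (X (?t + \<tau>)))"
    by (simp add: pot_step_add)
  then have "gn (\<lambda>j. Z (Suc n) j - pot_step \<theta> p q (X (?t + \<tau>)) j)
      = gn (pot_step (\<theta> + \<theta>) p q (\<lambda>j. flow_step \<omega> \<tau> (Z n) j - pot_step (- \<theta>) p q (X (?t + \<tau>)) j))"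
    unfolding ZSuc th by (simp only: pot_step_diff[symmetric])
  also have "\<dots> = gn (\<lambda>j. flow_step \<omega> \<tau> (Z n) j - pot_step (- \<theta>) p q (X (?t + \<tau>)) j)" by (rule gn_pot_step)
  also have "\<dots> \<le> gn (\<lambda>j. flow_step \<omega> \<tau> (Z n) j - flow_step \<omega> \<tau> ?D j)
      + gn (\<lambda>j. flow_step \<omega> \<tau> ?D j - pot_step (- \<theta>) p q (X (?t + \<tau>)) j)" by (rule gn_triangle_diff)
  also have "gn (\<lambda>j. flow_step \<omega> \<tau> (Z n) j - flow_step \<omega> \<tau> ?D j) = gn (\<lambda>j. Z n j - ?D j)"
    unfolding flow_step_diff[symmetric] by (rule gn_flow_step[OF \<omega>_pos])
  finally have "gn (\<lambda>j. Z (Suc n) j - pot_step \<theta> p q (X (?t + \<tau>)) j) \<le> gn (\<lambda>j. Z n j - ?D j)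
      + (4 * \<theta> * c\<^sub>0 * y + c\<^sub>1 * (\<omega> * \<tau>\<^sup>2 + \<omega> ^ 3 * \<tau> ^ 3))"
    using local_error[OF t] by linarith
  moreover have "gn (\<lambda>j. Z n j - ?D j) \<le> 2 * \<theta> * P * K + 4 * K * y
    + real n * (4 * \<theta> * c\<^sub>0 * y + c\<^sub>1 * (\<omega> * \<tau>\<^sup>2 + \<omega> ^ 3 * \<tau> ^ 3))"
    using t \<tau>_pos by (intro Suc.IH) auto
  ultimately show ?case unfolding t' by (simp add: algebra_simps)
qed

text \<open>The terms \<open>2 * P * K\<close> and \<open>8 * K\<close> come from
  \<open>R_minus_gate\<close> at the two ends; the others are the local errors summed over at most
  T/\<tau> steps.\<close>

definition "C\<^sub>E = 2 * P * K + 8 * K + 2 * c\<^sub>0 * T + c\<^sub>1 * T"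

lemma CE_nonneg: "0 \<le> C\<^sub>E"
  unfolding C\<^sub>E_def using K_nonneg P_nonneg c0_nonneg c1_nonneg T_pos by simp

lemma global_error:
  assumes n: "real n * \<tau> \<le> T"
  shows "gn (\<lambda>j. Z n j - R (real n * \<tau>) j) \<le> C\<^sub>E * (\<omega> * \<tau> + \<omega> ^ 3 * \<tau>\<^sup>2 + \<omega> * y)"
proof -
  let ?t = "real n * \<tau>"
  let ?a = "\<omega> * \<tau>" and ?b = "\<omega> ^ 3 * \<tau>\<^sup>2" and ?c = "\<omega> * y"
  have t: "?t \<in> {0..T}" using n \<tau>_pos by auto
  have pos: "0 \<le> ?a" "0 \<le> ?b" "0 \<le> ?c" using \<omega>_pos \<tau>_pos y_nonneg by auto
  have "gn (\<lambda>j. Z n j - R ?t j) \<le> gn (\<lambda>j. Z n j - pot_step \<theta> p q (X ?t) j) + gn (\<lambda>j. pot_step \<theta> p q (X ?t) j - R ?t j)"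
    by (rule gn_triangle_diff)
  also have "gn (\<lambda>j. pot_step \<theta> p q (X ?t) j - R ?t j) \<le> 2 * \<theta> * P * K + 4 * K * y"
    using R_minus_gate[OF t] by (subst gn_minus_commute)
  also have "gn (\<lambda>j. Z n j - pot_step \<theta> p q (X ?t) j) \<le> 2 * \<theta> * P * K + 4 * K * y
    + real n * (4 * \<theta> * c\<^sub>0 * y + c\<^sub>1 * (\<omega> * \<tau>\<^sup>2 + \<omega> ^ 3 * \<tau> ^ 3))" by (rule gate_error[OF n])
  also have "real n * (4 * \<theta> * c\<^sub>0 * y + c\<^sub>1 * (\<omega> * \<tau>\<^sup>2 + \<omega> ^ 3 * \<tau> ^ 3)) = ?t * (2 * c\<^sub>0 * ?c + c\<^sub>1 * (?a + ?b))"
    by (simp add: \<theta>_def algebra_simps power2_eq_square power3_eq_cube)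
  also have "\<dots> \<le> T * (2 * c\<^sub>0 * ?c + c\<^sub>1 * (?a + ?b))"
    using n pos c0_nonneg c1_nonneg by (intro mult_right_mono) auto
  finally have "gn (\<lambda>j. Z n j - R ?t j) \<le> 2 * P * K * ?a + 8 * K * y + T * (2 * c\<^sub>0 * ?c + c\<^sub>1 * (?a + ?b))"
    by (simp add: \<theta>_def algebra_simps)
  also have "\<dots> \<le> 2 * P * K * (?a + ?b + ?c) + 8 * K * (?a + ?b + ?c)
      + (2 * c\<^sub>0 * T * (?a + ?b + ?c) + c\<^sub>1 * T * (?a + ?b + ?c))"
  proof (intro add_mono)
    show "2 * P * K * ?a \<le> 2 * P * K * (?a + ?b + ?c)" using pos P_nonneg K_nonneg by (intro mult_left_mono) auto
    have "1 * y \<le> \<omega> * y" using \<omega>1 y_nonneg by (intro mult_right_mono) auto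
    then show "8 * K * y \<le> 8 * K * (?a + ?b + ?c)" using pos K_nonneg by (intro mult_left_mono) auto
    have "2 * c\<^sub>0 * T * ?c \<le> 2 * c\<^sub>0 * T * (?a + ?b + ?c)" using pos c0_nonneg T_pos by (intro mult_left_mono) auto
    moreover have "c\<^sub>1 * T * (?a + ?b) \<le> c\<^sub>1 * T * (?a + ?b + ?c)" using pos c1_nonneg T_pos by (intro mult_left_mono) auto
    ultimately show "T * (2 * c\<^sub>0 * ?c + c\<^sub>1 * (?a + ?b)) \<le> 2 * c\<^sub>0 * T * (?a + ?b + ?c) + c\<^sub>1 * T * (?a + ?b + ?c)"
      by (simp add: algebra_simps)
  qed
  finally show ?thesis by (simp add: C\<^sub>E_def algebra_simps)
qed

lemma Z_periodic: "Z n M = Z n 0"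
proof (cases n)
  case 0
  have "u 0 a = u 0 b" "w 0 a = w 0 b" using psm_periodic[OF su] psm_periodic[OF sw] T_pos by auto
  then show ?thesis using 0 Z0[of M] Z0[of 0] by (simp add: grid_M grid_0)
next
  case (Suc k)
  have "complex_of_real (p a) = of_real (p b)" "complex_of_real (q a) = of_real (q b)"
    using psm_periodic[OF sp] psm_periodic[OF sq] by auto
  then show ?thesis
    unfolding Suc ZSuc pot_step_eq flow_step_def trigp_periodic by (simp add: grid_M grid_0 phase_def)
qed

lemma gn_Z: "gn (Z n) \<le> 2 * K"
proof (induction n)
  case 0
  have "norm (Z 0 j) \<le> K + K" if "j < M" for j
    using that T_pos by (simp only: Z0 less_imp_le) (intro norm_pair_le u_bound grid_in(1) that, auto)
  then show ?case using K_nonneg by (intro gn_bound) auto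
next
  case (Suc n)
  then show ?case by (simp add: ZSuc gn_pot_step gn_flow_step \<omega>_pos)
qed

text \<open>The free step preserves the increments. A potential step adds only the variation
  \<omega>\<tau>Ph of its phases over one cell times the mean size of the solution, so that up to
  time T the increments stay of order \<omega>h.\<close>

lemma gn_Z_increment:
  "gn (\<lambda>j. Z n (Suc j) - Z n j) \<le> 2 * K * \<omega> * h + real n * (\<omega> * \<tau> * (P * h) * (2 * K))"
proof (induction n)
  case 0
  have "norm (Z 0 (Suc j) - Z 0 j) \<le> K * \<omega> * h + K * \<omega> * h" if j: "j < M" for j
  proof -
    have z: "Z 0 (Suc j) - Z 0 j = (u 0 (gx (Suc j)) - u 0 (gx j), w 0 (gx (Suc j)) - w 0 (gx j))"
      using j by (simp add: Z0)
    have g: "gx (Suc j) \<in> {a..b}" "gx j \<in> {a..b}" "\<bar>gx (Suc j) - gx j\<bar> = h"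
      using j grid_in(2)[of "Suc j"] grid_in(1)[of j] h_pos by (auto simp: grid_eq algebra_simps)
    show ?thesis unfolding z
      using psm_lipschitz[OF su g(1,2), of 0] psm_lipschitz[OF sw g(1,2), of 0] T_pos
      unfolding g(3) by (intro norm_pair_le) auto
  qed
  then have "norm (Z 0 (Suc j) - Z 0 j) \<le> 2 * K * \<omega> * h" if "j < M" for j using that by fastforce
  then have "gn (\<lambda>j. Z 0 (Suc j) - Z 0 j) \<le> 2 * K * \<omega> * h"
    by (rule gn_bound) (use K_nonneg \<omega>_pos h_pos in auto)
  then show ?case by simp
next
  case (Suc n)
  define Y where "Y = flow_step \<omega> \<tau> (Z n)"
  have "gn (\<lambda>j. Z (Suc n) (Suc j) - Z (Suc n) j) \<le>
      gn (\<lambda>j. Y (Suc j) - Y j) + gn (\<lambda>j. ((phase (- (\<omega> * \<tau>)) p (gx (Suc j)) - phase (- (\<omega> * \<tau>)) p (gx j)) * fst (Y j),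
        (phase (- (\<omega> * \<tau>)) q (gx (Suc j)) - phase (- (\<omega> * \<tau>)) q (gx j)) * snd (Y j)))"
    (is "_ \<le> _ + gn ?E")
  proof -
    let ?D = "\<lambda>j. (phase (- (\<omega> * \<tau>)) p (gx (Suc j)) * fst (Y (Suc j) - Y j), phase (- (\<omega> * \<tau>)) q (gx (Suc j)) * snd (Y (Suc j) - Y j))"
    have "Z (Suc n) (Suc j) - Z (Suc n) j = ?D j + ?E j" for j
      by (simp add: ZSuc pot_step_eq Y_def algebra_simps)
    then have "gn (\<lambda>j. Z (Suc n) (Suc j) - Z (Suc n) j) \<le> gn ?D + gn ?E"
      by (simp only: gn_triangle)
    also have "gn ?D = gn (\<lambda>j. Y (Suc j) - Y j)"
      by (rule gn_cong) (simp add: norm_prod_def norm_mult)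
    finally show ?thesis .
  qed
  also have "gn (\<lambda>j. Y (Suc j) - Y j) = gn (\<lambda>j. Z n (Suc j) - Z n j)"
    unfolding Y_def by (rule gn_flow_increment[OF \<omega>_pos Z_periodic])
  also have "gn ?E \<le> (\<omega> * \<tau> * (P * h)) * gn Y"
  proof (rule gn_mult_bound)
    show c: "0 \<le> \<omega> * \<tau> * (P * h)" using \<omega>_pos \<tau>_pos P_nonneg h_pos by simp
    fix j assume j: "j < M"
    have g: "gx (Suc j) \<in> {a..b}" "gx j \<in> {a..b}" "\<bar>gx (Suc j) - gx j\<bar> = h"
      using j grid_in(2)[of "Suc j"] grid_in(1)[of j] h_pos by (auto simp: grid_eq algebra_simps)
    have *: "norm (phase (- (\<omega> * \<tau>)) v (gx (Suc j)) - phase (- (\<omega> * \<tau>)) v (gx j)) \<le> \<omega> * \<tau> * (P * h)"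
      if "psm 1 (Suc r) P (\<lambda>x. of_real (v x))" for v
    proof -
      have "norm (phase (- (\<omega> * \<tau>)) v (gx (Suc j)) - phase (- (\<omega> * \<tau>)) v (gx j))
          \<le> \<bar>- (\<omega> * \<tau>) * v (gx (Suc j)) - (- (\<omega> * \<tau>)) * v (gx j)\<bar>"
        unfolding phase_def by (rule norm_exp_i_diff_le)
      also have "\<dots> = \<omega> * \<tau> * \<bar>v (gx (Suc j)) - v (gx j)\<bar>"
        using \<omega>_pos \<tau>_pos unfolding right_diff_distrib[symmetric] abs_mult by simp
      also have "\<bar>v (gx (Suc j)) - v (gx j)\<bar> \<le> P * h"
        using psm_lipschitz[OF that g(1,2)] unfolding g(3) by (simp flip: of_real_diff)
      finally show ?thesis using \<omega>_pos \<tau>_pos by (simp add: mult_left_mono)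
    qed
    have "(norm (?E j))\<^sup>2 \<le> (\<omega> * \<tau> * (P * h) * norm (Y j))\<^sup>2"
    proof -
      have "(norm (?E j))\<^sup>2 = (norm (fst (?E j)))\<^sup>2 + (norm (snd (?E j)))\<^sup>2" by (simp add: norm_prod_def)
      also have "\<dots> \<le> (\<omega> * \<tau> * (P * h) * norm (fst (Y j)))\<^sup>2 + (\<omega> * \<tau> * (P * h) * norm (snd (Y j)))\<^sup>2"
        unfolding fst_conv snd_conv norm_mult
        by (intro add_mono power_mono mult_right_mono * sp sq) auto
      also have "\<dots> = (\<omega> * \<tau> * (P * h) * norm (Y j))\<^sup>2"
        by (simp add: norm_prod_def power_mult_distrib algebra_simps)
      finally show ?thesis .
    qed
    then show "norm (?E j) \<le> \<omega> * \<tau> * (P * h) * norm (Y j)"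
      by (rule power2_le_imp_le) (intro mult_nonneg_nonneg c norm_ge_zero)
  qed
  also have "gn Y \<le> 2 * K" unfolding Y_def gn_flow_step[OF \<omega>_pos] by (rule gn_Z)
  finally show ?case
    using Suc.IH \<omega>_pos \<tau>_pos P_nonneg h_pos by (simp add: mult_left_mono distrib_right)
qed

definition "C\<^sub>S = sqrt (4 * K\<^sup>2 + 8 * K\<^sup>2 * (b - a) * (1 + T * P))"

text \<open>The factor \<open>M\<close> in the discrete Sobolev inequality cancels against
  \<open>h\<close> in the increments, which leaves a single \<omega> for the square.\<close>

lemma sup_Z:
  assumes n: "real n * \<tau> \<le> T" and j: "j < M"
  shows "norm (Z n j) \<le> C\<^sub>S * sqrt \<omega>"
proof -
  have hM: "real M * h = b - a" using M_pos by (simp add: h_def)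
  have "gn (\<lambda>j. Z n (Suc j) - Z n j) \<le> 2 * K * \<omega> * h * (1 + T * P)"
  proof -
    have "real n * (\<omega> * \<tau> * (P * h) * (2 * K)) = (real n * \<tau>) * (\<omega> * (P * h) * (2 * K))" by simp
    also have "\<dots> \<le> T * (\<omega> * (P * h) * (2 * K))"
      using n \<omega>_pos P_nonneg h_pos K_nonneg by (intro mult_right_mono) auto
    finally show ?thesis using gn_Z_increment[of n] by (simp add: algebra_simps)
  qed
  then have "gn (\<lambda>j. Z n (Suc j) - Z n j) * gn (Z n) \<le> (2 * K * \<omega> * h * (1 + T * P)) * (2 * K)"
    using gn_Z K_nonneg \<omega>_pos h_pos T_pos P_nonneg by (intro mult_mono) auto
  then have "2 * real M * (gn (\<lambda>j. Z n (Suc j) - Z n j) * gn (Z n)) \<le> 2 * real M * ((2 * K * \<omega> * h * (1 + T * P)) * (2 * K))"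
    by (intro mult_left_mono) auto
  also have "\<dots> = 8 * K\<^sup>2 * (real M * h) * (1 + T * P) * \<omega>"
    by (simp add: power2_eq_square algebra_simps)
  finally have "(norm (Z n j))\<^sup>2 \<le> (gn (Z n))\<^sup>2 + 8 * K\<^sup>2 * (b - a) * (1 + T * P) * \<omega>"
    using discrete_sobolev[of "Z n", OF Z_periodic j] unfolding hM mult.assoc[of "2 * real M"] by linarith
  also have "(gn (Z n))\<^sup>2 \<le> (2 * K)\<^sup>2" by (intro power_mono gn_Z) simp
  also have "(2 * K)\<^sup>2 \<le> 4 * K\<^sup>2 * \<omega>" using \<omega>1 mult_left_mono[of 1 \<omega> "4 * K\<^sup>2"] by (simp add: power_mult_distrib)
  finally have "(norm (Z n j))\<^sup>2 \<le> (4 * K\<^sup>2 + 8 * K\<^sup>2 * (b - a) * (1 + T * P)) * \<omega>"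
    by (simp add: distrib_right)
  then show ?thesis unfolding C\<^sub>S_def real_sqrt_mult[symmetric] by (rule real_le_rsqrt)
qed

definition "C\<^sub>D = 2 * (K + C\<^sub>S) * C\<^sub>E + K\<^sup>2 + 2 * K * C\<^sub>S"

lemma CS_nonneg: "0 \<le> C\<^sub>S"
  unfolding C\<^sub>S_def using K_nonneg P_nonneg T_pos ab by simp

text \<open>\<open>\<pi>\<close> stands for either coordinate projection of a pair, so that one
  argument serves both squares out of which the two densities are formed.\<close>

lemma density_error:
  fixes \<pi> :: "complex \<times> complex \<Rightarrow> complex"
  assumes n: "real n * \<tau> \<le> T" and \<pi>: "\<And>z z'. norm (\<pi> z - \<pi> z') \<le> norm (z - z')" "\<pi> 0 = 0"
    and R: "\<And>j. j < M \<Longrightarrow> norm (\<pi> (R (real n * \<tau>) j)) \<le> K"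
  shows "gn (\<lambda>j. (norm (\<pi> (R (real n * \<tau>) j)))\<^sup>2 - (norm (\<pi> (Z n j)))\<^sup>2) \<le> C\<^sub>D * (\<omega>\<^sup>2 * \<tau> + y / \<tau>)"
proof -
  let ?r = "\<lambda>j. norm (\<pi> (R (real n * \<tau>) j))" and ?z = "\<lambda>j. norm (\<pi> (Z n j))"
  let ?s = "sqrt \<omega>"
  have s: "1 \<le> ?s" "?s * ?s = \<omega>" using \<omega>1 by simp_all
  have z: "?z j \<le> norm (Z n j)" for j using \<pi>(1)[of "Z n j" 0] \<pi>(2) by simp
  have zS: "?z j \<le> C\<^sub>S * ?s" if "j < M" for j using order_trans[OF z sup_Z[OF n that]] .
  have Ks: "K \<le> K * ?s" using mult_left_mono[OF s(1) K_nonneg] by simp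
  have nn: "0 \<le> \<omega>\<^sup>2 * \<tau>" "0 \<le> y / \<tau>" using \<tau>_pos y_nonneg by auto
  have CS: "0 \<le> C\<^sub>S" by (rule CS_nonneg)
  show ?thesis
  proof (cases "\<omega> * ?s * \<tau> \<le> 1")
    case True
    have "gn (\<lambda>j. (?r j)\<^sup>2 - (?z j)\<^sup>2) \<le> ((K + C\<^sub>S) * ?s) * gn (\<lambda>j. Z n j - R (real n * \<tau>) j)"
    proof (rule gn_mult_bound)
      show "0 \<le> (K + C\<^sub>S) * ?s" using K_nonneg CS s by simp
      fix j assume j: "j < M"
      have "(?r j)\<^sup>2 - (?z j)\<^sup>2 = (?r j + ?z j) * (?r j - ?z j)" by (simp add: power2_eq_square algebra_simps)
      also have "norm \<dots> = (?r j + ?z j) * \<bar>?r j - ?z j\<bar>" by (simp add: abs_mult)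
      also have "\<dots> \<le> ((K + C\<^sub>S) * ?s) * norm (Z n j - R (real n * \<tau>) j)"
      proof (rule mult_mono)
        show "?r j + ?z j \<le> (K + C\<^sub>S) * ?s" using R[OF j] zS[OF j] Ks by (simp add: distrib_right)
        show "\<bar>?r j - ?z j\<bar> \<le> norm (Z n j - R (real n * \<tau>) j)"
          using norm_triangle_ineq3[of "\<pi> (R (real n * \<tau>) j)" "\<pi> (Z n j)"] \<pi>(1)[of "R (real n * \<tau>) j" "Z n j"]
          by (simp add: norm_minus_commute)
      qed (use K_nonneg CS s in auto)
      finally show "norm ((?r j)\<^sup>2 - (?z j)\<^sup>2) \<le> (K + C\<^sub>S) * ?s * norm (Z n j - R (real n * \<tau>) j)" .
    qed
    also have "\<dots> \<le> ((K + C\<^sub>S) * ?s) * (C\<^sub>E * (\<omega> * \<tau> + \<omega> ^ 3 * \<tau>\<^sup>2 + \<omega> * y))"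
      using K_nonneg CS s by (intro mult_left_mono global_error[OF n]) auto
    also have "\<dots> = ((K + C\<^sub>S) * C\<^sub>E) * (?s * (\<omega> * \<tau> + \<omega> ^ 3 * \<tau>\<^sup>2 + \<omega> * y))" by simp
    also have "\<dots> \<le> ((K + C\<^sub>S) * C\<^sub>E) * (2 * (\<omega>\<^sup>2 * \<tau> + y / \<tau>))"
    proof (rule mult_left_mono)
      have "?s * 1 \<le> ?s * ?s" using s by (intro mult_left_mono) auto
      then have "?s * (\<omega> * \<tau>) \<le> \<omega> * (\<omega> * \<tau>)" using s \<omega>_pos \<tau>_pos by (intro mult_right_mono) auto
      then have 1: "?s * (\<omega> * \<tau>) \<le> \<omega>\<^sup>2 * \<tau>" by (simp add: power2_eq_square)
      \<comment> \<open>The assumption \<omega>^(3/2) \<tau> \<le> 1 is split off from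
        \<omega>^(7/2) \<tau>^2 here, and from \<omega>^(3/2) y = (y/\<tau>) \<omega>^(3/2) \<tau>
        in the next estimate.\<close>
      have "(\<omega>\<^sup>2 * \<tau>) * (\<omega> * ?s * \<tau>) \<le> (\<omega>\<^sup>2 * \<tau>) * 1" using True nn by (intro mult_left_mono) auto
      then have 2: "?s * (\<omega> ^ 3 * \<tau>\<^sup>2) \<le> \<omega>\<^sup>2 * \<tau>" by (simp add: power2_eq_square power3_eq_cube mult_ac)
      have "(y / \<tau>) * (\<omega> * ?s * \<tau>) \<le> (y / \<tau>) * 1" using True nn by (intro mult_left_mono) auto
      then have 3: "?s * (\<omega> * y) \<le> y / \<tau>" using \<tau>_pos by (simp add: mult_ac)
      show "?s * (\<omega> * \<tau> + \<omega> ^ 3 * \<tau>\<^sup>2 + \<omega> * y) \<le> 2 * (\<omega>\<^sup>2 * \<tau> + y / \<tau>)"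
        unfolding distrib_left using 1 2 3 nn by linarith
      show "0 \<le> (K + C\<^sub>S) * C\<^sub>E" using K_nonneg CS CE_nonneg by simp
    qed
    also have "\<dots> = (2 * (K + C\<^sub>S) * C\<^sub>E) * (\<omega>\<^sup>2 * \<tau> + y / \<tau>)" by (simp only: mult_ac)
    also have "\<dots> \<le> C\<^sub>D * (\<omega>\<^sup>2 * \<tau> + y / \<tau>)"
      unfolding C\<^sub>D_def using K_nonneg CS nn by (intro mult_right_mono) auto
    finally show ?thesis .
  next
    case False
    have "gn (\<lambda>j. (?r j)\<^sup>2 - (?z j)\<^sup>2) \<le> gn (\<lambda>j. (?r j)\<^sup>2) + gn (\<lambda>j. - (?z j)\<^sup>2)"
      using gn_triangle[of "\<lambda>j. (?r j)\<^sup>2" "\<lambda>j. - (?z j)\<^sup>2"] by simp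
    also have "gn (\<lambda>j. (?r j)\<^sup>2) \<le> K\<^sup>2"
      using R by (intro gn_bound) (auto simp: power_mono)
    also have "gn (\<lambda>j. - (?z j)\<^sup>2) \<le> (C\<^sub>S * ?s) * gn (Z n)"
    proof (rule gn_mult_bound)
      show "0 \<le> C\<^sub>S * ?s" using CS s by simp
      show "norm (- (?z j)\<^sup>2) \<le> C\<^sub>S * ?s * norm (Z n j)" if "j < M" for j
        using mult_mono[OF zS[OF that] z[of j]] CS s by (simp add: power2_eq_square)
    qed
    also have "(C\<^sub>S * ?s) * gn (Z n) \<le> (C\<^sub>S * ?s) * (2 * K)" using CS s by (intro mult_left_mono gn_Z) auto
    finally have "gn (\<lambda>j. (?r j)\<^sup>2 - (?z j)\<^sup>2) \<le> K\<^sup>2 + (C\<^sub>S * ?s) * (2 * K)" by simp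
    also have "\<dots> \<le> (K\<^sup>2 + 2 * K * C\<^sub>S) * ?s"
      using mult_left_mono[OF s(1), of "K\<^sup>2"] by (simp add: algebra_simps)
    also have "\<dots> \<le> (K\<^sup>2 + 2 * K * C\<^sub>S) * (\<omega>\<^sup>2 * \<tau> + y / \<tau>)"
    proof (rule mult_left_mono)
      \<comment> \<open>With \<omega>^(3/2) \<tau> above 1, the size \<omega>^(1/2) of the densities
        is at most \<omega>^2 \<tau>.\<close>
      have "?s * 1 \<le> ?s * (\<omega> * ?s * \<tau>)" using False s by (intro mult_left_mono) auto
      also have "\<dots> = \<omega> * (?s * ?s) * \<tau>" by (simp only: mult_ac)
      finally show "?s \<le> \<omega>\<^sup>2 * \<tau> + y / \<tau>" unfolding s(2) using nn by (simp add: power2_eq_square)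
      show "0 \<le> K\<^sup>2 + 2 * K * C\<^sub>S" using K_nonneg CS by simp
    qed
    also have "\<dots> \<le> C\<^sub>D * (\<omega>\<^sup>2 * \<tau> + y / \<tau>)"
      unfolding C\<^sub>D_def using K_nonneg CS CE_nonneg nn by (intro mult_right_mono) auto
    finally show ?thesis .
  qed
qed

end

section \<open>Test functions\<close>

text \<open>Closed under differentiation, and rich enough for bump functions and their primitives.\<close>

inductive smooth_fun :: "(real \<Rightarrow> real) \<Rightarrow> bool" where
  const: "smooth_fun (\<lambda>_. c)"
| flat: "smooth_fun (\<lambda>x. if 0 < x then (1 / x) ^ n * exp (- (1 / x)) else 0)"
| add: "smooth_fun f \<Longrightarrow> smooth_fun g \<Longrightarrow> smooth_fun (\<lambda>x. f x + g x)"
| mult: "smooth_fun f \<Longrightarrow> smooth_fun g \<Longrightarrow> smooth_fun (\<lambda>x. f x * g x)"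
| affine: "smooth_fun f \<Longrightarrow> smooth_fun (\<lambda>x. f (c * x + d))"
| prim: "smooth_fun f \<Longrightarrow> (\<And>x. (F has_real_derivative f x) (at x)) \<Longrightarrow> smooth_fun F"

text \<open>The inequality 1 + t \<le> exp t at t = z/n, raised to the power n.\<close>

lemma power_le_exp: "0 \<le> z \<Longrightarrow> z ^ n \<le> real n ^ n * exp z"
proof (cases "n = 0")
  case False
  assume z: "0 \<le> z"
  have "z / real n \<le> exp (z / real n)" using exp_ge_add_one_self[of "z / real n"] by linarith
  then have "(z / real n) ^ n \<le> exp (z / real n) ^ n" using z by (intro power_mono) auto
  also have "\<dots> = exp z" using False exp_divide_power_eq[of n z] by simp
  finally show ?thesis using False by (simp add: power_divide field_simps)
qed simp

text \<open>The derivative stays in the span of the same family, so smoothness of all orders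
  follows. The only delicate point is 0, where \<open>power_le_exp\<close> with exponent n + 2
  bounds the function by a multiple of z^2.\<close>

lemma flat_deriv:
  fixes n :: nat
  defines "E \<equiv> \<lambda>n x. if 0 < x then (1 / x) ^ n * exp (- (1 / x)) else (0::real)"
  shows "(E n has_real_derivative E (n + 2) x + (- real n) * E (n + 1) x) (at x)"
proof -
  consider "0 < x" | "x < 0" | "x = 0" by linarith
  then show ?thesis
  proof cases
    case 1
    have "((\<lambda>x. (1 / x) ^ n * exp (- (1 / x))) has_real_derivative
        (1 / x) ^ (n + 2) * exp (- (1 / x)) + (- real n) * ((1 / x) ^ (n + 1) * exp (- (1 / x)))) (at x)"
    proof -
      have d: "((\<lambda>x. (1 / x) ^ n * exp (- (1 / x))) has_real_derivative
        (real n * (1 / x) ^ (n - 1) * (- (1 / x\<^sup>2))) * exp (- (1 / x)) + (1 / x) ^ n * (exp (- (1 / x)) * (1 / x\<^sup>2))) (at x)"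
        using 1 by (auto intro!: derivative_eq_intros simp: power2_eq_square)
      have e1: "real n * (1 / x) ^ (n - 1) * (- (1 / x\<^sup>2)) = (- real n) * (1 / x) ^ (n + 1)"
        using 1 by (cases n) (simp_all add: power2_eq_square algebra_simps add_divide_distrib diff_divide_distrib)
      have e2: "(1 / x) ^ n * (exp (- (1 / x)) * (1 / x\<^sup>2)) = (1 / x) ^ (n + 2) * exp (- (1 / x))"
        using 1 by (simp add: power2_eq_square power_add)
      show ?thesis using d unfolding e1 e2 by (simp only: mult.assoc add.commute)
    qed
    moreover have ev: "\<forall>\<^sub>F z in nhds x. (1 / z) ^ n * exp (- (1 / z)) = E n z"
      using eventually_nhds_in_open[of "{0<..}" x] 1 by (auto elim!: eventually_mono simp: E_def)
    ultimately show ?thesis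
      using DERIV_cong_ev[OF refl ev refl] 1 by (simp add: E_def)
  next
    case 2
    have ev: "\<forall>\<^sub>F z in nhds x. 0 = E n z"
      using eventually_nhds_in_open[of "{..<0}" x] 2 by (auto elim!: eventually_mono simp: E_def)
    have "((\<lambda>_. 0) has_real_derivative 0) (at x)" by simp
    then have "(E n has_real_derivative 0) (at x)"
      using DERIV_cong_ev[OF refl ev refl] by blast
    then show ?thesis using 2 by (simp add: E_def)
  next
    case 3
    let ?C = "real (n + 2) ^ (n + 2)"
    have bd: "\<bar>E n z\<bar> \<le> ?C * z\<^sup>2" for z
    proof (cases "0 < z")
      case True
      have "(1 / z) ^ (n + 2) \<le> ?C * exp (1 / z)" using True by (intro power_le_exp) simp
      then have "(1 / z) ^ (n + 2) * exp (- (1 / z)) \<le> ?C * exp (1 / z) * exp (- (1 / z))"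
        by (rule mult_right_mono) simp
      also have "\<dots> = ?C" by (simp only: mult.assoc exp_minus_inverse mult_1_right)
      finally have "((1 / z) ^ n * exp (- (1 / z))) * (1 / z)\<^sup>2 \<le> ?C" by (simp only: power_add mult_ac)
      then have "((1 / z) ^ n * exp (- (1 / z))) * (1 / z)\<^sup>2 * z\<^sup>2 \<le> ?C * z\<^sup>2" by (rule mult_right_mono) simp
      moreover have "w * (1 / z)\<^sup>2 * z\<^sup>2 = w" for w using True by (simp add: power2_eq_square)
      ultimately have "(1 / z) ^ n * exp (- (1 / z)) \<le> ?C * z\<^sup>2" by (simp only:)
      then show ?thesis using True by (simp add: E_def abs_mult)
    qed (simp add: E_def)
    have "(\<lambda>h. (E n (0 + h) - E n 0) / h) \<midarrow>0\<rightarrow> 0"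
    proof (rule Lim_null_comparison)
      show "\<forall>\<^sub>F h in at 0. norm ((E n (0 + h) - E n 0) / h) \<le> ?C * \<bar>h\<bar>"
      proof (rule eventually_at_filter[THEN iffD2], rule always_eventually, intro allI impI)
        fix h :: real assume "h \<noteq> 0"
        then have "\<bar>E n h\<bar> / \<bar>h\<bar> \<le> ?C * h\<^sup>2 / \<bar>h\<bar>" by (intro divide_right_mono bd) auto
        also have "h\<^sup>2 = \<bar>h\<bar> * \<bar>h\<bar>" by (simp add: power2_eq_square)
        also have "c * (d * d) / d = c * d" if "d \<noteq> 0" for c d :: real using that by simp
        then have "?C * (\<bar>h\<bar> * \<bar>h\<bar>) / \<bar>h\<bar> = ?C * \<bar>h\<bar>" using \<open>h \<noteq> 0\<close> by (simp only: abs_eq_0 not_False_eq_True)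
        finally show "norm ((E n (0 + h) - E n 0) / h) \<le> ?C * \<bar>h\<bar>" by (simp add: E_def)
      qed
      have "((\<lambda>h. ?C * \<bar>h\<bar>) \<longlongrightarrow> ?C * \<bar>0\<bar>) (at 0)" by (intro tendsto_intros)
      then show "((\<lambda>h. ?C * \<bar>h\<bar>) \<longlongrightarrow> 0) (at 0)" by simp
    qed
    then have "(E n has_real_derivative 0) (at 0)" by (simp only: DERIV_def)
    then show ?thesis using 3 by (simp add: E_def)
  qed
qed

lemma smooth_fun_derivative:
  "smooth_fun F \<Longrightarrow> \<exists>f. smooth_fun f \<and> (\<forall>x. (F has_real_derivative f x) (at x))"
proof (induction rule: smooth_fun.induct)
  case (const c)
  show ?case by (rule exI[of _ "\<lambda>_. 0"]) (auto intro: smooth_fun.const)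
next
  case (flat n)
  show ?case
    by (rule exI, rule conjI[OF smooth_fun.add[OF smooth_fun.flat[of "n + 2"] smooth_fun.mult[OF smooth_fun.const[of "- real n"] smooth_fun.flat[of "n + 1"]]]])
      (rule allI, rule flat_deriv)
next
  case (add f g)
  then obtain f' g' where "smooth_fun f'" "smooth_fun g'"
    "\<And>x. (f has_real_derivative f' x) (at x)" "\<And>x. (g has_real_derivative g' x) (at x)" by blast
  then show ?case
    by (intro exI[of _ "\<lambda>x. f' x + g' x"]) (auto intro: smooth_fun.add DERIV_add)
next
  case (mult f g)
  then obtain f' g' where d: "smooth_fun f'" "smooth_fun g'"
    "\<And>x. (f has_real_derivative f' x) (at x)" "\<And>x. (g has_real_derivative g' x) (at x)" by blast
  have "smooth_fun (\<lambda>x. f' x * g x + g' x * f x)"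
    by (intro smooth_fun.add smooth_fun.mult d mult.hyps)
  then show ?case using DERIV_mult[OF d(3) d(4)] by blast
next
  case (affine f c e)
  then obtain f' where d: "smooth_fun f'" "\<And>x. (f has_real_derivative f' x) (at x)" by blast
  have "((\<lambda>x. f (c * x + e)) has_real_derivative f' (c * x + e) * c) (at x)" for x
    by (rule DERIV_chain2[where f=f and g="\<lambda>x. c * x + e", OF d(2)]) (auto intro!: derivative_eq_intros)
  moreover have "smooth_fun (\<lambda>x. f' (c * x + e) * c)"
    by (rule smooth_fun.mult[OF smooth_fun.affine[OF d(1)] smooth_fun.const])
  ultimately show ?case by blast
next
  case (prim f F)
  then show ?case by blast
qed

lemma smooth_fun_deriv:
  assumes "smooth_fun F"
  shows "smooth_fun (deriv F)" "(F has_real_derivative deriv F x) (at x)"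
proof -
  obtain f where f: "smooth_fun f" "\<And>x. (F has_real_derivative f x) (at x)"
    using smooth_fun_derivative[OF assms] by blast
  have "deriv F = f" by (rule ext) (rule DERIV_imp_deriv[OF f(2)])
  then show "smooth_fun (deriv F)" "(F has_real_derivative deriv F x) (at x)" using f by simp_all
qed

lemma smooth_fun_higher_deriv: "smooth_fun F \<Longrightarrow> smooth_fun ((deriv ^^ k) F)"
  by (induction k) (auto intro: smooth_fun_deriv)

lemma smooth_fun_continuous: "smooth_fun F \<Longrightarrow> continuous_on A F"
  by (intro DERIV_continuous_on[of A F "deriv F"] DERIV_subset[OF smooth_fun_deriv(2)]) auto

lemma test_functionsI:
  assumes "smooth_fun \<phi>" "\<And>x. \<phi> x \<noteq> 0 \<Longrightarrow> x \<in> {c..d}" "{c..d} \<subseteq> A"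
  shows "\<phi> \<in> test_functions A"
proof -
  have sub: "closure {x. \<phi> x \<noteq> 0} \<subseteq> {c..d}" using assms(2) by (intro closure_minimal) auto
  moreover have "compact (closure {x. \<phi> x \<noteq> 0})"
  proof -
    have "{x. \<phi> x \<noteq> 0} \<subseteq> {c..d}" using assms(2) by auto
    then have "bounded {x. \<phi> x \<noteq> 0}" by (rule bounded_subset[OF bounded_closed_interval])
    then show ?thesis by (simp add: compact_closure)
  qed
  moreover have "(deriv ^^ k) \<phi> field_differentiable (at x)" for k x
    using smooth_fun_deriv(2)[OF smooth_fun_higher_deriv[OF assms(1)]] field_differentiable_def by blast
  ultimately show ?thesis using assms(3) unfolding test_functions_def by auto
qed

lemma test_functions_deriv: "\<phi> \<in> test_functions A \<Longrightarrow> deriv \<phi> \<in> test_functions A"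
proof -
  assume \<phi>: "\<phi> \<in> test_functions A"
  have sm: "(deriv ^^ k) \<phi> field_differentiable (at x)" for k x using \<phi> by (simp add: test_functions_def)
  have "{x. deriv \<phi> x \<noteq> 0} \<subseteq> closure {x. \<phi> x \<noteq> 0}"
  proof (rule subsetI, rule ccontr)
    fix x assume x: "x \<in> {x. deriv \<phi> x \<noteq> 0}" "x \<notin> closure {x. \<phi> x \<noteq> 0}"
    have "open (- closure {x. \<phi> x \<noteq> 0})" by auto
    then have "\<forall>\<^sub>F z in nhds x. z \<in> - closure {x. \<phi> x \<noteq> 0}" using x by (intro eventually_nhds_in_open) auto
    then have "\<forall>\<^sub>F z in nhds x. \<phi> z = 0"
    proof (rule eventually_mono)
      fix z assume "z \<in> - closure {x. \<phi> x \<noteq> 0}"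
      then show "\<phi> z = 0" using closure_subset[of "{x. \<phi> x \<noteq> 0}"] by auto
    qed
    from DERIV_cong_ev[OF refl this refl] have "(\<phi> has_real_derivative 0) (at x)" by simp
    then have "deriv \<phi> x = 0" by (rule DERIV_imp_deriv)
    then show False using x by simp
  qed
  then have sub: "closure {x. deriv \<phi> x \<noteq> 0} \<subseteq> closure {x. \<phi> x \<noteq> 0}" by (intro closure_minimal) auto
  have c: "compact (closure {x. \<phi> x \<noteq> 0})" "closure {x. \<phi> x \<noteq> 0} \<subseteq> A" using \<phi> by (auto simp: test_functions_def)
  have "closure {x. deriv \<phi> x \<noteq> 0} = closure {x. deriv \<phi> x \<noteq> 0} \<inter> closure {x. \<phi> x \<noteq> 0}" using sub by auto
  then have "compact (closure {x. deriv \<phi> x \<noteq> 0})" using closed_Int_compact[OF closed_closure c(1)] by metis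
  moreover have "(deriv ^^ k) (deriv \<phi>) field_differentiable (at x)" for k x
    using sm[of "Suc k"] by (simp add: funpow_swap1)
  ultimately show ?thesis using sub c(2) by (auto simp: test_functions_def)
qed

lemma test_functions_continuous:
  assumes "\<phi> \<in> test_functions A" shows "continuous_on B ((deriv ^^ k) \<phi>)"
  using assms by (intro continuous_at_imp_continuous_on ballI field_differentiable_imp_continuous_at)
    (auto simp: test_functions_def)

lemma test_functions_has_deriv:
  assumes "\<phi> \<in> test_functions A" shows "(\<phi> has_real_derivative deriv \<phi> x) (at x)"
proof -
  have "(deriv ^^ 0) \<phi> field_differentiable (at x)" using assms unfolding test_functions_def by blast
  then have "\<phi> field_differentiable (at x)" by simp
  then show ?thesis by (simp only: DERIV_deriv_iff_field_differentiable)
qed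

lemma test_functions_zero: "\<phi> \<in> test_functions A \<Longrightarrow> x \<notin> A \<Longrightarrow> \<phi> x = 0"
  unfolding test_functions_def using closure_subset[of "{x. \<phi> x \<noteq> 0}"] by blast

text \<open>The standard bump on the unit interval. The exponents 0 and the form
  \<open>-1 * z + 1\<close> make it literally an instance of the introduction rules of
  \<open>smooth_fun\<close>.\<close>

definition bump :: "real \<Rightarrow> real"
  where "bump z = (if 0 < z then (1 / z) ^ 0 * exp (- (1 / z)) else 0) *
    (if 0 < -1 * z + 1 then (1 / (-1 * z + 1)) ^ 0 * exp (- (1 / (-1 * z + 1))) else 0)"

lemma smooth_bump: "smooth_fun bump"
  unfolding bump_def[abs_def]
  by (rule smooth_fun.mult[OF smooth_fun.flat smooth_fun.affine[OF smooth_fun.flat]])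

lemma bump_nonneg: "0 \<le> bump z" by (simp add: bump_def)

lemma bump_outside: "z \<le> 0 \<or> 1 \<le> z \<Longrightarrow> bump z = 0" by (auto simp: bump_def)

lemma bump_pos: "0 < z \<Longrightarrow> z < 1 \<Longrightarrow> 0 < bump z" by (simp add: bump_def)

text \<open>The lower limit lies strictly to the left of the support, so that 0 is an interior point
  when the fundamental theorem is applied.\<close>

definition bump_int :: "real \<Rightarrow> real"
  where "bump_int x = integral {-1..x} bump"

lemma bump_int_deriv: "(bump_int has_real_derivative bump x) (at x)"
proof (cases "x < 0")
  case True
  have z: "bump_int y = 0" if "y < 0" for y
  proof -
    have "integral {-1..y} bump = integral {-1..y} (\<lambda>_. 0)"
      using that by (intro integral_cong) (auto intro: bump_outside)
    then show ?thesis by (simp add: bump_int_def)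
  qed
  have "\<forall>\<^sub>F y in nhds x. bump_int y = 0"
    using eventually_nhds_in_open[of "{..<0}" x] True z by (auto elim!: eventually_mono)
  from DERIV_cong_ev[OF refl this refl] have "(bump_int has_real_derivative 0) (at x)" by simp
  then show ?thesis using True bump_outside[of x] by simp
next
  case False
  have "(bump_int has_real_derivative bump x) (at x within {-1..x+1})"
    unfolding bump_int_def[abs_def]
    by (rule integral_has_real_derivative[OF smooth_fun_continuous[OF smooth_bump]]) (use False in auto)
  then show ?thesis using False by (subst (asm) at_within_interior) auto
qed

lemma bump_int_mono: "x \<le> y \<Longrightarrow> bump_int x \<le> bump_int y"
  by (rule DERIV_nonneg_imp_nondecreasing[of x y]) (auto intro: bump_int_deriv bump_nonneg)

lemma bump_int_0: "x \<le> 0 \<Longrightarrow> bump_int x = 0"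
proof -
  assume "x \<le> 0"
  then have "integral {-1..x} bump = integral {-1..x} (\<lambda>_. 0)"
    by (intro integral_cong) (auto intro: bump_outside)
  then show ?thesis by (simp add: bump_int_def)
qed

lemma bump_int_1: "1 \<le> x \<Longrightarrow> bump_int x = bump_int 1"
proof -
  assume x: "1 \<le> x"
  have "bump_int x \<le> bump_int 1"
    by (rule DERIV_nonpos_imp_nonincreasing[OF x]) (use bump_int_deriv bump_outside in fastforce)
  then show ?thesis using bump_int_mono[OF x] by simp
qed

lemma bump_int_pos: "0 < bump_int 1"
proof -
  have "bump_int 0 < bump_int 1"
  proof (rule ccontr)
    assume "\<not> bump_int 0 < bump_int 1"
    then have eq: "bump_int y = 0" if "y \<in> {0..1}" for y
      using bump_int_mono[of 0 y] bump_int_mono[of y 1] bump_int_0[of 0] that by auto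
    have "\<forall>\<^sub>F y in nhds (1/2 :: real). bump_int y = 0"
      using eventually_nhds_in_open[of "{0<..<1}" "1/2 :: real"] eq by (auto elim!: eventually_mono)
    from DERIV_cong_ev[OF refl this refl] have "(bump_int has_real_derivative 0) (at (1/2))" by simp
    then have "bump (1/2) = 0" by (rule DERIV_unique[OF bump_int_deriv])
    then show False using bump_pos[of "1/2"] by simp
  qed
  then show ?thesis using bump_int_0[of 0] by simp
qed

lemma bump_int_range: "0 \<le> bump_int x" "bump_int x \<le> bump_int 1"
  using bump_int_mono[of 0 x] bump_int_mono[of x 1] bump_int_0[of x] bump_int_1[of x] bump_int_0[of 0] bump_int_pos
  by (cases "x \<le> 0"; cases "1 \<le> x"; force)+

text \<open>Supported to the right of \<open>x\<close> and not normalised: its mass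
  \<open>bump_int 1\<close> is carried through the estimates and cancelled at the end.\<close>

definition mollifier :: "real \<Rightarrow> real \<Rightarrow> real \<Rightarrow> real"
  where "mollifier \<delta> x z = 1 / \<delta> * bump (1 / \<delta> * z + (- x / \<delta>))"

definition mollifier_int :: "real \<Rightarrow> real \<Rightarrow> real \<Rightarrow> real"
  where "mollifier_int \<delta> x z = bump_int (1 / \<delta> * z + (- x / \<delta>))"

lemma mollifier_int_deriv: "(mollifier_int \<delta> x has_real_derivative mollifier \<delta> x z) (at z)"
proof -
  have "((\<lambda>z. bump_int (1 / \<delta> * z + (- x / \<delta>))) has_real_derivative
      bump (1 / \<delta> * z + (- x / \<delta>)) * (1 / \<delta>)) (at z)"
  proof (rule DERIV_chain2[OF bump_int_deriv])
    have "((\<lambda>z. c * z + d) has_real_derivative c) (at z)" for c d :: real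
      by (auto intro!: derivative_eq_intros)
    then show "((\<lambda>z. 1 / \<delta> * z + (- x / \<delta>)) has_real_derivative 1 / \<delta>) (at z)" .
  qed
  then show ?thesis by (simp add: mollifier_int_def[abs_def] mollifier_def mult.commute)
qed

lemma smooth_mollifier: "smooth_fun (mollifier \<delta> x)" "smooth_fun (mollifier_int \<delta> x)"
proof -
  show 1: "smooth_fun (mollifier \<delta> x)"
    unfolding mollifier_def[abs_def]
    by (rule smooth_fun.mult[OF smooth_fun.const smooth_fun.affine[OF smooth_bump]])
  show "smooth_fun (mollifier_int \<delta> x)" by (rule smooth_fun.prim[OF 1 mollifier_int_deriv])
qed

lemma mollifier_nonneg: "0 < \<delta> \<Longrightarrow> 0 \<le> mollifier \<delta> x z"
  by (simp add: mollifier_def bump_nonneg)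

lemma scaled_arg: "0 < \<delta> \<Longrightarrow> 1 / \<delta> * z + (- x / \<delta>) = (z - x) / \<delta>" for \<delta> z x :: real
  by (simp add: diff_divide_distrib)

lemma mollifier_outside: "0 < \<delta> \<Longrightarrow> z \<notin> {x..x + \<delta>} \<Longrightarrow> mollifier \<delta> x z = 0"
proof -
  assume \<delta>: "0 < \<delta>" and z: "z \<notin> {x..x + \<delta>}"
  have "(z - x) / \<delta> \<le> 0 \<or> 1 \<le> (z - x) / \<delta>" using \<delta> z by (auto simp: field_simps)
  then have "bump ((z - x) / \<delta>) = 0" by (rule bump_outside)
  then show ?thesis by (simp only: mollifier_def scaled_arg[OF \<delta>] mult_zero_right)
qed

lemma mollifier_int_left:
  assumes "0 < \<delta>" "z \<le> x" shows "mollifier_int \<delta> x z = 0"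
proof -
  have "(z - x) / \<delta> \<le> 0" using assms by (simp add: divide_nonpos_pos)
  then show ?thesis unfolding mollifier_int_def scaled_arg[OF assms(1)] by (rule bump_int_0)
qed

lemma mollifier_int_right:
  assumes "0 < \<delta>" "x + \<delta> \<le> z" shows "mollifier_int \<delta> x z = bump_int 1"
proof -
  have "1 \<le> (z - x) / \<delta>" using assms by (simp add: field_simps)
  then show ?thesis unfolding mollifier_int_def scaled_arg[OF assms(1)] by (rule bump_int_1)
qed

section \<open>Supremum and Lipschitz bounds by duality with test functions\<close>

context real_interval
begin

lemma integrable_continuous:
  fixes f :: "real \<Rightarrow> 'v::euclidean_space"
  assumes "continuous_on {a..b} f" shows "integrable M\<^sub>S f" "(LINT x|M\<^sub>S. f x) = integral {a..b} f"
proof -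
  have "compact (f ` {a..b})" using assms by (intro compact_continuous_image) auto
  then obtain K where K: "\<forall>y\<in>f ` {a..b}. norm y \<le> K" using compact_imp_bounded bounded_iff by metis
  have "f \<in> borel_measurable M\<^sub>S"
    by (rule continuous_imp_measurable_on_sets_lebesgue[OF continuous_on_subset[OF assms]]) auto
  then show i: "integrable M\<^sub>S f" by (rule integrable_bounded[of f K]) (use K in auto)
  show "(LINT x|M\<^sub>S. f x) = integral {a..b} f"
    using lebesgue_integral_eq_integral[OF i] by (simp add: integral_open_interval_real)
qed

lemma set_integral_S: "(LINT x:S|lebesgue. f x) = (LINT x|M\<^sub>S. f x)"
  for f :: "real \<Rightarrow> 'v::{banach, second_countable_topology}"
  by (simp add: set_lebesgue_integral_def integral_restrict_space)

lemma integral_mollifier: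
  assumes "0 < \<delta>" "a < x" "x + \<delta> < b"
  shows "(LINT z|M\<^sub>S. mollifier \<delta> x z) = bump_int 1"
proof -
  have "(mollifier \<delta> x has_integral (mollifier_int \<delta> x b - mollifier_int \<delta> x a)) {a..b}"
    using ab by (intro fundamental_theorem_of_calculus)
      (auto simp flip: has_real_derivative_iff_has_vector_derivative intro: DERIV_subset mollifier_int_deriv)
  then have "integral {a..b} (mollifier \<delta> x) = bump_int 1"
    using assms by (simp add: integral_unique mollifier_int_left mollifier_int_right)
  then show ?thesis
    using integrable_continuous(2)[OF smooth_fun_continuous[OF smooth_mollifier(1)]] by simp
qed

lemma mollifier_approx:
  fixes g :: "real \<Rightarrow> 'v::euclidean_space"
  assumes g: "continuous_on {a..b} g" and \<delta>: "0 < \<delta>" "a < x" "x + \<delta> < b"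
    and \<epsilon>: "\<And>z. z \<in> {x..x + \<delta>} \<Longrightarrow> norm (g z - g x) \<le> \<epsilon>"
  shows "norm ((LINT z|M\<^sub>S. mollifier \<delta> x z *\<^sub>R g z) - bump_int 1 *\<^sub>R g x) \<le> bump_int 1 * \<epsilon>"
proof -
  have c: "continuous_on {a..b} (mollifier \<delta> x)" by (rule smooth_fun_continuous[OF smooth_mollifier(1)])
  have i: "integrable M\<^sub>S (\<lambda>z. mollifier \<delta> x z *\<^sub>R g z)" "integrable M\<^sub>S (\<lambda>z. mollifier \<delta> x z *\<^sub>R g x)"
    "integrable M\<^sub>S (\<lambda>z. mollifier \<delta> x z *\<^sub>R (g z - g x))" "integrable M\<^sub>S (\<lambda>z. mollifier \<delta> x z * \<epsilon>)"
    by (intro integrable_continuous continuous_intros c g)+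
  have "(LINT z|M\<^sub>S. mollifier \<delta> x z *\<^sub>R g x) = bump_int 1 *\<^sub>R g x"
    using integrable_continuous(1)[OF c] by (simp add: integral_mollifier[OF \<delta>])
  then have "(LINT z|M\<^sub>S. mollifier \<delta> x z *\<^sub>R g z) - bump_int 1 *\<^sub>R g x = (LINT z|M\<^sub>S. mollifier \<delta> x z *\<^sub>R (g z - g x))"
    using i by (simp add: scaleR_diff_right)
  also have "norm \<dots> \<le> (LINT z|M\<^sub>S. mollifier \<delta> x z * \<epsilon>)"
  proof (rule order_trans[OF integral_norm_bound integral_mono])
    show "integrable M\<^sub>S (\<lambda>z. norm (mollifier \<delta> x z *\<^sub>R (g z - g x)))" by (rule integrable_norm[OF i(3)])
    show "norm (mollifier \<delta> x z *\<^sub>R (g z - g x)) \<le> mollifier \<delta> x z * \<epsilon>" for z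
      using \<epsilon>[of z] mollifier_outside[OF \<delta>(1), of z x] mollifier_nonneg[OF \<delta>(1), of x z]
      by (cases "z \<in> {x..x + \<delta>}") (auto intro: mult_left_mono)
  qed (rule i)
  also have "\<dots> = bump_int 1 * \<epsilon>" using integral_mollifier[OF \<delta>] by simp
  finally show ?thesis .
qed

lemma right_modulus:
  fixes g :: "real \<Rightarrow> 'v::euclidean_space"
  assumes g: "continuous_on {a..b} g" and x: "x \<in> S" and \<epsilon>: "0 < \<epsilon>"
  obtains \<delta>0 where "0 < \<delta>0" "x + \<delta>0 < b" "\<And>z. z \<in> {x..x + \<delta>0} \<Longrightarrow> norm (g z - g x) \<le> \<epsilon>"
proof -
  obtain d where d: "0 < d" "\<And>z. z \<in> {a..b} \<Longrightarrow> dist z x < d \<Longrightarrow> dist (g z) (g x) < \<epsilon>"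
    using g x \<epsilon> unfolding continuous_on_iff by (metis atLeastAtMost_iff greaterThanLessThan_iff less_imp_le)
  let ?d = "min (d / 2) ((b - x) / 2)"
  show ?thesis
  proof (rule that[of ?d])
    show "0 < ?d" "x + ?d < b" using d x by (auto simp: min_def field_simps)
    fix z assume "z \<in> {x..x + ?d}"
    then have "z \<in> {a..b}" "dist z x < d" using x d by (auto simp: dist_real_def min_def field_simps split: if_splits)
    then show "norm (g z - g x) \<le> \<epsilon>" using d(2) by (simp add: dist_norm less_imp_le)
  qed
qed

text \<open>Duality between L1 and the supremum: mollifiers concentrate at an interior point, and
  continuity extends the bound to the endpoints.\<close>

lemma sup_bound_of_weak:
  fixes g :: "real \<Rightarrow> 'v::euclidean_space"
  assumes g: "continuous_on {a..b} g"
    and w: "\<And>\<phi>. \<phi> \<in> test_functions S \<Longrightarrow> norm (LINT x|M\<^sub>S. \<phi> x *\<^sub>R g x) \<le> C * (LINT x|M\<^sub>S. \<bar>\<phi> x\<bar>)"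
    and x: "x \<in> {a..b}"
  shows "norm (g x) \<le> C"
proof -
  have "norm (g x) \<le> C" if x: "x \<in> S" for x
  proof (rule field_le_epsilon)
    fix \<epsilon> :: real assume \<epsilon>: "0 < \<epsilon>"
    obtain \<delta> where \<delta>: "0 < \<delta>" "x + \<delta> < b" "\<And>z. z \<in> {x..x + \<delta>} \<Longrightarrow> norm (g z - g x) \<le> \<epsilon>"
      by (rule right_modulus[OF g x \<epsilon>]) (rule that)
    have a: "a < x" using x by simp
    have t: "mollifier \<delta> x \<in> test_functions S"
      by (rule test_functionsI[OF smooth_mollifier(1), of _ _ x "x + \<delta>"])
        (use mollifier_outside[OF \<delta>(1)] x \<delta> in auto)
    have "norm (bump_int 1 *\<^sub>R g x) \<le> norm (LINT z|M\<^sub>S. mollifier \<delta> x z *\<^sub>R g z)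
        + norm ((LINT z|M\<^sub>S. mollifier \<delta> x z *\<^sub>R g z) - bump_int 1 *\<^sub>R g x)"
      by (metis norm_minus_commute norm_triangle_sub)
    also have "\<dots> \<le> C * (LINT z|M\<^sub>S. \<bar>mollifier \<delta> x z\<bar>) + bump_int 1 * \<epsilon>"
      by (intro add_mono w t mollifier_approx g \<delta> a)
    also have "(LINT z|M\<^sub>S. \<bar>mollifier \<delta> x z\<bar>) = bump_int 1"
      using integral_mollifier[OF \<delta>(1) a \<delta>(2)] mollifier_nonneg[OF \<delta>(1)] by simp
    finally have "bump_int 1 * norm (g x) \<le> bump_int 1 * (C + \<epsilon>)"
      using bump_int_pos by (simp add: algebra_simps)
    then show "norm (g x) \<le> C + \<epsilon>" using bump_int_pos by simp
  qed
  then have "\<forall>x\<in>S. norm (g x) \<le> C" by blast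
  moreover have "closure S = {a..b}" using ab by (simp add: closure_greaterThanLessThan)
  ultimately show ?thesis using continuous_on_closure_norm_le[of S g C x] g x by simp
qed

text \<open>The test function whose derivative is a mollifier at x minus one at y is nearly a
  multiple of the indicator of the interval between them. Its L1 norm is proportional to y - x up to
  \<delta>, while pairing its derivative with \<open>g\<close> produces nearly g x - g y. With C = 0
  this says that a vanishing weak derivative makes \<open>g\<close> constant.\<close>

lemma lipschitz_of_weak:
  fixes g :: "real \<Rightarrow> 'v::euclidean_space"
  assumes g: "continuous_on {a..b} g" and C: "0 \<le> C"
    and w: "\<And>\<phi>. \<phi> \<in> test_functions S \<Longrightarrow> norm (LINT x|M\<^sub>S. deriv \<phi> x *\<^sub>R g x) \<le> C * (LINT x|M\<^sub>S. \<bar>\<phi> x\<bar>)"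
  shows "C-lipschitz_on {a..b} g"
proof -
  let ?c = "bump_int 1"
  have main: "norm (g x - g y) \<le> C * (y - x)" if x: "x \<in> S" and y: "y \<in> S" and xy: "x < y" for x y
  proof (rule field_le_epsilon)
    fix \<epsilon> :: real assume \<epsilon>: "0 < \<epsilon>"
    \<comment> \<open>The divisor 2 + C provides one share for each of the two mollification errors
      and C shares for the overhang \<delta> of the support.\<close>
    have \<epsilon>': "0 < \<epsilon> / (2 + C)" using \<epsilon> C by simp
    obtain \<delta>1 where \<delta>1: "0 < \<delta>1" "x + \<delta>1 < b" "\<And>z. z \<in> {x..x + \<delta>1} \<Longrightarrow> norm (g z - g x) \<le> \<epsilon> / (2 + C)"
      by (rule right_modulus[OF g x \<epsilon>']) (rule that)
    obtain \<delta>2 where \<delta>2: "0 < \<delta>2" "y + \<delta>2 < b" "\<And>z. z \<in> {y..y + \<delta>2} \<Longrightarrow> norm (g z - g y) \<le> \<epsilon> / (2 + C)"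
      by (rule right_modulus[OF g y \<epsilon>']) (rule that)
    define \<delta> where "\<delta> = min (min \<delta>1 \<delta>2) (\<epsilon> / (2 + C))"
    have \<delta>: "0 < \<delta>" "\<delta> \<le> \<delta>1" "\<delta> \<le> \<delta>2" "\<delta> \<le> \<epsilon> / (2 + C)" using \<delta>1 \<delta>2 \<epsilon>' by (auto simp: \<delta>_def)
    have ax: "a < x" "x + \<delta> < b" "a < y" "y + \<delta> < b" using x y \<delta> \<delta>1 \<delta>2 by auto
    define \<phi> where "\<phi> = (\<lambda>z. mollifier_int \<delta> x z + (-1) * mollifier_int \<delta> y z)"
    have sm: "smooth_fun \<phi>"
      unfolding \<phi>_def
      by (rule smooth_fun.add[OF smooth_mollifier(2) smooth_fun.mult[OF smooth_fun.const smooth_mollifier(2)]])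
    have t: "\<phi> \<in> test_functions S"
    proof (rule test_functionsI[OF sm, of x "y + \<delta>"])
      show "{x..y + \<delta>} \<subseteq> S" using ax by auto
      fix z assume z: "\<phi> z \<noteq> 0"
      show "z \<in> {x..y + \<delta>}"
      proof (rule ccontr)
        assume "z \<notin> {x..y + \<delta>}"
        then have "z \<le> x \<or> y + \<delta> \<le> z" by auto
        then show False using z xy \<delta>(1)
          by (auto simp: \<phi>_def mollifier_int_left mollifier_int_right)
      qed
    qed
    have d: "deriv \<phi> z = mollifier \<delta> x z - mollifier \<delta> y z" for z
      unfolding \<phi>_def by (rule DERIV_imp_deriv) (auto intro!: derivative_eq_intros mollifier_int_deriv)
    have \<phi>b: "\<bar>\<phi> z\<bar> \<le> ?c * indicat_real {x..y + \<delta>} z" for z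
    proof (cases "z \<in> {x..y + \<delta>}")
      case True
      have "\<bar>\<phi> z\<bar> \<le> ?c"
        using bump_int_range[of "1 / \<delta> * z + (- x / \<delta>)"] bump_int_range[of "1 / \<delta> * z + (- y / \<delta>)"]
        by (auto simp: \<phi>_def mollifier_int_def)
      then show ?thesis using True by simp
    next
      case False
      then have "z \<le> x \<or> y + \<delta> \<le> z" by auto
      then show ?thesis using xy \<delta>(1) False by (auto simp: \<phi>_def mollifier_int_left mollifier_int_right)
    qed
    have "(LINT z|M\<^sub>S. \<bar>\<phi> z\<bar>) \<le> (LINT z|M\<^sub>S. ?c * indicat_real {x..y + \<delta>} z)"
    proof (rule integral_mono[OF _ _ \<phi>b])
      show "integrable M\<^sub>S (\<lambda>z. \<bar>\<phi> z\<bar>)"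
        by (intro integrable_continuous continuous_intros smooth_fun_continuous sm)
      show "integrable M\<^sub>S (\<lambda>z. ?c * indicat_real {x..y + \<delta>} z)"
      proof (rule integrable_bounded[of _ ?c])
        have "{x..y + \<delta>} \<in> sets M\<^sub>S" using ax by (subst sets_restrict_space_iff) auto
        then show "(\<lambda>z. ?c * indicat_real {x..y + \<delta>} z) \<in> borel_measurable M\<^sub>S"
          by (intro borel_measurable_times borel_measurable_const borel_measurable_indicator)
      qed (use bump_int_pos in \<open>auto simp: indicator_def\<close>)
    qed
    also have "\<dots> = ?c * (y + \<delta> - x)"
    proof -
      have sub: "{x..y + \<delta>} \<subseteq> S" using ax by auto
      then have "{x..y + \<delta>} \<inter> S = {x..y + \<delta>}" by auto
      moreover have "measure M\<^sub>S {x..y + \<delta>} = y + \<delta> - x"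
        using xy \<delta>(1) sub by (subst measure_restrict_space) auto
      ultimately show ?thesis by simp
    qed
    finally have I: "(LINT z|M\<^sub>S. \<bar>\<phi> z\<bar>) \<le> ?c * (y + \<delta> - x)" .
    let ?Ix = "LINT z|M\<^sub>S. mollifier \<delta> x z *\<^sub>R g z" and ?Iy = "LINT z|M\<^sub>S. mollifier \<delta> y z *\<^sub>R g z"
    have i: "integrable M\<^sub>S (\<lambda>z. mollifier \<delta> v z *\<^sub>R g z)" for v
      by (intro integrable_continuous continuous_intros smooth_fun_continuous smooth_mollifier g)
    have "(LINT z|M\<^sub>S. deriv \<phi> z *\<^sub>R g z) = ?Ix - ?Iy"
      unfolding d scaleR_diff_left using i by simp
    then have 1: "norm (?Ix - ?Iy) \<le> C * (?c * (y + \<delta> - x))"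
      using order_trans[OF w[OF t] mult_left_mono[OF I C]] by simp
    have 2: "norm (?Ix - ?c *\<^sub>R g x) \<le> ?c * (\<epsilon> / (2 + C))"
      using \<delta> \<delta>1 by (intro mollifier_approx g ax \<delta>) auto
    have 3: "norm (?Iy - ?c *\<^sub>R g y) \<le> ?c * (\<epsilon> / (2 + C))"
      using \<delta> \<delta>2 by (intro mollifier_approx g ax \<delta>) auto
    have tri: "norm (A - B + D) \<le> norm A + norm B + norm D" for A B D :: 'v
      using norm_triangle_ineq[of "A - B" D] norm_triangle_ineq4[of A B] by linarith
    have "?c *\<^sub>R (g x - g y) = (?Ix - ?Iy) - (?Ix - ?c *\<^sub>R g x) + (?Iy - ?c *\<^sub>R g y)"
      by (simp add: scaleR_diff_right)
    then have "norm (?c *\<^sub>R (g x - g y)) \<le> norm (?Ix - ?Iy) + norm (?Ix - ?c *\<^sub>R g x) + norm (?Iy - ?c *\<^sub>R g y)"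
      by (simp only: tri)
    also have "\<dots> \<le> C * (?c * (y + \<delta> - x)) + ?c * (\<epsilon> / (2 + C)) + ?c * (\<epsilon> / (2 + C))"
      by (intro add_mono 1 2 3)
    also have "\<dots> \<le> C * (?c * (y + \<epsilon> / (2 + C) - x)) + ?c * (\<epsilon> / (2 + C)) + ?c * (\<epsilon> / (2 + C))"
      using C bump_int_pos \<delta>(4) by (intro add_mono mult_left_mono) auto
    also have "\<dots> = ?c * (C * (y - x) + (2 + C) * (\<epsilon> / (2 + C)))" by (simp add: algebra_simps add_divide_distrib)
    also have "(2 + C) * (\<epsilon> / (2 + C)) = \<epsilon>" using C by simp
    finally have "?c * norm (g x - g y) \<le> ?c * (C * (y - x) + \<epsilon>)" using bump_int_pos by simp
    then show "norm (g x - g y) \<le> C * (y - x) + \<epsilon>" using bump_int_pos by simp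
  qed
  have "C-lipschitz_on S g"
  proof (rule lipschitz_onI[OF _ C])
    fix x y assume "x \<in> S" "y \<in> S"
    then show "dist (g x) (g y) \<le> C * dist x y"
      using main[of x y] main[of y x] by (cases x y rule: linorder_cases) (auto simp: dist_norm dist_real_def norm_minus_commute)
  qed
  moreover have "closure S = {a..b}" using ab by (simp add: closure_greaterThanLessThan)
  ultimately show ?thesis using lipschitz_on_closure[of C S g] g by simp
qed

end

section \<open>From weak derivatives to classical ones\<close>

lemma ae_interval_witness:
  fixes c d :: real
  assumes ae: "AE x in lebesgue_on A. Q x" and A: "A \<in> sets lebesgue" and sub: "{c..d} \<subseteq> A" and cd: "c < d"
  shows "\<exists>x\<in>{c..d}. Q x"
proof (rule ccontr)
  assume no: "\<not> (\<exists>x\<in>{c..d}. Q x)"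
  have "AE x in lebesgue. x \<in> A \<longrightarrow> Q x"
    using ae A by (subst (asm) AE_restrict_space_iff) auto
  then obtain N where N: "N \<in> null_sets lebesgue" "{x. \<not> (x \<in> A \<longrightarrow> Q x)} \<subseteq> N"
    unfolding eventually_ae_filter by auto
  have "{c..d} \<subseteq> N" using no sub N(2) by blast
  then have "emeasure lebesgue {c..d} \<le> emeasure lebesgue N"
    using N(1) by (intro emeasure_mono) auto
  then have "emeasure lebesgue {c..d} = 0" using N(1) by auto
  then show False using cd by simp
qed

lemma ae_bound_continuous:
  fixes f :: "real \<Rightarrow> 'v::real_normed_vector"
  assumes ae: "AE x in lebesgue_on {a<..<b}. norm (f x) \<le> c" and f: "continuous_on {a<..<b} f" and x: "x \<in> {a<..<b}"
  shows "norm (f x) \<le> c"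
proof (rule field_le_epsilon)
  fix \<epsilon> :: real assume \<epsilon>: "0 < \<epsilon>"
  obtain \<delta> where \<delta>: "0 < \<delta>" "\<And>z. z \<in> {a<..<b} \<Longrightarrow> dist z x < \<delta> \<Longrightarrow> dist (f z) (f x) < \<epsilon>"
    using f x \<epsilon> unfolding continuous_on_iff by metis
  let ?d = "min (\<delta> / 2) ((b - x) / 2)"
  have d: "0 < ?d" "x + ?d < b" "?d < \<delta>" using \<delta> x by (auto simp: min_def field_simps)
  have "\<exists>z\<in>{x..x + ?d}. norm (f z) \<le> c"
    by (rule ae_interval_witness[OF ae]) (use d x in auto)
  then obtain z where z: "z \<in> {x..x + ?d}" "norm (f z) \<le> c" ..
  then have "z \<in> {a<..<b}" "dist z x < \<delta>" using x d by (auto simp: dist_real_def)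
  then have "norm (f x - f z) < \<epsilon>" using \<delta>(2)[of z] by (simp add: dist_norm norm_minus_commute[of "f x"])
  then show "norm (f x) \<le> c + \<epsilon>" using z(2) norm_triangle_sub[of "f x" "f z"] by linarith
qed

lemma Linf_norm_AE: "Linf_norm A f \<le> ereal c \<Longrightarrow> AE x in lebesgue_on A. norm (f x) \<le> c"
proof -
  assume c: "Linf_norm A f \<le> ereal c"
  have "AE x in lebesgue_on A. ereal (norm (f x)) \<le> Linf_norm A f"
    unfolding Linf_norm_def by (rule esssup_AE)
  then show ?thesis by (rule eventually_mono) (use c in \<open>auto dest: order_trans\<close>)
qed

context real_interval
begin

lemma psm_chain:
  assumes per: "\<And>k. k \<le> n \<Longrightarrow> g k a = g k b"
    and bd: "\<And>k x. k \<le> n \<Longrightarrow> x \<in> {a..b} \<Longrightarrow> norm (g k x) \<le> K * \<omega> ^ k"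
    and der: "\<And>k x. k < n \<Longrightarrow> x \<in> {a..b} \<Longrightarrow> (g k has_vector_derivative g (Suc k) x) (at x within {a..b})"
    and lip: "\<And>x y. x \<in> {a..b} \<Longrightarrow> y \<in> {a..b} \<Longrightarrow> norm (g n x - g n y) \<le> K * \<omega> ^ Suc n * \<bar>x - y\<bar>"
  shows "psm \<omega> n K (g 0)"
proof -
  have "j + k = n \<Longrightarrow> psm \<omega> j (K * \<omega> ^ k) (g k)" for j k
  proof (induction j arbitrary: k)
    case 0
    then have k: "k = n" by simp
    show ?case unfolding k by (rule psm_0I[OF per[OF order_refl] bd[OF order_refl]]) (use lip in \<open>simp_all add: mult_ac\<close>)
  next
    case (Suc j)
    have k: "k < n" "k \<le> n" "j + Suc k = n" using Suc.prems by auto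
    have *: "psm \<omega> j (K * \<omega> ^ k * \<omega>) (g (Suc k))" using Suc.IH[OF k(3)] by (simp add: mult_ac)
    show ?case
    proof (rule psm_SucI[OF _ *])
      show "(g k has_vector_derivative g (Suc k) x) (at x within {a..b})" if "x \<in> {a..b}" for x
        by (rule der[OF k(1) that])
      show "norm (g k x) \<le> K * \<omega> ^ k" if "x \<in> {a..b}" for x by (rule bd[OF k(2) that])
    qed (rule per[OF k(2)])
  qed
  from this[of n 0] show ?thesis by simp
qed

text \<open>In contrast to the weak derivative itself this is preserved by pointwise limits, which carries
  the bounds from almost every time to every time.\<close>

definition weak_bound :: "nat \<Rightarrow> real \<Rightarrow> (real \<Rightarrow> 'v::euclidean_space) \<Rightarrow> bool"
  where "weak_bound k c f \<longleftrightarrow> (\<forall>\<phi>\<in>test_functions S.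
    norm (LINT x|M\<^sub>S. (deriv ^^ k) \<phi> x *\<^sub>R f x) \<le> c * (LINT x|M\<^sub>S. \<bar>\<phi> x\<bar>))"

lemma weak_bound_of_Linf:
  fixes f :: "real \<Rightarrow> 'v::euclidean_space"
  assumes w: "has_weak_deriv S k f g" and c: "Linf_norm S g \<le> ereal c"
  shows "weak_bound k c f"
  unfolding weak_bound_def
proof
  fix \<phi> assume \<phi>: "\<phi> \<in> test_functions S"
  have i: "integrable M\<^sub>S (\<lambda>x. c * \<bar>\<phi> x\<bar>)"
    using test_functions_continuous[OF \<phi>, of "{a..b}" 0] by (intro integrable_continuous continuous_intros) auto
  have "(LINT x|M\<^sub>S. (deriv ^^ k) \<phi> x *\<^sub>R f x) = (-1) ^ k *\<^sub>R (LINT x|M\<^sub>S. \<phi> x *\<^sub>R g x)"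
    using w \<phi> unfolding has_weak_deriv_def set_integral_S by blast
  then have "norm (LINT x|M\<^sub>S. (deriv ^^ k) \<phi> x *\<^sub>R f x) = norm (LINT x|M\<^sub>S. \<phi> x *\<^sub>R g x)"
    by (simp add: power_abs)
  also have "\<dots> \<le> (LINT x|M\<^sub>S. norm (\<phi> x *\<^sub>R g x))" by (rule integral_norm_bound)
  also have "\<dots> \<le> (LINT x|M\<^sub>S. c * \<bar>\<phi> x\<bar>)"
  proof (rule integral_mono_AE'[OF i])
    show le: "AE x in M\<^sub>S. norm (\<phi> x *\<^sub>R g x) \<le> c * \<bar>\<phi> x\<bar>"
      using Linf_norm_AE[OF c] by eventually_elim (simp add: mult.commute[of c] mult_left_mono)
    show "AE x in M\<^sub>S. 0 \<le> c * \<bar>\<phi> x\<bar>"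
      using le by eventually_elim (rule order_trans[OF norm_ge_zero])
  qed
  finally show "norm (LINT x|M\<^sub>S. (deriv ^^ k) \<phi> x *\<^sub>R f x) \<le> c * (LINT x|M\<^sub>S. \<bar>\<phi> x\<bar>)" by simp
qed

lemma weak_bound_sup:
  assumes "weak_bound 0 c f" "continuous_on {a..b} f" "x \<in> {a..b}"
  shows "norm (f x) \<le> c"
  by (rule sup_bound_of_weak[OF assms(2) _ assms(3)]) (use assms(1) in \<open>simp add: weak_bound_def\<close>)

lemma weak_bound_limit:
  fixes f :: "nat \<Rightarrow> real \<Rightarrow> 'v::euclidean_space"
  assumes w: "\<And>i. weak_bound k c (f i)" and f: "\<And>i. continuous_on {a..b} (f i)" "continuous_on {a..b} g"
    and B: "\<And>i x. x \<in> {a..b} \<Longrightarrow> norm (f i x) \<le> B" and lim: "\<And>x. x \<in> {a..b} \<Longrightarrow> (\<lambda>i. f i x) \<longlonglongrightarrow> g x"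
  shows "weak_bound k c g"
  unfolding weak_bound_def
proof
  fix \<phi> assume \<phi>: "\<phi> \<in> test_functions S"
  let ?\<phi> = "(deriv ^^ k) \<phi>"
  have c: "continuous_on {a..b} ?\<phi>" by (rule test_functions_continuous[OF \<phi>])
  have "(\<lambda>i. LINT x|M\<^sub>S. ?\<phi> x *\<^sub>R f i x) \<longlonglongrightarrow> (LINT x|M\<^sub>S. ?\<phi> x *\<^sub>R g x)"
  proof (rule integral_dominated_convergence[where w="\<lambda>x. \<bar>?\<phi> x\<bar> * B"])
    show "(\<lambda>x. ?\<phi> x *\<^sub>R g x) \<in> borel_measurable M\<^sub>S" "(\<lambda>x. ?\<phi> x *\<^sub>R f i x) \<in> borel_measurable M\<^sub>S" for i
      by (intro borel_measurable_integrable integrable_continuous continuous_intros c f)+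
    show "integrable M\<^sub>S (\<lambda>x. \<bar>?\<phi> x\<bar> * B)" by (intro integrable_continuous continuous_intros c)
    show "AE x in M\<^sub>S. (\<lambda>i. ?\<phi> x *\<^sub>R f i x) \<longlonglongrightarrow> ?\<phi> x *\<^sub>R g x"
      by (intro AE_I2 tendsto_intros lim) auto
    show "AE x in M\<^sub>S. norm (?\<phi> x *\<^sub>R f i x) \<le> \<bar>?\<phi> x\<bar> * B" for i
      by (intro AE_I2) (auto intro!: mult_left_mono B)
  qed
  then have "(\<lambda>i. norm (LINT x|M\<^sub>S. ?\<phi> x *\<^sub>R f i x)) \<longlonglongrightarrow> norm (LINT x|M\<^sub>S. ?\<phi> x *\<^sub>R g x)"
    by (rule tendsto_norm)
  then show "norm (LINT x|M\<^sub>S. ?\<phi> x *\<^sub>R g x) \<le> c * (LINT x|M\<^sub>S. \<bar>\<phi> x\<bar>)"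
    by (rule LIMSEQ_le_const2) (use w \<phi> in \<open>auto simp: weak_bound_def\<close>)
qed

text \<open>The continuous weak derivatives \<open>g k\<close> turn out to be classical: a primitive
  of \<open>g (Suc k)\<close> differs from \<open>g k\<close> by a function with vanishing weak
  derivative, hence by a constant. Order \<open>Suc n\<close> is only bounded and becomes the
  Lipschitz constant of \<open>g n\<close>. The map \<open>L\<close> extracts a scalar coordinate at
  the end.\<close>

lemma psm_of_weak:
  fixes f :: "real \<Rightarrow> 'v::euclidean_space" and L :: "'v \<Rightarrow> complex"
  assumes f: "f \<in> Winf_per (Suc n) a b" and bd: "\<And>k. k \<le> Suc n \<Longrightarrow> weak_bound k (K * \<omega> ^ k) f"
    and K: "0 \<le> K" "0 \<le> \<omega>" and L: "bounded_linear L" "\<And>x. norm (L x) \<le> B * norm x" "0 \<le> B"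
  shows "psm \<omega> n (B * K) (\<lambda>x. L (f x))"
proof -
  have "\<forall>k. \<exists>g. k < Suc n \<longrightarrow> has_weak_deriv S k f g \<and> continuous_on {a..b} g \<and> g a = g b"
    using f unfolding Winf_per_def by auto
  then obtain g where g: "\<And>k. k < Suc n \<Longrightarrow> has_weak_deriv S k f (g k)"
    "\<And>k. k < Suc n \<Longrightarrow> continuous_on {a..b} (g k)" "\<And>k. k < Suc n \<Longrightarrow> g k a = g k b"
    by metis
  have fc: "continuous_on {a..b} f" using f by (simp add: Winf_per_def)
  have weak: "(LINT x|M\<^sub>S. (deriv ^^ k) \<phi> x *\<^sub>R f x) = (-1) ^ k *\<^sub>R (LINT x|M\<^sub>S. \<phi> x *\<^sub>R g k x)"
    if "\<phi> \<in> test_functions S" "k < Suc n" for \<phi> k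
    using g(1)[OF that(2)] that(1) unfolding has_weak_deriv_def set_integral_S by blast
  have sup: "norm (g k x) \<le> K * \<omega> ^ k" if k: "k < Suc n" and x: "x \<in> {a..b}" for k x
  proof (rule sup_bound_of_weak[OF g(2)[OF k] _ x])
    fix \<phi> assume \<phi>: "\<phi> \<in> test_functions S"
    have "norm (LINT x|M\<^sub>S. \<phi> x *\<^sub>R g k x) = norm (LINT x|M\<^sub>S. (deriv ^^ k) \<phi> x *\<^sub>R f x)"
      unfolding weak[OF \<phi> k] by (simp add: power_abs)
    then show "norm (LINT x|M\<^sub>S. \<phi> x *\<^sub>R g k x) \<le> K * \<omega> ^ k * (LINT x|M\<^sub>S. \<bar>\<phi> x\<bar>)"
      using bd[of k] k \<phi> by (simp add: weak_bound_def)
  qed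
  \<comment> \<open>One more derivative falls on the test function, so the bound of order k + 1 on
    \<open>f\<close> controls the Lipschitz constant of \<open>g k\<close>.\<close>
  have weak': "(-1) ^ k *\<^sub>R (LINT x|M\<^sub>S. deriv \<phi> x *\<^sub>R g k x) = (LINT x|M\<^sub>S. (deriv ^^ Suc k) \<phi> x *\<^sub>R f x)"
    if "\<phi> \<in> test_functions S" "k < Suc n" for \<phi> k
    using weak[OF test_functions_deriv[OF that(1)] that(2)] by (simp add: funpow_swap1)
  have lip: "(K * \<omega> ^ Suc k)-lipschitz_on {a..b} (g k)" if k: "k < Suc n" for k
  proof (rule lipschitz_of_weak[OF g(2)[OF k]])
    show "0 \<le> K * \<omega> ^ Suc k" using K by simp
    fix \<phi> assume \<phi>: "\<phi> \<in> test_functions S"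
    have "norm (LINT x|M\<^sub>S. deriv \<phi> x *\<^sub>R g k x) = norm ((-1) ^ k *\<^sub>R (LINT x|M\<^sub>S. deriv \<phi> x *\<^sub>R g k x))"
      by (simp add: power_abs)
    then show "norm (LINT x|M\<^sub>S. deriv \<phi> x *\<^sub>R g k x) \<le> K * \<omega> ^ Suc k * (LINT x|M\<^sub>S. \<bar>\<phi> x\<bar>)"
      unfolding weak'[OF \<phi> k] using bd[of "Suc k"] k \<phi> unfolding weak_bound_def by (simp only: Suc_leI)
  qed
  have der: "(g k has_vector_derivative g (Suc k) x) (at x within {a..b})" if k: "Suc k < Suc n" and x: "x \<in> {a..b}" for k x
  proof -
    have k': "k < Suc n" using k by simp
    define G where "G = (\<lambda>x. integral {a..x} (g (Suc k)))"
    have G: "(G has_vector_derivative g (Suc k) x) (at x within {a..b})" if "x \<in> {a..b}" for x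
      unfolding G_def by (rule integral_has_vector_derivative[OF g(2)[OF k] that])
    have Gc: "continuous_on {a..b} G" by (rule continuous_on_vector_derivative[OF G])
    have "0-lipschitz_on {a..b} (\<lambda>x. g k x - G x)"
    proof (rule lipschitz_of_weak)
      show "continuous_on {a..b} (\<lambda>x. g k x - G x)" by (intro continuous_intros g(2)[OF k'] Gc)
      fix \<phi> assume \<phi>: "\<phi> \<in> test_functions S"
      have \<phi>c: "continuous_on {a..b} \<phi>" "continuous_on {a..b} (deriv \<phi>)"
        using test_functions_continuous[OF \<phi>, of "{a..b}" 0] test_functions_continuous[OF \<phi>, of "{a..b}" 1] by simp_all
      have i: "integrable M\<^sub>S (\<lambda>x. deriv \<phi> x *\<^sub>R g k x)" "integrable M\<^sub>S (\<lambda>x. deriv \<phi> x *\<^sub>R G x)"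
        "integrable M\<^sub>S (\<lambda>x. \<phi> x *\<^sub>R g (Suc k) x)"
        by (intro integrable_continuous continuous_intros \<phi>c Gc g(2)[OF k'] g(2)[OF k])+
      have "((\<lambda>x. \<phi> x *\<^sub>R g (Suc k) x + deriv \<phi> x *\<^sub>R G x) has_integral (\<phi> b *\<^sub>R G b - \<phi> a *\<^sub>R G a)) {a..b}"
      proof (rule fundamental_theorem_of_calculus)
        show "((\<lambda>x. \<phi> x *\<^sub>R G x) has_vector_derivative \<phi> x *\<^sub>R g (Suc k) x + deriv \<phi> x *\<^sub>R G x) (at x within {a..b})"
          if "x \<in> {a..b}" for x
          by (intro has_vector_derivative_scaleR G that DERIV_subset[OF test_functions_has_deriv[OF \<phi>]]) simp
      qed (use ab in simp)
      then have int0: "integral {a..b} (\<lambda>x. \<phi> x *\<^sub>R g (Suc k) x + deriv \<phi> x *\<^sub>R G x) = 0"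
        using test_functions_zero[OF \<phi>, of a] test_functions_zero[OF \<phi>, of b] by (simp add: integral_unique)
      have "continuous_on {a..b} (\<lambda>x. \<phi> x *\<^sub>R g (Suc k) x + deriv \<phi> x *\<^sub>R G x)"
        by (intro continuous_intros \<phi>c Gc g(2)[OF k])
      from integrable_continuous(2)[OF this] int0
      have "(LINT x|M\<^sub>S. \<phi> x *\<^sub>R g (Suc k) x + deriv \<phi> x *\<^sub>R G x) = 0" by (simp only:)
      then have 1: "(LINT x|M\<^sub>S. deriv \<phi> x *\<^sub>R G x) = - (LINT x|M\<^sub>S. \<phi> x *\<^sub>R g (Suc k) x)"
        using i by (simp add: add_eq_0_iff)
      have "(-1) ^ k *\<^sub>R (LINT x|M\<^sub>S. deriv \<phi> x *\<^sub>R g k x) = (-1) ^ k *\<^sub>R (- (LINT x|M\<^sub>S. \<phi> x *\<^sub>R g (Suc k) x))"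
        unfolding weak'[OF \<phi> k'] weak[OF \<phi> k] by simp
      then have "(LINT x|M\<^sub>S. deriv \<phi> x *\<^sub>R g k x) = - (LINT x|M\<^sub>S. \<phi> x *\<^sub>R g (Suc k) x)"
        by (simp only: scaleR_cancel_left power_eq_0_iff) simp
      then have "(LINT x|M\<^sub>S. deriv \<phi> x *\<^sub>R (g k x - G x)) = 0"
        unfolding scaleR_diff_right using i 1 by simp
      then show "norm (LINT x|M\<^sub>S. deriv \<phi> x *\<^sub>R (g k x - G x)) \<le> 0 * (LINT x|M\<^sub>S. \<bar>\<phi> x\<bar>)" by simp
    qed simp
    then have "g k x - G x = g k a - G a" if "x \<in> {a..b}" for x
      using lipschitz_onD[of 0 "{a..b}" _ x a] that ab by fastforce
    then have eq: "G x + (g k a - G a) = g k x" if "x \<in> {a..b}" for x using that by (simp add: algebra_simps)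
    have "((\<lambda>x. G x + (g k a - G a)) has_vector_derivative g (Suc k) x + 0) (at x within {a..b})"
      by (intro has_vector_derivative_add has_vector_derivative_const G x)
    then show ?thesis
      using has_vector_derivative_transform[OF x _ , of "g k" "\<lambda>x. G x + (g k a - G a)"] eq by simp
  qed
  have f0: "f x = g 0 x" if x: "x \<in> {a..b}" for x
  proof -
    have "norm (f x - g 0 x) \<le> 0"
    proof (rule sup_bound_of_weak[OF _ _ x])
      show "continuous_on {a..b} (\<lambda>x. f x - g 0 x)" by (intro continuous_intros fc g(2)) simp
      fix \<phi> assume \<phi>: "\<phi> \<in> test_functions S"
      have \<phi>c: "continuous_on {a..b} \<phi>" using test_functions_continuous[OF \<phi>, of "{a..b}" 0] by simp
      have i: "integrable M\<^sub>S (\<lambda>x. \<phi> x *\<^sub>R f x)" "integrable M\<^sub>S (\<lambda>x. \<phi> x *\<^sub>R g 0 x)"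
        by (intro integrable_continuous continuous_intros \<phi>c fc g(2); simp)+
      show "norm (LINT x|M\<^sub>S. \<phi> x *\<^sub>R (f x - g 0 x)) \<le> 0 * (LINT x|M\<^sub>S. \<bar>\<phi> x\<bar>)"
        unfolding scaleR_diff_right using weak[OF \<phi>, of 0] i by simp
    qed
    then show ?thesis by simp
  qed
  have "psm \<omega> n (B * K) (\<lambda>x. L (g 0 x))"
  proof (rule psm_chain[of n "\<lambda>k x. L (g k x)"])
    show "L (g k a) = L (g k b)" if "k \<le> n" for k using g(3)[of k] that by simp
    show "norm (L (g k x)) \<le> B * K * \<omega> ^ k" if "k \<le> n" "x \<in> {a..b}" for k x
      using order_trans[OF L(2) mult_left_mono[OF sup L(3)]] that by (simp add: mult.assoc)
    show "((\<lambda>x. L (g k x)) has_vector_derivative L (g (Suc k) x)) (at x within {a..b})" if "k < n" "x \<in> {a..b}" for k x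
      by (rule bounded_linear.has_vector_derivative[OF L(1) der]) (use that in auto)
    fix x y assume xy: "x \<in> {a..b}" "y \<in> {a..b}"
    have "norm (L (g n x) - L (g n y)) = norm (L (g n x - g n y))"
      by (simp add: linear_diff[OF bounded_linear.linear[OF L(1)]])
    also have "\<dots> \<le> B * norm (g n x - g n y)" by (rule L(2))
    also have "\<dots> \<le> B * (K * \<omega> ^ Suc n * \<bar>x - y\<bar>)"
      using lipschitz_onD[OF lip[of n] xy] L(3) by (intro mult_left_mono) (auto simp: dist_norm)
    finally show "norm (L (g n x) - L (g n y)) \<le> B * K * \<omega> ^ Suc n * \<bar>x - y\<bar>" by (simp add: mult.assoc)
  qed
  then show ?thesis by (rule psm_cong) (simp add: f0)
qed

text \<open>The mixed norm controls almost every time, and such times are dense. Along a sequence of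
  them tending to \<open>t\<close> the functions converge pointwise by continuity in time, dominated
  by the bound of order 0.\<close>

lemma weak_bound_all_times:
  fixes \<Phi> :: "real \<Rightarrow> real \<Rightarrow> 'v::euclidean_space"
  assumes T: "0 < T" and W: "\<And>t. t \<in> {0..T} \<Longrightarrow> \<Phi> t \<in> Winf_per m a b"
    and cont: "\<And>x. x \<in> {a..b} \<Longrightarrow> continuous_on {0..T} (\<lambda>t. \<Phi> t x)"
    and mixed: "\<And>k. k \<le> m \<Longrightarrow> mixed_norm T a b 0 k \<Phi> \<le> ereal (c k)"
    and t: "t \<in> {0..T}" and k: "k \<le> m"
  shows "weak_bound k (c k) (\<Phi> t)"
proof -
  have good: "AE t in lebesgue_on {0..T}. weak_bound k (c k) (\<Phi> t)" if k: "k \<le> m" for k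
  proof -
    have "AE t in lebesgue_on {0..T}. Linf_norm S (weak_deriv S k (\<Phi> t)) \<le> mixed_norm T a b 0 k \<Phi>"
      unfolding mixed_norm_def funpow_0 by (rule esssup_AE)
    moreover have "AE t in lebesgue_on {0..T}. t \<in> {0..T}" by (rule AE_I2) simp
    ultimately show ?thesis
    proof eventually_elim
      case (elim t)
      \<comment> \<open>Existence is what gives the choice inside \<open>weak_deriv\<close> its
        meaning.\<close>
      have "\<exists>g. has_weak_deriv S k (\<Phi> t) g" using W[OF elim(2)] k by (auto simp: Winf_per_def Winf_def)
      then have "has_weak_deriv S k (\<Phi> t) (weak_deriv S k (\<Phi> t))" unfolding weak_deriv_def by (rule someI_ex)
      then show ?case by (rule weak_bound_of_Linf) (rule order_trans[OF elim(1) mixed[OF k]])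
    qed
  qed
  have both: "AE t in lebesgue_on {0..T}. weak_bound 0 (c 0) (\<Phi> t) \<and> weak_bound k (c k) (\<Phi> t)"
    using good[OF k] good[of 0] by simp
  have "\<exists>s. s \<in> {0..T} \<and> \<bar>s - t\<bar> < 1 / real (Suc i) \<and> weak_bound 0 (c 0) (\<Phi> s) \<and> weak_bound k (c k) (\<Phi> s)" for i
  proof -
    define d where "d = 1 / (2 * real (Suc i))"
    \<comment> \<open>As T is positive, the part of the neighbourhood inside the time interval stays
      nondegenerate even if \<open>t\<close> is an endpoint.\<close>
    let ?l = "max 0 (t - d)" and ?r = "min T (t + d)"
    have d: "0 < d" "d < 1 / real (Suc i)" by (simp_all add: d_def field_simps)
    have "\<exists>s\<in>{?l..?r}. weak_bound 0 (c 0) (\<Phi> s) \<and> weak_bound k (c k) (\<Phi> s)"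
      by (rule ae_interval_witness[OF both]) (use t T d(1) in auto)
    then obtain s where s: "s \<in> {?l..?r}" "weak_bound 0 (c 0) (\<Phi> s) \<and> weak_bound k (c k) (\<Phi> s)" ..
    then have "s \<in> {0..T}" "\<bar>s - t\<bar> \<le> d" by auto
    then show ?thesis using s(2) d(2) by (intro exI[of _ s]) auto
  qed
  then obtain s where s: "\<And>i. s i \<in> {0..T}" "\<And>i. \<bar>s i - t\<bar> < 1 / real (Suc i)"
    "\<And>i. weak_bound 0 (c 0) (\<Phi> (s i))" "\<And>i. weak_bound k (c k) (\<Phi> (s i))" by metis
  have lim: "s \<longlonglongrightarrow> t"
  proof (rule LIM_zero_cancel, rule Lim_null_comparison)
    show "\<forall>\<^sub>F i in sequentially. norm (s i - t) \<le> 1 / real (Suc i)"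
      using s(2) by (intro always_eventually) (auto intro: less_imp_le)
    show "(\<lambda>i. 1 / real (Suc i)) \<longlonglongrightarrow> 0" by (rule lim_1_over_n[THEN LIMSEQ_Suc])
  qed
  have \<Phi>c: "continuous_on {a..b} (\<Phi> t)" if "t \<in> {0..T}" for t using W[OF that] by (simp add: Winf_per_def)
  show ?thesis
  proof (rule weak_bound_limit[of k "c k" "\<lambda>i. \<Phi> (s i)" _ "c 0"])
    show "norm (\<Phi> (s i) x) \<le> c 0" if "x \<in> {a..b}" for i x
      by (rule weak_bound_sup[OF s(3) \<Phi>c[OF s(1)] that])
    show "(\<lambda>i. \<Phi> (s i) x) \<longlonglongrightarrow> \<Phi> t x" if "x \<in> {a..b}" for x
      by (rule continuous_on_tendsto_compose[OF cont[OF that] lim t]) (use s(1) in auto)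
  qed (use s \<Phi>c t in auto)
qed

text \<open>Differentiability is given in the interior only. At the endpoints it follows from the
  fundamental theorem, because the derivatives of order at most n are continuous up to the boundary.
  The derivative of order \<open>Suc n\<close> is bounded and continuous on the open interval and
  serves as a Lipschitz bound.\<close>

lemma psm_of_Cm:
  fixes V :: "real \<Rightarrow> real"
  assumes V: "V \<in> Cm_open (Suc n) a b" "periodic_derivs (Suc n) a b V"
    and D: "\<And>k. k \<le> Suc n \<Longrightarrow> Linf_norm S ((dx a b ^^ k) V) \<le> ereal P" and P: "0 \<le> P"
  shows "psm 1 n P (\<lambda>x. complex_of_real (V x))"
proof -
  let ?v = "\<lambda>k. (dx a b ^^ k) V"
  have cont: "continuous_on {a..b} (?v k)" and per: "?v k a = ?v k b" if "k < Suc n" for k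
    using V(2) that by (auto simp: periodic_derivs_def)
  have cont_open: "continuous_on S (?v k)" if "k \<le> Suc n" for k
  proof (cases "k = Suc n")
    case True then show ?thesis using V(1) by (simp add: Cm_open_def)
  next
    case False then show ?thesis using that by (intro continuous_on_subset[OF cont]) auto
  qed
  have bdS: "norm (?v k x) \<le> P" if "k \<le> Suc n" "x \<in> S" for k x
    by (rule ae_bound_continuous[OF Linf_norm_AE[OF D[OF that(1)]] cont_open[OF that(1)] that(2)])
  have clS: "closure S = {a..b}" using ab by (simp add: closure_greaterThanLessThan)
  have bd: "norm (?v k x) \<le> P" if "k < Suc n" "x \<in> {a..b}" for k x
    using continuous_on_closure_norm_le[of S "?v k" P x] bdS[of k] cont[OF that(1)] that clS by auto
  have derS: "(?v k has_vector_derivative ?v (Suc k) x) (at x)" if "k < Suc n" "x \<in> S" for k x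
  proof -
    have "?v k differentiable (at x)" using V(1) that by (simp add: Cm_open_def)
    then have "(?v k has_vector_derivative vector_derivative (?v k) (at x)) (at x)"
      by (simp only: vector_derivative_works)
    moreover have "at x within {a..b} = at x" using that by (intro at_within_interior) auto
    then have "?v (Suc k) x = vector_derivative (?v k) (at x)" by (simp add: dx_def)
    ultimately show ?thesis by simp
  qed
  have der: "(?v k has_vector_derivative ?v (Suc k) x) (at x within {a..b})" if k: "k < n" and x: "x \<in> {a..b}" for k x
  proof -
    let ?G = "\<lambda>x. integral {a..x} (?v (Suc k))"
    have eq: "?v k z = ?v k a + ?G z" if z: "z \<in> {a..b}" for z
    proof -
      have "(?v (Suc k) has_integral (?v k z - ?v k a)) {a..z}"
      proof (rule fundamental_theorem_of_calculus_interior)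
        show "continuous_on {a..z} (?v k)" using k z by (intro continuous_on_subset[OF cont]) auto
        show "(?v k has_vector_derivative ?v (Suc k) y) (at y)" if "y \<in> {a<..<z}" for y
          using k z that by (intro derS) auto
      qed (use z in simp)
      then show ?thesis by (simp add: integral_unique)
    qed
    have "(?G has_vector_derivative ?v (Suc k) x) (at x within {a..b})"
      using k by (intro integral_has_vector_derivative cont x) auto
    then have "((\<lambda>z. ?v k a + ?G z) has_vector_derivative 0 + ?v (Suc k) x) (at x within {a..b})"
      by (intro has_vector_derivative_add has_vector_derivative_const)
    then have "((\<lambda>z. ?v k a + ?G z) has_vector_derivative ?v (Suc k) x) (at x within {a..b})"
      by (simp only: add_0_left)
    from has_vector_derivative_transform[OF x _ this, of "?v k"] eq show ?thesis by blast
  qed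
  have lip: "\<bar>?v n x - ?v n y\<bar> \<le> P * \<bar>x - y\<bar>" if xy: "x \<in> {a..b}" "y \<in> {a..b}" for x y
  proof -
    have "P-lipschitz_on S (?v n)"
    proof (rule lipschitz_onI[OF _ P])
      fix x y assume "x \<in> S" "y \<in> S"
      then have "norm (?v n x - ?v n y) \<le> P * \<bar>x - y\<bar>"
        by (intro norm_diff_le_of_vector_derivative[of S "?v n" "?v (Suc n)"])
          (use bdS[of "Suc n"] in \<open>simp_all add: has_vector_derivative_at_within[OF derS] del: funpow.simps\<close>)
      then show "dist (?v n x) (?v n y) \<le> P * dist x y" by (simp add: dist_norm)
    qed
    then have "P-lipschitz_on {a..b} (?v n)" using lipschitz_on_closure[of P S "?v n"] cont[of n] clS by simp
    from lipschitz_onD[OF this xy] show ?thesis by (simp add: dist_real_def)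
  qed
  have "psm 1 n P (\<lambda>x. complex_of_real (?v 0 x))"
  proof (rule psm_chain[of n "\<lambda>k x. complex_of_real (?v k x)"])
    show "complex_of_real (?v k a) = complex_of_real (?v k b)" if "k \<le> n" for k using per[of k] that by simp
    show "norm (complex_of_real (?v k x)) \<le> P * 1 ^ k" if "k \<le> n" "x \<in> {a..b}" for k x using bd[of k x] that by simp
    show "((\<lambda>x. complex_of_real (?v k x)) has_vector_derivative complex_of_real (?v (Suc k) x)) (at x within {a..b})"
      if "k < n" "x \<in> {a..b}" for k x
      by (rule bounded_linear.has_vector_derivative[OF bounded_linear_of_real der[OF that]])
    show "norm (complex_of_real (?v n x) - complex_of_real (?v n y)) \<le> P * 1 ^ Suc n * \<bar>x - y\<bar>"
      if "x \<in> {a..b}" "y \<in> {a..b}" for x y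
      using lip[OF that] by (simp flip: of_real_diff)
  qed
  then show ?thesis by simp
qed

end

context dirac_scheme
begin

section \<open>The densities\<close>

definition "C\<^sub>F = 2 * sqrt (b - a) * (3 * (2 ^ (r + 2) * K\<^sup>2) * H + C\<^sub>D)"

text \<open>By \<open>norm2_pm_sum\<close>, s = 1 is the probability density and s = -1 the current.
  The squared moduli of the exact coordinates stay in the class \<open>psm\<close> on the scale
  \<omega>, so interpolating them costs only order \<open>y\<close>.\<close>

lemma interpolated_density_error:
  fixes s :: complex
  assumes n: "real n * \<tau> \<le> T" and s: "norm s = 1"
  shows "L2_norm_on S (\<lambda>x. (of_real ((norm (u (real n * \<tau>) x))\<^sup>2) + s * of_real ((norm (w (real n * \<tau>) x))\<^sup>2)) / 2
      - interpolant a b M (\<lambda>j. (of_real ((norm (fst (Z n j)))\<^sup>2) + s * of_real ((norm (snd (Z n j)))\<^sup>2)) / 2) x)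
    \<le> C\<^sub>F * (\<omega>\<^sup>2 * \<tau> + y / \<tau>)"
proof -
  let ?t = "real n * \<tau>"
  let ?X = "\<omega>\<^sup>2 * \<tau> + y / \<tau>"
  let ?f = "\<lambda>x. (of_real ((norm (u ?t x))\<^sup>2) + s * of_real ((norm (w ?t x))\<^sup>2)) / 2"
  let ?U = "\<lambda>j. (of_real ((norm (fst (Z n j)))\<^sup>2) + s * of_real ((norm (snd (Z n j)))\<^sup>2)) / 2"
  let ?K = "2 ^ (r + 2) * K\<^sup>2"
  have t: "?t \<in> {0..T}" using n \<tau>_pos by auto
  have \<omega>0: "0 \<le> \<omega>" using \<omega>_pos by simp
  have sq: "psm \<omega> (Suc r) ?K (\<lambda>x. complex_of_real ((norm (g x))\<^sup>2))" if g: "psm \<omega> (Suc r) K g" for g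
  proof -
    have "psm \<omega> (Suc r) (2 ^ (Suc r + 1) * K * K) (\<lambda>x. g x * cnj (g x))" by (rule psm_mult[OF g psm_cnj[OF g]])
    then show ?thesis unfolding complex_norm_square by (simp add: power2_eq_square mult.assoc)
  qed
  have "psm \<omega> (Suc r) (?K + 1 * ?K) (\<lambda>x. of_real ((norm (u ?t x))\<^sup>2) + s * of_real ((norm (w ?t x))\<^sup>2))"
    by (intro psm_add psm_cmult sq su sw t \<omega>0) (use s in simp)
  from psm_cmult[OF this _ \<omega>0, of "1 / 2" "1 / 2"]
  have f: "psm \<omega> (Suc r) ?K ?f" by (simp add: norm_divide mult_ac del: periodic_smooth.simps)
  have y: "Suc r + 1 = r + 2" by simp
  have d1: "gn (\<lambda>j. (norm (u ?t (gx j)))\<^sup>2 - (norm (fst (Z n j)))\<^sup>2) \<le> C\<^sub>D * ?X"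
  proof -
    have "norm (fst z - fst z') \<le> norm (z - z')" for z z' :: "complex \<times> complex"
      unfolding norm_prod_def[of "z - z'"] fst_diff by (rule real_sqrt_sum_squares_ge1)
    from density_error[OF n this] show ?thesis
      using u_bound(1)[OF t grid_in(1)] by (simp add: R_def)
  qed
  have d2: "gn (\<lambda>j. (norm (w ?t (gx j)))\<^sup>2 - (norm (snd (Z n j)))\<^sup>2) \<le> C\<^sub>D * ?X"
  proof -
    have "norm (snd z - snd z') \<le> norm (z - z')" for z z' :: "complex \<times> complex"
      unfolding norm_prod_def[of "z - z'"] snd_diff by (rule real_sqrt_sum_squares_ge2)
    from density_error[OF n this] show ?thesis
      using u_bound(2)[OF t grid_in(1)] by (simp add: R_def)
  qed
  let ?d1 = "\<lambda>j. complex_of_real ((norm (u ?t (gx j)))\<^sup>2 - (norm (fst (Z n j)))\<^sup>2) / 2"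
  let ?d2 = "\<lambda>j. s * complex_of_real ((norm (w ?t (gx j)))\<^sup>2 - (norm (snd (Z n j)))\<^sup>2) / 2"
  have half: "gn (\<lambda>j. c * complex_of_real (v j) / 2) \<le> 1/2 * gn v" if "norm c = 1" for c v
    using that by (intro gn_mult_bound) (simp_all add: norm_mult norm_divide)
  have "gn (\<lambda>j. ?f (gx j) - ?U j) = gn (\<lambda>j. ?d1 j + ?d2 j)"
    by (simp add: algebra_simps diff_divide_distrib add_divide_distrib)
  also have "\<dots> \<le> gn ?d1 + gn ?d2" by (rule gn_triangle)
  also have "\<dots> \<le> 1/2 * (C\<^sub>D * ?X) + 1/2 * (C\<^sub>D * ?X)"
    using half[of 1 "\<lambda>j. (norm (u ?t (gx j)))\<^sup>2 - (norm (fst (Z n j)))\<^sup>2"] d1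
      half[OF s, of "\<lambda>j. (norm (w ?t (gx j)))\<^sup>2 - (norm (snd (Z n j)))\<^sup>2"] d2
    by (intro add_mono) simp_all
  finally have g: "gn (\<lambda>j. ?f (gx j) - ?U j) \<le> C\<^sub>D * ?X" by simp
  \<comment> \<open>Since \<omega> is at least 1, \<tau> is at most \<open>H\<close>; this absorbs
    the interpolation error \<open>y\<close> into y/\<tau>.\<close>
  have "1 * \<tau> \<le> \<omega> * \<tau>" using \<omega>1 \<tau>_pos by (intro mult_right_mono) auto
  then have "\<tau> \<le> H" using \<tau>H by simp
  then have "y * \<tau> \<le> y * H" using y_nonneg by (rule mult_left_mono)
  then have "y \<le> H * (y / \<tau>)" using \<tau>_pos by (simp add: pos_le_divide_eq mult.commute)
  also have "\<dots> \<le> H * ?X" using H_nonneg \<omega>_pos \<tau>_pos by (intro mult_left_mono) auto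
  finally have yX: "y \<le> H * ?X" .
  have "L2_norm_on S (\<lambda>x. ?f x - interpolant a b M ?U x) \<le> 2 * sqrt (b - a) * (3 * ?K * y + gn (\<lambda>j. ?f (gx j) - ?U j))"
    using interpolation_error[OF f \<omega>0, of ?U] unfolding y_def y .
  also have "\<dots> \<le> 2 * sqrt (b - a) * (3 * ?K * (H * ?X) + C\<^sub>D * ?X)"
    using ab by (intro mult_left_mono add_mono yX g) auto
  also have "\<dots> = C\<^sub>F * ?X" by (simp add: C\<^sub>F_def algebra_simps)
  finally show ?thesis .
qed

end

text \<open>Parallelogram law and polarisation for the sum and the difference of the two
  components.\<close>

lemma norm2_pm_sum:
  "prob_density X = (of_real ((norm (fst (pm X)))\<^sup>2) + 1 * of_real ((norm (snd (pm X)))\<^sup>2)) / 2"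
  "current_density X = (of_real ((norm (fst (pm X)))\<^sup>2) + (- 1) * of_real ((norm (snd (pm X)))\<^sup>2)) / 2"
  unfolding complex_norm_square
  by (simp_all add: prob_density_def current_density_def herm_def pm_def sum_2 matrix_vector_2 algebra_simps)

lemma bounded_linear_pm: "bounded_linear (\<lambda>X. fst (pm X))" "bounded_linear (\<lambda>X. snd (pm X))"
  by (auto intro!: linear_conv_bounded_linear[THEN iffD1] linearI simp: pm_def algebra_simps)

lemma norm_pm_le: "norm (fst (pm X)) \<le> 2 * norm X" "norm (snd (pm X)) \<le> 2 * norm X"
proof -
  have "norm (X $ i) \<le> norm X" for i by (rule Finite_Cartesian_Product.norm_nth_le)
  then have "norm (X $ 1) + norm (X $ 2) \<le> 2 * norm X" by (smt (verit))
  then show "norm (fst (pm X)) \<le> 2 * norm X" "norm (snd (pm X)) \<le> 2 * norm X"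
    by (auto simp: pm_def intro: order_trans[OF norm_triangle_ineq] order_trans[OF norm_triangle_ineq4])
qed

section \<open>The Dirac equation in the coordinates \<open>pm\<close>\<close>

context real_interval
begin

text \<open>Sum and difference of the two components of the equation, divided by i\<epsilon>: the
  transport term becomes diagonal and \<open>\<sigma>\<^sub>3\<close> exchanges the two
  unknowns.\<close>

lemma dirac_solution_pm:
  assumes sol: "dirac_solution \<epsilon> T a b V A\<^sub>1 \<Phi>\<^sub>0 \<Phi>" and \<epsilon>: "0 < \<epsilon>" and t: "t \<in> {0..T}" and x: "x \<in> S"
  shows "((\<lambda>s. fst (pm (\<Phi> s x))) has_vector_derivative
      - Dx (\<lambda>x. fst (pm (\<Phi> t x))) x - \<i> * of_real (1 / \<epsilon>) * (snd (pm (\<Phi> t x)) + of_real (V x - A\<^sub>1 x) * fst (pm (\<Phi> t x))))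
      (at t within {0..T})"
    and "((\<lambda>s. snd (pm (\<Phi> s x))) has_vector_derivative
      Dx (\<lambda>x. snd (pm (\<Phi> t x))) x - \<i> * of_real (1 / \<epsilon>) * (fst (pm (\<Phi> t x)) + of_real (V x + A\<^sub>1 x) * snd (pm (\<Phi> t x))))
      (at t within {0..T})"
proof -
  have xab: "x \<in> {a..b}" using x by auto
  let ?Y = "dt T \<Phi> t x" and ?X = "dx a b (\<Phi> t) x"
  have "(\<lambda>s. \<Phi> s x) differentiable (at t within {0..T})" "\<Phi> t differentiable (at x within {a..b})"
    using sol t xab unfolding dirac_solution_def by blast+
  then have dT: "((\<lambda>s. \<Phi> s x) has_vector_derivative ?Y) (at t within {0..T})"
    and dX: "(\<Phi> t has_vector_derivative ?X) (at x within {a..b})"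
    unfolding dt_def dx_def by (simp_all only: vector_derivative_works)
  have DX: "Dx (\<lambda>x. fst (pm (\<Phi> t x))) x = fst (pm ?X)" "Dx (\<lambda>x. snd (pm (\<Phi> t x))) x = snd (pm ?X)"
    unfolding Dx_def
    by (rule vector_derivative_within_closed_interval[OF ab xab], rule bounded_linear.has_vector_derivative[OF bounded_linear_pm(1) dX])
      (rule vector_derivative_within_closed_interval[OF ab xab], rule bounded_linear.has_vector_derivative[OF bounded_linear_pm(2) dX])
  have pde: "(\<i> * of_real \<epsilon>) *s ?Y = (- \<i> * of_real \<epsilon>) *s (\<sigma>\<^sub>1 *v ?X) + \<sigma>\<^sub>3 *v \<Phi> t x
         + of_real (V x) *s \<Phi> t x - of_real (A\<^sub>1 x) *s (\<sigma>\<^sub>1 *v \<Phi> t x)"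
    using sol t x unfolding dirac_solution_def by blast
  have c1: "\<i> * of_real \<epsilon> * ?Y $ 1 = - \<i> * of_real \<epsilon> * ?X $ 2 + \<Phi> t x $ 1 + of_real (V x) * \<Phi> t x $ 1 - of_real (A\<^sub>1 x) * \<Phi> t x $ 2"
    using arg_cong[OF pde, of "\<lambda>X. X $ 1"] by (simp add: matrix_vector_2)
  have c2: "\<i> * of_real \<epsilon> * ?Y $ 2 = - \<i> * of_real \<epsilon> * ?X $ 1 - \<Phi> t x $ 2 + of_real (V x) * \<Phi> t x $ 2 - of_real (A\<^sub>1 x) * \<Phi> t x $ 1"
    using arg_cong[OF pde, of "\<lambda>X. X $ 2"] by (simp add: matrix_vector_2)
  have solve: "z = z' - \<i> * of_real (1 / \<epsilon>) * v" if "\<i> * of_real \<epsilon> * z = \<i> * of_real \<epsilon> * z' + v" for z z' v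
  proof -
    have "- \<i> * of_real (1 / \<epsilon>) * (\<i> * of_real \<epsilon> * z) = - \<i> * of_real (1 / \<epsilon>) * (\<i> * of_real \<epsilon> * z' + v)"
      using that by (simp only:)
    then show ?thesis using \<epsilon> by (simp add: distrib_left)
  qed
  have "fst (pm ?Y) = - fst (pm ?X) - \<i> * of_real (1 / \<epsilon>) * (snd (pm (\<Phi> t x)) + of_real (V x - A\<^sub>1 x) * fst (pm (\<Phi> t x)))"
  proof (rule solve)
    have "\<i> * of_real \<epsilon> * fst (pm ?Y) = \<i> * of_real \<epsilon> * ?Y $ 1 + \<i> * of_real \<epsilon> * ?Y $ 2"
      by (simp add: pm_def distrib_left)
    then show "\<i> * of_real \<epsilon> * fst (pm ?Y)
        = \<i> * of_real \<epsilon> * - fst (pm ?X) + (snd (pm (\<Phi> t x)) + of_real (V x - A\<^sub>1 x) * fst (pm (\<Phi> t x)))"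
      unfolding c1 c2 by (simp add: pm_def algebra_simps)
  qed
  then show "((\<lambda>s. fst (pm (\<Phi> s x))) has_vector_derivative
      - Dx (\<lambda>x. fst (pm (\<Phi> t x))) x - \<i> * of_real (1 / \<epsilon>) * (snd (pm (\<Phi> t x)) + of_real (V x - A\<^sub>1 x) * fst (pm (\<Phi> t x))))
      (at t within {0..T})"
    using bounded_linear.has_vector_derivative[OF bounded_linear_pm(1) dT] unfolding DX by simp
  have "snd (pm ?Y) = snd (pm ?X) - \<i> * of_real (1 / \<epsilon>) * (fst (pm (\<Phi> t x)) + of_real (V x + A\<^sub>1 x) * snd (pm (\<Phi> t x)))"
  proof (rule solve)
    have "\<i> * of_real \<epsilon> * snd (pm ?Y) = \<i> * of_real \<epsilon> * ?Y $ 1 - \<i> * of_real \<epsilon> * ?Y $ 2"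
      by (simp add: pm_def right_diff_distrib)
    then show "\<i> * of_real \<epsilon> * snd (pm ?Y)
        = \<i> * of_real \<epsilon> * snd (pm ?X) + (fst (pm (\<Phi> t x)) + of_real (V x + A\<^sub>1 x) * snd (pm (\<Phi> t x)))"
      unfolding c1 c2 by (simp add: pm_def algebra_simps)
  qed
  then show "((\<lambda>s. snd (pm (\<Phi> s x))) has_vector_derivative
      Dx (\<lambda>x. snd (pm (\<Phi> t x))) x - \<i> * of_real (1 / \<epsilon>) * (fst (pm (\<Phi> t x)) + of_real (V x + A\<^sub>1 x) * snd (pm (\<Phi> t x))))
      (at t within {0..T})"
    using bounded_linear.has_vector_derivative[OF bounded_linear_pm(2) dT] unfolding DX by simp
qed

end

theorem corollary3p1:
  fixes m :: nat and a b T :: real and C D :: "nat \<Rightarrow> real" and \<eta> :: "real \<Rightarrow> real"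
  assumes "m \<ge> 4" and "a < b" and "T > 0"
    and "\<And>\<epsilon>. \<epsilon> \<in> {0<..1} \<Longrightarrow> \<eta> \<epsilon> > 0"
    and "bounded (\<eta> ` {0<..1})"
    and "(\<eta> \<longlongrightarrow> 0) (at_right 0)"
  shows "\<exists>C\<^sub>1>0. \<exists>E>0.
    \<forall>(V::real \<Rightarrow> real) (A\<^sub>1::real \<Rightarrow> real) (\<epsilon>::real) (\<Phi>\<^sub>0::real \<Rightarrow> complex^2) (\<Phi>::real \<Rightarrow> real \<Rightarrow> complex^2)
     (\<tau>::real) (M::nat) (h::real).
      V \<in> Cm_open m a b \<and> A\<^sub>1 \<in> Cm_open m a b \<and>
      periodic_derivs m a b V \<and> periodic_derivs m a b A\<^sub>1 \<and>
      (\<forall>k\<le>m. Linf_norm {a<..<b} ((dx a b ^^ k) V) \<le> ereal (D k) \<and>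
              Linf_norm {a<..<b} ((dx a b ^^ k) A\<^sub>1) \<le> ereal (D k)) \<and>
      0 < \<epsilon> \<and> \<epsilon> \<le> 1 \<and>
      dirac_solution \<epsilon> T a b V A\<^sub>1 \<Phi>\<^sub>0 \<Phi> \<and>
      \<Phi> \<in> Cr_Winf_per 2 T m a b \<and>
      (\<forall>r\<le>2. \<forall>k\<le>m. mixed_norm T a b r k \<Phi> \<le> ereal (C (r + k) / \<epsilon> ^ (r + k))) \<and>
      0 < \<tau> \<and> 0 < M \<and> even M \<and> h = (b - a) / real M \<and>
      \<tau> / \<epsilon> \<le> \<eta> \<epsilon> \<and> h / \<epsilon> \<le> \<eta> \<epsilon>
      \<longrightarrow>
      (\<forall>n::nat. real n \<le> T / \<tau> \<longrightarrow>
        L2_norm_on {a<..<b} (\<lambda>x. prob_density (\<Phi> (real n * \<tau>) x)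
            - interpolant a b M (\<lambda>j. prob_density (scheme_S1 \<epsilon> a b M \<tau> V A\<^sub>1 \<Phi>\<^sub>0 n j)) x)
          \<le> C\<^sub>1 * T * (\<tau> / \<epsilon>\<^sup>2) + E * (T / \<tau>) * (h / (\<epsilon> * (b - a))) ^ m \<and>
        L2_norm_on {a<..<b} (\<lambda>x. current_density (\<Phi> (real n * \<tau>) x)
            - interpolant a b M (\<lambda>j. current_density (scheme_S1 \<epsilon> a b M \<tau> V A\<^sub>1 \<Phi>\<^sub>0 n j)) x)
          \<le> C\<^sub>1 * T * (\<tau> / \<epsilon>\<^sup>2) + E * (T / \<tau>) * (h / (\<epsilon> * (b - a))) ^ m)"
proof -
  \<comment> \<open>The solution then has index \<open>Suc r\<close>, that is, m - 1 classical
    derivatives and a Lipschitz bound on the last; the resulting power of h\<omega> is r + 2 =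
    m.\<close>
  define r where "r = m - 2"
  have m: "m = Suc (Suc r)" using \<open>m \<ge> 4\<close> by (simp add: r_def)
  obtain H where H: "\<And>\<epsilon>. \<epsilon> \<in> {0<..1} \<Longrightarrow> \<eta> \<epsilon> \<le> H"
  proof -
    from \<open>bounded (\<eta> ` {0<..1})\<close> obtain H where "\<forall>x\<in>\<eta> ` {0<..1}. norm x \<le> H" unfolding bounded_iff by blast
    then have "\<eta> \<epsilon> \<le> H" if "\<epsilon> \<in> {0<..1}" for \<epsilon>
      using order_trans[OF abs_ge_self, of "\<eta> \<epsilon>" H] that by (simp add: image_iff)
    then show thesis by (rule that)
  qed
  define K where "K = (\<Sum>k\<le>m. \<bar>C k\<bar>)"
  define P where "P = (\<Sum>k\<le>m. \<bar>D k\<bar>)"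
  \<comment> \<open>Named outside its locale, the constant displays its parameters: only a, b, T,
    the data bounds, r and H, so it is independent of \<epsilon>, \<tau> and M. The absolute value
    makes it nonnegative outright.\<close>
  define c where "c = \<bar>dirac_scheme.C\<^sub>F a b T (2 * K) (2 * P) r H\<bar>"
  have K: "C k \<le> K" if "k \<le> m" for k
    unfolding K_def using that member_le_sum[of k "{..m}" "\<lambda>k. \<bar>C k\<bar>"] by simp
  have P: "D k \<le> P" if "k \<le> m" for k
    unfolding P_def using that member_le_sum[of k "{..m}" "\<lambda>k. \<bar>D k\<bar>"] by simp
  have K0: "0 \<le> K" and P0: "0 \<le> P" unfolding K_def P_def by (simp_all add: sum_nonneg)
  \<comment> \<open>Dividing by T and multiplying by (b - a)^m compensate the normalisation in the
    claim; adding 1 makes both constants positive.\<close>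
  let ?c1 = "c / T + 1" and ?c2 = "c * (b - a) ^ m / T + 1"
  have c: "0 \<le> c" by (simp add: c_def)
  show ?thesis
  proof (rule exI[of _ ?c1], intro conjI exI[of _ ?c2] allI impI; (elim conjE)?)
    show "0 < ?c1" using c \<open>T > 0\<close> by (simp add: add_nonneg_pos)
    show "0 < ?c2" using c \<open>T > 0\<close> \<open>a < b\<close> by (intro add_nonneg_pos) simp_all
  next
    fix V A\<^sub>1 :: "real \<Rightarrow> real" and \<epsilon> :: real and \<Phi>\<^sub>0 :: "real \<Rightarrow> complex^2" and \<Phi> :: "real \<Rightarrow> real \<Rightarrow> complex^2"
      and \<tau> h :: real and M n :: nat
    assume V: "V \<in> Cm_open m a b" "periodic_derivs m a b V"
      and A: "A\<^sub>1 \<in> Cm_open m a b" "periodic_derivs m a b A\<^sub>1"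
      and D: "\<forall>k\<le>m. Linf_norm {a<..<b} ((dx a b ^^ k) V) \<le> ereal (D k) \<and>
              Linf_norm {a<..<b} ((dx a b ^^ k) A\<^sub>1) \<le> ereal (D k)"
      and \<epsilon>: "0 < \<epsilon>" "\<epsilon> \<le> 1" and sol: "dirac_solution \<epsilon> T a b V A\<^sub>1 \<Phi>\<^sub>0 \<Phi>"
      and \<Phi>: "\<Phi> \<in> Cr_Winf_per 2 T m a b"
      and mixed: "\<forall>r\<le>2. \<forall>k\<le>m. mixed_norm T a b r k \<Phi> \<le> ereal (C (r + k) / \<epsilon> ^ (r + k))"
      and \<tau>: "0 < \<tau>" "\<tau> / \<epsilon> \<le> \<eta> \<epsilon>" and M: "0 < M" "even M" and h: "h = (b - a) / real M"
      and n: "real n \<le> T / \<tau>"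
    define \<omega> where "\<omega> = 1 / \<epsilon>"
    have \<omega>: "1 \<le> \<omega>" using \<epsilon> by (simp add: \<omega>_def)
    interpret periodic_grid a b M
      using \<open>a < b\<close> M by unfold_locales
    have W: "\<Phi> t \<in> Winf_per m a b" if "t \<in> {0..T}" for t
    proof -
      have "(dt T ^^ 0) \<Phi> t \<in> Winf_per m a b" using \<Phi> that unfolding Cr_Winf_per_def by blast
      then show ?thesis by simp
    qed
    have cont: "continuous_on {0..T} (\<lambda>t. \<Phi> t x)" if "x \<in> {a..b}" for x
      using sol that unfolding dirac_solution_def continuous_on_eq_continuous_within
      by (blast intro: differentiable_imp_continuous_within)
    have mixed0: "mixed_norm T a b 0 k \<Phi> \<le> ereal (K * \<omega> ^ k)" if k: "k \<le> m" for k
    proof -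
      have "mixed_norm T a b 0 k \<Phi> \<le> ereal (C (0 + k) / \<epsilon> ^ (0 + k))" using mixed k by blast
      also have "C (0 + k) / \<epsilon> ^ (0 + k) = C k * \<omega> ^ k" by (simp add: \<omega>_def power_one_over)
      also have "ereal (C k * \<omega> ^ k) \<le> ereal (K * \<omega> ^ k)" using K[OF k] \<omega> by (simp add: mult_right_mono)
      finally show ?thesis .
    qed
    have weak: "weak_bound k (K * \<omega> ^ k) (\<Phi> t)" if "t \<in> {0..T}" "k \<le> m" for t k
      by (rule weak_bound_all_times[OF \<open>T > 0\<close> W cont mixed0 that])
    have sm: "psm \<omega> (Suc r) (2 * K) (\<lambda>x. L (\<Phi> t x))"
      if t: "t \<in> {0..T}" and L: "bounded_linear L" "\<And>X. norm (L X) \<le> 2 * norm X" for t L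
      by (rule psm_of_weak[OF W[OF t, unfolded m] weak[OF t, unfolded m] K0 _ L]) (use \<omega> in simp_all)
    have smV: "psm 1 (Suc r) P (\<lambda>x. complex_of_real (V x))"
      by (rule psm_of_Cm[OF V[unfolded m] _ P0]) (use D P m in \<open>auto intro: order_trans\<close>)
    have smA: "psm 1 (Suc r) P (\<lambda>x. complex_of_real (A\<^sub>1 x))"
      by (rule psm_of_Cm[OF A[unfolded m] _ P0]) (use D P m in \<open>auto intro: order_trans\<close>)
    define Z where "Z n j = pm (scheme_S1 \<epsilon> a b M \<tau> V A\<^sub>1 \<Phi>\<^sub>0 n j)" for n j
    \<comment> \<open>The 2 in \<open>2 * K\<close> is the factor from \<open>norm_pm_le\<close>;
      the 2 in \<open>2 * P\<close> comes from adding the bounds for V and A in V - A and V +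
      A.\<close>
    interpret dirac_scheme a b M \<omega> T "2 * K" "2 * P" r "\<lambda>t x. fst (pm (\<Phi> t x))" "\<lambda>t x. snd (pm (\<Phi> t x))"
      "\<lambda>x. V x - A\<^sub>1 x" "\<lambda>x. V x + A\<^sub>1 x" \<tau> H Z
    proof unfold_locales
      show "1 \<le> \<omega>" "0 < T" "0 < \<tau>" by fact+
      show "\<omega> * \<tau> \<le> H" using \<tau> H[of \<epsilon>] \<epsilon> by (simp add: \<omega>_def)
      show "psm \<omega> (Suc r) (2 * K) (\<lambda>x. fst (pm (\<Phi> t x)))" "psm \<omega> (Suc r) (2 * K) (\<lambda>x. snd (pm (\<Phi> t x)))"
        if "t \<in> {0..T}" for t
        by (rule sm[OF that bounded_linear_pm(1) norm_pm_le(1)], rule sm[OF that bounded_linear_pm(2) norm_pm_le(2)])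
      have "psm 1 (Suc r) (P + 1 * P) (\<lambda>x. complex_of_real (V x) + (- 1) * complex_of_real (A\<^sub>1 x))"
        by (intro psm_add psm_cmult smV smA) simp_all
      then show "psm 1 (Suc r) (2 * P) (\<lambda>x. complex_of_real (V x - A\<^sub>1 x))"
        by (simp del: periodic_smooth.simps)
      show "psm 1 (Suc r) (2 * P) (\<lambda>x. complex_of_real (V x + A\<^sub>1 x))"
        using psm_add[OF smV smA] by (simp del: periodic_smooth.simps)
      show "Z 0 j = (fst (pm (\<Phi> 0 (gx j))), snd (pm (\<Phi> 0 (gx j))))" if "j \<le> M" for j
        using sol grid_in(2)[OF that] by (simp add: Z_def dirac_solution_def del: atLeastAtMost_iff)
      show "Z (Suc n) = pot_step (\<omega> * \<tau>) (\<lambda>x. V x - A\<^sub>1 x) (\<lambda>x. V x + A\<^sub>1 x) (flow_step \<omega> \<tau> (Z n))" for n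
        by (rule ext) (simp add: Z_def[abs_def] pm_scheme[OF \<epsilon>(1)] \<omega>_def del: scheme_S1.simps)
    qed (unfold \<omega>_def, (rule dirac_solution_pm[OF sol \<epsilon>(1)]; assumption)+)
    have nT: "real n * \<tau> \<le> T" using n \<tau>(1) by (simp add: pos_le_divide_eq)
    have y: "y = (b - a) ^ m * (h / (\<epsilon> * (b - a))) ^ m"
      unfolding y_def m using \<open>a < b\<close> by (simp add: h h_def \<omega>_def flip: power_mult_distrib power_Suc)
    have "C\<^sub>F * (\<omega>\<^sup>2 * \<tau> + y / \<tau>) \<le> c * (\<omega>\<^sup>2 * \<tau> + y / \<tau>)"
      using \<tau>(1) y_nonneg by (intro mult_right_mono) (simp_all add: c_def)
    also have "\<dots> = c / T * T * (\<tau> / \<epsilon>\<^sup>2) + c * (b - a) ^ m / T * (T / \<tau>) * (h / (\<epsilon> * (b - a))) ^ m"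
      unfolding y using \<open>T > 0\<close> by (simp add: \<omega>_def power_one_over distrib_left)
    also have "\<dots> \<le> ?c1 * T * (\<tau> / \<epsilon>\<^sup>2) + ?c2 * (T / \<tau>) * (h / (\<epsilon> * (b - a))) ^ m"
      using \<open>T > 0\<close> \<tau>(1) \<open>a < b\<close> \<epsilon>(1) by (intro add_mono mult_right_mono) (simp_all add: h)
    finally have bound: "C\<^sub>F * (\<omega>\<^sup>2 * \<tau> + y / \<tau>)
      \<le> ?c1 * T * (\<tau> / \<epsilon>\<^sup>2) + ?c2 * (T / \<tau>) * (h / (\<epsilon> * (b - a))) ^ m" .
    show "L2_norm_on {a<..<b} (\<lambda>x. prob_density (\<Phi> (real n * \<tau>) x)
            - interpolant a b M (\<lambda>j. prob_density (scheme_S1 \<epsilon> a b M \<tau> V A\<^sub>1 \<Phi>\<^sub>0 n j)) x)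
          \<le> ?c1 * T * (\<tau> / \<epsilon>\<^sup>2) + ?c2 * (T / \<tau>) * (h / (\<epsilon> * (b - a))) ^ m"
      unfolding norm2_pm_sum
      by (rule order_trans[OF interpolated_density_error[OF nT, of 1, unfolded Z_def] bound]) simp
    show "L2_norm_on {a<..<b} (\<lambda>x. current_density (\<Phi> (real n * \<tau>) x)
            - interpolant a b M (\<lambda>j. current_density (scheme_S1 \<epsilon> a b M \<tau> V A\<^sub>1 \<Phi>\<^sub>0 n j)) x)
          \<le> ?c1 * T * (\<tau> / \<epsilon>\<^sup>2) + ?c2 * (T / \<tau>) * (h / (\<epsilon> * (b - a))) ^ m"
      unfolding norm2_pm_sum
      by (rule order_trans[OF interpolated_density_error[OF nT, of "- 1", unfolded Z_def] bound]) simp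
  qed
qed

end
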